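(* Assume that the control data $(U,r,g,l)$ satisfy conditions (C1)–(C4) of the context. For $t\in[0,T]$ and $(x,a)\in S$ let $(Y^{x,a}_{s,t},Z^{x,a}_{s,t}(\cdot))_{s\in[0,T-t]}$ be the unique solution of the BSDE of the context whose generator is the Hamiltonian $f$ and whose terminal datum is $g$. Assume moreover that all the sets $\Gamma(s,x,a,z(\cdot))$ defined in the context are nonempty and that for every $t\in[0,T]$ and $(x,a)\in S$ there is an $\mathcal F$-predictable $U$-valued process $u^{*\,t,x,a}(\cdot)$ such that $$u^{*\,t,x,a}_s\in\Gamma\big(t+s,X_{s-},a_{s-},Z^{x,a}_{s,t}(\cdot)\big),\qquad \mathbb P^{x,a}\text{-a.s., for all } s\in[0,T-t].$$ Then for every $t\in[0,T]$ and $(x,a)\in S$, $u^{*\,t,x,a}(\cdot)\in\mathcal A$ is an optimal control for the control problem starting from $(x,a)$ at time $s=0$ with terminal time $s=T-t$, i.e. it minimizes $J(t,x,a,\cdot)$ over $\mathcal A$. Moreover, $Y^{x,a}_{0,t}$ coincides with the value function: $$Y^{x,a}_{0,t}=J(t,x,a,u^{*\,t,x,a}(\cdot))=\inf_{u(\cdot)\in\mathcal A}J(t,x,a,u(\cdot)).$$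
   Context: **Semi-Markov process.** $(K,\mathcal K)$ is a measurable space such that $\mathcal K$ contains all one-point sets; $S:=K\times[0,\infty)$ with $\mathcal S:=\mathcal K\otimes\mathcal B([0,\infty))$; $\Delta$ is a point not in $K$. Given are an $\mathcal S$-measurable $\lambda:S\to[0,\infty)$ with $\sup_S\lambda<\infty$ and $\bar q:S\times\mathcal K\to[0,1]$ such that $(x,a)\mapsto\bar q(x,a,A)$ is $\mathcal S$-measurable for each $A\in\mathcal K$ and $\bar q(x,a,\cdot)$ is a probability on $\mathcal K$ for each $(x,a)\in S$. $X:\Omega\times[0,\infty)\to K$, $a:\Omega\times[0,\infty)\to[0,\infty)$ are given, $\mathcal F_t=\sigma((X_s,a_s),s\in[0,t])$, $\mathcal F=(\mathcal F_t)_{t\ge0}$, and for each $(x,a)\in S$ a probability $\mathbb P^{x,a}$ (expectation $\mathbb E^{x,a}$) on $\sigma((X_s,a_s),s\ge0)$ is given such that: $\mathbb P^{x,a}(X_0=x,a_0=a)=1$; $(x,a)\mapsto\mathbb P^{x,a}(X_s\in A,a_s\le p)$ is measurable for $s,p\ge0$, $A\in\mathcal K$; the Markov property $\mathbb P^{x,a}(X_s\in A,a_s\le p\mid\mathcal F_t)=\mathbb P^{X_t,a_t}(X_{s-t}\in A,a_{s-t}\le p)$ holds for $t\le s$ (time-homogeneous transition probabilities); trajectories of $X$ are piecewise constant and right-continuous (for the discrete topology of $K$) with finitely many jumps on bounded intervals; trajectories of $a$ are right-continuous, grow linearly with slope $1$ between consecutive jump times of $X$, and $a$ is reset to $0$ at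 each jump time of $X$. With $T_1=\inf\{p>0:X_p\ne X_0\}$ and $X_\infty:=\Delta$, the law of $(X_{T_1},T_1)$ under $\mathbb P^{x,a}$ is determined by $$\mathbb P^{x,a}(X_{T_1}\in A,\,T_1\in(c,d))=\int_c^d\bar q(x,s,A)\,\lambda(x,a+s)\,e^{-\int_a^{a+s}\lambda(x,r)dr}\,ds,\quad A\in\mathcal K,\ 0\le c<d\le\infty.$$ Put $T_0=0$, $T_{n+1}=\inf\{s\ge T_n:X_s\ne X_{T_n}\}$ ($\inf\emptyset=\infty$), $p(ds\,dy)=\sum_{n\ge1:\,T_n<\infty}\delta_{(T_n,X_{T_n})}(ds\,dy)$, and $q(ds\,dy)=p(ds\,dy)-\lambda(X_{s-},a_{s-})\bar q(X_{s-},a_{s-},dy)\,ds$ ($X_{0-}=X_0$, $a_{0-}=a_0$). $\mathcal P$ is the $\mathcal F$-predictable $\sigma$-algebra. **Control data.** $T>0$ is fixed. Conditions: (C1) $(U,\mathcal U)$ is a measurable space. (C2) $r:[0,T]\times S\times K\times U\to\mathbb R$ is measurable with respect to the product $\sigma$-algebra and $0\le r\le C_r$ for some constant $C_r>1$. (C3) $g:S\to\mathbb R$ is $\mathcal S$-measurable and $\mathbb E^{x,a}[|g(X_{T-t},a_{T-t})|^2]<\infty$ for all $t\in[0,T]$, $(x,a)\in S$. (C4) $l:[0,T]\times S\times U\to\mathbb R$ is measurable with respect to the product $\sigma$-algebra and there is $\alpha>1$ such that for all $t\in[0,T]$, $(x,a)\in S$, $u(\cdot)\in\mathcal A$: $\inf_{u\in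 U}l(t,x,a,u)>-\infty$; $\mathbb E^{x,a}\big[\int_0^{T-t}|\inf_{u\in U}l(t+s,X_s,a_s,u)|^2ds\big]<\infty$; $\mathbb E^{x,a}\big[\big(\int_0^{T-t}|l(t+s,X_s,a_s,u_s)|ds\big)^\alpha\big]<\infty$. $\mathcal A$ is the set of admissible controls, i.e. $\mathcal F$-predictable processes $(u_s)_{s\in[0,T]}$ with values in $U$. For $t\in[0,T]$, $u(\cdot)\in\mathcal A$ and $s\in[0,T-t]$, $$L^t_s=\exp\Big(\int_0^s\!\int_K(1-r(t+\sigma,X_\sigma,a_\sigma,y,u_\sigma))\lambda(X_\sigma,a_\sigma)\bar q(X_\sigma,a_\sigma,dy)d\sigma\Big)\prod_{n\ge1:\,T_n\le s}r(t+T_n,X_{T_n-},a_{T_n-},X_{T_n},u_{T_n})$$ (empty product $=1$), which is a $\mathbb P^{x,a}$-martingale; $\mathbb P^{x,a}_{u,t}(d\omega)=L^t_{T-t}(\omega)\mathbb P^{x,a}(d\omega)$ with expectation $\mathbb E^{x,a}_{u,t}$, and $$J(t,x,a,u(\cdot))=\mathbb E^{x,a}_{u,t}\Big[\int_0^{T-t}l(t+s,X_s,a_s,u_s)\,ds+g(X_{T-t},a_{T-t})\Big].$$ **Hamiltonian and BSDE.** For $s\in[0,T]$, $(x,a)\in S$, $z\in L^2(K,\mathcal K,\lambda(x,a)\bar q(x,a,dy))$, $$f(s,x,a,z(\cdot))=\inf_{u\in U}\Big\{l(s,x,a,u)+\int_Kz(y)(r(s,x,a,y,u)-1)\lambda(x,a)\bar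 q(x,a,dy)\Big\},$$ and $\Gamma(s,x,a,z(\cdot))$ is the (possibly empty) set of $u\in U$ attaining this infimum, i.e. with $f(s,x,a,z(\cdot))=l(s,x,a,u)+\int_Kz(y)(r(s,x,a,y,u)-1)\lambda(x,a)\bar q(x,a,dy)$. For fixed $t\in[0,T]$, $(x,a)\in S$, the BSDE is: $\mathbb P^{x,a}$-a.s., for all $s\in[0,T-t]$, $$Y^{x,a}_{s,t}+\int_s^{T-t}\!\int_KZ^{x,a}_{\sigma,t}(y)\,q(d\sigma\,dy)=g(X_{T-t},a_{T-t})+\int_s^{T-t}f(t+\sigma,X_\sigma,a_\sigma,Z^{x,a}_{\sigma,t}(\cdot))\,d\sigma,$$ with $Y^{x,a}_{\cdot,t}$ adapted càdlàg, $Z^{x,a}_{\cdot,t}(\cdot)$ $\mathcal P\otimes\mathcal K$-measurable, $\mathbb E^{x,a}[\int_0^{T-t}|Y^{x,a}_{s,t}|^2ds]<\infty$ and $\mathbb E^{x,a}[\int_0^{T-t}\int_K|Z^{x,a}_{s,t}(y)|^2\lambda(X_s,a_s)\bar q(X_s,a_s,dy)ds]<\infty$. Under (C1)–(C4) this BSDE has a unique solution (identifying pairs whose difference has zero norm), and $Y^{x,a}_{0,t}$ is deterministic. *)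

theory Defs
  imports "HOL-Probability.Probability"
begin

section \<open>Data of a semi-Markov process\<close>

text \<open>
  Time is \<open>real\<close>; only nonnegative times matter. Only the measurable-space part of
  \<open>state_space\<close> (and of \<open>control_space\<close> below) is used.
\<close>

record ('w, 'k) semi_markov_data =
  state_space :: "'k measure"                       (* (K, K-measurable sets) *)
  rate :: "'k \<Rightarrow> real \<Rightarrow> real"                       (* lambda *)
  jump_kernel :: "'k \<Rightarrow> real \<Rightarrow> 'k measure"          (* q-bar *)
  sample_space :: "'w set"                          (* Omega *)
  state :: "real \<Rightarrow> 'w \<Rightarrow> 'k"                        (* X *)
  age :: "real \<Rightarrow> 'w \<Rightarrow> real"                        (* a *)
  law :: "'k \<Rightarrow> real \<Rightarrow> 'w measure"                  (* P^{x,a} *)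

definition age_state_space :: "('w, 'k) semi_markov_data \<Rightarrow> ('k \<times> real) measure" where
  "age_state_space M = state_space M \<Otimes>\<^sub>M restrict_space borel {0..}"

text \<open>The measure \<open>\<lambda>(x,a) q(x,a,dy)\<close> on the state space.\<close>

definition intensity :: "('w, 'k) semi_markov_data \<Rightarrow> 'k \<Rightarrow> real \<Rightarrow> 'k measure" where
  "intensity M x a = scale_measure (ennreal (rate M x a)) (jump_kernel M x a)"

definition generated_by_times :: "('w, 'k) semi_markov_data \<Rightarrow> real set \<Rightarrow> 'w measure" where
  "generated_by_times M I =
     sigma (sample_space M)
       {(\<lambda>\<omega>. (state M s \<omega>, age M s \<omega>)) -` B \<inter> sample_space M | s B.
          s \<in> I \<and> B \<in> sets (age_state_space M)}"

definition nat_filtration :: "('w, 'k) semi_markov_data \<Rightarrow> real \<Rightarrow> 'w measure" where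
  "nat_filtration M t = generated_by_times M {0..t}"

text \<open>The predictable \<open>\<sigma>\<close>-algebra on \<open>\<Omega> \<times> [0,\<infinity>)\<close>.\<close>

definition predictable :: "('w, 'k) semi_markov_data \<Rightarrow> ('w \<times> real) measure" where
  "predictable M =
     sigma (sample_space M \<times> {0..})
       ({A \<times> {0} | A. A \<in> sets (nat_filtration M 0)} \<union>
        {A \<times> {s<..v} | A s v. 0 \<le> s \<and> s \<le> v \<and> A \<in> sets (nat_filtration M s)})"

text \<open>Jump times of a trajectory: the points of left discontinuity for the discrete topology.\<close>

definition jumps :: "('w, 'k) semi_markov_data \<Rightarrow> 'w \<Rightarrow> real set" where
  "jumps M \<omega> = {s. 0 < s \<and> \<not> (\<forall>\<^sub>F p in at_left s. state M p \<omega> = state M s \<omega>)}"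

text \<open>
  The successive times \<open>T n\<close>. If \<open>T n = \<infinity>\<close>, the set below is empty and \<open>T (Suc n) = \<infinity>\<close>.
\<close>

primrec jump_time :: "('w, 'k) semi_markov_data \<Rightarrow> nat \<Rightarrow> 'w \<Rightarrow> ereal" where
  "jump_time M 0 \<omega> = 0"
| "jump_time M (Suc n) \<omega> =
     Inf {ereal s | s. jump_time M n \<omega> \<le> ereal s \<and>
                       state M s \<omega> \<noteq> state M (real_of_ereal (jump_time M n \<omega>)) \<omega>}"

text \<open>
  Left limits, with the convention that the value at \<open>0-\<close> is the value at \<open>0\<close>; for the state
  the limit is taken in the discrete topology.
\<close>

definition state_left :: "('w, 'k) semi_markov_data \<Rightarrow> real \<Rightarrow> 'w \<Rightarrow> 'k" where
  "state_left M s \<omega> =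
     (if s \<le> 0 then state M 0 \<omega> else (THE x. \<forall>\<^sub>F p in at_left s. state M p \<omega> = x))"

definition age_left :: "('w, 'k) semi_markov_data \<Rightarrow> real \<Rightarrow> 'w \<Rightarrow> real" where
  "age_left M s \<omega> = (if s \<le> 0 then age M 0 \<omega> else Lim (at_left s) (\<lambda>p. age M p \<omega>))"

text \<open>
  The sum of the Dirac masses at \<open>(T n, X (T n))\<close> over all \<open>n \<ge> 1\<close> with \<open>T n < \<infinity>\<close>,
  as the image of a counting measure.
\<close>

definition jump_measure :: "('w, 'k) semi_markov_data \<Rightarrow> 'w \<Rightarrow> (real \<times> 'k) measure" where
  "jump_measure M \<omega> =
     distr (count_space {n. 1 \<le> n \<and> jump_time M n \<omega> < \<infinity>}) (borel \<Otimes>\<^sub>M state_space M)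
       (\<lambda>n. (real_of_ereal (jump_time M n \<omega>),
             state M (real_of_ereal (jump_time M n \<omega>)) \<omega>))"

text \<open>
  The pathwise integral over \<open>(s,v] \<times> K\<close> with respect to the compensated random measure
  \<open>q(d\<sigma> dy) = p(d\<sigma> dy) - \<lambda>(X\<^bsub>\<sigma>-\<^esub>,a\<^bsub>\<sigma>-\<^esub>) q(X\<^bsub>\<sigma>-\<^esub>,a\<^bsub>\<sigma>-\<^esub>,dy) d\<sigma>\<close>.
\<close>

definition compensated_integral ::
  "('w, 'k) semi_markov_data \<Rightarrow> real \<Rightarrow> real \<Rightarrow> (real \<Rightarrow> 'k \<Rightarrow> real) \<Rightarrow> 'w \<Rightarrow> real" where
  "compensated_integral M s v H \<omega> =
     (LINT z:{s<..v} \<times> space (state_space M)|jump_measure M \<omega>. H (fst z) (snd z))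
     - (LINT \<sigma>:{s<..v}|lborel.
          (LINT y|intensity M (state_left M \<sigma> \<omega>) (age_left M \<sigma> \<omega>). H \<sigma> y))"


section \<open>Semi-Markov processes\<close>

text \<open>
  In \<open>first_jump_law\<close> no cemetery value for the state at time infinity is needed: the event
  \<open>T 1 < d\<close> with \<open>d \<le> \<infinity>\<close> already forces \<open>T 1 < \<infinity>\<close>. The kernel is evaluated at
  \<open>(x, s)\<close>, with \<open>s\<close> the elapsed time, as in the source, while the rate is evaluated at the
  age \<open>a + s\<close>.
\<close>

locale semi_markov =
  fixes M :: "('w, 'k) semi_markov_data"
  assumes singletons: "\<And>x. x \<in> space (state_space M) \<Longrightarrow> {x} \<in> sets (state_space M)"
    and rate_measurable:
      "(\<lambda>(x, a). rate M x a) \<in> borel_measurable (age_state_space M)"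
    and rate_nonneg: "\<And>x a. (x, a) \<in> space (age_state_space M) \<Longrightarrow> 0 \<le> rate M x a"
    and rate_bounded: "bdd_above ((\<lambda>(x, a). rate M x a) ` space (age_state_space M))"
    and jump_kernel:
      "(\<lambda>(x, a). jump_kernel M x a) \<in> age_state_space M \<rightarrow>\<^sub>M prob_algebra (state_space M)"
    and process_space:
      "\<And>t \<omega>. 0 \<le> t \<Longrightarrow> \<omega> \<in> sample_space M \<Longrightarrow>
         (state M t \<omega>, age M t \<omega>) \<in> space (age_state_space M)"
    and law_prob: "\<And>x a. (x, a) \<in> space (age_state_space M) \<Longrightarrow> prob_space (law M x a)"
    and law_space: "\<And>x a. (x, a) \<in> space (age_state_space M) \<Longrightarrow>
         space (law M x a) = sample_space M"
    and law_sets: "\<And>x a. (x, a) \<in> space (age_state_space M) \<Longrightarrow>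
         sets (law M x a) = sets (generated_by_times M {0..})"
    and law_initial:
      "\<And>x a. (x, a) \<in> space (age_state_space M) \<Longrightarrow>
         measure (law M x a) {\<omega> \<in> sample_space M. state M 0 \<omega> = x \<and> age M 0 \<omega> = a} = 1"
    and law_measurable:
      "\<And>s p A. 0 \<le> s \<Longrightarrow> 0 \<le> p \<Longrightarrow> A \<in> sets (state_space M) \<Longrightarrow>
         (\<lambda>(x, a). measure (law M x a) {\<omega> \<in> sample_space M. state M s \<omega> \<in> A \<and> age M s \<omega> \<le> p})
           \<in> borel_measurable (age_state_space M)"
    and markov:
      "\<And>x a t s p A. (x, a) \<in> space (age_state_space M) \<Longrightarrow> 0 \<le> t \<Longrightarrow> t \<le> s \<Longrightarrow> 0 \<le> p \<Longrightarrow>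
         A \<in> sets (state_space M) \<Longrightarrow>
         AE \<omega> in law M x a.
           real_cond_exp (law M x a) (nat_filtration M t)
             (indicator {\<omega>' \<in> sample_space M. state M s \<omega>' \<in> A \<and> age M s \<omega>' \<le> p}) \<omega>
           = measure (law M (state M t \<omega>) (age M t \<omega>))
               {\<omega>' \<in> sample_space M. state M (s - t) \<omega>' \<in> A \<and> age M (s - t) \<omega>' \<le> p}"
    and state_right_continuous:
      "\<And>\<omega> t. \<omega> \<in> sample_space M \<Longrightarrow> 0 \<le> t \<Longrightarrow>
         \<forall>\<^sub>F s in at_right t. state M s \<omega> = state M t \<omega>"
    and state_piecewise_constant:
      "\<And>\<omega> s t. \<omega> \<in> sample_space M \<Longrightarrow> 0 \<le> s \<Longrightarrow> s \<le> t \<Longrightarrow> jumps M \<omega> \<inter> {s<..t} = {} \<Longrightarrow>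
         state M t \<omega> = state M s \<omega>"
    and finitely_many_jumps:
      "\<And>\<omega> t. \<omega> \<in> sample_space M \<Longrightarrow> 0 \<le> t \<Longrightarrow> finite (jumps M \<omega> \<inter> {0..t})"
    and age_right_continuous:
      "\<And>\<omega> t. \<omega> \<in> sample_space M \<Longrightarrow> 0 \<le> t \<Longrightarrow> continuous (at_right t) (\<lambda>s. age M s \<omega>)"
    and age_slope_one:
      "\<And>\<omega> s t. \<omega> \<in> sample_space M \<Longrightarrow> 0 \<le> s \<Longrightarrow> s \<le> t \<Longrightarrow> jumps M \<omega> \<inter> {s<..t} = {} \<Longrightarrow>
         age M t \<omega> = age M s \<omega> + (t - s)"
    and age_reset: "\<And>\<omega> t. \<omega> \<in> sample_space M \<Longrightarrow> t \<in> jumps M \<omega> \<Longrightarrow> age M t \<omega> = 0"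
    and first_jump_law:
      "\<And>x a A c d. (x, a) \<in> space (age_state_space M) \<Longrightarrow> A \<in> sets (state_space M) \<Longrightarrow>
         0 \<le> c \<Longrightarrow> ereal c < d \<Longrightarrow>
         measure (law M x a)
           {\<omega> \<in> sample_space M. ereal c < jump_time M 1 \<omega> \<and> jump_time M 1 \<omega> < d \<and>
              state M (real_of_ereal (jump_time M 1 \<omega>)) \<omega> \<in> A}
         = (LINT s:{s. c < s \<and> ereal s < d}|lborel.
              measure (jump_kernel M x s) A * rate M x (a + s)
              * exp (- (LINT r:{a..a + s}|lborel. rate M x r)))"


section \<open>The control problem\<close>

record ('k, 'u) control_data =
  horizon :: real
  control_space :: "'u measure"
  density_factor :: "real \<Rightarrow> 'k \<Rightarrow> real \<Rightarrow> 'k \<Rightarrow> 'u \<Rightarrow> real"   (* r(t,x,a,y,u) *)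
  terminal_cost :: "'k \<Rightarrow> real \<Rightarrow> real"                        (* g(x,a) *)
  running_cost :: "real \<Rightarrow> 'k \<Rightarrow> real \<Rightarrow> 'u \<Rightarrow> real"            (* l(t,x,a,u) *)

text \<open>A control \<open>u\<close> is a function of time and outcome; it is only constrained on \<open>[0,T]\<close>.\<close>

definition admissible ::
  "('w, 'k) semi_markov_data \<Rightarrow> ('k, 'u) control_data \<Rightarrow> (real \<Rightarrow> 'w \<Rightarrow> 'u) set" where
  "admissible M C =
     {u. (\<lambda>(\<omega>, s). u s \<omega>)
           \<in> restrict_space (predictable M) (sample_space M \<times> {0..horizon C})
              \<rightarrow>\<^sub>M control_space C}"

definition density_process ::
  "('w, 'k) semi_markov_data \<Rightarrow> ('k, 'u) control_data \<Rightarrow> real \<Rightarrow> (real \<Rightarrow> 'w \<Rightarrow> 'u)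
     \<Rightarrow> real \<Rightarrow> 'w \<Rightarrow> real" where
  "density_process M C t u s \<omega> =
     exp (LINT \<sigma>:{0..s}|lborel.
            (LINT y|intensity M (state M \<sigma> \<omega>) (age M \<sigma> \<omega>).
               1 - density_factor C (t + \<sigma>) (state M \<sigma> \<omega>) (age M \<sigma> \<omega>) y (u \<sigma> \<omega>)))
     * (\<Prod>n\<in>{n. 1 \<le> n \<and> jump_time M n \<omega> \<le> ereal s}.
          let \<tau> = real_of_ereal (jump_time M n \<omega>)
          in density_factor C (t + \<tau>) (state_left M \<tau> \<omega>) (age_left M \<tau> \<omega>) (state M \<tau> \<omega>) (u \<tau> \<omega>))"

definition controlled_law ::
  "('w, 'k) semi_markov_data \<Rightarrow> ('k, 'u) control_data \<Rightarrow> real \<Rightarrow> 'k \<Rightarrow> real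
     \<Rightarrow> (real \<Rightarrow> 'w \<Rightarrow> 'u) \<Rightarrow> 'w measure" where
  "controlled_law M C t x a u =
     density (law M x a) (\<lambda>\<omega>. ennreal (density_process M C t u (horizon C - t) \<omega>))"

definition cost ::
  "('w, 'k) semi_markov_data \<Rightarrow> ('k, 'u) control_data \<Rightarrow> real \<Rightarrow> 'k \<Rightarrow> real
     \<Rightarrow> (real \<Rightarrow> 'w \<Rightarrow> 'u) \<Rightarrow> real" where
  "cost M C t x a u =
     (LINT \<omega>|controlled_law M C t x a u.
        (LINT s:{0..horizon C - t}|lborel.
           running_cost C (t + s) (state M s \<omega>) (age M s \<omega>) (u s \<omega>))
        + terminal_cost C (state M (horizon C - t) \<omega>) (age M (horizon C - t) \<omega>))"

text \<open>
  The control space is an arbitrary measurable space. In the last clause of \<open>running_cost_bound\<close>,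
  almost sure integrability is stated separately because the power is taken of a real number.
\<close>

locale semi_markov_control = semi_markov M
  for M :: "('w, 'k) semi_markov_data" +
  fixes C :: "('k, 'u) control_data"
  assumes horizon_pos: "0 < horizon C"
    and density_factor_measurable:
      "(\<lambda>(t, (x, a), y, u). density_factor C t x a y u) \<in> borel_measurable
         (restrict_space borel {0..horizon C} \<Otimes>\<^sub>M age_state_space M \<Otimes>\<^sub>M state_space M
            \<Otimes>\<^sub>M control_space C)"
    and density_factor_bound:
      "\<exists>Cr>1. \<forall>t\<in>{0..horizon C}. \<forall>(x, a)\<in>space (age_state_space M).
         \<forall>y\<in>space (state_space M). \<forall>u\<in>space (control_space C).
           0 \<le> density_factor C t x a y u \<and> density_factor C t x a y u \<le> Cr"
    and terminal_cost_measurable: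
      "(\<lambda>(x, a). terminal_cost C x a) \<in> borel_measurable (age_state_space M)"
    and terminal_cost_bound:
      "\<And>t x a. t \<in> {0..horizon C} \<Longrightarrow> (x, a) \<in> space (age_state_space M) \<Longrightarrow>
         (\<integral>\<^sup>+ \<omega>. ennreal (\<bar>terminal_cost C (state M (horizon C - t) \<omega>)
                                          (age M (horizon C - t) \<omega>)\<bar>\<^sup>2) \<partial>law M x a) < \<infinity>"
    and running_cost_measurable:
      "(\<lambda>(t, (x, a), u). running_cost C t x a u) \<in> borel_measurable
         (restrict_space borel {0..horizon C} \<Otimes>\<^sub>M age_state_space M \<Otimes>\<^sub>M control_space C)"
    and running_cost_bound:
      "\<exists>\<alpha>>1. \<forall>t\<in>{0..horizon C}. \<forall>(x, a)\<in>space (age_state_space M). \<forall>u\<in>admissible M C.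
         bdd_below (running_cost C t x a ` space (control_space C)) \<and>
         (\<integral>\<^sup>+ \<omega>. (\<integral>\<^sup>+ s\<in>{0..horizon C - t}.
            ennreal (\<bar>INF v\<in>space (control_space C).
                        running_cost C (t + s) (state M s \<omega>) (age M s \<omega>) v\<bar>\<^sup>2) \<partial>lborel)
            \<partial>law M x a) < \<infinity> \<and>
         (AE \<omega> in law M x a. set_integrable lborel {0..horizon C - t}
            (\<lambda>s. running_cost C (t + s) (state M s \<omega>) (age M s \<omega>) (u s \<omega>))) \<and>
         (\<integral>\<^sup>+ \<omega>. ennreal ((LINT s:{0..horizon C - t}|lborel.
            \<bar>running_cost C (t + s) (state M s \<omega>) (age M s \<omega>) (u s \<omega>)\<bar>) powr \<alpha>)
            \<partial>law M x a) < \<infinity>"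


section \<open>Hamiltonian and backward equation\<close>

definition L2_intensity ::
  "('w, 'k) semi_markov_data \<Rightarrow> 'k \<Rightarrow> real \<Rightarrow> ('k \<Rightarrow> real) set" where
  "L2_intensity M x a =
     {z \<in> borel_measurable (state_space M). integrable (intensity M x a) (\<lambda>y. (z y)\<^sup>2)}"

definition pre_hamiltonian ::
  "('w, 'k) semi_markov_data \<Rightarrow> ('k, 'u) control_data \<Rightarrow> real \<Rightarrow> 'k \<Rightarrow> real
     \<Rightarrow> ('k \<Rightarrow> real) \<Rightarrow> 'u \<Rightarrow> real" where
  "pre_hamiltonian M C s x a z u =
     running_cost C s x a u
     + (LINT y|intensity M x a. z y * (density_factor C s x a y u - 1))"

definition hamiltonian ::
  "('w, 'k) semi_markov_data \<Rightarrow> ('k, 'u) control_data \<Rightarrow> real \<Rightarrow> 'k \<Rightarrow> real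
     \<Rightarrow> ('k \<Rightarrow> real) \<Rightarrow> real" where
  "hamiltonian M C s x a z = (INF u\<in>space (control_space C). pre_hamiltonian M C s x a z u)"

definition minimizers ::
  "('w, 'k) semi_markov_data \<Rightarrow> ('k, 'u) control_data \<Rightarrow> real \<Rightarrow> 'k \<Rightarrow> real
     \<Rightarrow> ('k \<Rightarrow> real) \<Rightarrow> 'u set" where
  "minimizers M C s x a z =
     {u \<in> space (control_space C). hamiltonian M C s x a z = pre_hamiltonian M C s x a z u}"

definition cadlag_on :: "real \<Rightarrow> (real \<Rightarrow> real) \<Rightarrow> bool" where
  "cadlag_on R y \<longleftrightarrow>
     (\<forall>s\<in>{0..<R}. continuous (at_right s) y) \<and> (\<forall>s\<in>{0<..R}. \<exists>b. (y \<longlongrightarrow> b) (at_left s))"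

text \<open>
  \<open>Y s \<omega>\<close> and \<open>Z s \<omega> y\<close> solve the backward equation on \<open>[0,T-t]\<close> under \<open>law M x a\<close>.
  Integrability of the generator along the path is part of the meaning of the equation
  (a Bochner integral would otherwise silently be \<open>0\<close>). Paths need to be cadlag only almost
  surely, since the filtration is not completed.
\<close>

definition bsde_solution ::
  "('w, 'k) semi_markov_data \<Rightarrow> ('k, 'u) control_data \<Rightarrow> real \<Rightarrow> 'k \<Rightarrow> real
     \<Rightarrow> (real \<Rightarrow> 'w \<Rightarrow> real) \<Rightarrow> (real \<Rightarrow> 'w \<Rightarrow> 'k \<Rightarrow> real) \<Rightarrow> bool" where
  "bsde_solution M C t x a Y Z \<longleftrightarrow>
     (let R = horizon C - t in
        (\<forall>s\<in>{0..R}. Y s \<in> borel_measurable (nat_filtration M s)) \<and>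
        (AE \<omega> in law M x a. cadlag_on R (\<lambda>s. Y s \<omega>)) \<and>
        (\<lambda>((\<omega>, s), y). Z s \<omega> y) \<in> borel_measurable
           (restrict_space (predictable M) (sample_space M \<times> {0..R}) \<Otimes>\<^sub>M state_space M) \<and>
        (\<integral>\<^sup>+ \<omega>. (\<integral>\<^sup>+ s\<in>{0..R}. ennreal (\<bar>Y s \<omega>\<bar>\<^sup>2) \<partial>lborel) \<partial>law M x a) < \<infinity> \<and>
        (\<integral>\<^sup>+ \<omega>. (\<integral>\<^sup>+ s\<in>{0..R}. (\<integral>\<^sup>+ y. ennreal (\<bar>Z s \<omega> y\<bar>\<^sup>2)
            \<partial>intensity M (state M s \<omega>) (age M s \<omega>)) \<partial>lborel) \<partial>law M x a) < \<infinity> \<and>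
        (AE \<omega> in law M x a.
           set_integrable lborel {0..R}
             (\<lambda>\<sigma>. hamiltonian M C (t + \<sigma>) (state M \<sigma> \<omega>) (age M \<sigma> \<omega>) (Z \<sigma> \<omega>)) \<and>
           (\<forall>s\<in>{0..R}.
              Y s \<omega> + compensated_integral M s R (\<lambda>\<sigma>. Z \<sigma> \<omega>) \<omega>
              = terminal_cost C (state M R \<omega>) (age M R \<omega>)
                + (LINT \<sigma>:{s..R}|lborel.
                     hamiltonian M C (t + \<sigma>) (state M \<sigma> \<omega>) (age M \<sigma> \<omega>) (Z \<sigma> \<omega>)))))"

end

theory Submission
  imports Defs
begin

text \<open>
  Write \<open>\<kappa>\<close> for the intensity \<open>\<lambda> q\<close> at the left limits of the process and \<open>p\<close> for its jump
  measure, let \<open>\<rho>\<close> be the density factor along a controlled path, and \<open>R = T - t\<close>. The control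
  changes the law by a density \<open>L\<close> under which the jumps have the intensity \<open>\<rho> \<kappa>\<close> instead of
  \<open>\<kappa>\<close>. So, if the backward equation at time \<open>0\<close> is multiplied by \<open>L\<close> and integrated, the
  stochastic integral of \<open>Z\<close> contributes \<open>E (L \<integral> Z (\<rho> - 1) d\<kappa>)\<close>, and
    \<open>Y 0 = E (L (g + \<integral> f - \<integral> Z (\<rho> - 1) d\<kappa>)) = J(u) + E (L \<integral> (f - (l + \<integral> Z (\<rho> - 1) d\<kappa>)))\<close>.
  The Hamiltonian \<open>f\<close> is the infimum over the controls of the expression subtracted from it. Hence
  \<open>Y 0 \<le> J(u)\<close>, with equality if \<open>u\<close> attains the infimum along the path (\<open>cost_ge_bsde\<close>).

  The work lies in the statement on the intensity (\<open>jump_density_intensity_L2\<close>), which has to be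
  obtained from the Markov property and the law of the first jump alone.

  First, \<open>\<kappa>\<close> is the compensator of \<open>p\<close>: \<open>E (\<integral> H dp) = E (\<integral> H d\<kappa>)\<close> for every nonnegative
  predictable \<open>H\<close> (\<open>jump_sum_compensator\<close>). By a monotone class argument it suffices to count the
  jumps into a set \<open>A\<close> in an interval, on an event of the past. The path of the age detects a jump
  in \<open>(s, v]\<close> by \<open>age v < v - s\<close>, so that on a fine grid the number of jumps is a sum of
  indicators of events that refer to the process at one time, and the Markov property for
  one-dimensional distributions applies to each of them (\<open>markov_landing\<close>). The resulting
  probability of a landing in \<open>A\<close> after a short time \<open>d\<close> is \<open>d\<close> times the intensity, up to
  \<open>O(d\<^sup>2)\<close> (\<open>landing_prob_approx\<close>). The law of the first jump has the kernel at the elapsed time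
  and not at the age; that both agree follows from the Markov property itself
  (\<open>arrival_density_age\<close>).

  Next, \<open>L\<close> is an exponential of finite variation and solves \<open>L = 1 + \<integral> L\<^sub>- (\<rho> - 1) (dp - d\<kappa>)\<close>
  path by path (\<open>jump_density_formula\<close>). The integrand is predictable, and the number of jumps has
  all exponential moments; so \<open>E L = 1\<close> for every bounded nonnegative predictable factor \<open>\<rho>\<close>
  (\<open>jump_density_expectation\<close>). Apply this to the factor \<open>\<rho> (1 + \<epsilon> Z)\<close> and differentiate at
  \<open>\<epsilon> = 0\<close>: the derivative of its density is \<open>L (\<integral> Z dp - \<integral> Z \<rho> d\<kappa>)\<close>, which therefore has
  expectation \<open>0\<close>. Truncation extends this to square integrable \<open>Z\<close>, because \<open>L\<close> has all
  moments; these also give the integrability of \<open>L\<close> times the costs.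
\<close>

section \<open>Jumps of a trajectory\<close>

definition landing_count ::
  "('w, 'k) semi_markov_data \<Rightarrow> 'k set \<Rightarrow> real \<Rightarrow> real \<Rightarrow> 'w \<Rightarrow> real" where
  "landing_count M A s v w =
     (\<Sum>\<tau>\<in>jumps M w \<inter> {s<..v}. indicator A (state M \<tau> w))"

text \<open>
  In terms of the values at time \<open>v\<close> alone, this says that the state is in \<open>A\<close> and that there
  was a jump after \<open>s\<close>: without one, the age at \<open>v\<close> would be at least \<open>v - s\<close>. Only such an
  event is accessible to a Markov property for one-dimensional distributions.
\<close>

definition landing_event ::
  "('w, 'k) semi_markov_data \<Rightarrow> 'k set \<Rightarrow> real \<Rightarrow> real \<Rightarrow> 'w set" where
  "landing_event M A s v = {w \<in> sample_space M. state M v w \<in> A \<and> age M v w < v - s}"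

definition grid_landings ::
  "('w, 'k) semi_markov_data \<Rightarrow> 'k set \<Rightarrow> (nat \<Rightarrow> real) \<Rightarrow> nat \<Rightarrow> 'w \<Rightarrow> real" where
  "grid_landings M A g n w = (\<Sum>i<n. indicator (landing_event M A (g i) (g (Suc i))) w)"

definition uniform_grid :: "real \<Rightarrow> real \<Rightarrow> nat \<Rightarrow> nat \<Rightarrow> real" where
  "uniform_grid s v m i = s + real i * ((v - s) / real m)"

declare jump_time.simps(2) [simp del]

lemma jump_time_Suc_infinite: "jump_time M n w = \<infinity> \<Longrightarrow> jump_time M (Suc n) w = \<infinity>"
  by (simp add: jump_time.simps(2) top_ereal_def)

context semi_markov
begin

lemma space_age_state_space: "space (age_state_space M) = space (state_space M) \<times> {0..}"
  by (simp add: age_state_space_def space_pair_measure space_restrict_space)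

lemma state_in_space: "w \<in> sample_space M \<Longrightarrow> 0 \<le> t \<Longrightarrow> state M t w \<in> space (state_space M)"
  and age_nonneg: "w \<in> sample_space M \<Longrightarrow> 0 \<le> t \<Longrightarrow> 0 \<le> age M t w"
  using process_space[of t w] by (auto simp: space_age_state_space)

lemma jumps_pos: "\<tau> \<in> jumps M w \<Longrightarrow> 0 < \<tau>"
  by (simp add: jumps_def)

lemma finite_jumps_bounded: "w \<in> sample_space M \<Longrightarrow> finite (jumps M w \<inter> {..v})"
  by (rule finite_subset[OF _ finitely_many_jumps[of w "max 0 v"]]) (auto dest: jumps_pos)

lemma finite_jumps: "w \<in> sample_space M \<Longrightarrow> I \<subseteq> {..v} \<Longrightarrow> finite (jumps M w \<inter> I)"
  by (rule finite_subset[OF _ finite_jumps_bounded[of w v]]) auto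

lemma finite_jumps_Ioc: "w \<in> sample_space M \<Longrightarrow> finite (jumps M w \<inter> {s<..v})"
  and finite_jumps_Ioo: "w \<in> sample_space M \<Longrightarrow> finite (jumps M w \<inter> {s<..<v})"
  by (rule finite_jumps[of w _ v]; auto)+

text \<open>
  After the last jump the age grows with slope one from \<open>0\<close>; without a jump it grows from a
  nonnegative value at \<open>s\<close>.
\<close>

lemma jump_between_iff_age:
  assumes "w \<in> sample_space M" "0 \<le> s" "s \<le> v"
  shows "jumps M w \<inter> {s<..v} \<noteq> {} \<longleftrightarrow> age M v w < v - s"
proof
  assume ne: "jumps M w \<inter> {s<..v} \<noteq> {}"
  define \<tau> where "\<tau> = Max (jumps M w \<inter> {s<..v})"
  have fin: "finite (jumps M w \<inter> {s<..v})"
    by (rule finite_jumps[OF assms(1), of _ v]) auto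
  have \<tau>: "\<tau> \<in> jumps M w \<inter> {s<..v}"
    unfolding \<tau>_def using fin ne by (rule Max_in)
  have "jumps M w \<inter> {\<tau><..v} = {}"
  proof (rule ccontr)
    assume "jumps M w \<inter> {\<tau><..v} \<noteq> {}"
    then obtain \<tau>' where "\<tau>' \<in> jumps M w" "\<tau> < \<tau>'" "\<tau>' \<le> v" by auto
    moreover from this have "\<tau>' \<le> \<tau>"
      using \<tau> Max_ge[OF fin, of \<tau>'] by (auto simp: \<tau>_def[symmetric])
    ultimately show False by simp
  qed
  then have "age M v w = age M \<tau> w + (v - \<tau>)"
    using \<tau> assms by (intro age_slope_one) auto
  with age_reset[OF assms(1), of \<tau>] \<tau> show "age M v w < v - s" by auto
next
  assume less: "age M v w < v - s"
  show "jumps M w \<inter> {s<..v} \<noteq> {}"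
  proof
    assume "jumps M w \<inter> {s<..v} = {}"
    then have "age M v w = age M s w + (v - s)" by (rule age_slope_one[OF assms])
    with age_nonneg[OF assms(1,2)] less show False by simp
  qed
qed

lemma no_jump_since_0_iff_age:
  assumes "w \<in> sample_space M" "0 \<le> v"
  shows "jumps M w \<inter> {0<..v} = {} \<longleftrightarrow> age M v w = age M 0 w + v"
  using jump_between_iff_age[OF assms(1) order_refl assms(2)] age_nonneg[OF assms(1), of 0]
    age_slope_one[OF assms(1) order_refl assms(2)] by auto

lemma landing_event_iff:
  assumes "w \<in> sample_space M" "0 \<le> s" "s \<le> v"
  shows "w \<in> landing_event M A s v \<longleftrightarrow> state M v w \<in> A \<and> jumps M w \<inter> {s<..v} \<noteq> {}"
  using jump_between_iff_age[OF assms] assms by (auto simp: landing_event_def)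

lemma left_gap:
  assumes "w \<in> sample_space M" "0 < s"
  obtains e where "0 \<le> e" "e < s" "jumps M w \<inter> {e<..<s} = {}"
proof -
  define F where "F = insert 0 (jumps M w \<inter> {..<s})"
  have fin: "finite F"
    unfolding F_def using finite_jumps[OF assms(1), of "{..<s}" s] by (simp add: subset_eq)
  then have "Max F \<in> F" by (intro Max_in) (auto simp: F_def)
  then have "Max F < s" using assms by (auto simp: F_def)
  moreover have "0 \<le> Max F" using fin by (intro Max_ge) (auto simp: F_def)
  moreover have "jumps M w \<inter> {Max F<..<s} = {}"
  proof (rule ccontr)
    assume "jumps M w \<inter> {Max F<..<s} \<noteq> {}"
    then obtain \<tau> where "\<tau> \<in> jumps M w" "Max F < \<tau>" "\<tau> < s" by auto
    moreover from this have "\<tau> \<le> Max F" using fin by (intro Max_ge) (auto simp: F_def)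
    ultimately show False by simp
  qed
  ultimately show ?thesis using that by blast
qed

lemma left_values:
  assumes w: "w \<in> sample_space M" and e: "0 \<le> e" "e < s" "jumps M w \<inter> {e<..<s} = {}"
    and p: "e \<le> p" "p < s"
  shows "state_left M s w = state M p w" "age_left M s w = age M p w + (s - p)"
proof -
  have no: "jumps M w \<inter> {e<..p'} = {}" if "p' < s" for p' using e that by fastforce
  have st: "state M p' w = state M e w" if "e \<le> p'" "p' < s" for p'
    using state_piecewise_constant[OF w e(1) that(1) no[OF that(2)]] .
  have ag: "age M p' w = age M e w + (p' - e)" if "e \<le> p'" "p' < s" for p'
    using age_slope_one[OF w e(1) that(1) no[OF that(2)]] .
  have ev: "\<forall>\<^sub>F p' in at_left s. e < p' \<and> p' < s"
    using e by (intro eventually_conj) (auto simp: eventually_at_left[of e])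
  have "(THE x. \<forall>\<^sub>F p in at_left s. state M p w = x) = state M e w"
  proof (rule the_equality)
    show "\<forall>\<^sub>F p in at_left s. state M p w = state M e w"
      using ev by eventually_elim (metis st less_imp_le)
    show "x = state M e w" if "\<forall>\<^sub>F p in at_left s. state M p w = x" for x
    proof -
      have "\<forall>\<^sub>F p in at_left s. x = state M e w"
        using that ev by eventually_elim (metis st less_imp_le)
      then show ?thesis by simp
    qed
  qed
  then show "state_left M s w = state M p w" using e st[OF p] by (simp add: state_left_def)
  have "((\<lambda>p. age M e w + (p - e)) \<longlongrightarrow> age M e w + (s - e)) (at_left s)"
    by (intro tendsto_intros)
  then have "((\<lambda>p. age M p w) \<longlongrightarrow> age M e w + (s - e)) (at_left s)"
    by (rule Lim_transform_eventually) (use ev in eventually_elim, metis ag less_imp_le)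
  then have "Lim (at_left s) (\<lambda>p. age M p w) = age M e w + (s - e)"
    by (intro tendsto_Lim) auto
  then show "age_left M s w = age M p w + (s - p)" using e ag[OF p] by (simp add: age_left_def)
qed

lemma left_eq_off_jumps:
  assumes w: "w \<in> sample_space M" and s: "0 \<le> s" "s \<notin> jumps M w"
  shows "state_left M s w = state M s w" "age_left M s w = age M s w"
proof -
  have "state_left M s w = state M s w \<and> age_left M s w = age M s w"
  proof (cases "s = 0")
    case False
    then obtain e where e: "0 \<le> e" "e < s" "jumps M w \<inter> {e<..<s} = {}"
      using left_gap[OF w, of s] s by auto
    then have no: "jumps M w \<inter> {e<..s} = {}"
      using s by (auto simp: disjoint_iff greaterThanAtMost_def less_le)
    have "e \<le> s" using e by simp
    show ?thesis
      using left_values[OF w e order_refl e(2)] state_piecewise_constant[OF w e(1) \<open>e \<le> s\<close> no]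
        age_slope_one[OF w e(1) \<open>e \<le> s\<close> no] by auto
  qed (simp add: state_left_def age_left_def)
  then show "state_left M s w = state M s w" "age_left M s w = age M s w" by auto
qed

lemma left_in_space:
  assumes w: "w \<in> sample_space M" and s: "0 \<le> s"
  shows "state_left M s w \<in> space (state_space M)" "0 \<le> age_left M s w"
proof -
  have "state_left M s w \<in> space (state_space M) \<and> 0 \<le> age_left M s w"
  proof (cases "s = 0")
    case True
    then show ?thesis using state_in_space[OF w, of 0] age_nonneg[OF w, of 0]
      by (simp add: state_left_def age_left_def)
  next
    case False
    then obtain e where e: "0 \<le> e" "e < s" "jumps M w \<inter> {e<..<s} = {}"
      using left_gap[OF w, of s] s by auto
    then show ?thesis
      using left_values[OF w e order_refl e(2)] state_in_space[OF w e(1)] age_nonneg[OF w e(1)] by auto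
  qed
  then show "state_left M s w \<in> space (state_space M)" "0 \<le> age_left M s w" by auto
qed

lemma state_jump_neq:
  assumes w: "w \<in> sample_space M" and \<tau>: "\<tau> \<in> jumps M w"
    and e: "0 \<le> e" "e < \<tau>" "jumps M w \<inter> {e<..<\<tau>} = {}"
  shows "state M \<tau> w \<noteq> state M e w"
proof
  assume eq: "state M \<tau> w = state M e w"
  have "\<forall>\<^sub>F p in at_left \<tau>. e < p \<and> p < \<tau>"
    using e by (intro eventually_conj) (auto simp: eventually_at_left[of e])
  then have "\<forall>\<^sub>F p in at_left \<tau>. state M p w = state M \<tau> w"
  proof eventually_elim
    case (elim p)
    then have "jumps M w \<inter> {e<..p} = {}" using e by fastforce
    with elim have "state M p w = state M e w"
      by (intro state_piecewise_constant[OF w e(1)]) simp_all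
    with eq show ?case by simp
  qed
  with \<tau> show False unfolding jumps_def by blast
qed

lemma jump_time_Suc_last:
  assumes w: "w \<in> sample_space M" and n: "jump_time M n w = ereal \<tau>" "0 \<le> \<tau>"
    and none: "jumps M w \<inter> {\<tau><..} = {}"
  shows "jump_time M (Suc n) w = \<infinity>"
proof -
  have "state M s w = state M \<tau> w" if "\<tau> \<le> s" for s
    by (rule state_piecewise_constant[OF w n(2) that]) (use none in auto)
  then have "\<not> (ereal \<tau> \<le> ereal s \<and> state M s w \<noteq> state M \<tau> w)" for s
    unfolding ereal_less_eq(3) by blast
  then have empty: "{ereal s | s. ereal \<tau> \<le> ereal s \<and> state M s w \<noteq> state M \<tau> w} = {}" by blast
  show ?thesis unfolding jump_time.simps n(1) real_of_ereal.simps empty by (simp add: top_ereal_def)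
qed

text \<open>
  The next time is defined as the first exit from the current state. Between two consecutive jumps
  the state is constant, and it changes at a jump; so the first exit is the next jump.
\<close>

lemma jump_time_Suc_next:
  assumes w: "w \<in> sample_space M" and n: "jump_time M n w = ereal \<tau>" "0 \<le> \<tau>"
    and \<tau>': "\<tau>' \<in> jumps M w" "\<tau> < \<tau>'" "jumps M w \<inter> {\<tau><..<\<tau>'} = {}"
  shows "jump_time M (Suc n) w = ereal \<tau>'"
proof -
  have neq: "state M \<tau>' w \<noteq> state M \<tau> w"
    by (rule state_jump_neq[OF w \<tau>'(1) n(2) \<tau>'(2,3)])
  have same: "state M s w = state M \<tau> w" if "\<tau> \<le> s" "s < \<tau>'" for s
  proof (rule state_piecewise_constant[OF w n(2) that(1)])
    show "jumps M w \<inter> {\<tau><..s} = {}" using \<tau>' that by fastforce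
  qed
  have "Inf {ereal s | s. ereal \<tau> \<le> ereal s \<and> state M s w \<noteq> state M \<tau> w} = ereal \<tau>'"
  proof (rule antisym)
    show "Inf {ereal s | s. ereal \<tau> \<le> ereal s \<and> state M s w \<noteq> state M \<tau> w} \<le> ereal \<tau>'"
      using neq \<tau>' by (intro Inf_lower) auto
    show "ereal \<tau>' \<le> Inf {ereal s | s. ereal \<tau> \<le> ereal s \<and> state M s w \<noteq> state M \<tau> w}"
    proof (rule Inf_greatest)
      fix z assume "z \<in> {ereal s | s. ereal \<tau> \<le> ereal s \<and> state M s w \<noteq> state M \<tau> w}"
      then obtain s where s: "z = ereal s" "ereal \<tau> \<le> ereal s" "state M s w \<noteq> state M \<tau> w"
        by blast
      have "\<tau> \<le> s" using s(2) by simp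
      then have "\<tau>' \<le> s" using same[of s] s(3) not_less by blast
      then show "ereal \<tau>' \<le> z" using s by simp
    qed
  qed
  then show ?thesis unfolding jump_time.simps n(1) real_of_ereal.simps .
qed

lemma next_jump:
  assumes w: "w \<in> sample_space M" and ne: "jumps M w \<inter> {\<tau><..} \<noteq> {}"
  obtains \<tau>' where "\<tau>' \<in> jumps M w" "\<tau> < \<tau>'" "jumps M w \<inter> {\<tau><..<\<tau>'} = {}"
proof -
  from ne obtain \<sigma> where \<sigma>: "\<sigma> \<in> jumps M w" "\<tau> < \<sigma>" by auto
  define F where "F = jumps M w \<inter> {\<tau><..\<sigma>}"
  have fin: "finite F" unfolding F_def by (rule finite_jumps[OF w, of _ \<sigma>]) auto
  have "\<sigma> \<in> F" using \<sigma> by (auto simp: F_def)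
  then have Min: "Min F \<in> F" using fin by (intro Min_in) auto
  have "jumps M w \<inter> {\<tau><..<Min F} = {}"
  proof (rule ccontr)
    assume "jumps M w \<inter> {\<tau><..<Min F} \<noteq> {}"
    then obtain \<rho> where r: "\<rho> \<in> jumps M w" "\<tau> < \<rho>" "\<rho> < Min F" by auto
    then have "\<rho> \<in> F" using Min by (auto simp: F_def)
    then have "Min F \<le> \<rho>" using fin by simp
    with r show False by simp
  qed
  then show ?thesis using Min that[of "Min F"] by (auto simp: F_def)
qed

lemma jump_time_cases:
  assumes w: "w \<in> sample_space M"
  shows "jump_time M n w = \<infinity> \<or>
    (\<exists>\<tau>. jump_time M n w = ereal \<tau> \<and> 0 \<le> \<tau> \<and> (1 \<le> n \<longrightarrow> \<tau> \<in> jumps M w))"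
proof (induction n)
  case 0
  then show ?case by (auto simp: zero_ereal_def)
next
  case (Suc n)
  show ?case
  proof (cases "jump_time M n w = \<infinity>")
    case True
    then show ?thesis by (simp add: jump_time_Suc_infinite)
  next
    case False
    with Suc obtain \<tau> where \<tau>: "jump_time M n w = ereal \<tau>" "0 \<le> \<tau>" by auto
    show ?thesis
    proof (cases "jumps M w \<inter> {\<tau><..} = {}")
      case True
      show ?thesis using jump_time_Suc_last[OF w \<tau> True] by blast
    next
      case False
      then obtain \<tau>' where \<tau>': "\<tau>' \<in> jumps M w" "\<tau> < \<tau>'" "jumps M w \<inter> {\<tau><..<\<tau>'} = {}"
        using next_jump[OF w] by blast
      have "0 \<le> \<tau>'" using jumps_pos[OF \<tau>'(1)] by simp
      then show ?thesis using jump_time_Suc_next[OF w \<tau> \<tau>'] \<tau>'(1) by blast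
    qed
  qed
qed

lemma jump_time_strict:
  assumes w: "w \<in> sample_space M" and "jump_time M n w = ereal \<tau>" "m < n"
  shows "jump_time M m w < ereal \<tau>"
  using assms(2,3)
proof (induction n arbitrary: \<tau>)
  case (Suc n)
  have nfin: "jump_time M n w \<noteq> \<infinity>"
    using Suc.prems(1) jump_time_Suc_infinite[of M n w] by auto
  with jump_time_cases[OF w, of n] obtain \<sigma> where \<sigma>: "jump_time M n w = ereal \<sigma>" "0 \<le> \<sigma>"
    by auto
  have "\<sigma> < \<tau>"
  proof (cases "jumps M w \<inter> {\<sigma><..} = {}")
    case True
    show ?thesis using jump_time_Suc_last[OF w \<sigma> True] Suc.prems(1) by simp
  next
    case False
    then obtain \<tau>' where \<tau>': "\<tau>' \<in> jumps M w" "\<sigma> < \<tau>'" "jumps M w \<inter> {\<sigma><..<\<tau>'} = {}"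
      using next_jump[OF w] by blast
    show ?thesis using jump_time_Suc_next[OF w \<sigma> \<tau>'] Suc.prems(1) \<tau>'(2) by simp
  qed
  then have "ereal \<sigma> < ereal \<tau>" by simp
  moreover have "jump_time M m w \<le> ereal \<sigma>"
    using Suc.IH[OF \<sigma>(1)] \<sigma>(1) Suc.prems(2) by (cases "m = n") auto
  ultimately show ?case by (rule le_less_trans[rotated])
qed simp

text \<open>
  A jump that no \<open>T n\<close> hits would lie above all of them; but these are then infinitely many jumps
  in a bounded interval.
\<close>

lemma jump_time_surj:
  assumes w: "w \<in> sample_space M" and \<tau>: "\<tau> \<in> jumps M w"
  obtains n where "1 \<le> n" "jump_time M n w = ereal \<tau>"
proof -
  have "\<exists>n. \<not> jump_time M n w < ereal \<tau>"
  proof (rule ccontr)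
    assume "\<nexists>n. \<not> jump_time M n w < ereal \<tau>"
    then have less: "jump_time M n w < ereal \<tau>" for n by auto
    have e: "\<exists>\<sigma>. jump_time M n w = ereal \<sigma> \<and> 0 \<le> \<sigma> \<and> (1 \<le> n \<longrightarrow> \<sigma> \<in> jumps M w)" for n
      using jump_time_cases[OF w, of n] less[of n] by auto
    then obtain f where f: "jump_time M n w = ereal (f n)" "1 \<le> n \<Longrightarrow> f n \<in> jumps M w" for n
      by metis
    have "strict_mono f"
      using jump_time_strict[OF w f(1)] f(1) by (auto intro!: strict_monoI)
    then have "inj_on f {1..}" using strict_mono_imp_inj_on inj_on_subset by blast
    moreover have "f ` {1..} \<subseteq> jumps M w \<inter> {..\<tau>}"
      using f less by (auto simp: less_imp_le)
    ultimately have "finite {1::nat..}"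
      using finite_jumps_bounded[OF w, of \<tau>] finite_imageD finite_subset by blast
    then show False using infinite_Ici by blast
  qed
  define n where "n = (LEAST n. \<not> jump_time M n w < ereal \<tau>)"
  have n: "\<not> jump_time M n w < ereal \<tau>" "\<And>m. m < n \<Longrightarrow> jump_time M m w < ereal \<tau>"
    unfolding n_def using LeastI_ex[OF \<open>\<exists>n. _\<close>] not_less_Least by blast+
  have "n \<noteq> 0" using n jumps_pos[OF \<tau>] by (metis jump_time.simps(1) ereal_less(2))
  then obtain m where m: "n = Suc m" using not0_implies_Suc by blast
  then have less: "jump_time M m w < ereal \<tau>" using n by simp
  with jump_time_cases[OF w, of m] obtain \<sigma> where \<sigma>: "jump_time M m w = ereal \<sigma>" "0 \<le> \<sigma>"
    by auto
  have "jumps M w \<inter> {\<sigma><..} \<noteq> {}" using \<tau> less \<sigma> by auto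
  then obtain \<tau>' where \<tau>': "\<tau>' \<in> jumps M w" "\<sigma> < \<tau>'" "jumps M w \<inter> {\<sigma><..<\<tau>'} = {}"
    using next_jump[OF w] by blast
  have "jump_time M n w = ereal \<tau>'" using jump_time_Suc_next[OF w \<sigma> \<tau>'] m by simp
  moreover have "\<tau>' \<le> \<tau>" using \<tau>' \<tau> less \<sigma> by (auto simp: disjoint_iff not_less)
  moreover have "\<tau> \<le> \<tau>'" using n calculation by auto
  ultimately show ?thesis using that[of n] m by auto
qed

lemma bij_betw_jump_time:
  assumes w: "w \<in> sample_space M"
  shows "bij_betw (\<lambda>n. real_of_ereal (jump_time M n w)) {n. 1 \<le> n \<and> jump_time M n w < \<infinity>}
           (jumps M w)"
proof (rule bij_betw_imageI)
  show "inj_on (\<lambda>n. real_of_ereal (jump_time M n w)) {n. 1 \<le> n \<and> jump_time M n w < \<infinity>}"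
  proof (rule inj_onI)
    fix m n assume *: "m \<in> {n. 1 \<le> n \<and> jump_time M n w < \<infinity>}" "n \<in> {n. 1 \<le> n \<and> jump_time M n w < \<infinity>}"
      "real_of_ereal (jump_time M m w) = real_of_ereal (jump_time M n w)"
    then obtain a b where "jump_time M m w = ereal a" "jump_time M n w = ereal b"
      using jump_time_cases[OF w, of m] jump_time_cases[OF w, of n] by auto
    with * show "m = n"
      using jump_time_strict[OF w, of n b m] jump_time_strict[OF w, of m a n]
      by (cases m n rule: linorder_cases) auto
  qed
  show "(\<lambda>n. real_of_ereal (jump_time M n w)) ` {n. 1 \<le> n \<and> jump_time M n w < \<infinity>} = jumps M w"
  proof (intro equalityI subsetI)
    fix \<tau> assume "\<tau> \<in> (\<lambda>n. real_of_ereal (jump_time M n w)) ` {n. 1 \<le> n \<and> jump_time M n w < \<infinity>}"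
    then obtain n where n: "1 \<le> n" "jump_time M n w < \<infinity>" "\<tau> = real_of_ereal (jump_time M n w)" by auto
    then show "\<tau> \<in> jumps M w" using jump_time_cases[OF w, of n] by auto
  next
    fix \<tau> assume "\<tau> \<in> jumps M w"
    then obtain n where "1 \<le> n" "jump_time M n w = ereal \<tau>" by (rule jump_time_surj[OF w])
    then show "\<tau> \<in> (\<lambda>n. real_of_ereal (jump_time M n w)) ` {n. 1 \<le> n \<and> jump_time M n w < \<infinity>}"
      by (intro image_eqI[of _ _ n]) auto
  qed
qed

lemma bij_betw_jump_time_upto:
  assumes w: "w \<in> sample_space M"
  shows "bij_betw (\<lambda>n. real_of_ereal (jump_time M n w)) {n. 1 \<le> n \<and> jump_time M n w \<le> ereal s}
           (jumps M w \<inter> {0<..s})"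
proof (rule bij_betw_subset[OF bij_betw_jump_time[OF w]])
  let ?f = "\<lambda>n. real_of_ereal (jump_time M n w)"
  show "{n. 1 \<le> n \<and> jump_time M n w \<le> ereal s} \<subseteq> {n. 1 \<le> n \<and> jump_time M n w < \<infinity>}"
  proof
    fix n assume "n \<in> {n. 1 \<le> n \<and> jump_time M n w \<le> ereal s}"
    then show "n \<in> {n. 1 \<le> n \<and> jump_time M n w < \<infinity>}"
      by (cases "jump_time M n w") simp_all
  qed
  show "?f ` {n. 1 \<le> n \<and> jump_time M n w \<le> ereal s} = jumps M w \<inter> {0<..s}"
  proof (intro equalityI subsetI)
    fix \<tau> assume "\<tau> \<in> ?f ` {n. 1 \<le> n \<and> jump_time M n w \<le> ereal s}"
    then obtain n where n: "1 \<le> n" "jump_time M n w \<le> ereal s" "\<tau> = ?f n" by auto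
    then obtain \<sigma> where "jump_time M n w = ereal \<sigma>" "\<sigma> \<in> jumps M w"
      using jump_time_cases[OF w, of n] by auto
    then show "\<tau> \<in> jumps M w \<inter> {0<..s}" using n jumps_pos[of \<sigma>] by simp
  next
    fix \<tau> assume *: "\<tau> \<in> jumps M w \<inter> {0<..s}"
    then obtain n where "1 \<le> n" "jump_time M n w = ereal \<tau>" using jump_time_surj[OF w] by blast
    then show "\<tau> \<in> ?f ` {n. 1 \<le> n \<and> jump_time M n w \<le> ereal s}"
      using * by (intro image_eqI[of _ _ n]) auto
  qed
qed

section \<open>Counting jumps on a grid\<close>

lemma landing_count_split:
  assumes "w \<in> sample_space M" "s \<le> c" "c \<le> v"
  shows "landing_count M A s v w = landing_count M A s c w + landing_count M A c v w"
proof -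
  have "jumps M w \<inter> {s<..v} = (jumps M w \<inter> {s<..c}) \<union> (jumps M w \<inter> {c<..v})"
    using assms by auto
  moreover have "finite (jumps M w \<inter> {s<..c})" "finite (jumps M w \<inter> {c<..v})"
    using finite_jumps_Ioc[OF assms(1), of s c] finite_jumps_Ioc[OF assms(1), of c v]
    by (simp_all add: subset_eq)
  moreover have "(jumps M w \<inter> {s<..c}) \<inter> (jumps M w \<inter> {c<..v}) = {}" by auto
  ultimately show ?thesis unfolding landing_count_def by (simp add: sum.union_disjoint)
qed

lemma landing_count_nonneg: "0 \<le> landing_count M A s v w"
  by (simp add: landing_count_def sum_nonneg)

lemma landing_count_UNIV: "landing_count M UNIV s v w = real (card (jumps M w \<inter> {s<..v}))"
  by (simp add: landing_count_def)

lemma landing_count_mono: "landing_count M A s v w \<le> landing_count M UNIV s v w"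
  unfolding landing_count_def by (intro sum_mono) (auto split: split_indicator)

lemma indicator_landing_event_le:
  assumes "w \<in> sample_space M" "0 \<le> s" "s \<le> v"
  shows "indicator (landing_event M A s v) w \<le> landing_count M UNIV s v w"
proof (cases "jumps M w \<inter> {s<..v} = {}")
  case True
  then show ?thesis using landing_event_iff[OF assms, of A] by (simp add: landing_count_nonneg)
next
  case False
  then have "0 < card (jumps M w \<inter> {s<..v})"
    using finite_jumps_Ioc[OF assms(1), of s v] by (simp add: card_gt_0_iff)
  then show ?thesis unfolding landing_count_UNIV by (auto split: split_indicator)
qed

text \<open>
  A single jump in the interval determines the state at its end. With two jumps the event only sees
  where the last one leads.
\<close>

lemma indicator_landing_event_eq:
  assumes "w \<in> sample_space M" "0 \<le> s" "s \<le> v" "card (jumps M w \<inter> {s<..v}) \<le> 1"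
  shows "indicator (landing_event M A s v) w = landing_count M A s v w"
proof (cases "jumps M w \<inter> {s<..v} = {}")
  case True
  then show ?thesis using landing_event_iff[OF assms(1-3), of A] by (simp add: landing_count_def)
next
  case False
  have "finite (jumps M w \<inter> {s<..v})" using finite_jumps_Ioc[OF assms(1), of s v] by auto
  with False assms(4) have "card (jumps M w \<inter> {s<..v}) = 1"
    by (metis One_nat_def card_gt_0_iff le_neq_implies_less less_one not_less0)
  then obtain \<tau> where \<tau>: "jumps M w \<inter> {s<..v} = {\<tau>}" by (auto simp: card_1_singleton_iff)
  then have t: "s < \<tau>" "\<tau> \<le> v" by auto
  have "jumps M w \<inter> {\<tau><..v} = {}" using \<tau> t by fastforce
  then have "state M v w = state M \<tau> w" using t assms by (intro state_piecewise_constant) auto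
  then show ?thesis using landing_event_iff[OF assms(1-3), of A] \<tau> 
    by (auto simp: landing_count_def split: split_indicator)
qed

lemma uniform_grid_0 [simp]: "uniform_grid s v m 0 = s"
  by (simp add: uniform_grid_def)

lemma uniform_grid_last [simp]: "0 < m \<Longrightarrow> uniform_grid s v m m = v"
  by (simp add: uniform_grid_def)

lemma uniform_grid_Suc: "uniform_grid s v m (Suc i) = uniform_grid s v m i + (v - s) / real m"
  by (simp add: uniform_grid_def distrib_right add_divide_distrib)

lemma uniform_grid_mono: "s \<le> v \<Longrightarrow> mono (uniform_grid s v m)"
  unfolding uniform_grid_def by (intro monoI add_left_mono mult_right_mono) auto

lemma landing_count_grid:
  assumes "w \<in> sample_space M" "mono g"
  shows "landing_count M A (g 0) (g n) w = (\<Sum>i<n. landing_count M A (g i) (g (Suc i)) w)"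
proof (induction n)
  case (Suc n)
  have "landing_count M A (g 0) (g (Suc n)) w
      = landing_count M A (g 0) (g n) w + landing_count M A (g n) (g (Suc n)) w"
    by (intro landing_count_split assms(1) monoD[OF assms(2)]) auto
  with Suc show ?case by simp
qed (simp add: landing_count_def)

lemma grid_landings_le:
  assumes "w \<in> sample_space M" "mono g" "0 \<le> g 0"
  shows "grid_landings M A g n w \<le> landing_count M UNIV (g 0) (g n) w"
  unfolding grid_landings_def landing_count_grid[OF assms(1,2)]
proof (intro sum_mono indicator_landing_event_le assms(1))
  fix i show "g i \<le> g (Suc i)" "0 \<le> g i"
    using monoD[OF assms(2), of i "Suc i"] monoD[OF assms(2), of 0 i] assms(3) by auto
qed

text \<open>
  On a given path there are finitely many jumps in \<open>(s, v]\<close>. As soon as the mesh is smaller than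
  their minimal distance, no cell contains two of them.
\<close>

lemma grid_landings_eventually:
  assumes w: "w \<in> sample_space M" and s: "0 \<le> s" "s < v"
  shows "\<forall>\<^sub>F m in sequentially. grid_landings M A (uniform_grid s v m) m w = landing_count M A s v w"
proof -
  define J where "J = jumps M w \<inter> {s<..v}"
  have fin: "finite J" unfolding J_def using finite_jumps_Ioc[OF w, of s v] by auto
  define D where "D = (\<lambda>(p, q). \<bar>p - q\<bar>) ` ((J \<times> J) - Id)"
  have "\<exists>\<delta>>0. \<forall>x\<in>D. \<delta> \<le> x"
  proof (cases "D = {}")
    case False
    have "finite D" using fin by (simp add: D_def)
    then show ?thesis using False Min_in[of D] by (intro exI[of _ "Min D"]) (auto simp: D_def)
  qed (auto intro: exI[of _ 1])
  then obtain \<delta> where d: "0 < \<delta>" "\<And>x. x \<in> D \<Longrightarrow> \<delta> \<le> x" by blast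
  have "\<delta> \<le> \<bar>p - q\<bar>" if "p \<in> J" "q \<in> J" "p \<noteq> q" for p q
    using that by (intro d(2)) (auto simp: D_def)
  note \<delta> = d(1) this
  obtain m0 where m0: "(v - s) / \<delta> < real m0" using reals_Archimedean2 by blast
  show ?thesis
  proof (rule eventually_sequentiallyI[of "max 1 m0"])
    fix m assume "max 1 m0 \<le> m"
    then have m: "0 < m" "m0 \<le> m" by auto
    have "(v - s) / \<delta> < real m" using m0 m(2) by (meson less_le_trans of_nat_mono)
    then have mesh: "(v - s) / real m < \<delta>" using \<delta>(1) m(1) by (simp add: field_simps)
    define g where "g = uniform_grid s v m"
    have gm: "mono g" using s by (simp add: g_def uniform_grid_mono)
    have g0: "g 0 = s" "g m = v" using m by (auto simp: g_def)
    have "grid_landings M A g m w = (\<Sum>i<m. landing_count M A (g i) (g (Suc i)) w)"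
      unfolding grid_landings_def
    proof (intro sum.cong refl indicator_landing_event_eq w)
      fix i assume "i \<in> {..<m}"
      then have le: "g i \<le> g (Suc i)" "s \<le> g i" "g (Suc i) \<le> v"
        using monoD[OF gm, of i "Suc i"] monoD[OF gm, of 0 i] monoD[OF gm, of "Suc i" m] g0 by auto
      then show "g i \<le> g (Suc i)" "0 \<le> g i" using s by auto
      have "p = q" if "p \<in> jumps M w \<inter> {g i<..g (Suc i)}" "q \<in> jumps M w \<inter> {g i<..g (Suc i)}" for p q
      proof (rule ccontr)
        assume "p \<noteq> q"
        with that le have "\<delta> \<le> \<bar>p - q\<bar>" by (intro \<delta>(2)) (auto simp: J_def)
        moreover have "\<bar>p - q\<bar> < \<delta>" using that mesh by (auto simp: g_def uniform_grid_Suc)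
        ultimately show False by simp
      qed
      then show "card (jumps M w \<inter> {g i<..g (Suc i)}) \<le> 1"
        by (metis (no_types, lifting) One_nat_def card_le_Suc0_iff_eq card.infinite le0)
    qed
    then show "grid_landings M A (uniform_grid s v m) m w = landing_count M A s v w"
      using landing_count_grid[OF w gm, of A m] g0 by (simp add: g_def)
  qed
qed

section \<open>The natural filtration\<close>

text \<open>
  Sets of states enter through preimages under paths in the state space only; this form admits
  \<open>UNIV\<close> as well.
\<close>

abbreviation target_set :: "'k set \<Rightarrow> bool" where
  "target_set A \<equiv> A \<inter> space (state_space M) \<in> sets (state_space M)"

lemma space_generated [simp]: "space (generated_by_times M I) = sample_space M"
  unfolding generated_by_times_def by (rule space_measure_of) auto

lemma space_nat_filtration [simp]: "space (nat_filtration M t) = sample_space M"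
  by (simp add: nat_filtration_def)

lemma sets_generated:
  "sets (generated_by_times M I) = sigma_sets (sample_space M)
     {(\<lambda>w. (state M s w, age M s w)) -` B \<inter> sample_space M | s B.
        s \<in> I \<and> B \<in> sets (age_state_space M)}"
  unfolding generated_by_times_def by (rule sets_measure_of) auto

lemma generated_mono: "I \<subseteq> I' \<Longrightarrow> sets (generated_by_times M I) \<subseteq> sets (generated_by_times M I')"
  unfolding sets_generated by (rule sigma_sets_mono') blast

lemma nat_filtration_mono: "s \<le> t \<Longrightarrow> sets (nat_filtration M s) \<subseteq> sets (nat_filtration M t)"
  unfolding nat_filtration_def by (rule generated_mono) auto

lemma nat_filtration_subset: "sets (nat_filtration M s) \<subseteq> sets (generated_by_times M {0..})"
  unfolding nat_filtration_def by (rule generated_mono) auto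

lemma measurable_nat_filtration_generated:
  "f \<in> nat_filtration M s \<rightarrow>\<^sub>M N \<Longrightarrow> f \<in> generated_by_times M {0..} \<rightarrow>\<^sub>M N"
  using nat_filtration_subset[of s] by (auto simp: measurable_def)

lemma state_age_measurable:
  assumes "0 \<le> s" "s \<le> t"
  shows "(\<lambda>w. (state M s w, age M s w)) \<in> nat_filtration M t \<rightarrow>\<^sub>M age_state_space M"
proof (rule measurableI)
  fix B assume "B \<in> sets (age_state_space M)"
  then show "(\<lambda>w. (state M s w, age M s w)) -` B \<inter> space (nat_filtration M t) \<in> sets (nat_filtration M t)"
    unfolding space_nat_filtration unfolding nat_filtration_def sets_generated
    using assms by (intro sigma_sets.Basic) auto
qed (use process_space assms in auto)

lemma fst_age_state_space: "fst \<in> age_state_space M \<rightarrow>\<^sub>M state_space M"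
  unfolding age_state_space_def by simp

lemma snd_age_state_space: "snd \<in> borel_measurable (age_state_space M)"
proof -
  have "snd \<in> age_state_space M \<rightarrow>\<^sub>M restrict_space borel {0..}"
    unfolding age_state_space_def by simp
  then show ?thesis by (simp add: measurable_restrict_space2_iff)
qed

lemma state_measurable: "0 \<le> s \<Longrightarrow> s \<le> t \<Longrightarrow> state M s \<in> nat_filtration M t \<rightarrow>\<^sub>M state_space M"
  using measurable_compose[OF state_age_measurable fst_age_state_space] by simp

lemma age_measurable: "0 \<le> s \<Longrightarrow> s \<le> t \<Longrightarrow> age M s \<in> borel_measurable (nat_filtration M t)"
  using measurable_compose[OF state_age_measurable snd_age_state_space] by simp

lemma landing_event_sets:
  assumes "target_set A" "0 \<le> s" "s \<le> v"
  shows "landing_event M A s v \<in> sets (nat_filtration M v)"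
proof -
  have [measurable]: "state M v \<in> nat_filtration M v \<rightarrow>\<^sub>M state_space M"
    "age M v \<in> borel_measurable (nat_filtration M v)"
    using assms by (auto intro: state_measurable age_measurable)
  note assms(1)[measurable]
  have "landing_event M A s v =
      {w \<in> space (nat_filtration M v). state M v w \<in> A \<inter> space (state_space M) \<and> age M v w < v - s}"
    using assms state_in_space[of _ v] by (auto simp: landing_event_def)
  also have "\<dots> \<in> sets (nat_filtration M v)" by measurable
  finally show ?thesis .
qed

lemma landing_event_sets': 
  assumes "target_set A" "0 \<le> s" "s \<le> v" "v \<le> t"
  shows "landing_event M A s v \<in> sets (nat_filtration M t)"
  using landing_event_sets[OF assms(1-3)] nat_filtration_mono[OF assms(4)] by auto

lemma grid_landings_measurable:
  assumes A: "target_set A" and g: "mono g" "0 \<le> g 0" "g n \<le> t"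
  shows "grid_landings M A g n \<in> borel_measurable (nat_filtration M t)"
proof -
  have "landing_event M A (g i) (g (Suc i)) \<in> sets (nat_filtration M t)" if "i < n" for i
    using monoD[OF g(1), of 0 i] monoD[OF g(1), of i "Suc i"] monoD[OF g(1), of "Suc i" n] g that
    by (intro landing_event_sets' A) auto
  then show ?thesis unfolding grid_landings_def
    by (intro borel_measurable_sum borel_measurable_indicator) auto
qed

lemma landing_count_measurable:
  assumes A: "target_set A" and s: "0 \<le> s" "v \<le> t"
  shows "landing_count M A s v \<in> borel_measurable (nat_filtration M t)"
proof (cases "s < v")
  case True
  show ?thesis
  proof (rule borel_measurable_LIMSEQ_real)
    show "(\<lambda>m. grid_landings M A (uniform_grid s v (Suc m)) (Suc m) w) \<longlonglongrightarrow> landing_count M A s v w"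
      if "w \<in> space (nat_filtration M t)" for w
      using grid_landings_eventually[of w s v A] that s True
      by (intro LIMSEQ_Suc tendsto_eventually) auto
    show "grid_landings M A (uniform_grid s v (Suc m)) (Suc m) \<in> borel_measurable (nat_filtration M t)" for m
      using s True by (intro grid_landings_measurable A uniform_grid_mono) auto
  qed
next
  case False
  then have "landing_count M A s v = (\<lambda>w. 0)" by (auto simp: landing_count_def)
  then show ?thesis by simp
qed

section \<open>Predictable processes\<close>

lemma nat_filtration_sets_into: "A \<in> sets (nat_filtration M s) \<Longrightarrow> A \<subseteq> sample_space M"
  using sets.sets_into_space by force

definition predictable_rectangles :: "('w \<times> real) set set" where
  "predictable_rectangles = {A \<times> {0} | A. A \<in> sets (nat_filtration M 0)} \<union>
        {A \<times> {s<..v} | A s v. 0 \<le> s \<and> s \<le> v \<and> A \<in> sets (nat_filtration M s)}"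

lemma predictable_rectangles_Pow: "predictable_rectangles \<subseteq> Pow (sample_space M \<times> {0..})"
  unfolding predictable_rectangles_def by (auto dest!: nat_filtration_sets_into)

lemma space_predictable [simp]: "space (predictable M) = sample_space M \<times> {0..}"
  unfolding predictable_def predictable_rectangles_def[symmetric]
  by (rule space_measure_of[OF predictable_rectangles_Pow])

lemma sets_predictable: "sets (predictable M) = sigma_sets (sample_space M \<times> {0..}) predictable_rectangles"
  unfolding predictable_def predictable_rectangles_def[symmetric]
  by (rule sets_measure_of[OF predictable_rectangles_Pow])

lemma predictable_0: "A \<in> sets (nat_filtration M 0) \<Longrightarrow> A \<times> {0} \<in> sets (predictable M)"
  and predictable_Ioc: "0 \<le> s \<Longrightarrow> A \<in> sets (nat_filtration M s) \<Longrightarrow> A \<times> {s<..v} \<in> sets (predictable M)"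
proof -
  show "A \<in> sets (nat_filtration M 0) \<Longrightarrow> A \<times> {0} \<in> sets (predictable M)"
    unfolding sets_predictable by (intro sigma_sets.Basic) (auto simp: predictable_rectangles_def)
  show "A \<times> {s<..v} \<in> sets (predictable M)" if "0 \<le> s" "A \<in> sets (nat_filtration M s)"
  proof (cases "s \<le> v")
    case True
    with that show ?thesis
      unfolding sets_predictable by (intro sigma_sets.Basic) (auto simp: predictable_rectangles_def)
  qed auto
qed

lemma predictable_Ioi:
  assumes "0 \<le> s" "A \<in> sets (nat_filtration M s)"
  shows "A \<times> {s<..} \<in> sets (predictable M)"
proof -
  have "A \<times> {s<..} = (\<Union>n. A \<times> {s<..real n})"
    by (auto simp: real_arch_simple)
  also have "\<dots> \<in> sets (predictable M)"
    using predictable_Ioc[OF assms] by auto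
  finally show ?thesis .
qed

lemma predictable_all:
  assumes "A \<in> sets (nat_filtration M 0)"
  shows "A \<times> {0..} \<in> sets (predictable M)"
proof -
  have "A \<times> {0..} = A \<times> {0} \<union> A \<times> {0::real<..}" by auto
  then show ?thesis using predictable_0[OF assms] predictable_Ioi[OF _ assms] by auto
qed

lemma measurable_into_predictable:
  assumes sp: "\<And>z. z \<in> space N \<Longrightarrow> f z \<in> sample_space M \<times> {0..}"
    and "\<And>A. A \<in> sets (nat_filtration M 0) \<Longrightarrow> f -` (A \<times> {0}) \<inter> space N \<in> sets N"
    and "\<And>A s v. 0 \<le> s \<Longrightarrow> s \<le> v \<Longrightarrow> A \<in> sets (nat_filtration M s) \<Longrightarrow>
      f -` (A \<times> {s<..v}) \<inter> space N \<in> sets N"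
  shows "f \<in> N \<rightarrow>\<^sub>M predictable M"
  by (rule measurable_sigma_sets[OF sets_predictable predictable_rectangles_Pow])
    (use assms in \<open>auto simp: predictable_rectangles_def\<close>)

lemma time_predictable [measurable]: "snd \<in> borel_measurable (predictable M)"
proof (rule borel_measurableI_greater)
  fix c :: real
  show "{z \<in> space (predictable M). c < snd z} \<in> sets (predictable M)"
  proof (cases "0 \<le> c")
    case True
    then have "{z \<in> space (predictable M). c < snd z} = sample_space M \<times> {c<..}" by auto
    then show ?thesis using predictable_Ioi[OF True] sets.top[of "nat_filtration M c"] by auto
  next
    case False
    then have "{z \<in> space (predictable M). c < snd z} = space (predictable M)" by auto
    then show ?thesis by (metis sets.top)
  qed
qed

text \<open>
  The point \<open>(\<lceil>k s\<rceil> - 1) / k\<close> is the last point of the grid of mesh \<open>1 / k\<close> that lies strictly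
  before \<open>s\<close>.
\<close>

lemma left_grid_filterlim:
  assumes "0 < s"
  shows "filterlim (\<lambda>n. max 0 ((real_of_int \<lceil>real (Suc n) * s\<rceil> - 1) / real (Suc n))) (at_left s) sequentially"
    (is "filterlim ?f _ _")
proof -
  have less: "?f n < s" for n
  proof -
    have "real_of_int \<lceil>real (Suc n) * s\<rceil> - 1 < real (Suc n) * s"
      using ceiling_correct[of "real (Suc n) * s"] by blast
    then have "(real_of_int \<lceil>real (Suc n) * s\<rceil> - 1) / real (Suc n) < s"
      by (subst pos_divide_less_eq) (simp_all only: mult.commute[of s] of_nat_0_less_iff zero_less_Suc)
    then show ?thesis using assms by (simp only: max_less_iff_conj)
  qed
  have ne: "?f n \<noteq> s" for n using less[of n] by (rule less_imp_neq)
  have ge: "s - 1 / real (Suc n) \<le> ?f n" for n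
  proof -
    have "real (Suc n) * s \<le> real_of_int \<lceil>real (Suc n) * s\<rceil>" by (rule le_of_int_ceiling)
    then have "(real (Suc n) * s - 1) / real (Suc n) \<le> (real_of_int \<lceil>real (Suc n) * s\<rceil> - 1) / real (Suc n)"
      by (intro divide_right_mono) simp_all
    moreover have "(real (Suc n) * s - 1) / real (Suc n) = s - 1 / real (Suc n)"
      by (simp add: diff_divide_distrib)
    ultimately show ?thesis by (intro max.coboundedI2) (simp only:)
  qed
  have "(\<lambda>n. s - 1 / real (Suc n)) \<longlonglongrightarrow> s - 0"
    by (intro tendsto_diff tendsto_const LIMSEQ_inverse_real_of_nat[unfolded inverse_eq_divide])
  then have "?f \<longlonglongrightarrow> s"
    by (intro tendsto_sandwich[of "\<lambda>n. s - 1 / real (Suc n)" ?f sequentially "\<lambda>_. s"] always_eventually)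
      (auto simp only: diff_zero ge less less_imp_le intro: tendsto_const)
  then show ?thesis
    unfolding filterlim_at by (intro conjI always_eventually allI) (simp_all only: lessThan_iff less ne simp_thms not_False_eq_True)
qed

text \<open>
  On each interval \<open>(i / k, (i + 1) / k]\<close> the sampled process is a random variable of the past at
  \<open>i / k\<close>.
\<close>

lemma left_grid_predictable:
  fixes W :: "real \<Rightarrow> 'w \<Rightarrow> real" and k :: real
  assumes W: "\<And>s. 0 \<le> s \<Longrightarrow> W s \<in> borel_measurable (nat_filtration M s)" and k: "0 < k"
  shows "(\<lambda>(w, s). W (max 0 ((real_of_int \<lceil>k * s\<rceil> - 1) / k)) w) \<in> borel_measurable (predictable M)"
proof (rule measurable_piecewise_restrict)
  define C where "C = range (\<lambda>i::int. {z \<in> space (predictable M). \<lceil>k * snd z\<rceil> = i})"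
  show "countable C" by (auto simp: C_def)
  show "space (predictable M) \<subseteq> \<Union>C" by (auto simp: C_def)
  fix D assume "D \<in> C"
  then obtain i :: int where D: "D = {z \<in> space (predictable M). \<lceil>k * snd z\<rceil> = i}" by (auto simp: C_def)
  show Ds: "D \<inter> space (predictable M) \<in> sets (predictable M)"
    unfolding D by measurable
  define u where "u = max 0 ((real_of_int i - 1) / k)"
  have [measurable]: "W u \<in> borel_measurable (nat_filtration M u)" by (rule W) (simp add: u_def)
  have "(\<lambda>(w, s). W (max 0 ((real_of_int \<lceil>k * s\<rceil> - 1) / k)) w) \<in> borel_measurable (restrict_space (predictable M) D)
     \<longleftrightarrow> (\<lambda>(w, s). W u w) \<in> borel_measurable (restrict_space (predictable M) D)"
    by (rule measurable_cong) (auto simp: D u_def space_restrict_space)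
  also have "\<dots>"
  proof (rule measurableI)
    fix B :: "real set" assume [measurable]: "B \<in> sets borel"
    have A: "{w \<in> sample_space M. W u w \<in> B} \<in> sets (nat_filtration M u)" (is "?A \<in> _")
      using measurable_sets[OF \<open>W u \<in> _\<close> \<open>B \<in> _\<close>] by (simp add: vimage_def Int_def conj_commute)
    have Dsub: "D \<subseteq> sample_space M \<times> (if u = 0 then {0..} else {u<..})"
    proof
      fix z assume "z \<in> D"
      then have z: "fst z \<in> sample_space M" "0 \<le> snd z" "\<lceil>k * snd z\<rceil> = i" by (auto simp: D)
      have "u < snd z" if "u \<noteq> 0"
      proof -
        have "u = (real_of_int i - 1) / k" using that by (auto simp: u_def max_def split: if_splits)
        moreover have "real_of_int i - 1 < k * snd z" using z(3) ceiling_correct[of "k * snd z"] by auto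
        ultimately have "k * u < k * snd z" using k by simp
        then show ?thesis using k by simp
      qed
      then show "z \<in> sample_space M \<times> (if u = 0 then {0..} else {u<..})" using z by (cases z) auto
    qed
    have "(\<lambda>(w, s). W u w) -` B \<inter> space (restrict_space (predictable M) D)
        = (?A \<times> (if u = 0 then {0..} else {u<..})) \<inter> D"
      using Dsub by (auto simp: space_restrict_space D)
    also have "\<dots> \<in> sets (predictable M)"
    proof (rule sets.Int)
      show "?A \<times> (if u = 0 then {0..} else {u<..}) \<in> sets (predictable M)"
      proof (cases "u = 0")
        case True
        then show ?thesis using predictable_all[of ?A] A by simp
      next
        case False
        have "0 \<le> u" by (simp add: u_def)
        then show ?thesis using predictable_Ioi[OF _ A] False by simp
      qed
      have "D \<inter> space (predictable M) = D" by (auto simp: D)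
      with Ds show "D \<in> sets (predictable M)" by simp
    qed
    finally show "(\<lambda>(w, s). W u w) -` B \<inter> space (restrict_space (predictable M) D)
        \<in> sets (restrict_space (predictable M) D)"
      using Ds by (subst sets_restrict_space_iff) (auto simp: space_restrict_space)
  qed simp
  finally show "(\<lambda>(w, s). W (max 0 ((real_of_int \<lceil>k * s\<rceil> - 1) / k)) w) \<in> borel_measurable (restrict_space (predictable M) D)" .
qed

text \<open>
  The left limits are the limits of the process sampled at grid points strictly before the current
  time.
\<close>

lemma left_limit_predictable:
  fixes W V :: "real \<Rightarrow> 'w \<Rightarrow> real"
  assumes W: "\<And>s. 0 \<le> s \<Longrightarrow> W s \<in> borel_measurable (nat_filtration M s)"
    and V0: "\<And>w. w \<in> sample_space M \<Longrightarrow> V 0 w = W 0 w"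
    and V: "\<And>w s. w \<in> sample_space M \<Longrightarrow> 0 < s \<Longrightarrow> ((\<lambda>p. W p w) \<longlongrightarrow> V s w) (at_left s)"
  shows "(\<lambda>(w, s). V s w) \<in> borel_measurable (predictable M)"
proof (rule borel_measurable_LIMSEQ_real)
  fix n :: nat
  show "(\<lambda>(w, s). W (max 0 ((real_of_int \<lceil>real (Suc n) * s\<rceil> - 1) / real (Suc n))) w)
      \<in> borel_measurable (predictable M)"
    by (rule left_grid_predictable[OF W]) auto
next
  fix z assume "z \<in> space (predictable M)"
  then obtain w s where z: "z = (w, s)" "w \<in> sample_space M" "0 \<le> s" by auto
  show "(\<lambda>n. case z of (w, s) \<Rightarrow> W (max 0 ((real_of_int \<lceil>real (Suc n) * s\<rceil> - 1) / real (Suc n))) w)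
      \<longlonglongrightarrow> (case z of (w, s) \<Rightarrow> V s w)"
  proof (cases "s = 0")
    case True
    have "max 0 (- 1 / (1 + real n)) = 0" for n by (simp add: max_def)
    then show ?thesis using True z V0 by simp
  next
    case False
    then show ?thesis
      using filterlim_compose[OF V[OF z(2)] left_grid_filterlim[of s]] z by simp
  qed
qed

lemma eventually_at_left_gap:
  assumes "w \<in> sample_space M" "0 < s"
  shows "\<forall>\<^sub>F p in at_left s. 0 \<le> p \<and> p < s \<and> jumps M w \<inter> {p<..<s} = {}
     \<and> state_left M s w = state M p w \<and> age_left M s w = age M p w + (s - p)"
proof -
  obtain e where e: "0 \<le> e" "e < s" "jumps M w \<inter> {e<..<s} = {}" using left_gap[OF assms] by blast
  have "\<forall>\<^sub>F p in at_left s. e < p \<and> p < s"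
    using e by (intro eventually_conj) (auto simp: eventually_at_left[of e])
  then show ?thesis
  proof eventually_elim
    case (elim p)
    have "jumps M w \<inter> {p<..<s} = {}" using elim e(3) by fastforce
    then show ?case using left_values[OF assms(1) e, of p] elim e(1) by simp
  qed
qed

lemma state_left_predictable: "(\<lambda>(w, s). state_left M s w) \<in> predictable M \<rightarrow>\<^sub>M state_space M"
proof (rule measurableI)
  fix A assume A: "A \<in> sets (state_space M)"
  have "(\<lambda>(w, s). indicator A (state_left M s w) :: real) \<in> borel_measurable (predictable M)"
  proof (rule left_limit_predictable)
    show "(\<lambda>w. indicator A (state M s w) :: real) \<in> borel_measurable (nat_filtration M s)" if "0 \<le> s" for s
      using state_measurable[OF that order_refl] A by measurable
    show "((\<lambda>p. indicator A (state M p w) :: real) \<longlongrightarrow> indicator A (state_left M s w)) (at_left s)"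
      if "w \<in> sample_space M" "0 < s" for w s
      by (rule tendsto_eventually)
        (use eventually_at_left_gap[OF that] in eventually_elim, elim conjE, simp only:)
  qed (simp add: state_left_def)
  from measurable_sets[OF this, of "{1}"]
  have "(\<lambda>(w, s). indicator A (state_left M s w) :: real) -` {1} \<inter> space (predictable M) \<in> sets (predictable M)"
    by simp
  also have "(\<lambda>(w, s). indicator A (state_left M s w) :: real) -` {1} \<inter> space (predictable M)
      = (\<lambda>(w, s). state_left M s w) -` A \<inter> space (predictable M)"
    by (auto split: split_indicator_asm)
  finally show "(\<lambda>(w, s). state_left M s w) -` A \<inter> space (predictable M) \<in> sets (predictable M)" .
qed (auto intro: left_in_space)

lemma age_left_predictable: "(\<lambda>(w, s). age_left M s w) \<in> borel_measurable (predictable M)"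
proof (rule left_limit_predictable)
  show "age M s \<in> borel_measurable (nat_filtration M s)" if "0 \<le> s" for s
    using that by (rule age_measurable) simp
  show "((\<lambda>p. age M p w) \<longlongrightarrow> age_left M s w) (at_left s)"
    if "w \<in> sample_space M" "0 < s" for w s
  proof (rule Lim_transform_eventually)
    have "((\<lambda>p. age_left M s w - (s - p)) \<longlongrightarrow> age_left M s w - (s - s)) (at_left s)"
      by (intro tendsto_intros)
    then show "((\<lambda>p. age_left M s w - (s - p)) \<longlongrightarrow> age_left M s w) (at_left s)" by simp
    show "\<forall>\<^sub>F p in at_left s. age_left M s w - (s - p) = age M p w"
      using eventually_at_left_gap[OF that] by eventually_elim (elim conjE, linarith)
  qed
qed (simp add: age_left_def)

lemma left_predictable:
  "(\<lambda>(w, s). (state_left M s w, age_left M s w)) \<in> predictable M \<rightarrow>\<^sub>M age_state_space M"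
proof -
  have "(\<lambda>z. (state_left M (snd z) (fst z), age_left M (snd z) (fst z))) \<in> predictable M \<rightarrow>\<^sub>M age_state_space M"
    unfolding age_state_space_def
  proof (intro measurable_Pair measurable_restrict_space2)
    show "(\<lambda>z. state_left M (snd z) (fst z)) \<in> predictable M \<rightarrow>\<^sub>M state_space M"
      using state_left_predictable by (simp add: split_beta')
    show "(\<lambda>z. age_left M (snd z) (fst z)) \<in> borel_measurable (predictable M)"
      using age_left_predictable by (simp add: split_beta')
    show "(\<lambda>z. age_left M (snd z) (fst z)) \<in> space (predictable M) \<rightarrow> {0..}"
    proof
      fix z assume "z \<in> space (predictable M)"
      then show "age_left M (snd z) (fst z) \<in> {0..}"
        using left_in_space(2)[of "fst z" "snd z"] by (simp add: mem_Times_iff)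
    qed
  qed
  then show ?thesis by (simp add: split_beta')
qed

text \<open>
  Predictable processes live on nonnegative times, Lebesgue measure on all of them. Replacing \<open>s\<close>
  by \<open>max 0 s\<close> allows Fubini arguments on the whole line.
\<close>

lemma clamp_predictable:
  "(\<lambda>(w, s). (w, max 0 s)) \<in> generated_by_times M {0..} \<Otimes>\<^sub>M borel \<rightarrow>\<^sub>M predictable M"
proof (rule measurable_into_predictable)
  fix A assume "A \<in> sets (nat_filtration M 0)"
  then have A: "A \<in> sets (generated_by_times M {0..})" "A \<subseteq> sample_space M"
    using nat_filtration_subset nat_filtration_sets_into by blast+
  have "(\<lambda>(w, s). (w, max 0 s)) -` (A \<times> {0}) \<inter> space (generated_by_times M {0..} \<Otimes>\<^sub>M borel) = A \<times> {..0::real}"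
    using A(2) by (auto simp: space_pair_measure max_def split: if_splits)
  then show "(\<lambda>(w, s). (w, max 0 s)) -` (A \<times> {0}) \<inter> space (generated_by_times M {0..} \<Otimes>\<^sub>M borel)
      \<in> sets (generated_by_times M {0..} \<Otimes>\<^sub>M (borel :: real measure))"
    using A(1) by auto
next
  fix A and s v :: real assume "0 \<le> s" "A \<in> sets (nat_filtration M s)"
  then have A: "A \<in> sets (generated_by_times M {0..})" "A \<subseteq> sample_space M"
    using nat_filtration_subset nat_filtration_sets_into by blast+
  have "(\<lambda>(w, s). (w, max 0 s)) -` (A \<times> {s<..v}) \<inter> space (generated_by_times M {0..} \<Otimes>\<^sub>M borel) = A \<times> {s<..v}"
    using A(2) \<open>0 \<le> s\<close> by (auto simp: space_pair_measure max_def split: if_splits)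
  then show "(\<lambda>(w, s). (w, max 0 s)) -` (A \<times> {s<..v}) \<inter> space (generated_by_times M {0..} \<Otimes>\<^sub>M borel)
      \<in> sets (generated_by_times M {0..} \<Otimes>\<^sub>M (borel :: real measure))"
    using A(1) by auto
qed (auto simp: space_pair_measure)

text \<open>
  A predictable process at an earlier time \<open>\<sigma>\<close> is known at time \<open>s\<close>; this makes running integrals
  of predictable processes predictable. Where \<open>\<sigma>\<close> is not an earlier time, \<open>0\<close> is substituted.
\<close>

lemma past_predictable:
  "(\<lambda>((w, s), \<sigma>). (w, if 0 < \<sigma> \<and> \<sigma> < s then \<sigma> else 0)) \<in> predictable M \<Otimes>\<^sub>M borel \<rightarrow>\<^sub>M predictable M"
    (is "?f \<in> _")
proof (rule measurable_into_predictable)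
  have [measurable]: "(\<lambda>z. snd (fst z)) \<in> borel_measurable (predictable M \<Otimes>\<^sub>M (borel :: real measure))"
    by measurable
  { fix A assume A: "A \<in> sets (nat_filtration M 0)"
    have "?f -` (A \<times> {0}) \<inter> space (predictable M \<Otimes>\<^sub>M borel) = 
        ((A \<times> {0..}) \<times> UNIV) \<inter> {z \<in> space (predictable M \<Otimes>\<^sub>M borel). \<not> (0 < snd z \<and> snd z < snd (fst z))}"
      by (auto simp: space_pair_measure split: if_splits)
    also have "\<dots> \<in> sets (predictable M \<Otimes>\<^sub>M borel)"
      using predictable_all[OF A] by (intro sets.Int) (auto, measurable)
    finally show "?f -` (A \<times> {0}) \<inter> space (predictable M \<Otimes>\<^sub>M borel) \<in> sets (predictable M \<Otimes>\<^sub>M borel)" . }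
  { fix A and s v :: real assume s: "0 \<le> s" "s \<le> v" and A: "A \<in> sets (nat_filtration M s)"
    have "?f -` (A \<times> {s<..v}) \<inter> space (predictable M \<Otimes>\<^sub>M borel) =
        ((A \<times> {s<..}) \<times> {s<..v}) \<inter> {z \<in> space (predictable M \<Otimes>\<^sub>M borel). 0 < snd z \<and> snd z < snd (fst z)}"
      using s by (auto simp: space_pair_measure split: if_splits)
    also have "\<dots> \<in> sets (predictable M \<Otimes>\<^sub>M borel)"
      using predictable_Ioi[OF s(1) A] by (intro sets.Int) (auto, measurable)
    finally show "?f -` (A \<times> {s<..v}) \<inter> space (predictable M \<Otimes>\<^sub>M borel) \<in> sets (predictable M \<Otimes>\<^sub>M borel)" . }
qed (auto simp: space_pair_measure)

lemma integral_past_predictable: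
  fixes b :: "'w \<times> real \<Rightarrow> real"
  assumes b: "b \<in> borel_measurable (predictable M)"
  shows "(\<lambda>(w, s). LINT \<sigma>:{0..s}|lborel. b (w, \<sigma>)) \<in> borel_measurable (predictable M)"
proof -
  note [measurable] = b past_predictable
  have "(\<lambda>z. LINT \<sigma>|lborel. indicator {0<..<snd z} \<sigma> *\<^sub>R b (fst z, if 0 < \<sigma> \<and> \<sigma> < snd z then \<sigma> else 0))
     \<in> borel_measurable (predictable M)"
  proof (rule lborel.borel_measurable_lebesgue_integral)
    have sets: "sets (predictable M \<Otimes>\<^sub>M lborel) = sets (predictable M \<Otimes>\<^sub>M borel)"
      by (rule sets_pair_measure_cong) simp_all
    have "(\<lambda>z. b (fst (fst z), if 0 < snd z \<and> snd z < snd (fst z) then snd z else 0))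
       \<in> borel_measurable (predictable M \<Otimes>\<^sub>M borel)"
      using measurable_compose[OF past_predictable b] by (simp add: split_beta')
    then have 1: "(\<lambda>z. b (fst (fst z), if 0 < snd z \<and> snd z < snd (fst z) then snd z else 0))
       \<in> borel_measurable (predictable M \<Otimes>\<^sub>M lborel)"
      unfolding measurable_cong_sets[OF sets refl] .
    have 2: "(\<lambda>z. indicator {0<..<snd (fst z)} (snd z) :: real) \<in> borel_measurable (predictable M \<Otimes>\<^sub>M lborel)"
    proof -
      have "(\<lambda>z. indicator {z \<in> space (predictable M \<Otimes>\<^sub>M lborel). 0 < snd z \<and> snd z < snd (fst z)} z :: real)
          \<in> borel_measurable (predictable M \<Otimes>\<^sub>M lborel)"
        by (intro borel_measurable_indicator) measurable
      then show ?thesis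
        by (rule measurable_cong[THEN iffD1, rotated]) (auto simp: indicator_def)
    qed
    show "(\<lambda>(z, \<sigma>). indicator {0<..<snd z} \<sigma> *\<^sub>R b (fst z, if 0 < \<sigma> \<and> \<sigma> < snd z then \<sigma> else 0))
      \<in> borel_measurable (predictable M \<Otimes>\<^sub>M lborel)"
      using borel_measurable_scaleR[OF 2 1] by (simp add: split_beta')
  qed
  also have "(\<lambda>z. LINT \<sigma>|lborel. indicator {0<..<snd z} \<sigma> *\<^sub>R b (fst z, if 0 < \<sigma> \<and> \<sigma> < snd z then \<sigma> else 0))
     = (\<lambda>(w, s). LINT \<sigma>:{0..s}|lborel. b (w, \<sigma>))"
    unfolding set_lebesgue_integral_def split_beta'
  proof
    fix z :: "'w \<times> real"
    show "(LINT \<sigma>|lborel. indicator {0<..<snd z} \<sigma> *\<^sub>R b (fst z, if 0 < \<sigma> \<and> \<sigma> < snd z then \<sigma> else 0))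
        = (LINT \<sigma>|lborel. indicator {0..snd z} \<sigma> *\<^sub>R b (fst z, \<sigma>))"
      by (rule integral_discrete_difference[where X="{0, snd z}"]) (auto simp: indicator_def)
  qed
  finally show ?thesis .
qed

end

section \<open>Sums of marked integrands over the jumps\<close>

text \<open>
  The integral of \<open>H\<close> over \<open>I \<times> K\<close> with respect to the jump measure.
\<close>

definition jump_sum ::
  "('w, 'k) semi_markov_data \<Rightarrow> real set \<Rightarrow> (('w \<times> real) \<times> 'k \<Rightarrow> 'b::comm_monoid_add) \<Rightarrow> 'w \<Rightarrow> 'b" where
  "jump_sum M I H w = (\<Sum>\<tau>\<in>jumps M w \<inter> I. H ((w, \<tau>), state M \<tau> w))"

definition left_intensity :: "('w, 'k) semi_markov_data \<Rightarrow> 'w \<times> real \<Rightarrow> 'k measure" where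
  "left_intensity M z = intensity M (state_left M (snd z) (fst z)) (age_left M (snd z) (fst z))"

context semi_markov
begin

abbreviation marked_predictable :: "(('w \<times> real) \<times> 'k) measure" where
  "marked_predictable \<equiv> predictable M \<Otimes>\<^sub>M state_space M"

text \<open>
  The rectangles with predictable first factor of the generating form are stable under intersection
  and generate the product \<open>\<sigma>\<close>-algebra; hence induction over its sets need only treat these
  rectangles.
\<close>

lemma sets_predictable_pair:
  "sets marked_predictable =
     sigma_sets ((sample_space M \<times> {0..}) \<times> space (state_space M))
       {C \<times> D | C D. C \<in> predictable_rectangles \<and> D \<in> sets (state_space M)}"
  (is "_ = sigma_sets ?\<Omega> ?G")
proof
  have Gsub: "?G \<subseteq> Pow ?\<Omega>"
    using predictable_rectangles_Pow sets.sets_into_space[where M="state_space M"] by fastforce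
  have rect: "C \<in> predictable_rectangles \<Longrightarrow> C \<in> sets (predictable M)" for C
    unfolding sets_predictable by (rule sigma_sets.Basic)
  show "sigma_sets ?\<Omega> ?G \<subseteq> sets marked_predictable"
  proof -
    have "?\<Omega> = space marked_predictable" by (simp add: space_pair_measure)
    then show ?thesis
      by (simp only:) (rule sets.sigma_sets_subset, use rect in auto)
  qed
  define N where "N = sigma ?\<Omega> ?G"
  have N: "space N = ?\<Omega>" "sets N = sigma_sets ?\<Omega> ?G"
    unfolding N_def using Gsub by (auto simp: space_measure_of)
  have G: "C \<times> D \<in> sets N" if "C \<in> predictable_rectangles" "D \<in> sets (state_space M)" for C D
    unfolding N using that by (intro sigma_sets.Basic) auto
  have fst: "fst \<in> N \<rightarrow>\<^sub>M predictable M"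
  proof (rule measurable_sigma_sets[OF sets_predictable predictable_rectangles_Pow])
    fix C assume C: "C \<in> predictable_rectangles"
    then have "C \<subseteq> sample_space M \<times> {0..}" using predictable_rectangles_Pow by blast
    then have "fst -` C \<inter> space N = C \<times> space (state_space M)" by (auto simp: N)
    then show "fst -` C \<inter> space N \<in> sets N" using G[OF C sets.top] by simp
  qed (auto simp: N)
  have snd: "snd \<in> N \<rightarrow>\<^sub>M state_space M"
  proof (rule measurableI)
    fix D assume D: "D \<in> sets (state_space M)"
    have top: "sample_space M \<in> sets (nat_filtration M s)" for s
      using sets.top[of "nat_filtration M s"] by simp
    have r0: "sample_space M \<times> {0} \<in> predictable_rectangles"
      unfolding predictable_rectangles_def using top[of 0] by blast
    have "0 \<le> (0::real)" "0 \<le> real n" for n by simp_all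
    then have rn: "sample_space M \<times> {0<..real n} \<in> predictable_rectangles" for n
      unfolding predictable_rectangles_def using top[of 0] by blast
    have cover: "({0..}::real set) = {0} \<union> (\<Union>n::nat. {0<..real n})"
      by (auto simp: real_arch_simple)
    have "snd -` D \<inter> space N = (sample_space M \<times> {0..}) \<times> D"
      using sets.sets_into_space[OF D] by (auto simp: N)
    also have "\<dots> = (sample_space M \<times> {0}) \<times> D \<union> (\<Union>n::nat. (sample_space M \<times> {0<..real n}) \<times> D)"
      unfolding cover by blast
    also have "\<dots> \<in> sets N"
      using r0 rn D by (intro sets.Un sets.countable_nat_UN G image_subsetI)
    finally show "snd -` D \<inter> space N \<in> sets N" .
  qed (auto simp: N)
  have "(\<lambda>z. (fst z, snd z)) \<in> N \<rightarrow>\<^sub>M marked_predictable"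
    using fst snd by (rule measurable_Pair)
  then have id: "(\<lambda>z. z) \<in> N \<rightarrow>\<^sub>M marked_predictable" by simp
  show "sets marked_predictable \<subseteq> sigma_sets ?\<Omega> ?G"
  proof
    fix B assume B: "B \<in> sets marked_predictable"
    then have "B \<subseteq> space N" using sets.sets_into_space[OF B] by (simp add: N space_pair_measure)
    then have "(\<lambda>z. z) -` B \<inter> space N = B" by auto
    then show "B \<in> sigma_sets ?\<Omega> ?G" using measurable_sets[OF id B] N by simp
  qed
qed

lemma Int_stable_predictable_pair:
  "Int_stable {C \<times> D | C D. C \<in> predictable_rectangles \<and> D \<in> sets (state_space M)}"
proof (rule Int_stableI)
  fix E E' assume "E \<in> {C \<times> D | C D. C \<in> predictable_rectangles \<and> D \<in> sets (state_space M)}"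
    "E' \<in> {C \<times> D | C D. C \<in> predictable_rectangles \<and> D \<in> sets (state_space M)}"
  then obtain C D C' D' where E: "E = C \<times> D" "E' = C' \<times> D'"
    and C: "C \<in> predictable_rectangles" "C' \<in> predictable_rectangles"
    and D: "D \<in> sets (state_space M)" "D' \<in> sets (state_space M)" by blast
  have "C \<inter> C' \<in> predictable_rectangles"
  proof -
    have emp: "{} \<in> predictable_rectangles" unfolding predictable_rectangles_def by auto
    have cases: "(\<exists>A. E = A \<times> {0} \<and> A \<in> sets (nat_filtration M 0)) \<or>
        (\<exists>A s v. E = A \<times> {s<..v} \<and> 0 \<le> s \<and> s \<le> v \<and> A \<in> sets (nat_filtration M s))"
      if "E \<in> predictable_rectangles" for E
      using that unfolding predictable_rectangles_def by blast
    show ?thesis using cases[OF C(1)] cases[OF C(2)]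
    proof (elim disjE exE conjE)
      fix A A' assume *: "C = A \<times> {0}" "C' = A' \<times> {0}"
        "A \<in> sets (nat_filtration M 0)" "A' \<in> sets (nat_filtration M 0)"
      then have "C \<inter> C' = (A \<inter> A') \<times> {0}" by auto
      then show ?thesis using * unfolding predictable_rectangles_def by blast
    next
      fix A A' s v s' v' assume *: "C = A \<times> {s<..v}" "C' = A' \<times> {s'<..v'}"
        "0 \<le> s" "s \<le> v" "A \<in> sets (nat_filtration M s)"
        "0 \<le> s'" "s' \<le> v'" "A' \<in> sets (nat_filtration M s')"
      have "A \<inter> A' \<in> sets (nat_filtration M (max s s'))"
        using * nat_filtration_mono[of s "max s s'"] nat_filtration_mono[of s' "max s s'"] by auto
      moreover have "C \<inter> C' = (A \<inter> A') \<times> {max s s'<..min v v'}" using * by auto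
      moreover have "0 \<le> max s s'" using * by simp
      moreover have "C \<inter> C' = {}" if "\<not> max s s' \<le> min v v'"
      proof -
        have "{max s s'<..min v v'} = {}" using that by (intro greaterThanAtMost_empty) linarith
        then show ?thesis unfolding \<open>C \<inter> C' = _\<close> by simp
      qed
      ultimately show ?thesis
        using emp unfolding predictable_rectangles_def
        by (cases "max s s' \<le> min v v'") blast+
    next
      fix A A' s v assume *: "C = A \<times> {0}" "C' = A' \<times> {s<..v}" "0 \<le> s"
      then have "C \<inter> C' = {}" by auto
      then show ?thesis using emp by simp
    next
      fix A A' s v assume *: "C = A \<times> {s<..v}" "C' = A' \<times> {0}" "0 \<le> s"
      then have "C \<inter> C' = {}" by auto
      then show ?thesis using emp by simp
    qed
  qed
  moreover have "E \<inter> E' = (C \<inter> C') \<times> (D \<inter> D')" unfolding E by blast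
  moreover have "D \<inter> D' \<in> sets (state_space M)" using D by blast
  ultimately show "E \<inter> E' \<in> {C \<times> D | C D. C \<in> predictable_rectangles \<and> D \<in> sets (state_space M)}"
    by blast
qed

lemma predictable_pair_induct [consumes 1, case_names initial rectangle compl union]:
  assumes B: "B \<in> sets marked_predictable"
    and initial: "\<And>A D. A \<in> sets (nat_filtration M 0) \<Longrightarrow> D \<in> sets (state_space M) \<Longrightarrow> P ((A \<times> {0}) \<times> D)"
    and rectangle: "\<And>A D s v. 0 \<le> s \<Longrightarrow> s \<le> v \<Longrightarrow> A \<in> sets (nat_filtration M s) \<Longrightarrow>
      D \<in> sets (state_space M) \<Longrightarrow> P ((A \<times> {s<..v}) \<times> D)"
    and compl: "\<And>B. B \<in> sets marked_predictable \<Longrightarrow> P B \<Longrightarrow>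
      P (space marked_predictable - B)"
    and union: "\<And>f :: nat \<Rightarrow> _. disjoint_family f \<Longrightarrow> range f \<subseteq> sets marked_predictable \<Longrightarrow>
      (\<And>i. P (f i)) \<Longrightarrow> P (\<Union>i. f i)"
  shows "P B"
proof -
  let ?\<Omega> = "(sample_space M \<times> {0..}) \<times> space (state_space M)"
  let ?G = "{C \<times> D | C D. C \<in> predictable_rectangles \<and> D \<in> sets (state_space M)}"
  have sp: "space marked_predictable = ?\<Omega>" by (simp add: space_pair_measure)
  have Gsub: "?G \<subseteq> Pow ?\<Omega>"
    using predictable_rectangles_Pow sets.sets_into_space[where M="state_space M"] by fastforce
  have "B \<in> sigma_sets ?\<Omega> ?G" using B unfolding sets_predictable_pair .
  then show ?thesis
  proof (induction rule: sigma_sets_induct_disjoint[OF Int_stable_predictable_pair Gsub, consumes 1])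
    case (1 B)
    then obtain C D where "B = C \<times> D" "C \<in> predictable_rectangles" "D \<in> sets (state_space M)" by blast
    then show ?case using initial rectangle unfolding predictable_rectangles_def by blast
  next
    case 2
    show ?case using initial[of "{}" "{}"] by simp
  next
    case (3 B)
    then show ?case using compl[of B] unfolding sp sets_predictable_pair by simp
  next
    case (4 f)
    then show ?case using union[of f] unfolding sets_predictable_pair by simp
  qed
qed

text \<open>
  For a rectangle, the sum over the jumps strictly before \<open>s\<close> is the left limit at \<open>s\<close> of an
  adapted counting process.
\<close>

lemma jump_sum_indicator_predictable:
  assumes B: "B \<in> sets marked_predictable"
  shows "(\<lambda>(w, s). jump_sum M {0<..<s} (indicator B) w :: ennreal) \<in> borel_measurable (predictable M)"
  using B
proof (induction rule: predictable_pair_induct)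
  case (initial A D)
  have "jump_sum M {0<..<s} (indicator ((A \<times> {0}) \<times> D)) w = (0 :: ennreal)" for w s
    unfolding jump_sum_def by (intro sum.neutral) auto
  then show ?case by simp
next
  case (rectangle A D u v)
  define W where "W p w = indicator A w * landing_count M D u (min p v) w * indicator {u<..} p" for p w
  define V where "V s w = (\<Sum>\<tau>\<in>jumps M w \<inter> {0<..<s}. indicator ((A \<times> {u<..v}) \<times> D) ((w, \<tau>), state M \<tau> w) :: real)" for s w
  have Veq: "V s w = indicator A w * (\<Sum>\<tau>\<in>jumps M w \<inter> {u<..v} \<inter> {..<s}. indicator D (state M \<tau> w))"
    if "w \<in> sample_space M" for s w
  proof -
    have "V s w = (\<Sum>\<tau>\<in>jumps M w \<inter> {u<..v} \<inter> {..<s}. indicator ((A \<times> {u<..v}) \<times> D) ((w, \<tau>), state M \<tau> w))"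
      unfolding V_def using finite_jumps_Ioo[OF that, of 0 s] rectangle(1)
      by (intro sum.mono_neutral_right) (auto simp: indicator_def)
    also have "\<dots> = indicator A w * (\<Sum>\<tau>\<in>jumps M w \<inter> {u<..v} \<inter> {..<s}. indicator D (state M \<tau> w))"
      unfolding sum_distrib_left by (intro sum.cong) (auto simp: indicator_def)
    finally show ?thesis .
  qed
  have "(\<lambda>(w, s). V s w) \<in> borel_measurable (predictable M)"
  proof (rule left_limit_predictable)
    fix s :: real assume s: "0 \<le> s"
    show "W s \<in> borel_measurable (nat_filtration M s)"
    proof (cases "u < s")
      case True
      have "A \<in> sets (nat_filtration M s)" using rectangle(3) nat_filtration_mono[of u s] True by auto
      moreover have "target_set D" using rectangle(4) by auto
      ultimately show ?thesis unfolding W_def using rectangle(1)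
        by (intro borel_measurable_times borel_measurable_indicator landing_count_measurable) auto
    qed (simp add: W_def[abs_def])
  next
    fix w s assume w: "w \<in> sample_space M" and s: "0 < (s :: real)"
    show "((\<lambda>p. W p w) \<longlongrightarrow> V s w) (at_left s)"
    proof (rule tendsto_eventually)
      show "\<forall>\<^sub>F p in at_left s. W p w = V s w"
        using eventually_at_left_gap[OF w s]
      proof eventually_elim
        case (elim p)
        then have p: "p < s" "\<And>\<tau>. \<tau> \<in> jumps M w \<Longrightarrow> \<tau> < s \<Longrightarrow> \<tau> \<le> p"
          by (force simp: disjoint_iff not_less[symmetric])+
        have "jumps M w \<inter> {u<..v} \<inter> {..<s} = jumps M w \<inter> {u<..min p v}"
          using p by force
        moreover have "jumps M w \<inter> {u<..min p v} = {}" if "\<not> u < p" using that by auto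
        ultimately show ?case
          unfolding Veq[OF w] W_def landing_count_def by (cases "u < p") auto
      qed
    qed
  next
    fix w assume "w \<in> sample_space M"
    show "V 0 w = W 0 w" using rectangle(1) by (simp add: V_def W_def)
  qed
  then have "(\<lambda>z. ennreal (case z of (w, s) \<Rightarrow> V s w)) \<in> borel_measurable (predictable M)"
    by (rule measurable_compose) simp
  also have "(\<lambda>z. ennreal (case z of (w, s) \<Rightarrow> V s w))
      = (\<lambda>(w, s). jump_sum M {0<..<s} (indicator ((A \<times> {u<..v}) \<times> D)) w)"
    by (auto simp: fun_eq_iff V_def jump_sum_def sum_ennreal[symmetric] ennreal_indicator simp del: sum_ennreal)
  finally show ?case .
next
  case (compl B)
  let ?\<Omega> = "space marked_predictable"
  have total: "(\<lambda>(w, s). jump_sum M {0<..<s} (\<lambda>_. 1) w :: ennreal) \<in> borel_measurable (predictable M)"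
  proof -
    have "(\<lambda>(w, s). real (card (jumps M w \<inter> {0<..<s}))) \<in> borel_measurable (predictable M)"
    proof (rule left_limit_predictable)
      show "landing_count M UNIV 0 s \<in> borel_measurable (nat_filtration M s)" if "0 \<le> s" for s
        by (rule landing_count_measurable) auto
      fix w s assume w: "w \<in> sample_space M" and s: "0 < (s :: real)"
      show "((\<lambda>p. landing_count M UNIV 0 p w) \<longlongrightarrow> real (card (jumps M w \<inter> {0<..<s}))) (at_left s)"
      proof (rule tendsto_eventually)
        show "\<forall>\<^sub>F p in at_left s. landing_count M UNIV 0 p w = real (card (jumps M w \<inter> {0<..<s}))"
          using eventually_at_left_gap[OF w s]
        proof eventually_elim
          case (elim p)
          then have p: "p < s" "\<And>\<tau>. \<tau> \<in> jumps M w \<Longrightarrow> \<tau> < s \<Longrightarrow> \<tau> \<le> p"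
            by (force simp: disjoint_iff not_less[symmetric])+
          then have "jumps M w \<inter> {0<..p} = jumps M w \<inter> {0<..<s}" by force
          then show ?case by (simp only: landing_count_UNIV)
        qed
      qed
    qed (simp add: landing_count_def)
    then have "(\<lambda>z. ennreal (case z of (w, s) \<Rightarrow> real (card (jumps M w \<inter> {0<..<s})))) \<in> borel_measurable (predictable M)"
      by (rule measurable_compose) simp
    also have "(\<lambda>z. ennreal (case z of (w, s) \<Rightarrow> real (card (jumps M w \<inter> {0<..<s}))))
       = (\<lambda>(w, s). jump_sum M {0<..<s} (\<lambda>_. 1) w)"
      by (auto simp: fun_eq_iff jump_sum_def ennreal_of_nat_eq_real_of_nat)
    finally show ?thesis .
  qed
  have "(\<lambda>z. (case z of (w, s) \<Rightarrow> jump_sum M {0<..<s} (\<lambda>_. 1 :: ennreal) w)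
      - (case z of (w, s) \<Rightarrow> jump_sum M {0<..<s} (indicator B) w)) \<in> borel_measurable (predictable M)"
    using total compl.IH by (rule borel_measurable_minus_ennreal)
  then show ?case
  proof (rule measurable_cong[THEN iffD1, rotated])
    fix z assume "z \<in> space (predictable M)"
    then obtain w s where z: "z = (w, s)" "w \<in> sample_space M" "0 \<le> s" by auto
    have 1: "jump_sum M {0<..<s} (\<lambda>_. 1) w = (jump_sum M {0<..<s} (indicator (?\<Omega> - B)) w + jump_sum M {0<..<s} (indicator B) w :: ennreal)"
      unfolding jump_sum_def sum.distrib[symmetric]
    proof (rule sum.cong[OF refl])
      fix \<tau> assume "\<tau> \<in> jumps M w \<inter> {0<..<s}"
      then have "((w, \<tau>), state M \<tau> w) \<in> ?\<Omega>"
        using z state_in_space[of w \<tau>] by (auto simp: space_pair_measure)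
      then show "(1::ennreal) = indicator (?\<Omega> - B) ((w, \<tau>), state M \<tau> w) + indicator B ((w, \<tau>), state M \<tau> w)"
        by (auto simp: indicator_def)
    qed
    have 2: "jump_sum M {0<..<s} (indicator B) w \<noteq> (top :: ennreal)"
    proof -
      have "jump_sum M {0<..<s} (indicator B) w \<le> (\<Sum>\<tau>\<in>jumps M w \<inter> {0<..<s}. 1 :: ennreal)"
        unfolding jump_sum_def by (intro sum_mono) (auto simp: indicator_def)
      also have "\<dots> < top" by (simp add: less_top[symmetric])
      finally show ?thesis by simp
    qed
    show "(case z of (w, s) \<Rightarrow> jump_sum M {0<..<s} (\<lambda>_. 1 :: ennreal) w)
      - (case z of (w, s) \<Rightarrow> jump_sum M {0<..<s} (indicator B) w)
      = (case z of (w, s) \<Rightarrow> jump_sum M {0<..<s} (indicator (?\<Omega> - B)) w)"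
      using 1 2 z by (simp add: ennreal_add_diff_cancel)
  qed
next
  case (union f)
  have "(\<lambda>z. \<Sum>i. (case z of (w, s) \<Rightarrow> jump_sum M {0<..<s} (indicator (f i) :: _ \<Rightarrow> ennreal) w))
     \<in> borel_measurable (predictable M)"
    using union.IH by (intro borel_measurable_suminf_order) auto
  also have "(\<lambda>z. \<Sum>i. (case z of (w, s) \<Rightarrow> jump_sum M {0<..<s} (indicator (f i) :: _ \<Rightarrow> ennreal) w))
     = (\<lambda>(w, s). jump_sum M {0<..<s} (indicator (\<Union>i. f i)) w)"
    unfolding jump_sum_def by (auto simp: fun_eq_iff suminf_sum suminf_indicator[OF union(1)])
  finally show ?case .
qed

lemma jump_sum_predictable:
  fixes H :: "('w \<times> real) \<times> 'k \<Rightarrow> ennreal"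
  assumes H: "H \<in> borel_measurable marked_predictable"
  shows "(\<lambda>(w, s). jump_sum M {0<..<s} H w) \<in> borel_measurable (predictable M)"
  using H
proof (induction rule: borel_measurable_induct)
  case (cong f g)
  have "jump_sum M {0<..<s} f w = jump_sum M {0<..<s} g w" if "w \<in> sample_space M" for w s
    unfolding jump_sum_def using that state_in_space[OF that]
    by (intro sum.cong refl cong(3)) (auto simp: space_pair_measure)
  then show ?case by (subst measurable_cong[where g="\<lambda>(w, s). jump_sum M {0<..<s} g w"]) (use cong(4) in auto)
next
  case (set A)
  then show ?case by (rule jump_sum_indicator_predictable)
next
  case (mult u c)
  have "(\<lambda>z. c * (case z of (w, s) \<Rightarrow> jump_sum M {0<..<s} u w)) \<in> borel_measurable (predictable M)"
    using mult.IH by measurable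
  also have "(\<lambda>z. c * (case z of (w, s) \<Rightarrow> jump_sum M {0<..<s} u w))
      = (\<lambda>(w, s). jump_sum M {0<..<s} (\<lambda>x. c * u x) w)"
    by (auto simp: fun_eq_iff jump_sum_def sum_distrib_left)
  finally show ?case .
next
  case (add u v)
  have "(\<lambda>z. (case z of (w, s) \<Rightarrow> jump_sum M {0<..<s} v w) + (case z of (w, s) \<Rightarrow> jump_sum M {0<..<s} u w))
      \<in> borel_measurable (predictable M)"
    using add.IH by measurable
  also have "(\<lambda>z. (case z of (w, s) \<Rightarrow> jump_sum M {0<..<s} v w) + (case z of (w, s) \<Rightarrow> jump_sum M {0<..<s} u w))
      = (\<lambda>(w, s). jump_sum M {0<..<s} (\<lambda>x. v x + u x) w)"
    by (auto simp: fun_eq_iff jump_sum_def sum.distrib)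
  finally show ?case .
next
  case (seq U)
  have "(\<lambda>z. SUP i. (case z of (w, s) \<Rightarrow> jump_sum M {0<..<s} (U i) w)) \<in> borel_measurable (predictable M)"
    using seq.IH by (intro borel_measurable_SUP) auto
  also have "(\<lambda>z. SUP i. (case z of (w, s) \<Rightarrow> jump_sum M {0<..<s} (U i) w))
      = (\<lambda>(w, s). jump_sum M {0<..<s} (SUP i. U i) w)"
  proof (rule ext, clarify)
    fix w and s :: real
    have "(SUP i. \<Sum>\<tau>\<in>jumps M w \<inter> {0<..<s}. U i ((w, \<tau>), state M \<tau> w))
        = (\<Sum>\<tau>\<in>jumps M w \<inter> {0<..<s}. SUP i. U i ((w, \<tau>), state M \<tau> w))"
      by (rule ennreal_SUP_sum) (use seq(3) in \<open>auto simp: incseq_def le_fun_def\<close>)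
    then show "(SUP i. jump_sum M {0<..<s} (U i) w) = jump_sum M {0<..<s} (SUP i. U i) w"
      unfolding jump_sum_def by (simp add: image_comp)
  qed
  finally show ?case .
qed

lemma jump_sum_predictable_real:
  fixes H :: "('w \<times> real) \<times> 'k \<Rightarrow> real"
  assumes H [measurable]: "H \<in> borel_measurable marked_predictable"
  shows "(\<lambda>(w, s). jump_sum M {0<..<s} H w) \<in> borel_measurable (predictable M)"
proof -
  have "(\<lambda>z. enn2real (case z of (w, s) \<Rightarrow> jump_sum M {0<..<s} (\<lambda>x. ennreal (H x)) w)
      - enn2real (case z of (w, s) \<Rightarrow> jump_sum M {0<..<s} (\<lambda>x. ennreal (- H x)) w)) \<in> borel_measurable (predictable M)"
    using jump_sum_predictable[of "\<lambda>x. ennreal (H x)"] jump_sum_predictable[of "\<lambda>x. ennreal (- H x)"]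
    by measurable
  also have "(\<lambda>z. enn2real (case z of (w, s) \<Rightarrow> jump_sum M {0<..<s} (\<lambda>x. ennreal (H x)) w)
      - enn2real (case z of (w, s) \<Rightarrow> jump_sum M {0<..<s} (\<lambda>x. ennreal (- H x)) w))
      = (\<lambda>(w, s). jump_sum M {0<..<s} H w)"
  proof (rule ext, clarify)
    fix w and s :: real
    have e: "enn2real (\<Sum>\<tau>\<in>F. ennreal (h \<tau>)) = (\<Sum>\<tau>\<in>F. max 0 (h \<tau>))" for F and h :: "real \<Rightarrow> real"
    proof -
      have "(\<Sum>\<tau>\<in>F. ennreal (h \<tau>)) = (\<Sum>\<tau>\<in>F. ennreal (max 0 (h \<tau>)))"
        by (intro sum.cong) (auto simp: max_def ennreal_neg)
      also have "\<dots> = ennreal (\<Sum>\<tau>\<in>F. max 0 (h \<tau>))" by (rule sum_ennreal) simp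
      finally show ?thesis by (simp add: sum_nonneg)
    qed
    show "enn2real (jump_sum M {0<..<s} (\<lambda>x. ennreal (H x)) w)
      - enn2real (jump_sum M {0<..<s} (\<lambda>x. ennreal (- H x)) w) = jump_sum M {0<..<s} H w"
      unfolding jump_sum_def e sum_subtractf[symmetric] by (intro sum.cong) auto
  qed
  finally show ?thesis .
qed

section \<open>The jump intensity\<close>

definition rate_sup :: real where
  "rate_sup = max 0 (SUP (x, a) \<in> space (age_state_space M). rate M x a)"

lemma rate_sup_nonneg: "0 \<le> rate_sup"
  by (simp add: rate_sup_def)

lemma rate_le: "(x, a) \<in> space (age_state_space M) \<Longrightarrow> rate M x a \<le> rate_sup"
  unfolding rate_sup_def using cSUP_upper[OF _ rate_bounded, of "(x, a)"] by (auto simp: le_max_iff_disj)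

lemma jump_kernel_props:
  assumes "(x, a) \<in> space (age_state_space M)"
  shows "prob_space (jump_kernel M x a)" "sets (jump_kernel M x a) = sets (state_space M)"
  using measurable_space[OF jump_kernel assms] by (auto simp: space_prob_algebra)

lemma sets_intensity:
  "(x, a) \<in> space (age_state_space M) \<Longrightarrow> sets (intensity M x a) = sets (state_space M)"
  by (simp add: intensity_def jump_kernel_props)

lemma space_intensity:
  "(x, a) \<in> space (age_state_space M) \<Longrightarrow> space (intensity M x a) = space (state_space M)"
  by (rule sets_eq_imp_space_eq[OF sets_intensity])

lemma emeasure_intensity_space:
  assumes "(x, a) \<in> space (age_state_space M)"
  shows "emeasure (intensity M x a) (space (state_space M)) = ennreal (rate M x a)"
proof -
  interpret prob_space "jump_kernel M x a" using assms by (rule jump_kernel_props)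
  have "emeasure (jump_kernel M x a) (space (state_space M)) = 1"
    using emeasure_space_1 sets_eq_imp_space_eq[OF jump_kernel_props(2)[OF assms]] by simp
  then show ?thesis by (simp add: intensity_def)
qed

lemma finite_measure_intensity:
  assumes "(x, a) \<in> space (age_state_space M)"
  shows "finite_measure (intensity M x a)"
  by (rule finite_measureI) (simp add: space_intensity[OF assms] emeasure_intensity_space[OF assms])

lemma left_state_space: "z \<in> space (predictable M) \<Longrightarrow>
    (state_left M (snd z) (fst z), age_left M (snd z) (fst z)) \<in> space (age_state_space M)"
  using measurable_space[OF left_predictable, of z] by (simp add: split_beta')

lemma rate_left_predictable:
  "(\<lambda>z. rate M (state_left M (snd z) (fst z)) (age_left M (snd z) (fst z))) \<in> borel_measurable (predictable M)"
  using measurable_compose[OF left_predictable rate_measurable] by (simp add: split_beta')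

lemma kernel_left_predictable:
  "(\<lambda>z. jump_kernel M (state_left M (snd z) (fst z)) (age_left M (snd z) (fst z)))
     \<in> predictable M \<rightarrow>\<^sub>M subprob_algebra (state_space M)"
  using measurable_prob_algebraD[OF measurable_compose[OF left_predictable jump_kernel]]
  by (simp add: split_beta')

lemma section_measurable:
  assumes "H \<in> borel_measurable (N \<Otimes>\<^sub>M state_space M)" "z \<in> space N"
  shows "(\<lambda>y. H (z, y)) \<in> borel_measurable (state_space M)"
  using measurable_compose[OF measurable_Pair1'[OF assms(2)] assms(1)] .

lemma nn_integral_left_intensity_predictable:
  fixes H :: "('w \<times> real) \<times> 'k \<Rightarrow> ennreal"
  assumes H: "H \<in> borel_measurable marked_predictable"
  shows "(\<lambda>z. \<integral>\<^sup>+ y. H (z, y) \<partial>left_intensity M z) \<in> borel_measurable (predictable M)"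
proof -
  have "(\<lambda>z. ennreal (rate M (state_left M (snd z) (fst z)) (age_left M (snd z) (fst z)))
     * (\<integral>\<^sup>+ y. H (z, y) \<partial>jump_kernel M (state_left M (snd z) (fst z)) (age_left M (snd z) (fst z))))
    \<in> borel_measurable (predictable M)"
    using rate_left_predictable nn_integral_measurable_subprob_algebra2[OF _ kernel_left_predictable, of "\<lambda>z y. H (z, y)"] H
    by (intro borel_measurable_times_ennreal) (auto simp: split_beta')
  then show ?thesis
  proof (rule measurable_cong[THEN iffD1, rotated])
    fix z assume z: "z \<in> space (predictable M)"
    have "(\<lambda>y. H (z, y)) \<in> borel_measurable (jump_kernel M (state_left M (snd z) (fst z)) (age_left M (snd z) (fst z)))"
      using section_measurable[OF H z] measurable_cong_sets[OF jump_kernel_props(2)[OF left_state_space[OF z]] refl] by blast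
    then show "ennreal (rate M (state_left M (snd z) (fst z)) (age_left M (snd z) (fst z)))
     * (\<integral>\<^sup>+ y. H (z, y) \<partial>jump_kernel M (state_left M (snd z) (fst z)) (age_left M (snd z) (fst z)))
      = (\<integral>\<^sup>+ y. H (z, y) \<partial>left_intensity M z)"
      unfolding left_intensity_def intensity_def by (simp add: nn_integral_scale_measure)
  qed
qed

text \<open>
  The Bochner integral is assembled from the integrals of the positive and negative parts, with the
  value \<open>0\<close> where the integrand is not integrable.
\<close>

lemma integral_left_intensity_predictable:
  fixes H :: "('w \<times> real) \<times> 'k \<Rightarrow> real"
  assumes H: "H \<in> borel_measurable marked_predictable"
  shows "(\<lambda>z. LINT y|left_intensity M z. H (z, y)) \<in> borel_measurable (predictable M)"
proof -
  have 1: "(\<lambda>z. enn2real (\<integral>\<^sup>+ y. ennreal (H (z, y)) \<partial>left_intensity M z)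
      - enn2real (\<integral>\<^sup>+ y. ennreal (- H (z, y)) \<partial>left_intensity M z)) \<in> borel_measurable (predictable M)"
    using nn_integral_left_intensity_predictable[of "\<lambda>x. ennreal (H x)"]
      nn_integral_left_intensity_predictable[of "\<lambda>x. ennreal (- H x)"] H by measurable
  have 2: "(\<lambda>z. \<integral>\<^sup>+ y. ennreal (norm (H (z, y))) \<partial>left_intensity M z) \<in> borel_measurable (predictable M)"
    using nn_integral_left_intensity_predictable[of "\<lambda>x. ennreal (norm (H x))"] H by measurable
  have "(\<lambda>z. if (\<integral>\<^sup>+ y. ennreal (norm (H (z, y))) \<partial>left_intensity M z) < \<infinity> then
      enn2real (\<integral>\<^sup>+ y. ennreal (H (z, y)) \<partial>left_intensity M z)
      - enn2real (\<integral>\<^sup>+ y. ennreal (- H (z, y)) \<partial>left_intensity M z) else 0) \<in> borel_measurable (predictable M)"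
    by (rule measurable_If[OF 1 borel_measurable_const]) (use 2 in measurable)
  then show ?thesis
  proof (rule measurable_cong[THEN iffD1, rotated])
    fix z assume z: "z \<in> space (predictable M)"
    have m: "(\<lambda>y. H (z, y)) \<in> borel_measurable (left_intensity M z)"
      using section_measurable[OF H z] measurable_cong_sets[OF sets_intensity[OF left_state_space[OF z]] refl]
      unfolding left_intensity_def by blast
    show "(if (\<integral>\<^sup>+ y. ennreal (norm (H (z, y))) \<partial>left_intensity M z) < \<infinity> then
      enn2real (\<integral>\<^sup>+ y. ennreal (H (z, y)) \<partial>left_intensity M z)
      - enn2real (\<integral>\<^sup>+ y. ennreal (- H (z, y)) \<partial>left_intensity M z) else 0) = (LINT y|left_intensity M z. H (z, y))"
      using m by (auto simp: integrable_iff_bounded real_lebesgue_integral_def not_integrable_integral_eq)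
  qed
qed

end

section \<open>Probabilities of a landing and the Markov property\<close>

definition landing_prob ::
  "('w, 'k) semi_markov_data \<Rightarrow> real \<Rightarrow> 'k set \<Rightarrow> 'k \<Rightarrow> real \<Rightarrow> real" where
  "landing_prob M d A x a = measure (law M x a) (landing_event M A 0 d)"

context semi_markov
begin

lemma measurable_law: 
  "(x, a) \<in> space (age_state_space M) \<Longrightarrow> f \<in> nat_filtration M t \<rightarrow>\<^sub>M N \<Longrightarrow> f \<in> law M x a \<rightarrow>\<^sub>M N"
  using measurable_nat_filtration_generated measurable_cong_sets[OF law_sets refl] by blast

lemma filtration_subset_law:
  "(x, a) \<in> space (age_state_space M) \<Longrightarrow> E \<in> sets (nat_filtration M t) \<Longrightarrow> E \<in> sets (law M x a)"
  using nat_filtration_subset law_sets by blast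

lemma target_UNIV: "target_set UNIV" by simp

text \<open>
  The Markov property is given for events \<open>age \<le> p\<close>; the strict inequality is reached from below.
\<close>

lemma landing_event_as_union:
  assumes "0 < d" "0 \<le> t"
  shows "(\<Union>n. {w \<in> sample_space M. state M (t + d) w \<in> A \<and> age M (t + d) w \<le> d - d / real (Suc n)})
    = landing_event M A t (t + d)"
proof (intro equalityI subsetI)
  fix w assume "w \<in> landing_event M A t (t + d)"
  then have w: "w \<in> sample_space M" "state M (t + d) w \<in> A" "age M (t + d) w < d"
    by (auto simp: landing_event_def)
  then obtain n where "inverse (real (Suc n)) < (d - age M (t + d) w) / d"
    using reals_Archimedean[of "(d - age M (t + d) w) / d"] assms by auto
  then have "d / real (Suc n) < d - age M (t + d) w"
    using assms(1) by (simp add: pos_less_divide_eq inverse_eq_divide mult.commute)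
  then have "age M (t + d) w \<le> d - d / real (Suc n)" by linarith
  with w show "w \<in> (\<Union>n. {w \<in> sample_space M. state M (t + d) w \<in> A \<and> age M (t + d) w \<le> d - d / real (Suc n)})"
    by blast
next
  fix w assume "w \<in> (\<Union>n. {w \<in> sample_space M. state M (t + d) w \<in> A \<and> age M (t + d) w \<le> d - d / real (Suc n)})"
  then obtain n where w: "w \<in> sample_space M" "state M (t + d) w \<in> A" "age M (t + d) w \<le> d - d / real (Suc n)"
    by blast
  have "0 < d / real (Suc n)" using assms(1) by simp
  with w show "w \<in> landing_event M A t (t + d)" by (auto simp: landing_event_def)
qed

lemma age_le_event_sets:
  assumes "A \<in> sets (state_space M)" "0 \<le> v"
  shows "{w \<in> sample_space M. state M v w \<in> A \<and> age M v w \<le> p} \<in> sets (nat_filtration M v)"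
proof -
  have [measurable]: "state M v \<in> nat_filtration M v \<rightarrow>\<^sub>M state_space M"
    "age M v \<in> borel_measurable (nat_filtration M v)"
    using assms by (auto intro: state_measurable age_measurable)
  note assms(1)[measurable]
  have "{w \<in> space (nat_filtration M v). state M v w \<in> A \<and> age M v w \<le> p} \<in> sets (nat_filtration M v)"
    by measurable
  then show ?thesis by simp
qed

lemma incseq_age_le:
  fixes d :: real
  assumes "0 < d"
  shows "incseq (\<lambda>n. {w \<in> \<Omega>. Q w \<and> h w \<le> d - d / real (Suc n)})"
proof (unfold incseq_def, intro allI impI subsetI)
  fix m n :: nat and w assume "m \<le> n" and w: "w \<in> {w \<in> \<Omega>. Q w \<and> h w \<le> d - d / real (Suc m)}"
  then have "d / real (Suc n) \<le> d / real (Suc m)"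
    using assms by (intro divide_left_mono) auto
  then have "d - d / real (Suc m) \<le> d - d / real (Suc n)" by simp
  moreover from w have "w \<in> \<Omega>" "Q w" "h w \<le> d - d / real (Suc m)" by blast+
  ultimately have "w \<in> \<Omega>" "Q w" "h w \<le> d - d / real (Suc n)" by linarith+
  then show "w \<in> {w \<in> \<Omega>. Q w \<and> h w \<le> d - d / real (Suc n)}" by blast
qed

lemma age_le_prob_tendsto:
  assumes S: "(x, a) \<in> space (age_state_space M)" and "0 < d" "A \<in> sets (state_space M)"
  shows "(\<lambda>n. measure (law M x a) {w \<in> sample_space M. state M d w \<in> A \<and> age M d w \<le> d - d / real (Suc n)})
     \<longlonglongrightarrow> landing_prob M d A x a"
proof -
  interpret prob_space "law M x a" using S by (rule law_prob)
  let ?E = "\<lambda>n. {w \<in> sample_space M. state M d w \<in> A \<and> age M d w \<le> d - d / real (Suc n)}"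
  have "(\<lambda>n. measure (law M x a) (?E n)) \<longlonglongrightarrow> measure (law M x a) (\<Union>n. ?E n)"
  proof (rule finite_Lim_measure_incseq)
    show "range ?E \<subseteq> sets (law M x a)"
      using assms(2) by (intro image_subsetI filtration_subset_law[OF S, of _ d] age_le_event_sets assms(3)) simp
    show "incseq ?E" using assms(2) by (rule incseq_age_le)
  qed
  then show ?thesis
    using landing_event_as_union[OF assms(2), of 0 A] by (simp add: landing_prob_def)
qed

lemma landing_prob_measurable:
  assumes "0 < d" "A \<in> sets (state_space M)"
  shows "(\<lambda>(x, a). landing_prob M d A x a) \<in> borel_measurable (age_state_space M)"
proof (rule borel_measurable_LIMSEQ_real)
  fix n
  have "d / real (Suc n) \<le> d / 1" using assms(1) by (intro divide_left_mono) auto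
  then show "(\<lambda>(x, a). measure (law M x a) {w \<in> sample_space M. state M d w \<in> A \<and> age M d w \<le> d - d / real (Suc n)})
     \<in> borel_measurable (age_state_space M)"
    using assms by (intro law_measurable) auto
next
  fix z assume "z \<in> space (age_state_space M)"
  then show "(\<lambda>n. case z of (x, a) \<Rightarrow> measure (law M x a) {w \<in> sample_space M. state M d w \<in> A \<and> age M d w \<le> d - d / real (Suc n)})
     \<longlonglongrightarrow> (case z of (x, a) \<Rightarrow> landing_prob M d A x a)"
    using age_le_prob_tendsto[OF _ assms] by (cases z) auto
qed

lemma landing_prob_le_1: "(x, a) \<in> space (age_state_space M) \<Longrightarrow> landing_prob M d A x a \<le> 1"
  unfolding landing_prob_def using prob_space.prob_le_1[OF law_prob] by auto

text \<open>
  The landing event between \<open>t\<close> and \<open>t + d\<close> refers to the process at time \<open>t + d\<close> only. So the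
  Markov property at \<open>t\<close> gives its conditional probability.
\<close>

lemma markov_landing:
  assumes S: "(x, a) \<in> space (age_state_space M)" and t: "0 \<le> t" and d: "0 < d"
    and A: "A \<in> sets (state_space M)"
    and W: "W \<in> borel_measurable (nat_filtration M t)" and c: "\<And>w. w \<in> sample_space M \<Longrightarrow> \<bar>W w\<bar> \<le> c"
  shows "(LINT w|law M x a. W w * indicator (landing_event M A t (t + d)) w)
    = (LINT w|law M x a. W w * landing_prob M d A (state M t w) (age M t w))"
proof -
  define P where "P = law M x a"
  interpret P: prob_space P unfolding P_def using S by (rule law_prob)
  have spP: "space P = sample_space M" unfolding P_def using S by (rule law_space)
  interpret finite_measure_subalgebra P "nat_filtration M t"
    by unfold_locales (simp add: subalgebra_def spP, use filtration_subset_law[OF S] in \<open>auto simp: P_def\<close>)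
  define E where "E n = {w \<in> sample_space M. state M (t + d) w \<in> A \<and> age M (t + d) w \<le> d - d / real (Suc n)}" for n
  define q where "q n x a = measure (law M x a) {w \<in> sample_space M. state M d w \<in> A \<and> age M d w \<le> d - d / real (Suc n)}" for n x a
  have p0: "0 \<le> d - d / real (Suc n)" for n
  proof -
    have "d / real (Suc n) \<le> d / 1" using d by (intro divide_left_mono) auto
    then show ?thesis by simp
  qed
  have WP [measurable]: "W \<in> borel_measurable P" unfolding P_def by (rule measurable_law[OF S W])
  have E [measurable]: "E n \<in> sets P" for n
    unfolding P_def E_def using t d
    by (intro filtration_subset_law[OF S, of _ "t + d"] age_le_event_sets A) auto
  have intW: "integrable P (\<lambda>w. W w * f w)" if "f \<in> borel_measurable P" "\<And>w. w \<in> sample_space M \<Longrightarrow> \<bar>f w\<bar> \<le> 1" for f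
  proof (rule P.integrable_const_bound[where B=c])
    show "AE w in P. norm (W w * f w) \<le> c"
    proof (rule AE_I2)
      fix w assume "w \<in> space P"
      then have "\<bar>W w\<bar> * \<bar>f w\<bar> \<le> c * 1" using c that spP
        by (intro mult_mono) (auto intro: order_trans[OF abs_ge_zero])
      then show "norm (W w * f w) \<le> c" by (simp add: abs_mult)
    qed
  qed (use that in measurable)
  have SP [measurable]: "(\<lambda>w. (state M t w, age M t w)) \<in> P \<rightarrow>\<^sub>M age_state_space M"
    unfolding P_def by (rule measurable_law[OF S state_age_measurable[OF t order_refl]])
  have step: "(LINT w|P. W w * indicator (E n) w) = (LINT w|P. W w * q n (state M t w) (age M t w))" for n
  proof -
    have i: "integrable P (\<lambda>w. W w * indicator (E n) w)" by (rule intW) (auto simp: indicator_def)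
    have "(LINT w|P. W w * indicator (E n) w) = (LINT w|P. W w * real_cond_exp P (nat_filtration M t) (indicator (E n)) w)"
      by (rule real_cond_exp_intg(2)[OF i W, symmetric]) simp
    also have "\<dots> = (LINT w|P. W w * q n (state M t w) (age M t w))"
    proof (rule integral_cong_AE)
      have "AE w in P. real_cond_exp P (nat_filtration M t) (indicator (E n)) w = q n (state M t w) (age M t w)"
        using markov[OF S t, of "t + d" "d - d / real (Suc n)" A] t d A p0
        unfolding E_def q_def P_def by simp
      then show "AE w in P. W w * real_cond_exp P (nat_filtration M t) (indicator (E n)) w = W w * q n (state M t w) (age M t w)"
        by eventually_elim simp
      show "(\<lambda>w. W w * q n (state M t w) (age M t w)) \<in> borel_measurable P"
        using measurable_compose[OF SP law_measurable[OF less_imp_le[OF d] p0 A]]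
        by (intro borel_measurable_times WP) (simp add: q_def)
    qed measurable
    finally show ?thesis .
  qed
  have "(\<lambda>n. LINT w|P. W w * indicator (E n) w) \<longlonglongrightarrow> (LINT w|P. W w * indicator (landing_event M A t (t + d)) w)"
  proof (rule integral_dominated_convergence[where w="\<lambda>_. c"])
    have ev: "landing_event M A t (t + d) = (\<Union>n. E n)"
      unfolding E_def by (rule landing_event_as_union[OF d t, symmetric])
    then show "(\<lambda>w. W w * indicator (landing_event M A t (t + d)) w) \<in> borel_measurable P" by simp
    have inc: "incseq E" unfolding E_def[abs_def] using d by (rule incseq_age_le)
    show "AE w in P. (\<lambda>n. W w * indicator (E n) w) \<longlonglongrightarrow> W w * indicator (landing_event M A t (t + d)) w"
      unfolding ev by (intro AE_I2 tendsto_mult tendsto_const LIMSEQ_indicator_incseq inc)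
    show "AE w in P. norm (W w * indicator (E n) w) \<le> c" for n
      using c order_trans[OF abs_ge_zero c] by (intro AE_I2) (auto simp: spP abs_mult indicator_def)
  qed auto
  moreover have "(\<lambda>n. LINT w|P. W w * q n (state M t w) (age M t w))
     \<longlonglongrightarrow> (LINT w|P. W w * landing_prob M d A (state M t w) (age M t w))"
  proof (rule integral_dominated_convergence[where w="\<lambda>_. c"])
    show "(\<lambda>w. W w * landing_prob M d A (state M t w) (age M t w)) \<in> borel_measurable P"
      using measurable_compose[OF SP landing_prob_measurable[OF d A]]
      by (intro borel_measurable_times WP) simp
    show "(\<lambda>w. W w * q n (state M t w) (age M t w)) \<in> borel_measurable P" for n
      using measurable_compose[OF SP law_measurable[OF less_imp_le[OF d] p0 A]]
      by (intro borel_measurable_times WP) (simp add: q_def)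
    show "AE w in P. (\<lambda>n. W w * q n (state M t w) (age M t w)) \<longlonglongrightarrow> W w * landing_prob M d A (state M t w) (age M t w)"
      unfolding q_def
      by (intro AE_I2 tendsto_mult tendsto_const age_le_prob_tendsto process_space t d A) (simp add: spP)
    show "AE w in P. norm (W w * q n (state M t w) (age M t w)) \<le> c" for n
    proof (rule AE_I2)
      fix w assume w: "w \<in> space P"
      then have "q n (state M t w) (age M t w) \<le> 1" unfolding q_def
        by (intro prob_space.prob_le_1 law_prob process_space t) (simp add: spP)
      moreover have "0 \<le> q n (state M t w) (age M t w)" unfolding q_def by simp
      ultimately have "\<bar>W w\<bar> * \<bar>q n (state M t w) (age M t w)\<bar> \<le> c * 1" using c[of w] w spP
        by (intro mult_mono) (auto intro: order_trans[OF abs_ge_zero])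
      then show "norm (W w * q n (state M t w) (age M t w)) \<le> c" by (simp add: abs_mult)
    qed
  qed auto
  ultimately show ?thesis unfolding step P_def[symmetric] using LIMSEQ_unique by blast
qed

section \<open>The law of the first jump\<close>

definition first_jump_event :: "'k set \<Rightarrow> real \<Rightarrow> real \<Rightarrow> 'w set" where
  "first_jump_event A c e = {w \<in> sample_space M. ereal c < jump_time M 1 w \<and> jump_time M 1 w < ereal e \<and>
     state M (real_of_ereal (jump_time M 1 w)) w \<in> A}"

lemma first_jump_event_iff:
  assumes w: "w \<in> sample_space M"
  shows "w \<in> first_jump_event A c e \<longleftrightarrow>
    (\<exists>\<tau>\<in>jumps M w. c < \<tau> \<and> \<tau> < e \<and> jumps M w \<inter> {0<..<\<tau>} = {} \<and> state M \<tau> w \<in> A)"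
proof (cases "jumps M w \<inter> {0<..} = {}")
  case True
  have "jump_time M (Suc 0) w = \<infinity>"
    by (rule jump_time_Suc_last[OF w, of 0 0]) (use True in auto)
  moreover have "jumps M w = {}" using True jumps_pos by blast
  ultimately show ?thesis by (simp add: first_jump_event_def)
next
  case False
  then obtain \<tau>' where \<tau>': "\<tau>' \<in> jumps M w" "0 < \<tau>'" "jumps M w \<inter> {0<..<\<tau>'} = {}"
    by (rule next_jump[OF w])
  have T1: "jump_time M 1 w = ereal \<tau>'"
    using jump_time_Suc_next[OF w, of 0 0 \<tau>'] \<tau>' by (simp add: zero_ereal_def)
  have uniq: "\<tau> = \<tau>'" if t: "\<tau> \<in> jumps M w" "jumps M w \<inter> {0<..<\<tau>} = {}" for \<tau>
  proof -
    have "0 < \<tau>" using t(1) by (rule jumps_pos)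
    have "\<not> \<tau> < \<tau>'" using \<tau>'(3) t(1) \<open>0 < \<tau>\<close> by (metis disjoint_iff greaterThanLessThan_iff)
    moreover have "\<not> \<tau>' < \<tau>" using t(2) \<tau>'(1,2) by (metis disjoint_iff greaterThanLessThan_iff)
    ultimately show ?thesis by simp
  qed
  have "w \<in> first_jump_event A c e \<longleftrightarrow> c < \<tau>' \<and> \<tau>' < e \<and> state M \<tau>' w \<in> A"
    unfolding first_jump_event_def using w T1 by simp
  also have "\<dots> \<longleftrightarrow> (\<exists>\<tau>\<in>jumps M w. c < \<tau> \<and> \<tau> < e \<and> jumps M w \<inter> {0<..<\<tau>} = {} \<and> state M \<tau> w \<in> A)"
    using uniq \<tau>'(1,3) by blast
  finally show ?thesis .
qed

text \<open>
  The first jump lies in \<open>(c, e)\<close> and leads to \<open>A\<close> iff there is no jump up to \<open>c\<close> and, for some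
  rational \<open>q\<close> in \<open>(c, e)\<close>, exactly one in \<open>(c, q]\<close>, which leads to \<open>A\<close>. These are countably many
  conditions on numbers of jumps.
\<close>

lemma first_jump_event_sets:
  assumes S: "(x, a) \<in> space (age_state_space M)" and A: "A \<in> sets (state_space M)" and c: "0 \<le> c"
  shows "first_jump_event A c e \<in> sets (law M x a)"
proof -
  define P where "P = law M x a"
  have spP: "space P = sample_space M" unfolding P_def using S by (rule law_space)
  have A': "target_set A" using A by auto
  have m [measurable]: "landing_count M A s v \<in> borel_measurable P" "landing_count M UNIV s v \<in> borel_measurable P"
    if "0 \<le> s" for s v
    unfolding P_def using measurable_law[OF S landing_count_measurable[OF A' that order_refl]]
      measurable_law[OF S landing_count_measurable[OF target_UNIV that order_refl]] by blast+
  have "first_jump_event A c e = (\<Union>q\<in>{q\<in>\<rat>. c < q \<and> q < e}. {w \<in> space P.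
     landing_count M UNIV 0 c w = 0 \<and> landing_count M UNIV c q w = 1 \<and> landing_count M A c q w = 1})"
    (is "_ = (\<Union>q\<in>?Q. ?G q)")
  proof (intro equalityI subsetI)
    fix w assume *: "w \<in> first_jump_event A c e"
    then have w: "w \<in> sample_space M" by (simp add: first_jump_event_def)
    with * obtain \<tau> where \<tau>: "\<tau> \<in> jumps M w" "c < \<tau>" "\<tau> < e" "jumps M w \<inter> {0<..<\<tau>} = {}" "state M \<tau> w \<in> A"
      using first_jump_event_iff[OF w] by auto
    obtain b where b: "\<tau> < b" "b \<le> e" "jumps M w \<inter> {\<tau><..<b} = {}"
    proof (cases "jumps M w \<inter> {\<tau><..} = {}")
      case True
      then have "jumps M w \<inter> {\<tau><..<e} = {}" by fastforce
      then show ?thesis using \<tau>(3) by (intro that[of e]) auto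
    next
      case False
      then obtain \<tau>' where "\<tau>' \<in> jumps M w" "\<tau> < \<tau>'" "jumps M w \<inter> {\<tau><..<\<tau>'} = {}"
        by (rule next_jump[OF w])
      then show ?thesis using \<tau>(3) by (intro that[of "min e \<tau>'"]) auto
    qed
    obtain q where q: "q \<in> \<rat>" "\<tau> < q" "q < b" using Rats_dense_in_real[OF b(1)] by auto
    have "jumps M w \<inter> {c<..q} = {\<tau>}"
    proof (intro equalityI subsetI)
      fix \<sigma> assume "\<sigma> \<in> jumps M w \<inter> {c<..q}"
      then have s: "\<sigma> \<in> jumps M w" "0 < \<sigma>" "\<sigma> < b" using jumps_pos q by auto
      then have "\<not> \<sigma> < \<tau>" "\<not> \<tau> < \<sigma>" using \<tau>(4) b(3) by (auto simp: disjoint_iff)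
      then show "\<sigma> \<in> {\<tau>}" by simp
    qed (use \<tau> q in auto)
    moreover have "jumps M w \<inter> {0<..c} = {}" using \<tau> by fastforce
    ultimately have "w \<in> ?G q" using w \<tau>(5) by (simp add: spP landing_count_def)
    then show "w \<in> (\<Union>q\<in>?Q. ?G q)" using q b \<tau> by auto
  next
    fix w assume "w \<in> (\<Union>q\<in>?Q. ?G q)"
    then obtain q where q: "c < q" "q < e" and w: "w \<in> sample_space M"
      and l: "landing_count M UNIV 0 c w = 0" "landing_count M UNIV c q w = 1" "landing_count M A c q w = 1"
      by (auto simp: spP)
    have "card (jumps M w \<inter> {c<..q}) = 1" using l(2) by (simp add: landing_count_UNIV)
    then obtain \<tau> where \<tau>: "jumps M w \<inter> {c<..q} = {\<tau>}" by (auto simp: card_1_singleton_iff)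
    have "jumps M w \<inter> {0<..c} = {}"
      using l(1) finite_jumps_Ioc[OF w, of 0 c] by (simp add: landing_count_UNIV)
    then have "jumps M w \<inter> {0<..<\<tau>} = {}" using \<tau> by (auto simp: set_eq_iff) (metis le_less_linear less_le_trans less_irrefl order.strict_implies_order)
    moreover have "state M \<tau> w \<in> A"
      using l(3) unfolding landing_count_def \<tau> by (cases "state M \<tau> w \<in> A") simp_all
    moreover have "\<tau> \<in> jumps M w" "c < \<tau>" "\<tau> \<le> q" using \<tau> by (auto simp only: set_eq_iff Int_iff greaterThanAtMost_iff singleton_iff)
    ultimately show "w \<in> first_jump_event A c e"
      unfolding first_jump_event_iff[OF w] using q by (metis le_less_trans)
  qed
  also have "\<dots> \<in> sets P"
  proof (rule sets.countable_UN'')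
    show "countable ?Q" using countable_rat by (rule countable_subset[rotated]) auto
    show "?G q \<in> sets P" if "q \<in> ?Q" for q using m[of 0 c] m[of c q] c that by measurable
  qed
  finally show ?thesis unfolding P_def .
qed

definition first_jump_rate :: "'k set \<Rightarrow> 'k \<Rightarrow> real \<Rightarrow> real \<Rightarrow> real" where
  "first_jump_rate A x a s = measure (jump_kernel M x s) A * rate M x (a + s)
              * exp (- (LINT r:{a..a + s}|lborel. rate M x r))"

lemma first_jump_prob:
  assumes "(x, a) \<in> space (age_state_space M)" "A \<in> sets (state_space M)" "0 \<le> c" "c < e"
  shows "measure (law M x a) (first_jump_event A c e) = (LINT s:{c<..<e}|lborel. first_jump_rate A x a s)"
proof -
  have "{s. c < s \<and> ereal s < ereal e} = {c<..<e}" by auto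
  then show ?thesis
    using first_jump_law[OF assms(1-3), of "ereal e"] assms(4)
    unfolding first_jump_event_def first_jump_rate_def by simp
qed

lemma first_jump_rate_bounds:
  assumes "(x, a) \<in> space (age_state_space M)" "0 \<le> s"
  shows "0 \<le> first_jump_rate A x a s" "first_jump_rate A x a s \<le> rate_sup"
proof -
  have xs: "(x, s) \<in> space (age_state_space M)" "(x, a + s) \<in> space (age_state_space M)"
    and xr: "\<And>r. a \<le> r \<Longrightarrow> (x, r) \<in> space (age_state_space M)"
    using assms by (auto simp: space_age_state_space)
  have r: "0 \<le> rate M x (a + s)" "rate M x (a + s) \<le> rate_sup"
    using xs(2) by (auto intro: rate_nonneg rate_le)
  have "0 \<le> (LINT r:{a..a + s}|lborel. rate M x r)"
    unfolding set_lebesgue_integral_def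
    by (intro Bochner_Integration.integral_nonneg) (auto simp: indicator_def intro!: rate_nonneg xr)
  then have e: "exp (- (LINT r:{a..a + s}|lborel. rate M x r)) \<le> 1" by simp
  have m: "measure (jump_kernel M x s) A \<le> 1"
    by (intro prob_space.prob_le_1 jump_kernel_props xs)
  show "0 \<le> first_jump_rate A x a s" using r by (simp add: first_jump_rate_def)
  have "first_jump_rate A x a s \<le> (1 * rate_sup) * 1"
    unfolding first_jump_rate_def using r e m rate_sup_nonneg
    by (intro mult_mono) auto
  then show "first_jump_rate A x a s \<le> rate_sup" by simp
qed

text \<open>
  The density of the first jump time is bounded by the rate, so a jump within time \<open>d\<close> has
  probability at most \<open>rate_sup * d\<close>.
\<close>

lemma landing_prob_le:
  assumes S: "(x, a) \<in> space (age_state_space M)" and d: "0 \<le> d"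
  shows "landing_prob M d A x a \<le> rate_sup * d"
proof (rule field_le_epsilon)
  fix \<epsilon> :: real assume \<epsilon>: "0 < \<epsilon>"
  define e where "e = d + \<epsilon> / (rate_sup + 1)"
  have e: "d < e" using \<epsilon> rate_sup_nonneg by (simp add: e_def)
  have top: "space (state_space M) \<in> sets (state_space M)" by simp
  interpret prob_space "law M x a" using S by (rule law_prob)
  have sub: "landing_event M A 0 d \<subseteq> first_jump_event (space (state_space M)) 0 e"
  proof
    fix w assume *: "w \<in> landing_event M A 0 d"
    then have w: "w \<in> sample_space M" by (simp add: landing_event_def)
    with * have "jumps M w \<inter> {0<..d} \<noteq> {}" using landing_event_iff[OF w order_refl d] by simp
    then have ne: "jumps M w \<inter> {0<..} \<noteq> {}" and "\<exists>\<sigma>\<in>jumps M w. \<sigma> \<le> d" by auto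
    then obtain \<sigma> where \<sigma>: "\<sigma> \<in> jumps M w" "\<sigma> \<le> d" by auto
    from ne obtain \<tau> where \<tau>: "\<tau> \<in> jumps M w" "0 < \<tau>" "jumps M w \<inter> {0<..<\<tau>} = {}"
      by (rule next_jump[OF w])
    then have "\<tau> \<le> \<sigma>" using \<sigma> jumps_pos[OF \<sigma>(1)] by (auto simp: disjoint_iff not_less)
    then show "w \<in> first_jump_event (space (state_space M)) 0 e"
      unfolding first_jump_event_iff[OF w] using \<tau> \<sigma> e state_in_space[OF w, of \<tau>]
      by (intro bexI[of _ \<tau>]) auto
  qed
  have "landing_prob M d A x a \<le> measure (law M x a) (first_jump_event (space (state_space M)) 0 e)"
    unfolding landing_prob_def by (intro finite_measure_mono sub first_jump_event_sets S top) simp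
  also have "\<dots> = (LINT s:{0<..<e}|lborel. first_jump_rate (space (state_space M)) x a s)"
    using d e by (intro first_jump_prob S top) auto
  also have "\<dots> \<le> (LINT s|lborel. indicator {0<..<e} s *\<^sub>R rate_sup)"
    unfolding set_lebesgue_integral_def
  proof (rule integral_mono')
    show "integrable lborel (\<lambda>s. indicator {0<..<e} s *\<^sub>R rate_sup)" using d e by simp
  qed (use first_jump_rate_bounds[OF S] rate_sup_nonneg in \<open>auto simp: indicator_def\<close>)
  also have "\<dots> = (LINT s|lborel. indicator {0<..<e} s) * rate_sup"
    unfolding real_scaleR_def by (rule integral_mult_left_zero)
  also have "\<dots> = rate_sup * e" using d e by simp
  also have "\<dots> \<le> rate_sup * d + \<epsilon>"
  proof -
    have "rate_sup * (\<epsilon> / (rate_sup + 1)) \<le> \<epsilon>"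
      using rate_sup_nonneg \<epsilon> by (simp add: field_simps)
    then show ?thesis by (simp add: e_def distrib_left)
  qed
  finally show "landing_prob M d A x a \<le> rate_sup * d + \<epsilon>" .
qed

lemma markov_jump_bound:
  assumes S: "(x, a) \<in> space (age_state_space M)" and t: "0 \<le> t" and d: "0 \<le> d" and e: "e = t + d"
    and A: "target_set A"
    and W: "W \<in> borel_measurable (nat_filtration M t)"
    and c: "\<And>w. w \<in> sample_space M \<Longrightarrow> 0 \<le> W w \<and> W w \<le> c"
  shows "(LINT w|law M x a. W w * indicator (landing_event M A t e) w) \<le> rate_sup * d * (LINT w|law M x a. W w)"
proof (cases "d = 0")
  case True
  have "landing_event M A t e = {}"
    using landing_event_iff[of _ t t A] t unfolding e True by (auto simp: landing_event_def)
  then show ?thesis using True by simp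
next
  case False
  with d have d: "0 < d" by simp
  interpret prob_space "law M x a" using S by (rule law_prob)
  have spP: "space (law M x a) = sample_space M" using S by (rule law_space)
  let ?A = "A \<inter> space (state_space M)"
  have WP: "W \<in> borel_measurable (law M x a)" by (rule measurable_law[OF S W])
  have iW: "integrable (law M x a) W"
    by (rule integrable_const_bound[where B=c]) (use c spP WP in auto)
  have ev: "landing_event M A t e = landing_event M ?A t (t + d)"
    unfolding e landing_event_def using state_in_space[of _ "t + d"] t d by auto
  have "(LINT w|law M x a. W w * indicator (landing_event M A t e) w)
      = (LINT w|law M x a. W w * landing_prob M d ?A (state M t w) (age M t w))"
    unfolding ev by (rule markov_landing[OF S t d A W, of c]) (use c in auto)
  also have "\<dots> \<le> (LINT w|law M x a. W w * (rate_sup * d))"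
  proof (rule integral_mono')
    show "integrable (law M x a) (\<lambda>w. W w * (rate_sup * d))" using iW by simp
    fix w assume "w \<in> space (law M x a)"
    then have w: "w \<in> sample_space M" by (simp add: spP)
    show "W w * landing_prob M d ?A (state M t w) (age M t w) \<le> W w * (rate_sup * d)"
      using c[OF w] d by (intro mult_left_mono landing_prob_le process_space t w) auto
    show "0 \<le> W w * (rate_sup * d)" using c[OF w] d rate_sup_nonneg by simp
  qed
  also have "\<dots> = rate_sup * d * (LINT w|law M x a. W w)" by simp
  finally show ?thesis .
qed

end

section \<open>Integral equations by quadratic increments\<close>

text \<open>
  Such a function has derivative zero. Integral equations for functions that are only absolutely
  continuous, and identities between probabilities known up to \<open>O(d\<^sup>2)\<close> on short intervals, are proved below
  by applying this to the difference of both sides.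
\<close>

lemma quadratic_increments_const:
  fixes f :: "real \<Rightarrow> real"
  assumes R: "0 \<le> R" and f: "\<And>s s'. 0 \<le> s \<Longrightarrow> s < s' \<Longrightarrow> s' \<le> R \<Longrightarrow> \<bar>f s' - f s\<bar> \<le> C * (s' - s)\<^sup>2"
  shows "f R = f 0"
proof -
  have bound: "\<bar>f R - f 0\<bar> \<le> C * R\<^sup>2 / real (Suc n)" if "0 < R" for n
  proof -
    define g where "g i = real i * (R / real (Suc n))" for i
    have gS: "g (Suc i) - g i = R / real (Suc n)" for i by (simp add: g_def distrib_right add_divide_distrib)
    have gR: "g (Suc n) = R" "g 0 = 0" by (simp_all add: g_def)
    have gle: "g i \<le> R" if "i \<le> Suc n" for i
    proof -
      have "real i * (R / real (Suc n)) \<le> real (Suc n) * (R / real (Suc n))"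
        using that R by (intro mult_right_mono) (simp_all only: of_nat_le_iff divide_nonneg_nonneg of_nat_0_le_iff)
      then show ?thesis by (simp add: g_def)
    qed
    have "f R - f 0 = (\<Sum>i<Suc n. f (g (Suc i)) - f (g i))"
      by (subst sum_lessThan_telescope) (simp add: gR)
    then have "\<bar>f R - f 0\<bar> \<le> (\<Sum>i<Suc n. \<bar>f (g (Suc i)) - f (g i)\<bar>)"
      by (simp only: sum_abs)
    also have "\<dots> \<le> (\<Sum>i<Suc n. C * (R / real (Suc n))\<^sup>2)"
    proof (rule sum_mono)
      fix i assume i: "i \<in> {..<Suc n}"
      have "0 < R / real (Suc n)" using that by simp
      then have "g i < g (Suc i)" using gS[of i] by linarith
      moreover have "0 \<le> g i" using R by (simp add: g_def)
      ultimately show "\<bar>f (g (Suc i)) - f (g i)\<bar> \<le> C * (R / real (Suc n))\<^sup>2"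
        using f[of "g i" "g (Suc i)"] gle[of "Suc i"] i gS[of i] by simp
    qed
    also have "\<dots> = C * R\<^sup>2 / real (Suc n)" by (simp add: power2_eq_square)
    finally show ?thesis .
  qed
  show ?thesis
  proof (cases "R = 0")
    case False
    with R have "0 < R" by simp
    have "(\<lambda>n. C * R\<^sup>2 * inverse (real (Suc n))) \<longlonglongrightarrow> C * R\<^sup>2 * 0"
      by (intro tendsto_mult tendsto_const LIMSEQ_inverse_real_of_nat)
    then have "\<bar>f R - f 0\<bar> \<le> C * R\<^sup>2 * 0"
      by (rule LIMSEQ_le_const) (use bound[OF \<open>0 < R\<close>] in \<open>auto simp: field_simps\<close>)
    then show ?thesis by simp
  qed simp
qed

lemma set_integrable_bounded_interval:
  fixes b :: "real \<Rightarrow> real"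
  assumes b: "b \<in> borel_measurable borel" and B: "\<And>r. s \<le> r \<Longrightarrow> r \<le> v \<Longrightarrow> \<bar>b r\<bar> \<le> B"
    and I: "I \<in> sets borel" "I \<subseteq> {s..v}"
  shows "set_integrable lborel I b"
  unfolding set_integrable_def
proof (rule Bochner_Integration.integrable_bound)
  show "integrable lborel (\<lambda>r. indicator {s..v} r *\<^sub>R B)" by (cases "s \<le> v") simp_all
  show "(\<lambda>r. indicator I r *\<^sub>R b r) \<in> borel_measurable lborel"
    using b I by measurable
  show "AE r in lborel. norm (indicator I r *\<^sub>R b r) \<le> norm (indicator {s..v} r *\<^sub>R B)"
    using I B by (intro AE_I2) (force simp: indicator_def intro: order_trans[OF _ abs_ge_self])
qed

lemma abs_set_integral_le:
  fixes b :: "real \<Rightarrow> real"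
  assumes B: "\<And>r. s < r \<Longrightarrow> r \<le> v \<Longrightarrow> \<bar>b r\<bar> \<le> B" and "s \<le> v" "0 \<le> B"
  shows "\<bar>LINT r:{s<..v}|lborel. b r\<bar> \<le> B * (v - s)"
proof -
  have "\<bar>LINT r:{s<..v}|lborel. b r\<bar> \<le> (LINT r|lborel. norm (indicator {s<..v} r *\<^sub>R b r))"
    unfolding set_lebesgue_integral_def real_norm_def[symmetric] by (rule integral_norm_bound)
  also have "\<dots> \<le> (LINT r|lborel. indicator {s<..v} r *\<^sub>R B)"
  proof (rule integral_mono')
    show "integrable lborel (\<lambda>r. indicator {s<..v} r *\<^sub>R B)" using assms(2) by simp
  qed (use B assms(2,3) in \<open>auto simp: indicator_def\<close>)
  also have "\<dots> = B * (v - s)" using assms(2) by simp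
  finally show ?thesis .
qed

lemma set_integral_Icc_split:
  fixes b :: "real \<Rightarrow> real"
  assumes "set_integrable lborel {u..v} b" "u \<le> s" "s \<le> v"
  shows "(LINT r:{u..v}|lborel. b r) = (LINT r:{u..s}|lborel. b r) + (LINT r:{s<..v}|lborel. b r)"
proof -
  have "{u..v} = {u..s} \<union> {s<..v}" using assms by auto
  moreover have "set_integrable lborel {u..s} b" "set_integrable lborel {s<..v} b"
    using assms by (auto intro!: set_integrable_subset[OF assms(1)])
  ultimately show ?thesis by (simp add: set_integral_Un ivl_disj_int)
qed

lemma set_integral_endpoints:
  fixes b :: "real \<Rightarrow> real"
  shows "(LINT r:{u<..v}|lborel. b r) = (LINT r:{u..v}|lborel. b r)"
    "(LINT r:{u<..<v}|lborel. b r) = (LINT r:{u..v}|lborel. b r)"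
  unfolding set_lebesgue_integral_def
  by (rule integral_discrete_difference[where X="{u, v}"]; auto simp: indicator_def)+

lemma set_integral_singleton:
  fixes b :: "real \<Rightarrow> real"
  shows "(LINT r:{u..u}|lborel. b r) = 0"
  unfolding set_integral_endpoints(2)[symmetric] by (simp add: set_lebesgue_integral_def)

lemma abs_exp_diff_le:
  fixes u v :: real
  assumes "u \<le> C" "v \<le> C"
  shows "\<bar>exp u - exp v\<bar> \<le> exp C * \<bar>u - v\<bar>"
proof -
  have one: "exp p - exp q \<le> exp C * \<bar>p - q\<bar>" if "p \<le> C" for p q :: real
  proof -
    have "1 + (q - p) \<le> exp (q - p)" by (rule exp_ge_add_one_self)
    then have "exp p * (1 + (q - p)) \<le> exp p * exp (q - p)" by (intro mult_left_mono) auto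
    also have "\<dots> = exp q" by (simp add: exp_add[symmetric])
    finally have "exp p - exp q \<le> exp p * (p - q)" by (simp add: algebra_simps)
    also have "\<dots> \<le> exp p * \<bar>p - q\<bar>" by (intro mult_left_mono) auto
    also have "\<dots> \<le> exp C * \<bar>p - q\<bar>" using that by (intro mult_right_mono) auto
    finally show ?thesis .
  qed
  show ?thesis using one[OF assms(1), of v] one[OF assms(2), of u]
    by (simp only: abs_le_iff minus_diff_eq abs_minus_commute[of v u])
qed

lemma abs_exp_second_order_le:
  fixes y :: real
  shows "\<bar>exp y - 1 - y\<bar> \<le> exp \<bar>y\<bar> * y\<^sup>2"
proof -
  have ge: "0 \<le> exp y - 1 - y" using exp_ge_add_one_self[of y] by linarith
  have "1 - y \<le> exp (- y)" using exp_ge_add_one_self[of "- y"] by simp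
  then have "exp y * (1 - y) \<le> exp y * exp (- y)" by (intro mult_left_mono) auto
  then have "exp y - 1 \<le> y * exp y" by (simp add: exp_minus field_simps)
  then have "exp y - 1 - y \<le> y * (exp y - 1)" by (simp add: algebra_simps)
  also have "\<dots> \<le> \<bar>y\<bar> * \<bar>exp y - exp 0\<bar>" by (simp add: abs_mult[symmetric])
  also have "\<dots> \<le> \<bar>y\<bar> * (exp \<bar>y\<bar> * \<bar>y - 0\<bar>)"
    by (intro mult_left_mono abs_exp_diff_le) auto
  also have "\<dots> = exp \<bar>y\<bar> * y\<^sup>2" by (simp add: power2_eq_square)
  finally show ?thesis using ge by simp
qed

text \<open>
  The fundamental theorem of calculus for \<open>exp \<circ> I\<close> with a bounded measurable derivative of \<open>I\<close>.
  As \<open>I\<close> need not be differentiable everywhere, the increments of both sides are compared.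
\<close>

lemma exp_set_integral:
  fixes b :: "real \<Rightarrow> real"
  assumes b: "b \<in> borel_measurable borel" and B: "\<And>r. \<bar>b r\<bar> \<le> B" and R: "0 \<le> R"
  shows "exp (LINT r:{0..R}|lborel. b r) = 1 + (LINT s:{0..R}|lborel. b s * exp (LINT r:{0..s}|lborel. b r))"
proof -
  have Ioc_borel: "{s<..v} \<in> sets borel" and Ioc_sub_Icc: "{s<..v} \<subseteq> {s..v}" for s v :: real by auto
  define I where "I s = (LINT r:{0..s}|lborel. b r)" for s
  have B0: "0 \<le> B" using B[of 0] by linarith
  have bi: "set_integrable lborel {s..v} b" for s v
    by (rule set_integrable_bounded_interval[OF b B]) auto
  have I_inc: "I s' - I s = (LINT r:{s<..s'}|lborel. b r)" if "0 \<le> s" "s \<le> s'" for s s'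
    unfolding I_def using set_integral_Icc_split[OF bi that] by simp
  have I_lip: "\<bar>I s' - I s\<bar> \<le> B * (s' - s)" if "0 \<le> s" "s \<le> s'" for s s'
    unfolding I_inc[OF that] using B B0 that by (intro abs_set_integral_le) auto
  have I0: "I 0 = 0" unfolding I_def by (rule set_integral_singleton)
  have I_bound: "\<bar>I s\<bar> \<le> B * R" if "0 \<le> s" "s \<le> R" for s
  proof -
    have "\<bar>I s\<bar> \<le> B * (s - 0)" using I_lip[of 0 s] that I0 by simp
    also have "\<dots> \<le> B * R" using that B0 by (intro mult_left_mono) auto
    finally show ?thesis .
  qed
  \<comment> \<open>clamped to \<open>[0, R]\<close>, so that continuity gives measurability on the whole line\<close>
  define Ic where "Ic s = I (max 0 (min s R))" for s
  have Ic_cont: "continuous_on UNIV Ic"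
  proof (rule continuous_onI)
    fix x \<epsilon> :: real assume e: "0 < \<epsilon>"
    have lip: "\<bar>Ic y - Ic x\<bar> \<le> B * \<bar>y - x\<bar>" for y x
    proof -
      have *: "\<bar>I p - I q\<bar> \<le> B * \<bar>p - q\<bar>" if "0 \<le> p" "0 \<le> q" for p q
        using I_lip[of p q] I_lip[of q p] that by (cases "p \<le> q") (auto simp: abs_minus_commute)
      have "\<bar>Ic y - Ic x\<bar> \<le> B * \<bar>max 0 (min y R) - max 0 (min x R)\<bar>" unfolding Ic_def by (rule *) auto
      also have "\<dots> \<le> B * \<bar>y - x\<bar>" using B0 by (intro mult_left_mono) auto
      finally show ?thesis .
    qed
    show "\<exists>d>0. \<forall>x'\<in>UNIV. dist x' x < d \<longrightarrow> dist (Ic x') (Ic x) \<le> \<epsilon>"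
    proof (intro exI[of _ "\<epsilon> / (B + 1)"] conjI ballI impI)
      show "0 < \<epsilon> / (B + 1)" using e B0 by simp
      fix y assume "dist y x < \<epsilon> / (B + 1)"
      then have "B * \<bar>y - x\<bar> \<le> (B + 1) * (\<epsilon> / (B + 1))"
        using B0 by (intro mult_mono) (auto simp: dist_real_def)
      then show "dist (Ic y) (Ic x) \<le> \<epsilon>" using lip[of y x] B0 by (simp add: dist_real_def)
    qed
  qed
  define h where "h s = b s * exp (Ic s)" for s
  have h_meas: "h \<in> borel_measurable borel"
    unfolding h_def using b borel_measurable_continuous_onI[OF Ic_cont] by measurable
  define E where "E = exp (B * R)"
  have E1: "1 \<le> E" unfolding E_def using B0 R by simp
  have Ic_eq: "Ic s = I s" if "0 \<le> s" "s \<le> R" for s using that by (simp add: Ic_def min_def max_def)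
  have Ic_bound: "Ic s \<le> B * R" for s
    using I_bound[of "max 0 (min s R)"] R by (simp add: Ic_def)
  have h_bound: "\<bar>h s\<bar> \<le> B * E" for s
    unfolding h_def E_def abs_mult using B[of s] B0 Ic_bound[of s] by (intro mult_mono) auto
  have hi: "set_integrable lborel {s..v} h" for s v
    by (rule set_integrable_bounded_interval[OF h_meas h_bound]) auto
  define f where "f s = exp (I s) - (LINT r:{0..s}|lborel. h r)" for s
  have "f R = f 0"
  proof (rule quadratic_increments_const[OF R, where C="E * (E * B\<^sup>2) + B * E * B"])
    fix s s' assume s: "0 \<le> s" "s < s'" "s' \<le> R"
    then have s': "0 \<le> s" "s \<le> s'" by auto
    define y where "y = (LINT r:{s<..s'}|lborel. b r)"
    have Iy: "I s' = I s + y" using I_inc[OF s'] by (simp add: y_def)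
    have y: "\<bar>y\<bar> \<le> B * (s' - s)" unfolding y_def using B B0 s by (intro abs_set_integral_le) auto
    have yE: "exp \<bar>y\<bar> \<le> E"
    proof -
      have "B * (s' - s) \<le> B * R" using B0 s by (intro mult_left_mono) auto
      then show ?thesis using y by (simp add: E_def)
    qed
    have IsE: "exp (I s) \<le> E" unfolding E_def using I_bound[of s] s by auto
    have si1: "set_integrable lborel {s<..s'} (\<lambda>r. h r)" "set_integrable lborel {s<..s'} (\<lambda>r. exp (I s) * b r)"
      using set_integrable_bounded_interval[OF h_meas h_bound Ioc_borel Ioc_sub_Icc]
        set_integrable_bounded_interval[OF b B Ioc_borel Ioc_sub_Icc]
      by auto
    have "f s' - f s = exp (I s) * (exp y - 1) - (LINT r:{s<..s'}|lborel. h r)"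
      unfolding f_def Iy exp_add using set_integral_Icc_split[OF hi s'] by (simp add: algebra_simps)
    also have "\<dots> = exp (I s) * (exp y - 1 - y) - (LINT r:{s<..s'}|lborel. h r - exp (I s) * b r)"
      using si1 by (simp add: set_integral_diff y_def algebra_simps)
    finally have "\<bar>f s' - f s\<bar> \<le> exp (I s) * \<bar>exp y - 1 - y\<bar> + \<bar>LINT r:{s<..s'}|lborel. h r - exp (I s) * b r\<bar>"
      by (simp only:) (rule order_trans[OF abs_triangle_ineq4], simp add: abs_mult)
    also have "\<dots> \<le> E * (E * B\<^sup>2 * (s' - s)\<^sup>2) + (B * E * B * (s' - s)) * (s' - s)"
    proof (rule add_mono)
      have "y\<^sup>2 \<le> (B * (s' - s))\<^sup>2" using y by (metis abs_ge_zero power2_abs power_mono)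
      then have "exp \<bar>y\<bar> * y\<^sup>2 \<le> E * (B * (s' - s))\<^sup>2" using yE E1 by (intro mult_mono) auto
      then have "\<bar>exp y - 1 - y\<bar> \<le> E * (B * (s' - s))\<^sup>2"
        using abs_exp_second_order_le[of y] by linarith
      then show "exp (I s) * \<bar>exp y - 1 - y\<bar> \<le> E * (E * B\<^sup>2 * (s' - s)\<^sup>2)"
        using IsE E1 by (intro mult_mono) (auto simp: power_mult_distrib mult.assoc)
      show "\<bar>LINT r:{s<..s'}|lborel. h r - exp (I s) * b r\<bar> \<le> (B * E * B * (s' - s)) * (s' - s)"
      proof (rule abs_set_integral_le)
        fix r assume r: "s < r" "r \<le> s'"
        have "\<bar>h r - exp (I s) * b r\<bar> = \<bar>b r\<bar> * \<bar>exp (I r) - exp (I s)\<bar>"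
          using r s by (simp add: h_def Ic_eq abs_mult[symmetric] right_diff_distrib mult.commute)
        also have "\<dots> \<le> B * (E * (B * (s' - s)))"
        proof (rule mult_mono)
          have "\<bar>exp (I r) - exp (I s)\<bar> \<le> E * \<bar>I r - I s\<bar>"
            unfolding E_def using I_bound[of r] I_bound[of s] r s by (intro abs_exp_diff_le) auto
          also have "\<dots> \<le> E * (B * (s' - s))"
          proof (rule mult_left_mono)
            have "\<bar>I r - I s\<bar> \<le> B * (r - s)" using r s by (intro I_lip) auto
            also have "\<dots> \<le> B * (s' - s)" using r B0 by (intro mult_left_mono) auto
            finally show "\<bar>I r - I s\<bar> \<le> B * (s' - s)" .
          qed (use E1 in auto)
          finally show "\<bar>exp (I r) - exp (I s)\<bar> \<le> E * (B * (s' - s))" .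
        qed (use B B0 in auto)
        finally show "\<bar>h r - exp (I s) * b r\<bar> \<le> B * E * B * (s' - s)" by (simp add: mult.assoc)
      qed (use s B0 E1 in auto)
    qed
    also have "\<dots> = (E * (E * B\<^sup>2) + B * E * B) * (s' - s)\<^sup>2"
      by (simp add: power2_eq_square algebra_simps)
    finally show "\<bar>f s' - f s\<bar> \<le> (E * (E * B\<^sup>2) + B * E * B) * (s' - s)\<^sup>2" .
  qed
  moreover have "(LINT r:{0..0}|lborel. h r) = 0" by (rule set_integral_singleton)
  ultimately have "exp (I R) = 1 + (LINT r:{0..R}|lborel. h r)" by (simp add: f_def I0)
  also have "(LINT r:{0..R}|lborel. h r) = (LINT s:{0..R}|lborel. b s * exp (I s))"
    unfolding set_lebesgue_integral_def
    by (intro Bochner_Integration.integral_cong refl) (auto simp: indicator_def h_def Ic_eq)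
  finally show ?thesis unfolding I_def .
qed

section \<open>Moments of the number of jumps\<close>

context semi_markov
begin

lemma jump_prob_le:
  assumes S: "(x, a) \<in> space (age_state_space M)" and t: "0 \<le> t" "t \<le> e"
  shows "measure (law M x a) (landing_event M UNIV t e) \<le> rate_sup * (e - t)"
proof -
  interpret prob_space "law M x a" using S by (rule law_prob)
  have "landing_event M UNIV t e \<subseteq> space (law M x a)"
    by (auto simp: landing_event_def law_space[OF S])
  then have "measure (law M x a) (landing_event M UNIV t e) = (LINT w|law M x a. 1 * indicator (landing_event M UNIV t e) w)"
    by (simp add: Int_absorb2 Int_absorb1)
  also have "\<dots> \<le> rate_sup * (e - t) * (LINT w|law M x a. 1)"
    by (rule markov_jump_bound[OF S t(1), where c=1]) (use t target_UNIV in auto)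
  also have "(LINT w|law M x a. 1) = (1::real)" using prob_space by simp
  finally show ?thesis by simp
qed

text \<open>
  Each cell of a grid contains a jump with probability at most \<open>b = rate_sup * mesh\<close>, even
  conditionally on the past. So at least one jump in the first \<open>i\<close> cells has probability at most
  \<open>i b\<close>, and by induction on \<open>i\<close> jumps in two of them have probability at most \<open>(i b)\<^sup>2\<close>.
\<close>

lemma two_jumps_prob_le:
  assumes S: "(x, a) \<in> space (age_state_space M)" and s: "0 \<le> s" "s < v"
  shows "measure (law M x a) {w \<in> sample_space M. 2 \<le> landing_count M UNIV s v w} \<le> (rate_sup * (v - s))\<^sup>2"
proof -
  define P where "P = law M x a"
  interpret prob_space P unfolding P_def using S by (rule law_prob)
  have spP: "space P = sample_space M" unfolding P_def using S by (rule law_space)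
  have lc [measurable]: "landing_count M UNIV s v \<in> borel_measurable P"
    unfolding P_def by (rule measurable_law[OF S landing_count_measurable[OF target_UNIV s(1) order_refl]])
  define D where "D m i w = grid_landings M UNIV (uniform_grid s v m) i w" for m i w
  have bound: "measure P {w \<in> sample_space M. 2 \<le> D m m w} \<le> (rate_sup * (v - s))\<^sup>2" if m: "0 < m" for m
  proof -
    define g where "g = uniform_grid s v m"
    define b where "b = rate_sup * ((v - s) / real m)"
    have b0: "0 \<le> b" using rate_sup_nonneg s by (simp add: b_def)
    have gm: "mono g" unfolding g_def using s by (intro uniform_grid_mono) simp
    have g0: "0 \<le> g i" for i using monoD[OF gm, of 0 i] s by (simp add: g_def)
    have gS: "g (Suc i) = g i + (v - s) / real m" for i by (simp add: g_def uniform_grid_Suc)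
    have DF: "D m i \<in> borel_measurable (nat_filtration M (g i))" for i
      unfolding D_def[abs_def] g_def[symmetric] using g0[of 0]
      by (intro grid_landings_measurable target_UNIV gm) auto
    have DP [measurable]: "D m i \<in> borel_measurable P" for i
      unfolding P_def by (rule measurable_law[OF S DF])
    have IP [measurable]: "landing_event M UNIV (g i) (g (Suc i)) \<in> sets P" for i
      unfolding P_def using g0[of i] monoD[OF gm, of i "Suc i"]
      by (intro filtration_subset_law[OF S, of _ "g (Suc i)"] landing_event_sets target_UNIV) auto
    have [measurable]: "sample_space M \<in> sets P" using sets.top[of P] by (simp add: spP)
    have setD [measurable]: "{w \<in> sample_space M. k \<le> D m i w} \<in> sets P" for k i
      unfolding spP[symmetric] by measurable
    have DS: "D m (Suc i) w = D m i w + indicator (landing_event M UNIV (g i) (g (Suc i))) w" for i w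
      by (simp add: D_def grid_landings_def g_def)
    have I1: "measure P (landing_event M UNIV (g i) (g (Suc i))) \<le> b" for i
      using jump_prob_le[OF S g0[of i], of "g (Suc i)"] monoD[OF gm, of i "Suc i"]
      by (simp add: P_def b_def gS)
    have one: "measure P {w \<in> sample_space M. 1 \<le> D m i w} \<le> real i * b" for i
    proof (induction i)
      case 0
      have emp: "{w \<in> sample_space M. 1 \<le> D m 0 w} = {}" by (auto simp: D_def grid_landings_def)
      show ?case unfolding emp by simp
    next
      case (Suc i)
      have "{w \<in> sample_space M. 1 \<le> D m (Suc i) w}
          \<subseteq> {w \<in> sample_space M. 1 \<le> D m i w} \<union> landing_event M UNIV (g i) (g (Suc i))"
        unfolding DS by (auto simp: indicator_def split: if_splits)
      then have "measure P {w \<in> sample_space M. 1 \<le> D m (Suc i) w}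
          \<le> measure P ({w \<in> sample_space M. 1 \<le> D m i w} \<union> landing_event M UNIV (g i) (g (Suc i)))"
        by (intro finite_measure_mono) measurable
      also have "\<dots> \<le> real i * b + b"
        using Suc I1[of i] measure_Un_le[OF setD[of 1 i] IP[of i]] by linarith
      finally show ?case by (simp add: distrib_right)
    qed
    have two: "measure P {w \<in> sample_space M. 2 \<le> D m i w} \<le> (real i * b)\<^sup>2" for i
    proof (induction i)
      case 0
      have emp: "{w \<in> sample_space M. 2 \<le> D m 0 w} = {}" by (auto simp: D_def grid_landings_def)
      show ?case unfolding emp by simp
    next
      case (Suc i)
      let ?W = "{w \<in> sample_space M. 1 \<le> D m i w}" and ?I = "landing_event M UNIV (g i) (g (Suc i))"
      have "{w \<in> sample_space M. 2 \<le> D m (Suc i) w} \<subseteq> {w \<in> sample_space M. 2 \<le> D m i w} \<union> (?W \<inter> ?I)"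
        unfolding DS by (auto simp: indicator_def split: if_splits)
      then have "measure P {w \<in> sample_space M. 2 \<le> D m (Suc i) w}
          \<le> measure P ({w \<in> sample_space M. 2 \<le> D m i w} \<union> (?W \<inter> ?I))"
        by (intro finite_measure_mono) measurable
      also have "\<dots> \<le> measure P {w \<in> sample_space M. 2 \<le> D m i w} + measure P (?W \<inter> ?I)"
        by (intro measure_Un_le) measurable
      also have "measure P (?W \<inter> ?I) \<le> b * measure P ?W"
      proof -
        have WI: "?W \<inter> ?I \<subseteq> space P" "?W \<subseteq> space P" by (auto simp: spP)
        have "measure P (?W \<inter> ?I) = (LINT w|P. indicator ?W w * indicator ?I w)"
          using WI by (simp add: indicator_inter_arith[symmetric] Int_absorb2 Int_absorb1)
        also have "\<dots> \<le> rate_sup * ((v - s) / real m) * (LINT w|P. indicator ?W w)"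
          unfolding P_def
        proof (rule markov_jump_bound[OF S g0 _ gS target_UNIV])
          have "{w \<in> space (nat_filtration M (g i)). 1 \<le> D m i w} \<in> sets (nat_filtration M (g i))"
            using DF[of i] by measurable
          then show "indicator ?W \<in> borel_measurable (nat_filtration M (g i))"
            by (intro borel_measurable_indicator) simp
          show "0 \<le> (indicator ?W w :: real) \<and> (indicator ?W w :: real) \<le> 1" for w
            by (simp add: indicator_def)
        qed (use s in simp)
        also have "(LINT w|P. indicator ?W w) = measure P ?W"
          using WI by (simp add: Int_absorb2 Int_absorb1)
        finally show ?thesis by (simp add: b_def)
      qed
      also have "b * measure P ?W \<le> b * (real i * b)" using one[of i] b0 by (rule mult_left_mono)
      finally have "measure P {w \<in> sample_space M. 2 \<le> D m (Suc i) w} \<le> (real i * b)\<^sup>2 + b * (real i * b)"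
        using Suc by linarith
      also have "\<dots> \<le> (real (Suc i) * b)\<^sup>2"
        using b0 by (simp add: power2_eq_square algebra_simps)
      finally show ?case .
    qed
    have "real m * b = rate_sup * (v - s)" using m by (simp add: b_def)
    then show ?thesis using two[of m] by simp
  qed
  have "(\<lambda>m. measure P {w \<in> sample_space M. 2 \<le> D (Suc m) (Suc m) w}) \<longlonglongrightarrow> measure P {w \<in> sample_space M. 2 \<le> landing_count M UNIV s v w}"
  proof -
    have DmP [measurable]: "D m m \<in> borel_measurable P" if "0 < m" for m
      unfolding P_def D_def[abs_def] using that s
      by (intro measurable_law[OF S grid_landings_measurable[of _ _ _ v]] target_UNIV uniform_grid_mono) auto
    have e: "measure P {w \<in> sample_space M. Q w} = (LINT w|P. indicator {w \<in> sample_space M. Q w} w)" for Q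
    proof -
      have "{w \<in> sample_space M. Q w} \<inter> space P = {w \<in> sample_space M. Q w}" by (auto simp: spP)
      then show ?thesis by simp
    qed
    show ?thesis unfolding e
    proof (rule integral_dominated_convergence[where w="\<lambda>_. 1"])
      show "indicator {w \<in> sample_space M. 2 \<le> landing_count M UNIV s v w} \<in> borel_measurable P"
        unfolding spP[symmetric] by measurable
      show "indicator {w \<in> sample_space M. 2 \<le> D (Suc m) (Suc m) w} \<in> borel_measurable P" for m
        unfolding spP[symmetric] using DmP[of "Suc m"] by measurable
      show "AE w in P. (\<lambda>m. indicator {w \<in> sample_space M. 2 \<le> D (Suc m) (Suc m) w} w :: real)
          \<longlonglongrightarrow> indicator {w \<in> sample_space M. 2 \<le> landing_count M UNIV s v w} w"
      proof (rule AE_I2, rule LIMSEQ_Suc, rule tendsto_eventually)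
        fix w assume "w \<in> space P"
        then have "\<forall>\<^sub>F m in sequentially. D m m w = landing_count M UNIV s v w"
          unfolding D_def spP by (rule grid_landings_eventually[OF _ s])
        then show "\<forall>\<^sub>F m in sequentially. indicator {w \<in> sample_space M. 2 \<le> D m m w} w
            = (indicator {w \<in> sample_space M. 2 \<le> landing_count M UNIV s v w} w :: real)"
          by eventually_elim (simp add: indicator_def)
      qed
    qed (auto simp: indicator_def)
  qed
  then show ?thesis unfolding P_def[symmetric]
    by (rule LIMSEQ_le_const2) (use bound in auto)
qed

text \<open>
  On a grid, a further cell multiplies the moment by at most \<open>1 + (\<kappa> - 1) b\<close>, where \<open>b\<close> bounds
  the conditional probability of a jump in it. The limit of the grids is taken with Fatou's lemma.
\<close>

lemma exponential_moment:
  assumes S: "(x, a) \<in> space (age_state_space M)" and s: "0 \<le> s" "s < v" and k: "1 \<le> \<kappa>"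
  shows "(\<integral>\<^sup>+ w. ennreal (\<kappa> powr landing_count M UNIV s v w) \<partial>law M x a) \<le> ennreal (exp ((\<kappa> - 1) * rate_sup * (v - s)))"
proof -
  define P where "P = law M x a"
  interpret prob_space P unfolding P_def using S by (rule law_prob)
  have spP: "space P = sample_space M" unfolding P_def using S by (rule law_space)
  define D where "D m i w = grid_landings M UNIV (uniform_grid s v m) i w" for m i w
  have bound: "(\<integral>\<^sup>+ w. ennreal (\<kappa> powr D m m w) \<partial>P) \<le> ennreal (exp ((\<kappa> - 1) * rate_sup * (v - s)))"
    if m: "0 < m" for m
  proof -
    define g where "g = uniform_grid s v m"
    define b where "b = rate_sup * ((v - s) / real m)"
    have b0: "0 \<le> b" using rate_sup_nonneg s by (simp add: b_def)
    have gm: "mono g" unfolding g_def using s by (intro uniform_grid_mono) simp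
    have g0: "0 \<le> g i" for i using monoD[OF gm, of 0 i] s by (simp add: g_def)
    have gS: "g (Suc i) = g i + (v - s) / real m" for i by (simp add: g_def uniform_grid_Suc)
    have DF: "D m i \<in> borel_measurable (nat_filtration M (g i))" for i
      unfolding D_def[abs_def] g_def[symmetric] using g0[of 0]
      by (intro grid_landings_measurable target_UNIV gm) auto
    have DP [measurable]: "D m i \<in> borel_measurable P" for i
      unfolding P_def by (rule measurable_law[OF S DF])
    have IP [measurable]: "landing_event M UNIV (g i) (g (Suc i)) \<in> sets P" for i
      unfolding P_def using g0[of i] monoD[OF gm, of i "Suc i"]
      by (intro filtration_subset_law[OF S, of _ "g (Suc i)"] landing_event_sets target_UNIV) auto
    have DS: "D m (Suc i) w = D m i w + indicator (landing_event M UNIV (g i) (g (Suc i))) w" for i w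
      by (simp add: D_def grid_landings_def g_def)
    have Dle: "D m i w \<le> real i" for i w
    proof -
      have "D m i w \<le> (\<Sum>j<i. 1)" unfolding D_def grid_landings_def by (intro sum_mono) (auto simp: indicator_def)
      then show ?thesis by simp
    qed
    have Qb: "0 \<le> \<kappa> powr D m i w \<and> \<kappa> powr D m i w \<le> \<kappa> powr real i" for i w
      using k Dle[of i w] by (simp add: powr_mono)
    have Qi: "integrable P (\<lambda>w. \<kappa> powr D m i w)" for i
      by (rule integrable_const_bound[where B="\<kappa> powr real i"]) (use Qb in auto)
    have E: "(LINT w|P. \<kappa> powr D m i w) \<le> (1 + (\<kappa> - 1) * b) ^ i" for i
    proof (induction i)
      case 0
      then show ?case using prob_space by (simp add: D_def grid_landings_def)
    next
      case (Suc i)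
      let ?I = "landing_event M UNIV (g i) (g (Suc i))"
      have QI: "integrable P (\<lambda>w. \<kappa> powr D m i w * indicator ?I w)"
        by (rule integrable_const_bound[where B="\<kappa> powr real i"]) (use Qb in \<open>auto simp: indicator_def\<close>)
      have "(LINT w|P. \<kappa> powr D m (Suc i) w)
          = (LINT w|P. \<kappa> powr D m i w + (\<kappa> - 1) * (\<kappa> powr D m i w * indicator ?I w))"
        using k by (intro Bochner_Integration.integral_cong refl)
          (auto simp: DS powr_add indicator_def algebra_simps)
      also have "\<dots> = (LINT w|P. \<kappa> powr D m i w) + (\<kappa> - 1) * (LINT w|P. \<kappa> powr D m i w * indicator ?I w)"
        using Qi QI by simp
      also have "\<dots> \<le> (LINT w|P. \<kappa> powr D m i w) + (\<kappa> - 1) * (b * (LINT w|P. \<kappa> powr D m i w))"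
      proof -
        have "(LINT w|P. \<kappa> powr D m i w * indicator ?I w) \<le> b * (LINT w|P. \<kappa> powr D m i w)"
          unfolding P_def b_def
        proof (rule markov_jump_bound[OF S g0 _ gS target_UNIV])
          show "(\<lambda>w. \<kappa> powr D m i w) \<in> borel_measurable (nat_filtration M (g i))"
            using DF[of i] by measurable
        qed (use s Qb in auto)
        then show ?thesis using k by (intro add_left_mono mult_left_mono) auto
      qed
      also have "\<dots> = (1 + (\<kappa> - 1) * b) * (LINT w|P. \<kappa> powr D m i w)" by (simp add: algebra_simps)
      also have "\<dots> \<le> (1 + (\<kappa> - 1) * b) * (1 + (\<kappa> - 1) * b) ^ i"
        using Suc k b0 by (intro mult_left_mono) auto
      finally show ?case by simp
    qed
    have "(1 + (\<kappa> - 1) * b) ^ m \<le> exp ((\<kappa> - 1) * b) ^ m"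
      using k b0 by (intro power_mono) (auto simp: exp_ge_add_one_self)
    also have "\<dots> = exp (real m * ((\<kappa> - 1) * b))" by (simp add: exp_of_nat_mult)
    also have "real m * ((\<kappa> - 1) * b) = (\<kappa> - 1) * rate_sup * (v - s)" using m by (simp add: b_def)
    finally have "(LINT w|P. \<kappa> powr D m m w) \<le> exp ((\<kappa> - 1) * rate_sup * (v - s))"
      using E[of m] by simp
    then show ?thesis using Qi[of m] Qb by (subst nn_integral_eq_integral) auto
  qed
  have "(\<integral>\<^sup>+ w. ennreal (\<kappa> powr landing_count M UNIV s v w) \<partial>P)
      = (\<integral>\<^sup>+ w. liminf (\<lambda>m. ennreal (\<kappa> powr D (Suc m) (Suc m) w)) \<partial>P)"
  proof (rule nn_integral_cong)
    fix w assume "w \<in> space P"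
    then have "\<forall>\<^sub>F m in sequentially. D m m w = landing_count M UNIV s v w"
      unfolding D_def spP by (rule grid_landings_eventually[OF _ s])
    then have "\<forall>\<^sub>F m in sequentially. ennreal (\<kappa> powr D m m w) = ennreal (\<kappa> powr landing_count M UNIV s v w)"
      by eventually_elim simp
    then have "(\<lambda>m. ennreal (\<kappa> powr D (Suc m) (Suc m) w)) \<longlonglongrightarrow> ennreal (\<kappa> powr landing_count M UNIV s v w)"
      by (intro LIMSEQ_Suc[where f="\<lambda>m. ennreal (\<kappa> powr D m m w)"] tendsto_eventually)
    then show "ennreal (\<kappa> powr landing_count M UNIV s v w) = liminf (\<lambda>m. ennreal (\<kappa> powr D (Suc m) (Suc m) w))"
      using lim_imp_Liminf trivial_limit_sequentially by metis
  qed
  also have "\<dots> \<le> liminf (\<lambda>m. \<integral>\<^sup>+ w. ennreal (\<kappa> powr D (Suc m) (Suc m) w) \<partial>P)"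
  proof (rule nn_integral_liminf)
    fix m
    have "D (Suc m) (Suc m) \<in> borel_measurable P"
      unfolding P_def D_def[abs_def] using s
      by (intro measurable_law[OF S grid_landings_measurable[of _ _ _ v]] target_UNIV uniform_grid_mono) auto
    then show "(\<lambda>w. ennreal (\<kappa> powr D (Suc m) (Suc m) w)) \<in> borel_measurable P" by measurable
  qed
  also have "\<dots> \<le> ennreal (exp ((\<kappa> - 1) * rate_sup * (v - s)))"
    using bound by (intro Liminf_le) (auto intro!: always_eventually)
  finally show ?thesis unfolding P_def .
qed

end

section \<open>The landing probability for short times\<close>

lemma borel_measurable_indefinite_integral:
  fixes b :: "real \<Rightarrow> real"
  assumes b [measurable]: "b \<in> borel_measurable borel"
  shows "(\<lambda>s. LINT r:{0..s}|lborel. b r) \<in> borel_measurable borel"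
proof -
  have "(\<lambda>s. LINT r|lborel. (if 0 \<le> r \<and> r \<le> s then b r else 0)) \<in> borel_measurable borel"
    by (rule lborel.borel_measurable_lebesgue_integral) measurable
  also have "(\<lambda>s. LINT r|lborel. (if 0 \<le> r \<and> r \<le> s then b r else 0)) = (\<lambda>s. LINT r:{0..s}|lborel. b r)"
    unfolding set_lebesgue_integral_def
    by (intro ext Bochner_Integration.integral_cong refl) (auto simp: indicator_def)
  finally show ?thesis .
qed

lemma set_integral_shift:
  fixes f :: "real \<Rightarrow> real"
  shows "(LINT r:{t + u..t + v}|lborel. f r) = (LINT s:{u..v}|lborel. f (t + s))"
proof -
  have "(LINT r|lborel. indicator {t + u..t + v} r *\<^sub>R f r)
      = \<bar>1\<bar> *\<^sub>R (LINT s|lborel. indicator {t + u..t + v} (t + 1 * s) *\<^sub>R f (t + 1 * s))"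
    by (rule lborel_integral_real_affine) simp
  also have "\<dots> = (LINT s|lborel. indicator {u..v} s *\<^sub>R f (t + s))"
    by (simp add: indicator_def)
  finally show ?thesis unfolding set_lebesgue_integral_def .
qed

context semi_markov
begin

text \<open>
  Rate and kernel as functions of an age on the whole real line, constant for negative arguments,
  so that their integrals over intervals are integrals of Borel functions.
\<close>

definition rate0 :: "'k \<Rightarrow> real \<Rightarrow> real" where "rate0 x r = rate M x (max 0 r)"
definition kernel0 :: "'k set \<Rightarrow> 'k \<Rightarrow> real \<Rightarrow> real" where "kernel0 A x r = measure (jump_kernel M x (max 0 r)) A"

definition survival :: "'k \<Rightarrow> real \<Rightarrow> real \<Rightarrow> real" where
  "survival x a s = exp (- (LINT r:{0..s}|lborel. rate0 x (a + r)))"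

lemma state_clamp_measurable: "x \<in> space (state_space M) \<Longrightarrow> (\<lambda>r. (x, max 0 r)) \<in> borel \<rightarrow>\<^sub>M age_state_space M"
  unfolding age_state_space_def by (intro measurable_Pair measurable_restrict_space2) auto

lemma rate0_measurable: "x \<in> space (state_space M) \<Longrightarrow> rate0 x \<in> borel_measurable borel"
  unfolding rate0_def using measurable_compose[OF state_clamp_measurable rate_measurable] by simp

lemma kernel0_measurable:
  assumes "x \<in> space (state_space M)" "A \<in> sets (state_space M)"
  shows "kernel0 A x \<in> borel_measurable borel"
proof -
  have "(\<lambda>N. measure N A) \<in> borel_measurable (prob_algebra (state_space M))" using assms(2) by measurable
  from measurable_compose[OF measurable_compose[OF state_clamp_measurable[OF assms(1)] jump_kernel] this]
  show ?thesis unfolding kernel0_def by simp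
qed

lemma rate0_bounds: "x \<in> space (state_space M) \<Longrightarrow> 0 \<le> rate0 x r \<and> rate0 x r \<le> rate_sup"
  unfolding rate0_def by (auto intro!: rate_nonneg rate_le simp: space_age_state_space)

lemma kernel0_bounds: "x \<in> space (state_space M) \<Longrightarrow> 0 \<le> kernel0 A x r \<and> kernel0 A x r \<le> 1"
  unfolding kernel0_def by (auto intro!: prob_space.prob_le_1 jump_kernel_props simp: space_age_state_space)

lemma survival_measurable: "x \<in> space (state_space M) \<Longrightarrow> survival x a \<in> borel_measurable borel"
proof -
  assume "x \<in> space (state_space M)"
  then have [measurable]: "rate0 x \<in> borel_measurable borel" by (rule rate0_measurable)
  have "(\<lambda>s. LINT r:{0..s}|lborel. rate0 x (a + r)) \<in> borel_measurable borel"
    by (rule borel_measurable_indefinite_integral) measurable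
  then show ?thesis unfolding survival_def[abs_def] by measurable
qed

lemma rate0_set_integral_bounds:
  assumes x: "x \<in> space (state_space M)" and s: "0 \<le> s"
  shows "0 \<le> (LINT r:{0..s}|lborel. rate0 x (a + r))" "(LINT r:{0..s}|lborel. rate0 x (a + r)) \<le> rate_sup * s"
proof -
  show "0 \<le> (LINT r:{0..s}|lborel. rate0 x (a + r))"
    unfolding set_lebesgue_integral_def using rate0_bounds[OF x]
    by (intro Bochner_Integration.integral_nonneg) (auto simp: indicator_def)
  have "\<bar>LINT r:{0<..s}|lborel. rate0 x (a + r)\<bar> \<le> rate_sup * (s - 0)"
    using rate0_bounds[OF x] s rate_sup_nonneg by (intro abs_set_integral_le) auto
  then show "(LINT r:{0..s}|lborel. rate0 x (a + r)) \<le> rate_sup * s"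
    unfolding set_integral_endpoints(1) by simp
qed

lemma survival_bounds:
  assumes "x \<in> space (state_space M)" "0 \<le> s"
  shows "0 < survival x a s" "survival x a s \<le> 1" "1 - survival x a s \<le> rate_sup * s"
proof -
  note I = rate0_set_integral_bounds[OF assms, of a]
  show "0 < survival x a s" "survival x a s \<le> 1" using I by (auto simp: survival_def)
  have "1 + (- (LINT r:{0..s}|lborel. rate0 x (a + r))) \<le> survival x a s"
    unfolding survival_def by (rule exp_ge_add_one_self)
  then show "1 - survival x a s \<le> rate_sup * s" using I by linarith
qed

lemma survival_add:
  assumes x: "x \<in> space (state_space M)" and a: "0 \<le> a" "0 \<le> s"
  shows "survival x 0 (a + s) = survival x 0 a * survival x a s"
proof -
  have i: "set_integrable lborel {0..a + s} (rate0 x)"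
    by (rule set_integrable_bounded_interval[OF rate0_measurable[OF x], where B=rate_sup])
      (use rate0_bounds[OF x] in auto)
  have "(LINT r:{0..a + s}|lborel. rate0 x r) = (LINT r:{0..a}|lborel. rate0 x r) + (LINT r:{a<..a + s}|lborel. rate0 x r)"
    using a by (intro set_integral_Icc_split[OF i]) auto
  also have "(LINT r:{a<..a + s}|lborel. rate0 x r) = (LINT r:{0..s}|lborel. rate0 x (a + r))"
    unfolding set_integral_endpoints(1) using set_integral_shift[of a 0 s "rate0 x"] by simp
  finally show ?thesis by (simp add: survival_def exp_add[symmetric])
qed

lemma survival_integral:
  assumes x: "x \<in> space (state_space M)" and d: "0 \<le> d"
  shows "(LINT s:{0..d}|lborel. rate0 x (a + s) * survival x a s) = 1 - survival x a d"
proof -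
  have [measurable]: "rate0 x \<in> borel_measurable borel" by (rule rate0_measurable[OF x])
  have "exp (LINT r:{0..d}|lborel. - rate0 x (a + r))
      = 1 + (LINT s:{0..d}|lborel. - rate0 x (a + s) * exp (LINT r:{0..s}|lborel. - rate0 x (a + r)))"
    using rate0_bounds[OF x] by (intro exp_set_integral[where B=rate_sup] d) auto
  then show ?thesis by (simp add: survival_def set_lebesgue_integral_def)
qed

lemma first_jump_rate_eq:
  assumes "x \<in> space (state_space M)" "0 \<le> a" "0 \<le> s"
  shows "first_jump_rate A x a s = kernel0 A x s * rate0 x (a + s) * survival x a s"
proof -
  have "(LINT r:{a..a + s}|lborel. rate M x r) = (LINT r:{a + 0..a + s}|lborel. rate0 x r)"
    unfolding set_lebesgue_integral_def rate0_def using assms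
    by (intro Bochner_Integration.integral_cong refl) (auto simp: indicator_def max_def)
  also have "\<dots> = (LINT r:{0..s}|lborel. rate0 x (a + r))" by (rule set_integral_shift)
  finally show ?thesis using assms
    by (simp add: first_jump_rate_def kernel0_def rate0_def survival_def max_def)
qed

text \<open>
  The density of the first jump into \<open>A\<close> from \<open>(x, a)\<close>. The rate is taken at the age \<open>a + s\<close> and
  the kernel at the elapsed time \<open>s\<close>.
\<close>

definition arrival_density :: "'k set \<Rightarrow> 'k \<Rightarrow> real \<Rightarrow> real \<Rightarrow> real" where
  "arrival_density A x a s = kernel0 A x s * rate0 x (a + s) * survival x a s"

lemma arrival_density_measurable:
  assumes "x \<in> space (state_space M)" "A \<in> sets (state_space M)"
  shows "arrival_density A x a \<in> borel_measurable borel"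
  using rate0_measurable[OF assms(1)] kernel0_measurable[OF assms] survival_measurable[OF assms(1), of a]
  unfolding arrival_density_def[abs_def] by measurable

lemma arrival_density_bound:
  assumes "x \<in> space (state_space M)" "0 \<le> s"
  shows "\<bar>arrival_density A x a s\<bar> \<le> rate_sup"
proof -
  have "\<bar>arrival_density A x a s\<bar> \<le> 1 * rate_sup * 1"
    unfolding arrival_density_def abs_mult
    using rate0_bounds[OF assms(1), of "a + s"] kernel0_bounds[OF assms(1), of A s]
      survival_bounds[OF assms, of a] rate_sup_nonneg
    by (intro mult_mono) auto
  then show ?thesis by simp
qed

lemma arrival_density_integrable:
  assumes "x \<in> space (state_space M)" "A \<in> sets (state_space M)" "0 \<le> u"
  shows "set_integrable lborel {u..v} (arrival_density A x a)"
  by (rule set_integrable_bounded_interval[OF arrival_density_measurable[OF assms(1,2)], where B=rate_sup])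
    (use arrival_density_bound[OF assms(1)] assms(3) in auto)

lemma first_jump_prob':
  assumes S: "(x, a) \<in> space (age_state_space M)" and A: "A \<in> sets (state_space M)" and c: "0 \<le> c" "c < e"
  shows "measure (law M x a) (first_jump_event A c e) = (LINT s:{c..e}|lborel. arrival_density A x a s)"
proof -
  have x: "x \<in> space (state_space M)" "0 \<le> a" using S by (auto simp: space_age_state_space)
  have "(LINT s:{c<..<e}|lborel. first_jump_rate A x a s) = (LINT s:{c<..<e}|lborel. arrival_density A x a s)"
    unfolding set_lebesgue_integral_def arrival_density_def using c first_jump_rate_eq[OF x]
    by (intro Bochner_Integration.integral_cong refl) (auto simp: indicator_def)
  then show ?thesis using first_jump_prob[OF S A c] by (simp add: set_integral_endpoints)
qed

lemma AE_initial:
  assumes S: "(x, a) \<in> space (age_state_space M)"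
  shows "AE w in law M x a. state M 0 w = x \<and> age M 0 w = a"
proof -
  interpret prob_space "law M x a" using S by (rule law_prob)
  let ?E = "{w \<in> sample_space M. state M 0 w = x \<and> age M 0 w = a}"
  have E: "measure (law M x a) ?E = 1" using S by (rule law_initial)
  then have "?E \<in> sets (law M x a)" using measure_notin_sets[of ?E "law M x a"] by force
  with E have "AE w in law M x a. w \<in> ?E" by (simp add: prob_eq_1)
  then show ?thesis by eventually_elim simp
qed

text \<open>
  By the slope of the age, this is the event of no jump up to \<open>c\<close>.
\<close>

definition no_jump :: "real \<Rightarrow> 'w set" where
  "no_jump c = {w \<in> sample_space M. age M c w = age M 0 w + c}"

lemma no_jump_iff: "w \<in> sample_space M \<Longrightarrow> 0 \<le> c \<Longrightarrow> w \<in> no_jump c \<longleftrightarrow> jumps M w \<inter> {0<..c} = {}"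
  using no_jump_since_0_iff_age by (simp add: no_jump_def)

lemma no_jump_sets: 
  assumes "0 \<le> c" shows "no_jump c \<in> sets (nat_filtration M c)"
proof -
  have [measurable]: "age M c \<in> borel_measurable (nat_filtration M c)" "age M 0 \<in> borel_measurable (nat_filtration M c)"
    using assms by (auto intro: age_measurable)
  have "{w \<in> space (nat_filtration M c). age M c w = age M 0 w + c} \<in> sets (nat_filtration M c)" by measurable
  then show ?thesis by (simp add: no_jump_def)
qed

text \<open>
  Outside the event of two jumps in \<open>(c, e]\<close> and of a jump at \<open>e\<close>, the first jump falls into
  \<open>(c, e)\<close> and leads to \<open>A\<close> iff there is no jump up to \<open>c\<close> and one after \<open>c\<close> that leaves the
  state in \<open>A\<close> at time \<open>e\<close>. The former event has a quadratically small probability, the latter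
  the probability zero, since it is contained in that of a jump in \<open>(b, e]\<close> for every \<open>b < e\<close>.
\<close>

lemma first_jump_event_approx:
  assumes S: "(x, a) \<in> space (age_state_space M)" and A: "A \<in> sets (state_space M)" and c: "0 \<le> c" "c < e"
  shows "\<bar>measure (law M x a) (first_jump_event A c e) - measure (law M x a) (no_jump c \<inter> landing_event M A c e)\<bar>
    \<le> (rate_sup * (e - c))\<^sup>2"
proof -
  define P where "P = law M x a"
  interpret prob_space P unfolding P_def using S by (rule law_prob)
  have spP: "space P = sample_space M" unfolding P_def using S by (rule law_space)
  let ?F = "first_jump_event A c e" and ?G = "no_jump c \<inter> landing_event M A c e"
    and ?T = "{w \<in> sample_space M. 2 \<le> landing_count M UNIV c e w}"
  have [measurable]: "landing_count M UNIV c e \<in> borel_measurable P"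
    unfolding P_def by (rule measurable_law[OF S landing_count_measurable[OF target_UNIV c(1) order_refl]])
  have T [measurable]: "?T \<in> sets P" unfolding spP[symmetric] by measurable
  have F [measurable]: "?F \<in> sets P" unfolding P_def by (rule first_jump_event_sets[OF S A c(1)])
  have G [measurable]: "?G \<in> sets P"
    unfolding P_def using no_jump_sets[OF c(1)] landing_event_sets[of A c e] A c
      filtration_subset_law[OF S]
    by (intro sets.Int) (auto intro!: filtration_subset_law[OF S, of _ e] filtration_subset_law[OF S, of _ c])
  have single: "\<exists>\<tau>. jumps M w \<inter> {c<..e} = {\<tau>}" if w: "w \<in> sample_space M" and "w \<notin> ?T" "jumps M w \<inter> {c<..e} \<noteq> {}" for w
  proof -
    have "card (jumps M w \<inter> {c<..e}) < 2" using that by (simp add: landing_count_UNIV)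
    moreover have "card (jumps M w \<inter> {c<..e}) \<noteq> 0" using that(3) finite_jumps_Ioc[OF w, of c e] by simp
    ultimately have "card (jumps M w \<inter> {c<..e}) = 1" by linarith
    then show ?thesis by (simp add: card_1_singleton_iff)
  qed
  have end_state: "state M e w = state M \<tau> w \<and> c < \<tau> \<and> \<tau> \<le> e \<and> \<tau> \<in> jumps M w"
    if w: "w \<in> sample_space M" and \<tau>: "jumps M w \<inter> {c<..e} = {\<tau>}" for w \<tau>
  proof -
    have t: "\<tau> \<in> jumps M w" "c < \<tau>" "\<tau> \<le> e" using \<tau> by (auto simp only: set_eq_iff Int_iff greaterThanAtMost_iff singleton_iff)
    have "jumps M w \<inter> {\<tau><..e} \<subseteq> jumps M w \<inter> {c<..e} - {\<tau>}" using t by auto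
    then have "jumps M w \<inter> {\<tau><..e} = {}" unfolding \<tau> by blast
    then have "state M e w = state M \<tau> w" by (intro state_piecewise_constant[OF w]) (use t c in auto)
    then show ?thesis using t by blast
  qed
  have FG: "?F \<subseteq> ?G \<union> ?T"
  proof
    fix w assume f: "w \<in> ?F"
    then have w: "w \<in> sample_space M" by (simp add: first_jump_event_def)
    from f obtain \<tau> where \<tau>: "\<tau> \<in> jumps M w" "c < \<tau>" "\<tau> < e" "jumps M w \<inter> {0<..<\<tau>} = {}" "state M \<tau> w \<in> A"
      unfolding first_jump_event_iff[OF w] by blast
    show "w \<in> ?G \<union> ?T"
    proof (cases "w \<in> ?T")
      case False
      have ne: "jumps M w \<inter> {c<..e} \<noteq> {}" using \<tau> by auto
      then obtain \<sigma> where \<sigma>: "jumps M w \<inter> {c<..e} = {\<sigma>}" using single[OF w False] by blast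
      moreover have "\<tau> \<in> jumps M w \<inter> {c<..e}" using \<tau> by simp
      ultimately have "\<tau> \<in> {\<sigma>}" by (simp only:)
      then have "\<sigma> = \<tau>" by simp
      with end_state[OF w \<sigma>] \<tau>(5) have "state M e w \<in> A" by simp
      then have "w \<in> landing_event M A c e"
        using ne c by (subst landing_event_iff[OF w c(1)]) auto
      moreover have "jumps M w \<inter> {0<..c} \<subseteq> jumps M w \<inter> {0<..<\<tau>}" using \<tau>(2) by auto
      then have "w \<in> no_jump c" using \<tau>(4) no_jump_iff[OF w c(1)] by blast
      ultimately show ?thesis by blast
    qed blast
  qed
  have GF: "?G \<subseteq> ?F \<union> ?T \<union> landing_event M UNIV b e" if b: "c \<le> b" "b < e" for b
  proof
    fix w assume g: "w \<in> ?G"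
    then have w: "w \<in> sample_space M" by (simp add: no_jump_def)
    have l: "state M e w \<in> A" "jumps M w \<inter> {c<..e} \<noteq> {}"
      using g landing_event_iff[OF w c(1), of e A] c by auto
    have n: "jumps M w \<inter> {0<..c} = {}" using g no_jump_iff[OF w c(1)] by blast
    show "w \<in> ?F \<union> ?T \<union> landing_event M UNIV b e"
    proof (cases "w \<in> ?T")
      case False
      then obtain \<tau> where \<tau>: "jumps M w \<inter> {c<..e} = {\<tau>}" using single[OF w _ l(2)] by blast
      note t = end_state[OF w \<tau>]
      show ?thesis
      proof (cases "\<tau> = e")
        case True
        then have "jumps M w \<inter> {b<..e} \<noteq> {}" using t b by auto
        then have "w \<in> landing_event M UNIV b e"
          using c b by (subst landing_event_iff[OF w]) auto
        then show ?thesis by blast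
      next
        case False
        have "jumps M w \<inter> {0<..<\<tau>} \<subseteq> jumps M w \<inter> {0<..c} \<union> (jumps M w \<inter> {c<..e} - {\<tau>})" using t by auto
        then have "jumps M w \<inter> {0<..<\<tau>} = {}" unfolding n \<tau> by blast
        then have "w \<in> ?F" unfolding first_jump_event_iff[OF w] using t l(1) False
          by (intro bexI[of _ \<tau>]) auto
        then show ?thesis by blast
      qed
    qed blast
  qed
  have PT: "measure P ?T \<le> (rate_sup * (e - c))\<^sup>2" unfolding P_def by (rule two_jumps_prob_le[OF S c])
  have up: "measure P ?F \<le> measure P ?G + (rate_sup * (e - c))\<^sup>2"
  proof -
    have "measure P ?F \<le> measure P (?G \<union> ?T)" by (intro finite_measure_mono FG) measurable
    also have "\<dots> \<le> measure P ?G + measure P ?T" by (intro measure_Un_le) measurable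
    finally show ?thesis using PT by simp
  qed
  have down: "measure P ?G \<le> measure P ?F + (rate_sup * (e - c))\<^sup>2"
  proof (rule field_le_epsilon)
    fix \<epsilon> :: real assume \<epsilon>: "0 < \<epsilon>"
    \<comment> \<open>close enough to \<open>e\<close> that a jump in \<open>(b, e]\<close> has probability at most \<open>\<epsilon>\<close>\<close>
    define b where "b = max c (e - \<epsilon> / (rate_sup + 1))"
    have b: "c \<le> b" "b < e" "e - b \<le> \<epsilon> / (rate_sup + 1)"
      using \<epsilon> rate_sup_nonneg c by (auto simp: b_def max_def)
    have L [measurable]: "landing_event M UNIV b e \<in> sets P"
      unfolding P_def using b c by (intro filtration_subset_law[OF S, of _ e] landing_event_sets target_UNIV) auto
    have "measure P ?G \<le> measure P (?F \<union> ?T \<union> landing_event M UNIV b e)"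
      by (intro finite_measure_mono GF b) measurable
    also have "\<dots> \<le> measure P (?F \<union> ?T) + measure P (landing_event M UNIV b e)" by (intro measure_Un_le) measurable
    also have "measure P (?F \<union> ?T) \<le> measure P ?F + measure P ?T" by (intro measure_Un_le) measurable
    also have "measure P (landing_event M UNIV b e) \<le> \<epsilon>"
    proof -
      have "measure P (landing_event M UNIV b e) \<le> rate_sup * (e - b)"
        unfolding P_def using b c by (intro jump_prob_le S) auto
      also have "\<dots> \<le> rate_sup * (\<epsilon> / (rate_sup + 1))" using b rate_sup_nonneg by (intro mult_left_mono) auto
      also have "\<dots> \<le> \<epsilon>" using \<epsilon> rate_sup_nonneg by (simp add: field_simps)
      finally show ?thesis .
    qed
    finally show "measure P ?G \<le> measure P ?F + (rate_sup * (e - c))\<^sup>2 + \<epsilon>" using PT by simp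
  qed
  show ?thesis using up down unfolding P_def by linarith
qed

text \<open>
  Without a jump up to \<open>c\<close> the process is in \<open>(x, a + c)\<close> at time \<open>c\<close>, from where it starts
  afresh.
\<close>

lemma no_jump_landing_prob:
  assumes S: "(x, a) \<in> space (age_state_space M)" and A: "A \<in> sets (state_space M)" and c: "0 \<le> c" "0 < d"
  shows "measure (law M x a) (no_jump c \<inter> landing_event M A c (c + d))
    = measure (law M x a) (no_jump c) * landing_prob M d A x (a + c)"
proof -
  define P where "P = law M x a"
  interpret prob_space P unfolding P_def using S by (rule law_prob)
  have spP: "space P = sample_space M" unfolding P_def using S by (rule law_space)
  have nP: "no_jump c \<in> sets P" unfolding P_def by (rule filtration_subset_law[OF S no_jump_sets[OF c(1)]])
  have sub: "no_jump c \<inter> landing_event M A c (c + d) \<inter> space P = no_jump c \<inter> landing_event M A c (c + d)"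
    "no_jump c \<inter> space P = no_jump c" by (auto simp: spP no_jump_def)
  have "measure P (no_jump c \<inter> landing_event M A c (c + d))
      = (LINT w|P. indicator (no_jump c) w * indicator (landing_event M A c (c + d)) w)"
    using sub by (simp add: indicator_inter_arith[symmetric])
  also have "\<dots> = (LINT w|P. indicator (no_jump c) w * landing_prob M d A (state M c w) (age M c w))"
    unfolding P_def
    by (rule markov_landing[OF S c A borel_measurable_indicator[OF no_jump_sets[OF c(1)]], where c=1])
      (simp add: indicator_def)
  also have "\<dots> = (LINT w|P. indicator (no_jump c) w * landing_prob M d A x (a + c))"
  proof (rule integral_cong_AE)
    have "(\<lambda>w. (state M c w, age M c w)) \<in> P \<rightarrow>\<^sub>M age_state_space M"
      unfolding P_def by (rule measurable_law[OF S state_age_measurable[OF c(1) order_refl]])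
    from measurable_compose[OF this landing_prob_measurable[OF c(2) A]]
    show "(\<lambda>w. indicator (no_jump c) w * landing_prob M d A (state M c w) (age M c w)) \<in> borel_measurable P"
      using nP by (intro borel_measurable_times borel_measurable_indicator) simp_all
    show "(\<lambda>w. indicator (no_jump c) w * landing_prob M d A x (a + c)) \<in> borel_measurable P"
      using nP by (intro borel_measurable_times borel_measurable_indicator) simp_all
    have "AE w in P. state M 0 w = x \<and> age M 0 w = a" unfolding P_def by (rule AE_initial[OF S])
    then show "AE w in P. indicator (no_jump c) w * landing_prob M d A (state M c w) (age M c w)
        = indicator (no_jump c) w * landing_prob M d A x (a + c)"
    proof eventually_elim
      case (elim w)
      show ?case
      proof (cases "w \<in> no_jump c")
        case True
        then have w: "w \<in> sample_space M" by (simp add: no_jump_def)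
        then have "jumps M w \<inter> {0<..c} = {}" using True no_jump_iff[OF w c(1)] by blast
        then have "state M c w = x" "age M c w = a + c"
          using state_piecewise_constant[OF w order_refl c(1)] age_slope_one[OF w order_refl c(1)] elim
          by (simp_all only:)
        then show ?thesis by simp
      qed simp
    qed
  qed
  also have "\<dots> = measure P (no_jump c) * landing_prob M d A x (a + c)" using sub by simp
  finally show ?thesis unfolding P_def .
qed

lemma no_jump_prob:
  assumes S: "(x, a) \<in> space (age_state_space M)" and c: "0 \<le> c"
  shows "measure (law M x a) (no_jump c) = survival x a c"
proof -
  have x: "x \<in> space (state_space M)" "0 \<le> a" using S by (auto simp: space_age_state_space)
  define P where "P = law M x a"
  interpret prob_space P unfolding P_def using S by (rule law_prob)
  have spP: "space P = sample_space M" unfolding P_def using S by (rule law_space)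
  let ?K = "space (state_space M)"
  have nP: "no_jump c \<in> sets P" unfolding P_def by (rule filtration_subset_law[OF S no_jump_sets[OF c(1)]])
  have J: "(LINT s:{0..e}|lborel. arrival_density ?K x a s) = 1 - survival x a e" if "0 \<le> e" for e
  proof -
    have "kernel0 ?K x s = 1" for s
    proof -
      have xs: "(x, max 0 s) \<in> space (age_state_space M)" using x by (auto simp: space_age_state_space)
      show ?thesis unfolding kernel0_def
        using prob_space.prob_space[OF jump_kernel_props(1)[OF xs]] sets_eq_imp_space_eq[OF jump_kernel_props(2)[OF xs]] by simp
    qed
    then show ?thesis using survival_integral[OF x(1) that, of a] by (simp add: arrival_density_def)
  qed
  \<comment> \<open>\<open>{T1 < c}\<close>, \<open>{T1 \<le> c}\<close> and \<open>{T1 < c + 1/n}\<close> squeeze the probability of a jump up to \<open>c\<close>\<close>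
  have first: "first_jump_event ?K 0 e = {w \<in> sample_space M. jumps M w \<inter> {0<..<e} \<noteq> {}}" for e
  proof (intro equalityI subsetI)
    fix w assume f: "w \<in> first_jump_event ?K 0 e"
    then have w: "w \<in> sample_space M" by (simp add: first_jump_event_def)
    then show "w \<in> {w \<in> sample_space M. jumps M w \<inter> {0<..<e} \<noteq> {}}"
      using f unfolding first_jump_event_iff[OF w] by auto
  next
    fix w assume "w \<in> {w \<in> sample_space M. jumps M w \<inter> {0<..<e} \<noteq> {}}"
    then obtain \<sigma> where w: "w \<in> sample_space M" and \<sigma>: "\<sigma> \<in> jumps M w" "0 < \<sigma>" "\<sigma> < e" by auto
    then have "jumps M w \<inter> {0<..} \<noteq> {}" by auto
    then obtain \<tau> where \<tau>: "\<tau> \<in> jumps M w" "0 < \<tau>" "jumps M w \<inter> {0<..<\<tau>} = {}" by (rule next_jump[OF w])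
    have "\<tau> \<le> \<sigma>" using \<tau>(3) \<sigma> by (metis disjoint_iff greaterThanLessThan_iff not_le)
    then show "w \<in> first_jump_event ?K 0 e"
      unfolding first_jump_event_iff[OF w] using \<tau> \<sigma> state_in_space[OF w, of \<tau>] by (intro bexI[of _ \<tau>]) auto
  qed
  have lower: "1 - survival x a c \<le> 1 - measure P (no_jump c)"
  proof (cases "c = 0")
    case True
    have "survival x a 0 = 1" unfolding survival_def set_integral_singleton by simp
    then show ?thesis using True by simp
  next
    case False
    with c have c0: "0 < c" by simp
    have "first_jump_event ?K 0 c \<subseteq> space P - no_jump c"
    proof
      fix w assume "w \<in> first_jump_event ?K 0 c"
      then have w: "w \<in> sample_space M" and "jumps M w \<inter> {0<..<c} \<noteq> {}" unfolding first by auto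
      then have "jumps M w \<inter> {0<..c} \<noteq> {}" by auto
      then show "w \<in> space P - no_jump c" using no_jump_iff[OF w c] w spP by blast
    qed
    then have "measure P (first_jump_event ?K 0 c) \<le> measure P (space P - no_jump c)"
      using nP by (intro finite_measure_mono) auto
    then show ?thesis using first_jump_prob'[OF S sets.top order_refl c0] J[OF c] prob_compl[OF nP]
      by (simp add: P_def)
  qed
  have upper: "1 - measure P (no_jump c) \<le> 1 - survival x a c + rate_sup * d" if d: "0 < d" for d
  proof -
    have "space P - no_jump c \<subseteq> first_jump_event ?K 0 (c + d)"
    proof
      fix w assume "w \<in> space P - no_jump c"
      then have w: "w \<in> sample_space M" and "jumps M w \<inter> {0<..c} \<noteq> {}" using no_jump_iff[OF _ c] spP by auto
      then have "jumps M w \<inter> {0<..<c + d} \<noteq> {}" using d by fastforce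
      then show "w \<in> first_jump_event ?K 0 (c + d)" unfolding first using w by blast
    qed
    then have "measure P (space P - no_jump c) \<le> measure P (first_jump_event ?K 0 (c + d))"
      using first_jump_event_sets[OF S sets.top order_refl] unfolding P_def[symmetric]
      by (intro finite_measure_mono) auto
    also have "\<dots> = 1 - survival x a (c + d)"
      unfolding P_def using first_jump_prob'[OF S sets.top order_refl, of "c + d"] J[of "c + d"] c d by simp
    also have "\<dots> = (LINT s:{0..c + d}|lborel. arrival_density ?K x a s)" using J[of "c + d"] c d by simp
    also have "\<dots> = (LINT s:{0..c}|lborel. arrival_density ?K x a s) + (LINT s:{c<..c + d}|lborel. arrival_density ?K x a s)"
      using c d by (intro set_integral_Icc_split arrival_density_integrable x) auto
    also have "(LINT s:{c<..c + d}|lborel. arrival_density ?K x a s) \<le> rate_sup * (c + d - c)"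
      by (rule order_trans[OF abs_ge_self abs_set_integral_le])
        (use arrival_density_bound[OF x(1)] c d rate_sup_nonneg in auto)
    finally show ?thesis using J[OF c] prob_compl[OF nP] by simp
  qed
  have "1 - measure P (no_jump c) \<le> 1 - survival x a c"
  proof (rule field_le_epsilon)
    fix \<epsilon> :: real assume \<epsilon>: "0 < \<epsilon>"
    have "rate_sup * (\<epsilon> / (rate_sup + 1)) \<le> \<epsilon>" using \<epsilon> rate_sup_nonneg by (simp add: field_simps)
    then show "1 - measure P (no_jump c) \<le> 1 - survival x a c + \<epsilon>"
      using upper[of "\<epsilon> / (rate_sup + 1)"] \<epsilon> rate_sup_nonneg by simp
  qed
  with lower show ?thesis unfolding P_def by linarith
qed

lemma arrival_density_approx:
  assumes S: "(x, a) \<in> space (age_state_space M)" and A: "A \<in> sets (state_space M)" and c: "0 \<le> c" "0 < d"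
  shows "\<bar>(LINT s:{c<..c + d}|lborel. arrival_density A x a s) - survival x a c * landing_prob M d A x (a + c)\<bar>
    \<le> (rate_sup * d)\<^sup>2"
  using first_jump_event_approx[OF S A c(1), of "c + d"] no_jump_landing_prob[OF S A c] no_jump_prob[OF S c(1)]
    first_jump_prob'[OF S A c(1), of "c + d"] c by (simp add: set_integral_endpoints(1))

text \<open>
  Started from age \<open>0\<close> and conditioned on no jump up to \<open>a\<close>, the process must behave as if
  started from age \<open>a\<close>. Both laws of the first jump have the same infinitesimal description
  through \<open>landing_prob\<close>, up to quadratic errors; so their integrals coincide. This shows
  that the kernel may be evaluated at the age \<open>a + s\<close> instead of the elapsed time \<open>s\<close>.
\<close>

lemma arrival_density_age:
  assumes S: "(x, a) \<in> space (age_state_space M)" and A: "A \<in> sets (state_space M)" and d: "0 \<le> d"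
  shows "(LINT s:{0..d}|lborel. arrival_density A x a s)
    = (LINT s:{0..d}|lborel. kernel0 A x (a + s) * rate0 x (a + s) * survival x a s)"
proof -
  have x: "x \<in> space (state_space M)" "0 \<le> a" using S by (auto simp: space_age_state_space)
  have S0: "(x, 0) \<in> space (age_state_space M)" using x by (auto simp: space_age_state_space)
  \<comment> \<open>up to the constant \<open>D 0\<close>, the probability of a first jump into \<open>A\<close> during \<open>(a, a + c]\<close> from age \<open>0\<close>, minus its value for a restart at age \<open>a\<close>\<close>
  define D where "D c = (LINT s:{0..a + c}|lborel. arrival_density A x 0 s)
      - survival x 0 a * (LINT s:{0..c}|lborel. arrival_density A x a s)" for c
  have "D d = D 0"
  proof (rule quadratic_increments_const[OF d, where C="2 * rate_sup\<^sup>2"])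
    fix c c' assume c: "0 \<le> c" "c < c'" "c' \<le> d"
    define h where "h = c' - c"
    have h: "0 < h" "c' = c + h" using c by (auto simp: h_def)
    let ?l = "landing_prob M h A x (a + c)"
    have 1: "\<bar>(LINT s:{a + c<..a + c + h}|lborel. arrival_density A x 0 s) - survival x 0 (a + c) * ?l\<bar> \<le> (rate_sup * h)\<^sup>2"
      using arrival_density_approx[OF S0 A, of "a + c" h] x c h by simp
    have 2: "\<bar>(LINT s:{c<..c + h}|lborel. arrival_density A x a s) - survival x a c * ?l\<bar> \<le> (rate_sup * h)\<^sup>2"
      by (rule arrival_density_approx[OF S A c(1) h(1)])
    have "D c' - D c = (LINT s:{a + c<..a + c + h}|lborel. arrival_density A x 0 s)
        - survival x 0 a * (LINT s:{c<..c + h}|lborel. arrival_density A x a s)"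
    proof -
      have i1: "(LINT s:{0..a + c + h}|lborel. arrival_density A x 0 s)
          = (LINT s:{0..a + c}|lborel. arrival_density A x 0 s) + (LINT s:{a + c<..a + c + h}|lborel. arrival_density A x 0 s)"
        using x c h by (intro set_integral_Icc_split arrival_density_integrable A) auto
      have i2: "(LINT s:{0..c + h}|lborel. arrival_density A x a s)
          = (LINT s:{0..c}|lborel. arrival_density A x a s) + (LINT s:{c<..c + h}|lborel. arrival_density A x a s)"
        using x c h by (intro set_integral_Icc_split arrival_density_integrable A) auto
      have "D c' = (LINT s:{0..a + c + h}|lborel. arrival_density A x 0 s)
          - survival x 0 a * (LINT s:{0..c + h}|lborel. arrival_density A x a s)"
        by (simp add: D_def h(2) add.assoc)
      then show ?thesis unfolding i1 i2 by (simp add: D_def algebra_simps)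
    qed
    also have "\<dots> = ((LINT s:{a + c<..a + c + h}|lborel. arrival_density A x 0 s) - survival x 0 (a + c) * ?l)
        - survival x 0 a * ((LINT s:{c<..c + h}|lborel. arrival_density A x a s) - survival x a c * ?l)"
      unfolding survival_add[OF x c(1)] by (simp add: algebra_simps)
    finally have eq: "D c' - D c = ((LINT s:{a + c<..a + c + h}|lborel. arrival_density A x 0 s) - survival x 0 (a + c) * ?l)
        - survival x 0 a * ((LINT s:{c<..c + h}|lborel. arrival_density A x a s) - survival x a c * ?l)" .
    have "\<bar>survival x 0 a * ((LINT s:{c<..c + h}|lborel. arrival_density A x a s) - survival x a c * ?l)\<bar> \<le> 1 * (rate_sup * h)\<^sup>2"
      unfolding abs_mult using survival_bounds[OF x, of 0] 2 by (intro mult_mono) auto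
    then have "\<bar>D c' - D c\<bar> \<le> (rate_sup * h)\<^sup>2 + 1 * (rate_sup * h)\<^sup>2"
      unfolding eq by (rule order_trans[OF abs_triangle_ineq4 add_mono[OF 1]])
    then show "\<bar>D c' - D c\<bar> \<le> 2 * rate_sup\<^sup>2 * (c' - c)\<^sup>2"
      by (simp add: h_def power_mult_distrib)
  qed
  then have "survival x 0 a * (LINT s:{0..d}|lborel. arrival_density A x a s)
      = (LINT s:{0..a + d}|lborel. arrival_density A x 0 s) - (LINT s:{0..a}|lborel. arrival_density A x 0 s)"
    using set_integral_singleton[of 0 "arrival_density A x a", unfolded atLeastAtMost_singleton]
    by (simp add: D_def)
  also have "\<dots> = (LINT s:{a<..a + d}|lborel. arrival_density A x 0 s)"
    using set_integral_Icc_split[OF arrival_density_integrable[OF x(1) A order_refl], of a "a + d" 0] x d by simp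
  also have "\<dots> = (LINT s:{0..d}|lborel. arrival_density A x 0 (a + s))"
    unfolding set_integral_endpoints(1) using set_integral_shift[of a 0 d "arrival_density A x 0"] by simp
  also have "\<dots> = (LINT s:{0..d}|lborel. survival x 0 a * (kernel0 A x (a + s) * rate0 x (a + s) * survival x a s))"
    unfolding set_lebesgue_integral_def
    by (intro Bochner_Integration.integral_cong refl)
      (auto simp: indicator_def arrival_density_def survival_add[OF x])
  also have "\<dots> = survival x 0 a * (LINT s:{0..d}|lborel. kernel0 A x (a + s) * rate0 x (a + s) * survival x a s)"
    by simp
  finally show ?thesis using survival_bounds(1)[OF x, of 0] by simp
qed

text \<open>
  Up to \<open>O(d\<^sup>2)\<close> the landing is the first jump, and the survival factor in its density differs from
  \<open>1\<close> by \<open>O(d)\<close>.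
\<close>

lemma landing_prob_approx:
  assumes S: "(x, a) \<in> space (age_state_space M)" and A: "A \<in> sets (state_space M)" and d: "0 < d"
  shows "\<bar>landing_prob M d A x a - (LINT s:{0..d}|lborel. kernel0 A x (a + s) * rate0 x (a + s))\<bar> \<le> 2 * (rate_sup * d)\<^sup>2"
proof -
  have x: "x \<in> space (state_space M)" "0 \<le> a" using S by (auto simp: space_age_state_space)
  have [measurable]: "kernel0 A x \<in> borel_measurable borel" "rate0 x \<in> borel_measurable borel" "survival x a \<in> borel_measurable borel"
    using x A by (auto intro: kernel0_measurable rate0_measurable survival_measurable)
  define p where "p s = kernel0 A x (a + s) * rate0 x (a + s)" for s
  have p: "0 \<le> p s" "p s \<le> rate_sup" for s
  proof -
    have "p s \<le> 1 * rate_sup" unfolding p_def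
      using rate0_bounds[OF x(1), of "a + s"] kernel0_bounds[OF x(1), of A "a + s"] by (intro mult_mono) auto
    then show "p s \<le> rate_sup" by simp
    show "0 \<le> p s" unfolding p_def using rate0_bounds[OF x(1), of "a + s"] kernel0_bounds[OF x(1), of A "a + s"] by simp
  qed
  have pm [measurable]: "p \<in> borel_measurable borel" unfolding p_def[abs_def] by measurable
  have s0: "survival x a 0 = 1" unfolding survival_def set_integral_singleton by simp
  have i1: "set_integrable lborel {0<..d} p"
    by (rule set_integrable_bounded_interval[OF pm, of 0 d rate_sup]) (use p in auto)
  have i2: "set_integrable lborel {0<..d} (\<lambda>s. p s * survival x a s)"
  proof (rule set_integrable_bounded_interval[of _ 0 d rate_sup])
    fix r :: real assume "0 \<le> r"
    then have "\<bar>p r\<bar> * \<bar>survival x a r\<bar> \<le> rate_sup * 1"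
      using p[of r] survival_bounds[OF x(1), of r a] rate_sup_nonneg by (intro mult_mono) auto
    then show "\<bar>p r * survival x a r\<bar> \<le> rate_sup" by (simp add: abs_mult)
  qed (auto, measurable)
  have "\<bar>(LINT s:{0<..d}|lborel. p s - p s * survival x a s)\<bar> \<le> rate_sup * (rate_sup * d) * (d - 0)"
  proof (rule abs_set_integral_le)
    fix r assume r: "0 < r" "r \<le> d"
    have "p r - p r * survival x a r = p r * (1 - survival x a r)" by (simp add: algebra_simps)
    moreover have "\<bar>p r * (1 - survival x a r)\<bar> \<le> rate_sup * (rate_sup * d)"
      unfolding abs_mult
    proof (rule mult_mono)
      have "1 - survival x a r \<le> rate_sup * r" using survival_bounds(3)[OF x(1), of r a] r by simp
      also have "\<dots> \<le> rate_sup * d" using r rate_sup_nonneg by (intro mult_left_mono) auto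
      finally show "\<bar>1 - survival x a r\<bar> \<le> rate_sup * d" using survival_bounds(2)[OF x(1), of r a] r by simp
    qed (use p[of r] rate_sup_nonneg in auto)
    ultimately show "\<bar>p r - p r * survival x a r\<bar> \<le> rate_sup * (rate_sup * d)" by simp
  qed (use d rate_sup_nonneg in auto)
  then have 1: "\<bar>(LINT s:{0..d}|lborel. p s) - (LINT s:{0..d}|lborel. p s * survival x a s)\<bar> \<le> (rate_sup * d)\<^sup>2"
    unfolding set_integral_diff(2)[OF i1 i2] unfolding set_integral_endpoints(1)
    by (simp add: power2_eq_square mult_ac)
  have 2: "\<bar>(LINT s:{0..d}|lborel. p s * survival x a s) - landing_prob M d A x a\<bar> \<le> (rate_sup * d)\<^sup>2"
    using arrival_density_approx[OF S A order_refl d] arrival_density_age[OF S A less_imp_le[OF d]]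
    by (simp add: set_integral_endpoints(1) s0 p_def)
  show ?thesis using 1 2 unfolding p_def[symmetric] by linarith
qed

end

section \<open>The compensator of the jump measure\<close>

definition compensator ::
  "('w, 'k) semi_markov_data \<Rightarrow> real \<Rightarrow> (('w \<times> real) \<times> 'k \<Rightarrow> ennreal) \<Rightarrow> 'w \<Rightarrow> ennreal" where
  "compensator M R H w = (\<integral>\<^sup>+ r\<in>{0<..R}. (\<integral>\<^sup>+ y. H ((w, r), y) \<partial>left_intensity M (w, r)) \<partial>lborel)"

context semi_markov
begin

lemma measurable_pair_time: "0 \<le> s \<Longrightarrow> (\<lambda>w. (w, s)) \<in> generated_by_times M {0..} \<rightarrow>\<^sub>M predictable M"
proof -
  assume s: "0 \<le> s"
  have "(\<lambda>w. (w, s)) \<in> generated_by_times M {0..} \<rightarrow>\<^sub>M generated_by_times M {0..} \<Otimes>\<^sub>M borel" by measurable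
  from measurable_compose[OF this clamp_predictable] show ?thesis using s by (simp add: max_def)
qed

lemma clamp_predictable_lborel:
  "(\<lambda>z. (fst z, max 0 (snd z))) \<in> generated_by_times M {0..} \<Otimes>\<^sub>M lborel \<rightarrow>\<^sub>M predictable M"
proof -
  have "sets (generated_by_times M {0..} \<Otimes>\<^sub>M lborel) = sets (generated_by_times M {0..} \<Otimes>\<^sub>M borel)"
    by (rule sets_pair_measure_cong) simp_all
  from measurable_cong_sets[OF this refl] show ?thesis using clamp_predictable by (simp add: split_beta')
qed

lemma path_integral_measurable:
  fixes b :: "'w \<times> real \<Rightarrow> real"
  assumes b: "b \<in> borel_measurable (predictable M)" and I [measurable]: "I \<in> sets borel" "I \<subseteq> {0..}"
  shows "(\<lambda>w. LINT r:I|lborel. b (w, r)) \<in> borel_measurable (generated_by_times M {0..})"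
proof -
  have [measurable]: "(\<lambda>z. b (fst z, max 0 (snd z))) \<in> borel_measurable (generated_by_times M {0..} \<Otimes>\<^sub>M lborel)"
    by (rule measurable_compose[OF clamp_predictable_lborel b])
  have "(\<lambda>w. LINT r|lborel. indicator I r *\<^sub>R b (w, max 0 r)) \<in> borel_measurable (generated_by_times M {0..})"
    by (rule lborel.borel_measurable_lebesgue_integral) (simp add: split_beta', measurable)
  also have "(\<lambda>w. LINT r|lborel. indicator I r *\<^sub>R b (w, max 0 r)) = (\<lambda>w. LINT r:I|lborel. b (w, r))"
    unfolding set_lebesgue_integral_def using I(2)
    by (intro ext Bochner_Integration.integral_cong refl) (auto simp: indicator_def max_def)
  finally show ?thesis .
qed

lemma path_nn_integral_measurable:
  fixes b :: "'w \<times> real \<Rightarrow> ennreal"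
  assumes b: "b \<in> borel_measurable (predictable M)" and I [measurable]: "I \<in> sets borel" "I \<subseteq> {0..}"
  shows "(\<lambda>w. \<integral>\<^sup>+ r\<in>I. b (w, r) \<partial>lborel) \<in> borel_measurable (generated_by_times M {0..})"
proof -
  have [measurable]: "(\<lambda>z. b (fst z, max 0 (snd z))) \<in> borel_measurable (generated_by_times M {0..} \<Otimes>\<^sub>M lborel)"
    by (rule measurable_compose[OF clamp_predictable_lborel b])
  have "(\<lambda>w. \<integral>\<^sup>+ r. b (w, max 0 r) * indicator I r \<partial>lborel) \<in> borel_measurable (generated_by_times M {0..})"
    by (rule lborel.borel_measurable_nn_integral) (simp add: split_beta', measurable)
  also have "(\<lambda>w. \<integral>\<^sup>+ r. b (w, max 0 r) * indicator I r \<partial>lborel) = (\<lambda>w. \<integral>\<^sup>+ r\<in>I. b (w, r) \<partial>lborel)"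
    using I(2) by (intro ext nn_integral_cong) (auto simp: indicator_def max_def)
  finally show ?thesis .
qed

lemma path_section_measurable:
  assumes b: "b \<in> borel_measurable (predictable M)" and w: "w \<in> sample_space M"
  shows "(\<lambda>r. b (w, max 0 r)) \<in> borel_measurable borel"
proof -
  have "w \<in> space (generated_by_times M {0..})" using w by simp
  from measurable_compose[OF measurable_compose[OF measurable_Pair1'[OF this] clamp_predictable] b]
  show ?thesis by simp
qed

lemma intensity_measure:
  assumes "(x, a) \<in> space (age_state_space M)"
  shows "measure (intensity M x a) A = rate M x a * measure (jump_kernel M x a) A"
  using rate_nonneg[OF assms] by (simp add: intensity_def)

lemma left_intensity_emeasure_measurable:
  assumes "A \<in> sets (state_space M)"
  shows "(\<lambda>z. emeasure (left_intensity M z) A) \<in> borel_measurable (predictable M)"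
proof -
  have "(\<lambda>z. \<integral>\<^sup>+ y. indicator A (snd (z, y)) \<partial>left_intensity M z) \<in> borel_measurable (predictable M)"
    by (rule nn_integral_left_intensity_predictable) (use assms in measurable)
  then show ?thesis
    by (rule measurable_cong[THEN iffD1, rotated])
      (use assms sets_intensity[OF left_state_space] in \<open>simp add: left_intensity_def\<close>)
qed

lemma left_intensity_measure_measurable:
  assumes "A \<in> sets (state_space M)"
  shows "(\<lambda>z. measure (left_intensity M z) A) \<in> borel_measurable (predictable M)"
  unfolding measure_def using left_intensity_emeasure_measurable[OF assms] by measurable

lemma left_intensity_emeasure_le:
  assumes "z \<in> space (predictable M)"
  shows "emeasure (left_intensity M z) A \<le> ennreal rate_sup"
proof -
  note S = left_state_space[OF assms]
  have "emeasure (left_intensity M z) A \<le> emeasure (left_intensity M z) (space (left_intensity M z))"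
    by (rule emeasure_space)
  also have "\<dots> = ennreal (rate M (state_left M (snd z) (fst z)) (age_left M (snd z) (fst z)))"
    unfolding left_intensity_def space_intensity[OF S] by (rule emeasure_intensity_space[OF S])
  also have "\<dots> \<le> ennreal rate_sup" by (rule ennreal_leI[OF rate_le[OF S]])
  finally show ?thesis .
qed

lemma left_intensity_finite: "z \<in> space (predictable M) \<Longrightarrow> finite_measure (left_intensity M z)"
  unfolding left_intensity_def by (rule finite_measure_intensity[OF left_state_space])

lemma left_intensity_measure_bounds:
  assumes "z \<in> space (predictable M)"
  shows "0 \<le> measure (left_intensity M z) A" "measure (left_intensity M z) A \<le> rate_sup"
  using left_intensity_emeasure_le[OF assms, of A] rate_sup_nonneg
  by (auto simp: measure_def intro: enn2real_leI)

lemma left_intensity_emeasure_eq: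
  assumes "z \<in> space (predictable M)"
  shows "emeasure (left_intensity M z) A = ennreal (measure (left_intensity M z) A)"
  using finite_measure.emeasure_eq_measure[OF left_intensity_finite[OF assms]] by simp

text \<open>
  Without a jump in \<open>(t, t + d]\<close> the intensity along the path is a deterministic function of the
  process at \<open>t\<close>, whose integral is close to the landing probability. With a jump, both are at most
  \<open>rate_sup * d\<close>.
\<close>

lemma landing_prob_path_approx:
  assumes w: "w \<in> sample_space M" and A: "A \<in> sets (state_space M)" and t: "0 \<le> t" and d: "0 < d"
  shows "\<bar>landing_prob M d A (state M t w) (age M t w) - (LINT r:{t<..t + d}|lborel. measure (left_intensity M (w, r)) A)\<bar>
    \<le> 2 * (rate_sup * d)\<^sup>2 + rate_sup * d * indicator (landing_event M UNIV t (t + d)) w"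
proof -
  let ?x = "state M t w" and ?a = "age M t w"
  have S: "(?x, ?a) \<in> space (age_state_space M)" by (rule process_space[OF t w])
  have ltd: "t \<le> t + d" using d by simp
  show ?thesis
  proof (cases "jumps M w \<inter> {t<..t + d} = {}")
    case True
    have "measure (left_intensity M (w, r)) A = kernel0 A ?x (?a + (r - t)) * rate0 ?x (?a + (r - t))"
      if r: "t < r" "r \<le> t + d" for r
    proof -
      have no: "jumps M w \<inter> {t<..r} = {}" using True r by fastforce
      have rJ: "r \<notin> jumps M w" using True r by auto
      have "state M r w = ?x" "age M r w = ?a + (r - t)"
        using state_piecewise_constant[OF w t _ no] age_slope_one[OF w t _ no] r by simp_all
      then have "state_left M r w = ?x" "age_left M r w = ?a + (r - t)"
        using left_eq_off_jumps[OF w _ rJ] t r by simp_all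
      moreover have "(?x, ?a + (r - t)) \<in> space (age_state_space M)"
        using S r by (auto simp: space_age_state_space)
      ultimately show ?thesis
        using age_nonneg[OF w t] r by (simp add: left_intensity_def intensity_measure kernel0_def rate0_def max_def)
    qed
    then have "(LINT r:{t<..t + d}|lborel. measure (left_intensity M (w, r)) A)
        = (LINT r:{t<..t + d}|lborel. kernel0 A ?x (?a + (r - t)) * rate0 ?x (?a + (r - t)))"
      unfolding set_lebesgue_integral_def
      by (intro Bochner_Integration.integral_cong refl) (simp add: indicator_def)
    also have "\<dots> = (LINT s:{0..d}|lborel. kernel0 A ?x (?a + s) * rate0 ?x (?a + s))"
      unfolding set_integral_endpoints(1)
      using set_integral_shift[of t 0 d "\<lambda>r. kernel0 A ?x (?a + (r - t)) * rate0 ?x (?a + (r - t))"] by simp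
    finally show ?thesis
      using landing_prob_approx[OF S A d] mult_nonneg_nonneg[OF rate_sup_nonneg less_imp_le[OF d]]
      by (auto simp: indicator_def)
  next
    case False
    then have "w \<in> landing_event M UNIV t (t + d)" using landing_event_iff[OF w t ltd, of UNIV] by simp
    moreover have "0 \<le> landing_prob M d A ?x ?a" "landing_prob M d A ?x ?a \<le> rate_sup * d"
      using landing_prob_le[OF S, of d A] d by (auto simp: landing_prob_def)
    moreover have "0 \<le> (LINT r:{t<..t + d}|lborel. measure (left_intensity M (w, r)) A)"
      unfolding set_lebesgue_integral_def by (intro Bochner_Integration.integral_nonneg) simp
    moreover have "(LINT r:{t<..t + d}|lborel. measure (left_intensity M (w, r)) A) \<le> rate_sup * (t + d - t)"
      by (rule order_trans[OF abs_ge_self abs_set_integral_le])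
        (use left_intensity_measure_bounds[of "(w, _)" A] w t d rate_sup_nonneg in auto)
    ultimately have L: "w \<in> landing_event M UNIV t (t + d)"
      and "\<bar>landing_prob M d A ?x ?a - (LINT r:{t<..t + d}|lborel. measure (left_intensity M (w, r)) A)\<bar> \<le> rate_sup * d"
      by (simp_all add: abs_le_iff)
    moreover have "rate_sup * d \<le> 2 * (rate_sup * d)\<^sup>2 + rate_sup * d" by simp
    ultimately show ?thesis by (simp only: indicator_simps(1)[OF L] mult_1_right order_trans)
  qed
qed

lemma landing_count_integrable:
  assumes S: "(x, a) \<in> space (age_state_space M)" and s: "0 \<le> s" "s < v"
  shows "integrable (law M x a) (landing_count M UNIV s v)"
proof (rule integrableI_nonneg)
  show "landing_count M UNIV s v \<in> borel_measurable (law M x a)"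
    by (rule measurable_law[OF S landing_count_measurable[OF target_UNIV s(1) order_refl]])
  have "(\<integral>\<^sup>+ w. ennreal (landing_count M UNIV s v w) \<partial>law M x a)
      \<le> (\<integral>\<^sup>+ w. ennreal (2 powr landing_count M UNIV s v w) \<partial>law M x a)"
  proof (intro nn_integral_mono ennreal_leI)
    fix w
    have "real n \<le> 2 powr real n" for n :: nat
      using of_nat_less_two_power[of n, where 'a=real] by (simp add: powr_realpow)
    then show "landing_count M UNIV s v w \<le> 2 powr landing_count M UNIV s v w" unfolding landing_count_UNIV .
  qed
  also have "\<dots> \<le> ennreal (exp ((2 - 1) * rate_sup * (v - s)))"
    by (rule exponential_moment[OF S s]) simp
  also have "\<dots> < \<infinity>" by simp
  finally show "(\<integral>\<^sup>+ w. ennreal (landing_count M UNIV s v w) \<partial>law M x a) < \<infinity>" .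
qed (simp add: landing_count_nonneg)

text \<open>
  On a grid the number of landings is a sum of indicators of landing events; conditioning each cell
  on its left end point turns them into landing probabilities, and these into integrals of the
  intensity. The error per cell is quadratic in the mesh, so the total error vanishes in the limit.
\<close>

lemma landing_count_compensator:
  assumes S: "(x, a) \<in> space (age_state_space M)" and s: "0 \<le> s" "s < v"
    and F: "F \<in> sets (nat_filtration M s)" and A: "A \<in> sets (state_space M)"
  shows "(LINT w|law M x a. indicator F w * landing_count M A s v w)
    = (LINT w|law M x a. indicator F w * (LINT r:{s<..v}|lborel. measure (left_intensity M (w, r)) A))"
proof -
  define P where "P = law M x a"
  interpret prob_space P unfolding P_def using S by (rule law_prob)
  have spP: "space P = sample_space M" unfolding P_def using S by (rule law_space)
  have PM: "f \<in> borel_measurable P" if "f \<in> borel_measurable (generated_by_times M {0..})" for f :: "_ \<Rightarrow> real"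
    using that measurable_cong_sets[OF law_sets[OF S] refl] by (auto simp: P_def)
  have A': "target_set A" using A by auto
  define k where "k u r w = (LINT r:{u<..r}|lborel. measure (left_intensity M (w, r)) A)" for u r w
  have kP [measurable]: "k u r \<in> borel_measurable P" if "0 \<le> u" for u r
    unfolding k_def[abs_def] using that
    by (intro PM path_integral_measurable left_intensity_measure_measurable A) auto
  have k_bounds: "0 \<le> k u r w \<and> k u r w \<le> rate_sup * (r - u)" if "w \<in> sample_space M" "0 \<le> u" "u \<le> r" for u r w
  proof
    show "0 \<le> k u r w" unfolding k_def set_lebesgue_integral_def
      by (intro Bochner_Integration.integral_nonneg) simp
    show "k u r w \<le> rate_sup * (r - u)" unfolding k_def
      by (rule order_trans[OF abs_ge_self abs_set_integral_le])
        (use left_intensity_measure_bounds[of "(w, _)" A] that rate_sup_nonneg in auto)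
  qed
  have FP [measurable]: "F \<in> sets P" unfolding P_def by (rule filtration_subset_law[OF S F])
  define D where "D m w = grid_landings M A (uniform_grid s v m) m w" for m w
  have approx: "\<bar>(LINT w|P. indicator F w * D m w) - (LINT w|P. indicator F w * k s v w)\<bar>
      \<le> 3 * (rate_sup * (v - s))\<^sup>2 / real m" if m: "0 < m" for m
  proof -
    define g where "g = uniform_grid s v m"
    define d where "d = (v - s) / real m"
    have d: "0 < d" using s m by (simp add: d_def)
    have gm: "mono g" unfolding g_def using s by (intro uniform_grid_mono) simp
    have g0: "0 \<le> g i" for i using monoD[OF gm, of 0 i] s by (simp add: g_def)
    have gs: "s \<le> g i" for i using monoD[OF gm, of 0 i] by (simp add: g_def)
    have gS: "g (Suc i) = g i + d" for i by (simp add: g_def d_def uniform_grid_Suc)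
    have FF: "F \<in> sets (nat_filtration M (g i))" for i using F nat_filtration_mono[OF gs[of i]] by blast
    have IP [measurable]: "landing_event M B (g i) (g (Suc i)) \<in> sets P" if "target_set B" for i B
      unfolding P_def using g0[of i] monoD[OF gm, of i "Suc i"] that
      by (intro filtration_subset_law[OF S, of _ "g (Suc i)"] landing_event_sets) auto
    have iI: "integrable P (\<lambda>w. indicator F w * indicator (landing_event M A (g i) (g (Suc i))) w :: real)" for i
      by (rule integrable_const_bound[where B=1]) (use IP[OF A'] in \<open>auto simp: indicator_def\<close>)
    have ik: "integrable P (\<lambda>w. indicator F w * k (g i) (g (Suc i)) w)" for i
      by (rule integrable_const_bound[where B="rate_sup * d"])
        (use k_bounds[OF _ g0[of i], of _ "g (Suc i)"] d kP[OF g0[of i]]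
            mult_nonneg_nonneg[OF rate_sup_nonneg less_imp_le[OF d]] in \<open>auto simp: spP gS indicator_def\<close>)
    have ksplit: "k s (g n) w = (\<Sum>i<n. k (g i) (g (Suc i)) w)" if w: "w \<in> sample_space M" for n w
    proof (induction n)
      case 0
      then show ?case using set_integral_singleton[of s "\<lambda>r. measure (left_intensity M (w, r)) A"] by (simp add: k_def g_def set_lebesgue_integral_def)
    next
      case (Suc n)
      have "set_integrable lborel {s..g (Suc n)} (\<lambda>r. measure (left_intensity M (w, max 0 r)) A)"
        by (rule set_integrable_bounded_interval[OF path_section_measurable[OF left_intensity_measure_measurable[OF A] w], where B=rate_sup])
          (use left_intensity_measure_bounds[of "(w, max 0 _)" A] w in auto)
      then have "set_integrable lborel {s..g (Suc n)} (\<lambda>r. measure (left_intensity M (w, r)) A)"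
        unfolding set_integrable_def
        by (rule Bochner_Integration.integrable_cong[OF refl, THEN iffD1, rotated]) (use s in \<open>auto simp: indicator_def max_def\<close>)
      from set_integral_Icc_split[OF this gs[of n]] monoD[OF gm, of n "Suc n"] Suc show ?case
        by (simp add: k_def set_integral_endpoints(1))
    qed
    have gv: "g m = v" using m by (simp add: g_def)
    \<comment> \<open>a jump in the cell spoils the estimate of \<open>landing_prob_path_approx\<close>, but has probability \<open>O(d)\<close> itself\<close>
    have cell: "\<bar>(LINT w|P. indicator F w * indicator (landing_event M A (g i) (g (Suc i))) w)
        - (LINT w|P. indicator F w * k (g i) (g (Suc i)) w)\<bar> \<le> 3 * (rate_sup * d)\<^sup>2" for i
    proof -
      let ?l = "\<lambda>w. landing_prob M d A (state M (g i) w) (age M (g i) w)"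
      let ?I = "landing_event M UNIV (g i) (g (Suc i))"
      have lP [measurable]: "?l \<in> borel_measurable P"
        unfolding P_def
        using measurable_compose[OF measurable_law[OF S state_age_measurable[OF g0 order_refl]] landing_prob_measurable[OF d A]] by simp
      have il: "integrable P (\<lambda>w. indicator F w * ?l w)"
      proof (rule integrable_const_bound[where B=1])
        show "AE w in P. norm (indicator F w * ?l w) \<le> 1"
          using landing_prob_le_1[OF process_space[OF g0[of i]], of _ d A]
          by (intro AE_I2) (auto simp: spP indicator_def landing_prob_def)
      qed measurable
      have "(LINT w|P. indicator F w * indicator (landing_event M A (g i) (g (Suc i))) w) = (LINT w|P. indicator F w * ?l w)"
        unfolding P_def gS
        by (rule markov_landing[OF S g0 d A borel_measurable_indicator[OF FF], where c=1]) (simp add: indicator_def)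
      then have "\<bar>(LINT w|P. indicator F w * indicator (landing_event M A (g i) (g (Suc i))) w)
        - (LINT w|P. indicator F w * k (g i) (g (Suc i)) w)\<bar>
        = \<bar>LINT w|P. indicator F w * ?l w - indicator F w * k (g i) (g (Suc i)) w\<bar>"
        using il ik by simp
      also have "\<dots> \<le> (LINT w|P. \<bar>indicator F w * ?l w - indicator F w * k (g i) (g (Suc i)) w\<bar>)"
        by (rule integral_abs_bound)
      also have "\<dots> \<le> (LINT w|P. 2 * (rate_sup * d)\<^sup>2 + rate_sup * d * indicator ?I w)"
      proof (rule integral_mono)
        show "integrable P (\<lambda>w. \<bar>indicator F w * ?l w - indicator F w * k (g i) (g (Suc i)) w\<bar>)"
          using il ik by simp
        show "integrable P (\<lambda>w. 2 * (rate_sup * d)\<^sup>2 + rate_sup * d * indicator ?I w)"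
          using IP[OF target_UNIV, of i] by (simp add: less_top[symmetric])
        fix w assume "w \<in> space P"
        then have w: "w \<in> sample_space M" by (simp add: spP)
        have "0 \<le> rate_sup * d" using d rate_sup_nonneg by simp
        then show "\<bar>indicator F w * ?l w - indicator F w * k (g i) (g (Suc i)) w\<bar>
            \<le> 2 * (rate_sup * d)\<^sup>2 + rate_sup * d * indicator ?I w"
          using landing_prob_path_approx[OF w A g0[of i] d] by (auto simp: indicator_def k_def gS)
      qed
      also have "\<dots> = 2 * (rate_sup * d)\<^sup>2 + rate_sup * d * measure P ?I"
      proof -
        have "?I \<inter> space P = ?I" by (auto simp: landing_event_def spP)
        then show ?thesis using IP[OF target_UNIV, of i] prob_space by (simp add: less_top[symmetric])
      qed
      also have "\<dots> \<le> 2 * (rate_sup * d)\<^sup>2 + rate_sup * d * (rate_sup * d)"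
      proof -
        have "measure P ?I \<le> rate_sup * d" unfolding P_def using jump_prob_le[OF S g0[of i], of "g (Suc i)"] d by (simp add: gS)
        then show ?thesis using d rate_sup_nonneg by (intro add_left_mono mult_left_mono) auto
      qed
      also have "\<dots> = 3 * (rate_sup * d)\<^sup>2" by (simp add: power2_eq_square)
      finally show ?thesis .
    qed
    have "(LINT w|P. indicator F w * D m w)
        = (\<Sum>i<m. LINT w|P. indicator F w * indicator (landing_event M A (g i) (g (Suc i))) w)"
      unfolding D_def grid_landings_def g_def[symmetric] sum_distrib_left by (rule Bochner_Integration.integral_sum) (rule iI)
    moreover have "(LINT w|P. indicator F w * k s v w) = (\<Sum>i<m. LINT w|P. indicator F w * k (g i) (g (Suc i)) w)"
    proof -
      have "(LINT w|P. indicator F w * k s v w) = (LINT w|P. (\<Sum>i<m. indicator F w * k (g i) (g (Suc i)) w))"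
        using ksplit[of _ m] by (intro Bochner_Integration.integral_cong refl) (simp add: spP gv sum_distrib_left)
      also have "\<dots> = (\<Sum>i<m. LINT w|P. indicator F w * k (g i) (g (Suc i)) w)"
        by (rule Bochner_Integration.integral_sum) (rule ik)
      finally show ?thesis .
    qed
    ultimately have "\<bar>(LINT w|P. indicator F w * D m w) - (LINT w|P. indicator F w * k s v w)\<bar>
       \<le> (\<Sum>i<m. \<bar>(LINT w|P. indicator F w * indicator (landing_event M A (g i) (g (Suc i))) w)
        - (LINT w|P. indicator F w * k (g i) (g (Suc i)) w)\<bar>)"
      by (simp only: sum_subtractf[symmetric] sum_abs)
    also have "\<dots> \<le> (\<Sum>i<m. 3 * (rate_sup * d)\<^sup>2)" by (intro sum_mono cell)
    also have "\<dots> = 3 * (rate_sup * (v - s))\<^sup>2 / real m"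
      using m by (simp add: d_def power2_eq_square)
    finally show ?thesis .
  qed
  have lim1: "(\<lambda>m. LINT w|P. indicator F w * D (Suc m) w) \<longlonglongrightarrow> (LINT w|P. indicator F w * landing_count M A s v w)"
  proof (rule integral_dominated_convergence[where w="landing_count M UNIV s v"])
    show "(\<lambda>w. indicator F w * landing_count M A s v w) \<in> borel_measurable P"
      using measurable_law[OF S landing_count_measurable[OF A' s(1) order_refl]]
      by (intro borel_measurable_times borel_measurable_indicator FP) (simp add: P_def)
    have DP: "D (Suc m) \<in> borel_measurable P" for m
      unfolding P_def D_def[abs_def] using s
      by (intro measurable_law[OF S grid_landings_measurable[of _ _ _ v]] A' uniform_grid_mono) auto
    then show "(\<lambda>w. indicator F w * D (Suc m) w) \<in> borel_measurable P" for m
      by (intro borel_measurable_times borel_measurable_indicator FP)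
    show "integrable P (landing_count M UNIV s v)" unfolding P_def by (rule landing_count_integrable[OF S s])
    show "AE w in P. (\<lambda>m. indicator F w * D (Suc m) w) \<longlonglongrightarrow> indicator F w * landing_count M A s v w"
      unfolding D_def
      by (intro AE_I2 tendsto_mult tendsto_const LIMSEQ_Suc tendsto_eventually grid_landings_eventually s) (simp add: spP)
    show "AE w in P. norm (indicator F w * D (Suc m) w) \<le> landing_count M UNIV s v w" for m
    proof (rule AE_I2)
      fix w assume "w \<in> space P"
      then have "D (Suc m) w \<le> landing_count M UNIV s v w"
        using grid_landings_le[of w "uniform_grid s v (Suc m)" A "Suc m"] uniform_grid_mono[of s v "Suc m"] s
        by (simp add: spP D_def)
      moreover have "0 \<le> D (Suc m) w" by (simp add: D_def grid_landings_def sum_nonneg)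
      ultimately show "norm (indicator F w * D (Suc m) w) \<le> landing_count M UNIV s v w"
        using landing_count_nonneg[of UNIV s v w] by (auto simp: indicator_def)
    qed
  qed
  have lim2: "(\<lambda>m. LINT w|P. indicator F w * D (Suc m) w) \<longlonglongrightarrow> (LINT w|P. indicator F w * k s v w)"
  proof (rule LIM_zero_cancel, rule Lim_null_comparison)
    show "\<forall>\<^sub>F m in sequentially. norm ((LINT w|P. indicator F w * D (Suc m) w) - (LINT w|P. indicator F w * k s v w))
        \<le> 3 * (rate_sup * (v - s))\<^sup>2 * inverse (real (Suc m))"
      using approx by (intro always_eventually allI) (simp add: divide_inverse del: of_nat_Suc)
    have "(\<lambda>m. 3 * (rate_sup * (v - s))\<^sup>2 * inverse (real (Suc m))) \<longlonglongrightarrow> 3 * (rate_sup * (v - s))\<^sup>2 * 0"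
      by (intro tendsto_mult tendsto_const LIMSEQ_inverse_real_of_nat)
    then show "(\<lambda>m. 3 * (rate_sup * (v - s))\<^sup>2 * inverse (real (Suc m))) \<longlonglongrightarrow> 0" by simp
  qed
  show ?thesis using LIMSEQ_unique[OF lim1 lim2] unfolding P_def k_def .
qed

lemma nn_integral_left_intensity_indicator:
  assumes z: "z \<in> space (predictable M)" and D: "D \<in> sets (state_space M)"
  shows "(\<integral>\<^sup>+ y. indicator (C \<times> D) (z, y) \<partial>left_intensity M z) = indicator C z * emeasure (left_intensity M z) D"
proof -
  have D': "D \<in> sets (left_intensity M z)"
    unfolding left_intensity_def using sets_intensity[OF left_state_space[OF z]] D by simp
  have "(\<integral>\<^sup>+ y. indicator (C \<times> D) (z, y) \<partial>left_intensity M z) = (\<integral>\<^sup>+ y. indicator C z * indicator D y \<partial>left_intensity M z)"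
    by (intro nn_integral_cong) (auto simp: indicator_def)
  also have "\<dots> = indicator C z * emeasure (left_intensity M z) D"
    using D' by (simp add: nn_integral_cmult)
  finally show ?thesis .
qed

lemma jump_sum_upto:
  assumes w: "w \<in> sample_space M" and R: "0 \<le> R"
  shows "jump_sum M {0<..<R + 1} (\<lambda>z. if snd (fst z) \<le> R then H z else 0) w = jump_sum M {0<..R} H w"
proof -
  have "jump_sum M {0<..<R + 1} (\<lambda>z. if snd (fst z) \<le> R then H z else 0) w
      = (\<Sum>\<tau>\<in>jumps M w \<inter> {0<..R}. (if \<tau> \<le> R then H ((w, \<tau>), state M \<tau> w) else 0))"
    unfolding jump_sum_def using finite_jumps_Ioo[OF w, of 0 "R + 1"]
    by (intro sum.mono_neutral_cong_right) auto
  also have "\<dots> = jump_sum M {0<..R} H w" unfolding jump_sum_def by (intro sum.cong) auto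
  finally show ?thesis .
qed

lemma jump_sum_measurable:
  fixes H :: "('w \<times> real) \<times> 'k \<Rightarrow> ennreal"
  assumes H [measurable]: "H \<in> borel_measurable marked_predictable" and R: "0 \<le> R"
  shows "jump_sum M {0<..R} H \<in> borel_measurable (generated_by_times M {0..})"
proof -
  let ?H = "\<lambda>z. if snd (fst z) \<le> R then H z else 0"
  have "?H \<in> borel_measurable marked_predictable" by measurable
  from measurable_compose[OF measurable_pair_time[of "R + 1"] jump_sum_predictable[OF this]] R
  have "(\<lambda>w. jump_sum M {0<..<R + 1} ?H w) \<in> borel_measurable (generated_by_times M {0..})" by simp
  then show ?thesis
    by (rule measurable_cong[THEN iffD1, rotated]) (simp add: jump_sum_upto[OF _ R])
qed

lemma jump_sum_measurable_real:
  fixes H :: "('w \<times> real) \<times> 'k \<Rightarrow> real"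
  assumes H [measurable]: "H \<in> borel_measurable marked_predictable" and R: "0 \<le> R"
  shows "jump_sum M {0<..R} H \<in> borel_measurable (generated_by_times M {0..})"
proof -
  let ?H = "\<lambda>z. if snd (fst z) \<le> R then H z else 0"
  have "?H \<in> borel_measurable marked_predictable" by measurable
  from measurable_compose[OF measurable_pair_time[of "R + 1"] jump_sum_predictable_real[OF this]] R
  have "(\<lambda>w. jump_sum M {0<..<R + 1} ?H w) \<in> borel_measurable (generated_by_times M {0..})" by simp
  then show ?thesis
    by (rule measurable_cong[THEN iffD1, rotated]) (simp add: jump_sum_upto[OF _ R])
qed

lemma compensator_measurable:
  assumes H: "H \<in> borel_measurable marked_predictable"
  shows "compensator M R H \<in> borel_measurable (generated_by_times M {0..})"
  unfolding compensator_def[abs_def]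
  by (rule path_nn_integral_measurable[OF nn_integral_left_intensity_predictable[OF H]]) auto

lemma measurable_law_generated:
  "(x, a) \<in> space (age_state_space M) \<Longrightarrow> f \<in> generated_by_times M {0..} \<rightarrow>\<^sub>M N \<Longrightarrow> f \<in> law M x a \<rightarrow>\<^sub>M N"
  using measurable_cong_sets[OF law_sets refl] by blast

text \<open>
  On a rectangle both sides reduce to the number of landings in \<open>D\<close> between \<open>u\<close> and the smaller of
  \<open>v\<close> and \<open>R\<close>, on an event of the past at \<open>u\<close>.
\<close>

lemma compensator_rectangle:
  assumes S: "(x, a) \<in> space (age_state_space M)" and u: "0 \<le> u"
    and F: "F \<in> sets (nat_filtration M u)" and D: "D \<in> sets (state_space M)"
  shows "(\<integral>\<^sup>+ w. jump_sum M {0<..R} (indicator ((F \<times> {u<..v}) \<times> D)) w \<partial>law M x a)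
    = (\<integral>\<^sup>+ w. compensator M R (indicator ((F \<times> {u<..v}) \<times> D)) w \<partial>law M x a)"
proof -
  define P where "P = law M x a"
  interpret prob_space P unfolding P_def using S by (rule law_prob)
  have spP: "space P = sample_space M" unfolding P_def using S by (rule law_space)
  define m where "m = min v R"
  have D': "target_set D" using D by auto
  have FP [measurable]: "F \<in> sets P" unfolding P_def by (rule filtration_subset_law[OF S F])
  have js: "jump_sum M {0<..R} (indicator ((F \<times> {u<..v}) \<times> D)) w
      = ennreal (indicator F w * landing_count M D u m w)" if w: "w \<in> sample_space M" for w
  proof -
    have "jump_sum M {0<..R} (indicator ((F \<times> {u<..v}) \<times> D)) w
        = (\<Sum>\<tau>\<in>jumps M w \<inter> {u<..m}. ennreal (indicator F w * indicator D (state M \<tau> w)))"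
      unfolding jump_sum_def using finite_jumps_Ioc[OF w, of 0 R] u
      by (intro sum.mono_neutral_cong_right) (auto simp: indicator_def m_def)
    also have "\<dots> = ennreal (indicator F w * landing_count M D u m w)"
      unfolding landing_count_def sum_distrib_left by (rule sum_ennreal) simp
    finally show ?thesis .
  qed
  have cm: "compensator M R (indicator ((F \<times> {u<..v}) \<times> D)) w
      = ennreal (indicator F w * (LINT r:{u<..m}|lborel. measure (left_intensity M (w, r)) D))"
    if w: "w \<in> sample_space M" for w
  proof -
    have "compensator M R (indicator ((F \<times> {u<..v}) \<times> D)) w
        = (\<integral>\<^sup>+ r. ennreal (indicator F w * (indicator {u<..m} r *\<^sub>R measure (left_intensity M (w, max 0 r)) D)) \<partial>lborel)"
      unfolding compensator_def
    proof (intro nn_integral_cong)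
      fix r
      show "(\<integral>\<^sup>+ y. indicator ((F \<times> {u<..v}) \<times> D) ((w, r), y) \<partial>left_intensity M (w, r)) * indicator {0<..R} r
          = ennreal (indicator F w * (indicator {u<..m} r *\<^sub>R measure (left_intensity M (w, max 0 r)) D))"
      proof (cases "r \<in> {0<..R}")
        case True
        then have z: "(w, r) \<in> space (predictable M)" using w by simp
        show ?thesis unfolding nn_integral_left_intensity_indicator[OF z D] left_intensity_emeasure_eq[OF z]
          using True u by (auto simp: indicator_def m_def max_def)
      next
        case False
        then show ?thesis using u by (auto simp: indicator_def m_def)
      qed
    qed
    also have "\<dots> = ennreal (LINT r|lborel. indicator F w * (indicator {u<..m} r *\<^sub>R measure (left_intensity M (w, max 0 r)) D))"
    proof (rule nn_integral_eq_integral)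
      have "set_integrable lborel {u<..m} (\<lambda>r. measure (left_intensity M (w, max 0 r)) D)"
        by (rule set_integrable_bounded_interval[OF path_section_measurable[OF left_intensity_measure_measurable[OF D] w], where B=rate_sup and s=u and v=m])
          (use left_intensity_measure_bounds[of "(w, max 0 _)" D] w in auto)
      then show "integrable lborel (\<lambda>r. indicator F w * (indicator {u<..m} r *\<^sub>R measure (left_intensity M (w, max 0 r)) D))"
        unfolding set_integrable_def by simp
    qed simp
    also have "(LINT r|lborel. indicator F w * (indicator {u<..m} r *\<^sub>R measure (left_intensity M (w, max 0 r)) D))
        = indicator F w * (LINT r|lborel. indicator {u<..m} r *\<^sub>R measure (left_intensity M (w, max 0 r)) D)"
      by (rule integral_mult_right_zero)
    also have "(LINT r|lborel. indicator {u<..m} r *\<^sub>R measure (left_intensity M (w, max 0 r)) D)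
        = (LINT r:{u<..m}|lborel. measure (left_intensity M (w, r)) D)"
      unfolding set_lebesgue_integral_def using u
      by (intro Bochner_Integration.integral_cong refl) (auto simp: indicator_def max_def)
    finally show ?thesis .
  qed
  have "(\<integral>\<^sup>+ w. ennreal (indicator F w * landing_count M D u m w) \<partial>P)
     = (\<integral>\<^sup>+ w. ennreal (indicator F w * (LINT r:{u<..m}|lborel. measure (left_intensity M (w, r)) D)) \<partial>P)"
  proof (cases "u < m")
    case True
    have lm: "landing_count M D u m \<in> borel_measurable P"
      unfolding P_def by (rule measurable_law[OF S landing_count_measurable[OF D' u order_refl]])
    have "integrable P (\<lambda>w. indicator F w * landing_count M D u m w)"
    proof (rule Bochner_Integration.integrable_bound)
      show "integrable P (landing_count M UNIV u m)" unfolding P_def by (rule landing_count_integrable[OF S u True])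
      show "(\<lambda>w. indicator F w * landing_count M D u m w) \<in> borel_measurable P" using lm by measurable
      show "AE w in P. norm (indicator F w * landing_count M D u m w) \<le> norm (landing_count M UNIV u m w)"
        using landing_count_mono[of D u m] landing_count_nonneg[of D u m] landing_count_nonneg[of UNIV u m]
        by (intro AE_I2) (auto simp: indicator_def)
    qed
    moreover have "integrable P (\<lambda>w. indicator F w * (LINT r:{u<..m}|lborel. measure (left_intensity M (w, r)) D))"
    proof (rule integrable_const_bound[where B="rate_sup * (m - u)"])
      show "(\<lambda>w. indicator F w * (LINT r:{u<..m}|lborel. measure (left_intensity M (w, r)) D)) \<in> borel_measurable P"
        unfolding P_def using u FP
        by (intro borel_measurable_times borel_measurable_indicator measurable_law_generated[OF S path_integral_measurable[OF left_intensity_measure_measurable[OF D]]])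
          (auto simp: P_def)
      show "AE w in P. norm (indicator F w * (LINT r:{u<..m}|lborel. measure (left_intensity M (w, r)) D)) \<le> rate_sup * (m - u)"
      proof (rule AE_I2)
        fix w assume "w \<in> space P"
        then have "\<bar>LINT r:{u<..m}|lborel. measure (left_intensity M (w, r)) D\<bar> \<le> rate_sup * (m - u)"
          using left_intensity_measure_bounds[of "(w, _)" D] u True rate_sup_nonneg
          by (intro abs_set_integral_le) (auto simp: spP)
        then show "norm (indicator F w * (LINT r:{u<..m}|lborel. measure (left_intensity M (w, r)) D)) \<le> rate_sup * (m - u)"
          using True rate_sup_nonneg by (auto simp: indicator_def)
      qed
    qed
    moreover have "0 \<le> (LINT r:{u<..m}|lborel. measure (left_intensity M (w, r)) D)" for w
      unfolding set_lebesgue_integral_def by (intro Bochner_Integration.integral_nonneg) simp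
    ultimately show ?thesis
      using landing_count_compensator[OF S u True F D] landing_count_nonneg[of D u m]
      by (simp add: nn_integral_eq_integral P_def)
  next
    case False
    then show ?thesis by (simp add: landing_count_def set_lebesgue_integral_def)
  qed
  also have "(\<integral>\<^sup>+ w. ennreal (indicator F w * landing_count M D u m w) \<partial>P)
      = (\<integral>\<^sup>+ w. jump_sum M {0<..R} (indicator ((F \<times> {u<..v}) \<times> D)) w \<partial>P)"
    by (intro nn_integral_cong) (simp add: js spP)
  also have "(\<integral>\<^sup>+ w. ennreal (indicator F w * (LINT r:{u<..m}|lborel. measure (left_intensity M (w, r)) D)) \<partial>P)
      = (\<integral>\<^sup>+ w. compensator M R (indicator ((F \<times> {u<..v}) \<times> D)) w \<partial>P)"
    by (intro nn_integral_cong) (simp add: cm spP)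
  finally show ?thesis unfolding P_def .
qed

lemma jump_sum_cong:
  assumes "w \<in> sample_space M"
    "\<And>r y. 0 < r \<Longrightarrow> r \<le> R \<Longrightarrow> y \<in> space (state_space M) \<Longrightarrow> H ((w, r), y) = H' ((w, r), y)"
  shows "jump_sum M {0<..R} H w = jump_sum M {0<..R} H' w"
  unfolding jump_sum_def using assms state_in_space[OF assms(1)] by (intro sum.cong) auto

lemma space_left_intensity: "z \<in> space (predictable M) \<Longrightarrow> space (left_intensity M z) = space (state_space M)"
  unfolding left_intensity_def by (rule space_intensity[OF left_state_space])

lemma compensator_cong:
  assumes "w \<in> sample_space M"
    "\<And>r y. 0 < r \<Longrightarrow> r \<le> R \<Longrightarrow> y \<in> space (state_space M) \<Longrightarrow> H ((w, r), y) = H' ((w, r), y)"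
  shows "compensator M R H w = compensator M R H' w"
  unfolding compensator_def
proof (intro nn_integral_cong)
  fix r
  show "(\<integral>\<^sup>+ y. H ((w, r), y) \<partial>left_intensity M (w, r)) * indicator {0<..R} r
      = (\<integral>\<^sup>+ y. H' ((w, r), y) \<partial>left_intensity M (w, r)) * indicator {0<..R} r"
  proof (cases "r \<in> {0<..R}")
    case True
    then have "(\<integral>\<^sup>+ y. H ((w, r), y) \<partial>left_intensity M (w, r)) = (\<integral>\<^sup>+ y. H' ((w, r), y) \<partial>left_intensity M (w, r))"
      using assms by (intro nn_integral_cong) (auto simp: space_left_intensity)
    then show ?thesis by simp
  qed simp
qed

lemma left_intensity_section:
  assumes H: "H \<in> borel_measurable marked_predictable" and z: "z \<in> space (predictable M)"
  shows "(\<lambda>y. H (z, y)) \<in> borel_measurable (left_intensity M z)"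
  using section_measurable[OF H z] measurable_cong_sets[OF sets_intensity[OF left_state_space[OF z]] refl]
  unfolding left_intensity_def by blast

lemma path_left_intensity_measurable:
  assumes H: "H \<in> borel_measurable marked_predictable" and w: "w \<in> sample_space M"
  shows "(\<lambda>r. (\<integral>\<^sup>+ y. H ((w, r), y) \<partial>left_intensity M (w, r)) * indicator {0<..R} r) \<in> borel_measurable lborel"
proof -
  have "(\<lambda>r. (\<integral>\<^sup>+ y. H ((w, max 0 r), y) \<partial>left_intensity M (w, max 0 r)) * indicator {0<..R} r) \<in> borel_measurable lborel"
    using path_section_measurable[OF nn_integral_left_intensity_predictable[OF H] w] by measurable
  then show ?thesis
    by (rule measurable_cong[THEN iffD1, rotated]) (auto simp: indicator_def max_def)
qed

lemma compensator_add:
  assumes H: "H \<in> borel_measurable marked_predictable"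
    and H': "H' \<in> borel_measurable marked_predictable" and w: "w \<in> sample_space M"
  shows "compensator M R (\<lambda>z. H z + H' z) w = compensator M R H w + compensator M R H' w"
  unfolding compensator_def
proof (subst nn_integral_add[symmetric])
  show "(\<integral>\<^sup>+ r\<in>{0<..R}. (\<integral>\<^sup>+ y. H ((w, r), y) + H' ((w, r), y) \<partial>left_intensity M (w, r)) \<partial>lborel)
    = (\<integral>\<^sup>+ r. (\<integral>\<^sup>+ y. H ((w, r), y) \<partial>left_intensity M (w, r)) * indicator {0<..R} r
        + (\<integral>\<^sup>+ y. H' ((w, r), y) \<partial>left_intensity M (w, r)) * indicator {0<..R} r \<partial>lborel)"
    using w by (intro nn_integral_cong)
      (auto simp: indicator_def nn_integral_add left_intensity_section[OF H] left_intensity_section[OF H'])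
qed (rule path_left_intensity_measurable[OF H w] path_left_intensity_measurable[OF H' w])+

lemma compensator_cmult:
  assumes H: "H \<in> borel_measurable marked_predictable" and w: "w \<in> sample_space M"
  shows "compensator M R (\<lambda>z. c * H z) w = c * compensator M R H w"
  unfolding compensator_def
proof (subst nn_integral_cmult[symmetric])
  show "(\<integral>\<^sup>+ r\<in>{0<..R}. (\<integral>\<^sup>+ y. c * H ((w, r), y) \<partial>left_intensity M (w, r)) \<partial>lborel)
    = (\<integral>\<^sup>+ r. c * ((\<integral>\<^sup>+ y. H ((w, r), y) \<partial>left_intensity M (w, r)) * indicator {0<..R} r) \<partial>lborel)"
    using w by (intro nn_integral_cong)
      (auto simp: indicator_def nn_integral_cmult left_intensity_section[OF H])
qed (rule path_left_intensity_measurable[OF H w])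

lemma compensator_SUP:
  assumes H: "\<And>i. H i \<in> borel_measurable marked_predictable" and inc: "incseq H"
    and w: "w \<in> sample_space M"
  shows "compensator M R (SUP i. H i) w = (SUP i. compensator M R (H i) w)"
proof -
  have step: "(\<integral>\<^sup>+ y. (SUP i. H i) (z, y) \<partial>left_intensity M z) = (SUP i. \<integral>\<^sup>+ y. H i (z, y) \<partial>left_intensity M z)"
    if "z \<in> space (predictable M)" for z
  proof -
    have "(\<integral>\<^sup>+ y. (SUP i. H i (z, y)) \<partial>left_intensity M z) = (SUP i. \<integral>\<^sup>+ y. H i (z, y) \<partial>left_intensity M z)"
      by (intro nn_integral_monotone_convergence_SUP left_intensity_section[OF H that]
          incseq_SucI le_funI le_funD[OF incseq_SucD[OF inc]])
    then show ?thesis by (simp add: image_comp)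
  qed
  have "compensator M R (SUP i. H i) w
      = (\<integral>\<^sup>+ r. (SUP i. (\<integral>\<^sup>+ y. H i ((w, r), y) \<partial>left_intensity M (w, r)) * indicator {0<..R} r) \<partial>lborel)"
    unfolding compensator_def
  proof (intro nn_integral_cong)
    fix r
    show "(\<integral>\<^sup>+ y. (SUP i. H i) ((w, r), y) \<partial>left_intensity M (w, r)) * indicator {0<..R} r
        = (SUP i. (\<integral>\<^sup>+ y. H i ((w, r), y) \<partial>left_intensity M (w, r)) * indicator {0<..R} r)"
      using step[of "(w, r)"] w by (cases "r \<in> {0<..R}") auto
  qed
  also have "\<dots> = (SUP i. compensator M R (H i) w)"
    unfolding compensator_def
  proof (rule nn_integral_monotone_convergence_SUP)
    show "incseq (\<lambda>i r. (\<integral>\<^sup>+ y. H i ((w, r), y) \<partial>left_intensity M (w, r)) * indicator {0<..R} r)"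
      using inc by (auto simp: incseq_def le_fun_def intro!: mult_right_mono nn_integral_mono)
  qed (rule path_left_intensity_measurable[OF H w])
  finally show ?thesis .
qed

lemma jump_sum_SUP:
  fixes H :: "nat \<Rightarrow> ('w \<times> real) \<times> 'k \<Rightarrow> ennreal"
  assumes "incseq H"
  shows "jump_sum M I (SUP i. H i) w = (SUP i. jump_sum M I (H i) w)"
proof -
  have "(SUP i. \<Sum>\<tau>\<in>jumps M w \<inter> I. H i ((w, \<tau>), state M \<tau> w))
      = (\<Sum>\<tau>\<in>jumps M w \<inter> I. SUP i. H i ((w, \<tau>), state M \<tau> w))"
    by (rule ennreal_SUP_sum) (use assms in \<open>auto simp: incseq_def le_fun_def\<close>)
  then show ?thesis unfolding jump_sum_def by (simp add: image_comp)
qed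

theorem jump_sum_compensator_indicator:
  assumes S: "(x, a) \<in> space (age_state_space M)" and R: "0 \<le> R"
    and B: "B \<in> sets marked_predictable"
  shows "(\<integral>\<^sup>+ w. jump_sum M {0<..R} (indicator B) w \<partial>law M x a) = (\<integral>\<^sup>+ w. compensator M R (indicator B) w \<partial>law M x a)"
proof -
  define P where "P = law M x a"
  interpret prob_space P unfolding P_def using S by (rule law_prob)
  have spP: "space P = sample_space M" unfolding P_def using S by (rule law_space)
  have jm: "jump_sum M {0<..R} (indicator B :: _ \<Rightarrow> ennreal) \<in> borel_measurable P"
    and cm: "compensator M R (indicator B) \<in> borel_measurable P"
    if "B \<in> sets marked_predictable" for B
    unfolding P_def
    by - (rule measurable_law_generated[OF S jump_sum_measurable[OF borel_measurable_indicator[OF that] R]],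
        rule measurable_law_generated[OF S compensator_measurable[OF borel_measurable_indicator[OF that]]])
  let ?Om = "space marked_predictable"
  have top: "sample_space M \<in> sets (nat_filtration M 0)" using sets.top[of "nat_filtration M 0"] by simp
  let ?T = "(sample_space M \<times> {0<..R}) \<times> space (state_space M)"
  have T: "?T \<in> sets marked_predictable" using predictable_Ioc[OF order_refl top] by auto
  have totJ: "(\<integral>\<^sup>+ w. jump_sum M {0<..R} (indicator ?Om) w \<partial>P) = (\<integral>\<^sup>+ w. jump_sum M {0<..R} (indicator ?T) w \<partial>P)"
    by (intro nn_integral_cong jump_sum_cong) (auto simp: spP space_pair_measure)
  have totC: "(\<integral>\<^sup>+ w. compensator M R (indicator ?Om) w \<partial>P) = (\<integral>\<^sup>+ w. compensator M R (indicator ?T) w \<partial>P)"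
    by (intro nn_integral_cong compensator_cong) (auto simp: spP space_pair_measure)
  have tot: "(\<integral>\<^sup>+ w. jump_sum M {0<..R} (indicator ?Om) w \<partial>P) = (\<integral>\<^sup>+ w. compensator M R (indicator ?Om) w \<partial>P)"
    unfolding totJ totC unfolding P_def by (rule compensator_rectangle[OF S order_refl top sets.top])
  have fin: "(\<integral>\<^sup>+ w. jump_sum M {0<..R} (indicator B) w \<partial>P) \<noteq> top" for B
  proof -
    have "(\<integral>\<^sup>+ w. jump_sum M {0<..R} (indicator B) w \<partial>P) \<le> (\<integral>\<^sup>+ w. ennreal (landing_count M UNIV 0 (R + 1) w) \<partial>P)"
    proof (intro nn_integral_mono)
      fix w assume "w \<in> space P"
      then have w: "w \<in> sample_space M" by (simp add: spP)
      have "jump_sum M {0<..R} (indicator B) w \<le> (\<Sum>\<tau>\<in>jumps M w \<inter> {0<..R}. 1 :: ennreal)"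
        unfolding jump_sum_def by (intro sum_mono) (auto simp: indicator_def)
      also have "\<dots> \<le> (\<Sum>\<tau>\<in>jumps M w \<inter> {0<..R + 1}. 1 :: ennreal)"
        using finite_jumps_Ioc[OF w, of 0 "R + 1"] by (intro sum_mono2) auto
      finally show "jump_sum M {0<..R} (indicator B) w \<le> ennreal (landing_count M UNIV 0 (R + 1) w)"
        by (simp add: landing_count_UNIV ennreal_of_nat_eq_real_of_nat)
    qed
    also have "\<dots> < top"
      using landing_count_integrable[OF S order_refl, of "R + 1"] R landing_count_nonneg[of UNIV 0 "R + 1"]
      by (simp add: integrable_iff_bounded P_def)
    finally show ?thesis by simp
  qed
  show ?thesis using B unfolding P_def[symmetric]
  proof (induction rule: predictable_pair_induct)
    case (initial A D)
    have "jump_sum M {0<..R} (indicator ((A \<times> {0}) \<times> D)) w = (0 :: ennreal)" for w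
      unfolding jump_sum_def by (intro sum.neutral) auto
    moreover have "compensator M R (indicator ((A \<times> {0}) \<times> D)) w = compensator M R (\<lambda>_. 0) w" if "w \<in> sample_space M" for w
      using that by (intro compensator_cong) auto
    then have "(\<integral>\<^sup>+ w. compensator M R (indicator ((A \<times> {0}) \<times> D)) w \<partial>P) = (\<integral>\<^sup>+ w. compensator M R (\<lambda>_. 0) w \<partial>P)"
      by (intro nn_integral_cong) (simp add: spP)
    ultimately show ?case by (simp add: compensator_def)
  next
    case (rectangle A D s v)
    then show ?case unfolding P_def by (intro compensator_rectangle[OF S])
  next
    case (compl B)
    have cB: "?Om - B \<in> sets marked_predictable" using compl(1) by auto
    have "(\<integral>\<^sup>+ w. jump_sum M {0<..R} (indicator ?Om) w \<partial>P)
       = (\<integral>\<^sup>+ w. jump_sum M {0<..R} (indicator B) w + jump_sum M {0<..R} (indicator (?Om - B)) w \<partial>P)"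
    proof (intro nn_integral_cong)
      fix w assume "w \<in> space P"
      then have "jump_sum M {0<..R} (indicator ?Om) w = (jump_sum M {0<..R} (\<lambda>z. indicator B z + indicator (?Om - B) z) w :: ennreal)"
        by (intro jump_sum_cong) (auto simp: spP space_pair_measure indicator_def)
      then show "jump_sum M {0<..R} (indicator ?Om) w = (jump_sum M {0<..R} (indicator B) w + jump_sum M {0<..R} (indicator (?Om - B)) w :: ennreal)"
        by (simp add: jump_sum_def sum.distrib)
    qed
    also have "\<dots> = (\<integral>\<^sup>+ w. jump_sum M {0<..R} (indicator B) w \<partial>P) + (\<integral>\<^sup>+ w. jump_sum M {0<..R} (indicator (?Om - B)) w \<partial>P)"
      by (rule nn_integral_add[OF jm[OF compl(1)] jm[OF cB]])
    finally have J: "(\<integral>\<^sup>+ w. jump_sum M {0<..R} (indicator ?Om) w \<partial>P)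
      = (\<integral>\<^sup>+ w. jump_sum M {0<..R} (indicator B) w \<partial>P) + (\<integral>\<^sup>+ w. jump_sum M {0<..R} (indicator (?Om - B)) w \<partial>P)" .
    have "(\<integral>\<^sup>+ w. compensator M R (indicator ?Om) w \<partial>P)
       = (\<integral>\<^sup>+ w. compensator M R (indicator B) w + compensator M R (indicator (?Om - B)) w \<partial>P)"
    proof (intro nn_integral_cong)
      fix w assume "w \<in> space P"
      then have w: "w \<in> sample_space M" by (simp add: spP)
      have "compensator M R (indicator ?Om) w = compensator M R (\<lambda>z. indicator B z + indicator (?Om - B) z) w"
        using w by (intro compensator_cong) (auto simp: space_pair_measure indicator_def)
      also have "\<dots> = compensator M R (indicator B) w + compensator M R (indicator (?Om - B)) w"
        using compl(1) cB by (intro compensator_add borel_measurable_indicator w)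
      finally show "compensator M R (indicator ?Om) w = compensator M R (indicator B) w + compensator M R (indicator (?Om - B)) w" .
    qed
    also have "\<dots> = (\<integral>\<^sup>+ w. compensator M R (indicator B) w \<partial>P) + (\<integral>\<^sup>+ w. compensator M R (indicator (?Om - B)) w \<partial>P)"
      by (rule nn_integral_add[OF cm[OF compl(1)] cm[OF cB]])
    finally have C: "(\<integral>\<^sup>+ w. compensator M R (indicator ?Om) w \<partial>P)
      = (\<integral>\<^sup>+ w. jump_sum M {0<..R} (indicator B) w \<partial>P) + (\<integral>\<^sup>+ w. compensator M R (indicator (?Om - B)) w \<partial>P)"
      unfolding compl.IH .
    show ?case using J C tot fin[of B] by (simp add: ennreal_add_left_cancel)
  next
    case (union f)
    have f: "f i \<in> sets marked_predictable" for i using union(2) by auto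
    have suminf_ind: "indicator (\<Union>i. f i) z = (\<Sum>i. indicator (f i) z :: ennreal)" for z
      by (rule suminf_indicator[OF union(1), symmetric])
    have "(\<integral>\<^sup>+ w. jump_sum M {0<..R} (indicator (\<Union>i. f i)) w \<partial>P) = (\<integral>\<^sup>+ w. (\<Sum>i. jump_sum M {0<..R} (indicator (f i)) w) \<partial>P)"
      unfolding jump_sum_def suminf_ind by (simp add: suminf_sum)
    also have "\<dots> = (\<Sum>i. \<integral>\<^sup>+ w. jump_sum M {0<..R} (indicator (f i)) w \<partial>P)"
      by (rule nn_integral_suminf) (rule jm[OF f])
    also have "\<dots> = (\<Sum>i. \<integral>\<^sup>+ w. compensator M R (indicator (f i)) w \<partial>P)" by (simp add: union.IH)
    also have "\<dots> = (\<integral>\<^sup>+ w. (\<Sum>i. compensator M R (indicator (f i)) w) \<partial>P)"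
      by (rule nn_integral_suminf[symmetric]) (rule cm[OF f])
    also have "\<dots> = (\<integral>\<^sup>+ w. compensator M R (indicator (\<Union>i. f i)) w \<partial>P)"
    proof (intro nn_integral_cong)
      fix w assume "w \<in> space P"
      then have w: "w \<in> sample_space M" by (simp add: spP)
      have "(\<integral>\<^sup>+ y. indicator (\<Union>i. f i) ((w, r), y) \<partial>left_intensity M (w, r)) * indicator {0<..R} r
          = (\<Sum>i. (\<integral>\<^sup>+ y. indicator (f i) ((w, r), y) \<partial>left_intensity M (w, r)) * indicator {0<..R} r)" for r
      proof (cases "r \<in> {0<..R}")
        case True
        then have "(w, r) \<in> space (predictable M)" using w by simp
        then have "(\<integral>\<^sup>+ y. indicator (\<Union>i. f i) ((w, r), y) \<partial>left_intensity M (w, r))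
            = (\<Sum>i. \<integral>\<^sup>+ y. indicator (f i) ((w, r), y) \<partial>left_intensity M (w, r))"
          unfolding suminf_ind
          by (intro nn_integral_suminf left_intensity_section borel_measurable_indicator f)
        then show ?thesis using True by simp
      qed simp
      then show "(\<Sum>i. compensator M R (indicator (f i)) w) = compensator M R (indicator (\<Union>i. f i)) w"
        unfolding compensator_def
        by (simp only:) (rule nn_integral_suminf[symmetric], rule path_left_intensity_measurable[OF borel_measurable_indicator[OF f] w])
    qed
    finally show ?case .
  qed
qed

text \<open>
  From indicators to nonnegative functions by linearity and monotone convergence.
\<close>

theorem jump_sum_compensator:
  assumes S: "(x, a) \<in> space (age_state_space M)" and R: "0 \<le> R"
    and H: "H \<in> borel_measurable marked_predictable"
  shows "(\<integral>\<^sup>+ w. jump_sum M {0<..R} H w \<partial>law M x a) = (\<integral>\<^sup>+ w. compensator M R H w \<partial>law M x a)"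
  using H
proof (induction rule: borel_measurable_induct)
  case (cong f g)
  have "(\<integral>\<^sup>+ w. jump_sum M {0<..R} f w \<partial>law M x a) = (\<integral>\<^sup>+ w. jump_sum M {0<..R} g w \<partial>law M x a)"
    using cong(3) by (intro nn_integral_cong jump_sum_cong) (auto simp: law_space[OF S] space_pair_measure)
  moreover have "(\<integral>\<^sup>+ w. compensator M R f w \<partial>law M x a) = (\<integral>\<^sup>+ w. compensator M R g w \<partial>law M x a)"
    using cong(3) by (intro nn_integral_cong compensator_cong) (auto simp: law_space[OF S] space_pair_measure)
  ultimately show ?case using cong.IH by simp
next
  case (set A)
  then show ?case by (rule jump_sum_compensator_indicator[OF S R])
next
  case (mult u c)
  have "(\<integral>\<^sup>+ w. jump_sum M {0<..R} (\<lambda>z. c * u z) w \<partial>law M x a) = (\<integral>\<^sup>+ w. c * jump_sum M {0<..R} u w \<partial>law M x a)"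
    by (simp add: jump_sum_def sum_distrib_left)
  also have "\<dots> = (\<integral>\<^sup>+ w. c * compensator M R u w \<partial>law M x a)"
    using mult measurable_law_generated[OF S jump_sum_measurable[OF _ R]] measurable_law_generated[OF S compensator_measurable]
    by (simp add: nn_integral_cmult)
  also have "\<dots> = (\<integral>\<^sup>+ w. compensator M R (\<lambda>z. c * u z) w \<partial>law M x a)"
    using mult(2) by (intro nn_integral_cong) (simp add: compensator_cmult law_space[OF S])
  finally show ?case .
next
  case (add u v)
  have "(\<integral>\<^sup>+ w. jump_sum M {0<..R} (\<lambda>z. v z + u z) w \<partial>law M x a)
      = (\<integral>\<^sup>+ w. jump_sum M {0<..R} v w + jump_sum M {0<..R} u w \<partial>law M x a)"
    by (simp add: jump_sum_def sum.distrib)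
  also have "\<dots> = (\<integral>\<^sup>+ w. compensator M R v w + compensator M R u w \<partial>law M x a)"
    using add measurable_law_generated[OF S jump_sum_measurable[OF _ R]] measurable_law_generated[OF S compensator_measurable]
    by (simp add: nn_integral_add)
  also have "\<dots> = (\<integral>\<^sup>+ w. compensator M R (\<lambda>z. v z + u z) w \<partial>law M x a)"
    using add.hyps by (intro nn_integral_cong) (simp add: compensator_add law_space[OF S])
  finally show ?case .
next
  case (seq U)
  have "(\<integral>\<^sup>+ w. jump_sum M {0<..R} (SUP i. U i) w \<partial>law M x a) = (\<integral>\<^sup>+ w. (SUP i. jump_sum M {0<..R} (U i) w) \<partial>law M x a)"
    by (simp add: jump_sum_SUP[OF seq(3)])
  also have "\<dots> = (SUP i. \<integral>\<^sup>+ w. jump_sum M {0<..R} (U i) w \<partial>law M x a)"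
  proof (rule nn_integral_monotone_convergence_SUP)
    show "incseq (\<lambda>i w. jump_sum M {0<..R} (U i) w)"
      unfolding jump_sum_def
      by (intro incseq_SucI le_funI sum_mono le_funD[OF incseq_SucD[OF seq(3)]])
  qed (rule measurable_law_generated[OF S jump_sum_measurable[OF seq(1) R]])
  also have "\<dots> = (SUP i. \<integral>\<^sup>+ w. compensator M R (U i) w \<partial>law M x a)" by (simp add: seq.IH)
  also have "\<dots> = (\<integral>\<^sup>+ w. (SUP i. compensator M R (U i) w) \<partial>law M x a)"
  proof (rule nn_integral_monotone_convergence_SUP[symmetric])
    show "incseq (\<lambda>i w. compensator M R (U i) w)"
      unfolding compensator_def
      by (intro incseq_SucI le_funI nn_integral_mono mult_right_mono le_funD[OF incseq_SucD[OF seq(3)]]) simp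
  qed (rule measurable_law_generated[OF S compensator_measurable[OF seq(1)]])
  also have "\<dots> = (\<integral>\<^sup>+ w. compensator M R (SUP i. U i) w \<partial>law M x a)"
    by (intro nn_integral_cong) (simp add: compensator_SUP[OF seq(1,3)] law_space[OF S])
  finally show ?case .
qed

end

section \<open>Exponentials of finite variation\<close>

text \<open>
  The product extends over the points before \<open>s\<close> only; for \<open>J\<close> the jump times, this is the left
  limit at \<open>s\<close> of the exponential.
\<close>

definition jump_exp :: "(real \<Rightarrow> real) \<Rightarrow> (real \<Rightarrow> real) \<Rightarrow> real set \<Rightarrow> real \<Rightarrow> real" where
  "jump_exp \<beta> \<rho> J s = exp (LINT r:{0..s}|lborel. \<beta> r) * (\<Prod>\<sigma>\<in>J. if \<sigma> < s then \<rho> \<sigma> else 1)"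

lemma jump_exp_integrable:
  assumes \<beta> [measurable]: "\<beta> \<in> borel_measurable borel" and B: "\<And>r. \<bar>\<beta> r\<bar> \<le> B" and J: "finite J"
  shows "set_integrable lborel {0..R} (\<lambda>s. \<beta> s * jump_exp \<beta> \<rho> J s)"
proof (rule set_integrable_bounded_interval[where B="B * (exp (B * R) * (\<Prod>\<sigma>\<in>J. max 1 \<bar>\<rho> \<sigma>\<bar>))"])
  have [measurable]: "(\<lambda>s. LINT r:{0..s}|lborel. \<beta> r) \<in> borel_measurable borel"
    by (rule borel_measurable_indefinite_integral[OF \<beta>])
  show "(\<lambda>s. \<beta> s * jump_exp \<beta> \<rho> J s) \<in> borel_measurable borel"
    unfolding jump_exp_def by measurable
  fix s :: real assume s: "0 \<le> s" "s \<le> R"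
  have B0: "0 \<le> B" using B[of 0] by linarith
  have "\<bar>LINT r:{0<..s}|lborel. \<beta> r\<bar> \<le> B * (s - 0)" using B B0 s by (intro abs_set_integral_le) auto
  also have "\<dots> \<le> B * R" using s B0 by (intro mult_left_mono) auto
  finally have "(LINT r:{0..s}|lborel. \<beta> r) \<le> B * R" by (simp add: set_integral_endpoints(1))
  moreover have "\<bar>\<Prod>\<sigma>\<in>J. if \<sigma> < s then \<rho> \<sigma> else 1\<bar> \<le> (\<Prod>\<sigma>\<in>J. max 1 \<bar>\<rho> \<sigma>\<bar>)"
    unfolding abs_prod by (intro prod_mono) auto
  ultimately show "\<bar>\<beta> s * jump_exp \<beta> \<rho> J s\<bar> \<le> B * (exp (B * R) * (\<Prod>\<sigma>\<in>J. max 1 \<bar>\<rho> \<sigma>\<bar>))"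
    unfolding jump_exp_def abs_mult using B[of s] B0 by (intro mult_mono) auto
qed auto

text \<open>
  The equation \<open>dL = L\<^sub>- (\<beta> ds + \<Sum> (\<rho> - 1) \<delta>\<^bsub>\<sigma>\<^esub>)\<close> of the exponential of a path of finite variation.
  The proof adds the largest point \<open>b\<close> of \<open>J\<close>: up to \<open>b\<close> nothing changes, and after \<open>b\<close> all
  terms are multiplied by \<open>\<rho> b\<close>.
\<close>

lemma jump_exp_formula:
  assumes \<beta>: "\<beta> \<in> borel_measurable borel" and B: "\<And>r. \<bar>\<beta> r\<bar> \<le> B"
    and "finite J" "0 \<le> R" "J \<subseteq> {0<..R}"
  shows "exp (LINT r:{0..R}|lborel. \<beta> r) * (\<Prod>\<sigma>\<in>J. \<rho> \<sigma>)
    = 1 + (LINT s:{0..R}|lborel. \<beta> s * jump_exp \<beta> \<rho> J s) + (\<Sum>\<tau>\<in>J. jump_exp \<beta> \<rho> J \<tau> * (\<rho> \<tau> - 1))"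
  using assms(3-5)
proof (induction J arbitrary: R rule: finite_linorder_max_induct)
  case empty
  then show ?case using exp_set_integral[OF \<beta> B] by (simp add: jump_exp_def)
next
  case (insert b A)
  define I where "I s = (LINT r:{0..s}|lborel. \<beta> r)" for s
  let ?h = "\<lambda>s. \<beta> s * jump_exp \<beta> \<rho> A s"
  have b: "0 < b" "b \<le> R" "b \<notin> A" using insert by auto
  have A: "A \<subseteq> {0<..b}" "A \<subseteq> {0<..R}"
  proof -
    show "A \<subseteq> {0<..R}" using insert.prems by blast
    then show "A \<subseteq> {0<..b}" using insert.hyps(2) by (meson greaterThanAtMost_iff less_imp_le subset_iff)
  qed
  have IHb: "exp (I b) * (\<Prod>\<sigma>\<in>A. \<rho> \<sigma>) = 1 + (LINT s:{0..b}|lborel. ?h s) + (\<Sum>\<tau>\<in>A. jump_exp \<beta> \<rho> A \<tau> * (\<rho> \<tau> - 1))"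
    unfolding I_def using insert.IH[OF _ A(1)] b by simp
  have IHR: "exp (I R) * (\<Prod>\<sigma>\<in>A. \<rho> \<sigma>) = 1 + (LINT s:{0..R}|lborel. ?h s) + (\<Sum>\<tau>\<in>A. jump_exp \<beta> \<rho> A \<tau> * (\<rho> \<tau> - 1))"
    unfolding I_def using insert.IH[OF insert.prems(1) A(2)] .
  have before: "jump_exp \<beta> \<rho> (insert b A) s = jump_exp \<beta> \<rho> A s" if "s \<le> b" for s
    using that insert.hyps(1) b by (simp add: jump_exp_def)
  have after: "jump_exp \<beta> \<rho> (insert b A) s = \<rho> b * jump_exp \<beta> \<rho> A s" if "b < s" for s
    using that insert.hyps(1) b by (simp add: jump_exp_def)
  have at: "jump_exp \<beta> \<rho> A b = exp (I b) * (\<Prod>\<sigma>\<in>A. \<rho> \<sigma>)"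
    using insert.hyps(2) by (simp add: jump_exp_def I_def)
  have split: "(LINT s:{0..R}|lborel. \<beta> s * jump_exp \<beta> \<rho> (insert b A) s)
      = (LINT s:{0..b}|lborel. ?h s) + \<rho> b * (LINT s:{b<..R}|lborel. ?h s)"
  proof -
    have "(LINT s:{0..R}|lborel. \<beta> s * jump_exp \<beta> \<rho> (insert b A) s)
        = (LINT s:{0..b}|lborel. \<beta> s * jump_exp \<beta> \<rho> (insert b A) s) + (LINT s:{b<..R}|lborel. \<beta> s * jump_exp \<beta> \<rho> (insert b A) s)"
      using b by (intro set_integral_Icc_split jump_exp_integrable[OF \<beta> B]) (auto simp: insert.hyps(1))
    also have "(LINT s:{0..b}|lborel. \<beta> s * jump_exp \<beta> \<rho> (insert b A) s) = (LINT s:{0..b}|lborel. ?h s)"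
      unfolding set_lebesgue_integral_def
      by (intro Bochner_Integration.integral_cong refl) (simp add: indicator_def before)
    also have "(LINT s:{b<..R}|lborel. \<beta> s * jump_exp \<beta> \<rho> (insert b A) s) = (LINT s:{b<..R}|lborel. \<rho> b * ?h s)"
      unfolding set_lebesgue_integral_def
      by (intro Bochner_Integration.integral_cong refl) (simp add: indicator_def after)
    finally show ?thesis by simp
  qed
  have whole: "(LINT s:{0..R}|lborel. ?h s) = (LINT s:{0..b}|lborel. ?h s) + (LINT s:{b<..R}|lborel. ?h s)"
    using b by (intro set_integral_Icc_split jump_exp_integrable[OF \<beta> B]) (auto simp: insert.hyps(1))
  have sums: "(\<Sum>\<tau>\<in>insert b A. jump_exp \<beta> \<rho> (insert b A) \<tau> * (\<rho> \<tau> - 1))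
      = jump_exp \<beta> \<rho> A b * (\<rho> b - 1) + (\<Sum>\<tau>\<in>A. jump_exp \<beta> \<rho> A \<tau> * (\<rho> \<tau> - 1))"
    using insert.hyps(1,2) b by (simp add: before less_imp_le)
  have prod: "(\<Prod>\<sigma>\<in>insert b A. \<rho> \<sigma>) = \<rho> b * (\<Prod>\<sigma>\<in>A. \<rho> \<sigma>)" using insert.hyps(1) b by simp
  have "exp (I R) * (\<Prod>\<sigma>\<in>A. \<rho> \<sigma>) = exp (I b) * (\<Prod>\<sigma>\<in>A. \<rho> \<sigma>) + (LINT s:{b<..R}|lborel. ?h s)"
    unfolding IHb IHR whole by simp
  then have "\<rho> b * (exp (I R) * (\<Prod>\<sigma>\<in>A. \<rho> \<sigma>)) = \<rho> b * jump_exp \<beta> \<rho> A b + \<rho> b * (LINT s:{b<..R}|lborel. ?h s)"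
    unfolding at by (simp add: distrib_left)
  then show ?case
    unfolding split sums prod I_def[symmetric] using IHb unfolding at[symmetric] by (simp add: algebra_simps)
qed

section \<open>The density of a change of intensity\<close>

context semi_markov
begin

lemma powr_count_integrable:
  assumes S: "(x, a) \<in> space (age_state_space M)" and "0 \<le> R" "1 \<le> \<kappa>"
  shows "integrable (law M x a) (\<lambda>w. \<kappa> powr landing_count M UNIV 0 R w)"
proof -
  have m: "(\<lambda>w. \<kappa> powr landing_count M UNIV 0 R w) \<in> borel_measurable (law M x a)"
    using measurable_law[OF S landing_count_measurable[OF target_UNIV order_refl order_refl, of R]] by measurable
  interpret prob_space "law M x a" using S by (rule law_prob)
  show ?thesis
  proof (cases "R = 0")
    case True
    then show ?thesis using assms by (simp add: landing_count_def)
  next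
    case False
    with assms have "0 < R" by simp
    show ?thesis
    proof (rule integrableI_nonneg[OF m])
      show "(\<integral>\<^sup>+ w. ennreal (\<kappa> powr landing_count M UNIV 0 R w) \<partial>law M x a) < \<infinity>"
        using exponential_moment[OF S order_refl \<open>0 < R\<close> assms(3)] by (rule le_less_trans) simp
    qed (use assms in simp)
  qed
qed

text \<open>
  The compensator of a real integrand, as a Bochner integral. It has the default value \<open>0\<close> where
  this integral does not exist.
\<close>

definition comp_int :: "real \<Rightarrow> (('w \<times> real) \<times> 'k \<Rightarrow> real) \<Rightarrow> 'w \<Rightarrow> real" where
  "comp_int R H w = (LINT r:{0<..R}|lborel. (LINT y|left_intensity M (w, r). H ((w, r), y)))"

lemma comp_int_measurable:
  assumes "H \<in> borel_measurable marked_predictable"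
  shows "comp_int R H \<in> borel_measurable (generated_by_times M {0..})"
  unfolding comp_int_def[abs_def]
  by (rule path_integral_measurable[OF integral_left_intensity_predictable[OF assms]]) auto

lemma left_intensity_integrable:
  fixes H :: "('w \<times> real) \<times> 'k \<Rightarrow> real"
  assumes H: "H \<in> borel_measurable marked_predictable" and z: "z \<in> space (predictable M)"
    and G: "\<And>y. y \<in> space (state_space M) \<Longrightarrow> \<bar>H (z, y)\<bar> \<le> G"
  shows "integrable (left_intensity M z) (\<lambda>y. H (z, y))"
  by (rule finite_measure.integrable_const_bound[OF left_intensity_finite[OF z], where B=G])
    (use left_intensity_section[OF H z] G in \<open>auto simp: space_left_intensity[OF z]\<close>)

lemma left_intensity_integral_le:
  fixes H :: "('w \<times> real) \<times> 'k \<Rightarrow> real"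
  assumes z: "z \<in> space (predictable M)" and G: "\<And>y. y \<in> space (state_space M) \<Longrightarrow> \<bar>H (z, y)\<bar> \<le> G" and G0: "0 \<le> G"
  shows "\<bar>LINT y|left_intensity M z. H (z, y)\<bar> \<le> rate_sup * G"
proof -
  interpret finite_measure "left_intensity M z" by (rule left_intensity_finite[OF z])
  have "\<bar>LINT y|left_intensity M z. H (z, y)\<bar> \<le> (LINT y|left_intensity M z. \<bar>H (z, y)\<bar>)" by (rule integral_abs_bound)
  also have "\<dots> \<le> (LINT y|left_intensity M z. G)"
    using G G0 by (intro integral_mono') (auto simp: space_left_intensity[OF z])
  also have "\<dots> = measure (left_intensity M z) (space (left_intensity M z)) * G" by simp
  also have "\<dots> \<le> rate_sup * G" using left_intensity_measure_bounds[OF z] G0 by (intro mult_right_mono)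
  finally show ?thesis .
qed

lemma path_integral_left_intensity_measurable:
  fixes H :: "('w \<times> real) \<times> 'k \<Rightarrow> real"
  assumes H: "H \<in> borel_measurable marked_predictable" and w: "w \<in> sample_space M"
  shows "(\<lambda>r. LINT y|left_intensity M (w, max 0 r). H ((w, max 0 r), y)) \<in> borel_measurable borel"
  by (rule path_section_measurable[OF integral_left_intensity_predictable[OF H] w])

lemma set_integrable_clamp:
  fixes f :: "real \<Rightarrow> real"
  assumes "set_integrable lborel I (\<lambda>r. f (max 0 r))" "I \<subseteq> {0..}"
  shows "set_integrable lborel I f"
  using assms(1) unfolding set_integrable_def
  by (rule Bochner_Integration.integrable_cong[OF refl, THEN iffD1, rotated]) (use assms(2) in \<open>auto simp: indicator_def max_def\<close>)

lemma left_intensity_path_integrable: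
  fixes H :: "('w \<times> real) \<times> 'k \<Rightarrow> real"
  assumes H: "H \<in> borel_measurable marked_predictable" and w: "w \<in> sample_space M"
    and G: "\<And>r y. 0 < r \<Longrightarrow> r \<le> R \<Longrightarrow> y \<in> space (state_space M) \<Longrightarrow> \<bar>H ((w, r), y)\<bar> \<le> G" and G0: "0 \<le> G"
  shows "set_integrable lborel {0<..R} (\<lambda>r. LINT y|left_intensity M (w, r). H ((w, r), y))"
proof (rule set_integrable_clamp)
  have m: "(\<lambda>r. indicator {0<..R} r * (LINT y|left_intensity M (w, max 0 r). H ((w, max 0 r), y))) \<in> borel_measurable borel"
    using path_integral_left_intensity_measurable[OF H w] by measurable
  have "set_integrable lborel {0<..R} (\<lambda>r. indicator {0<..R} r * (LINT y|left_intensity M (w, max 0 r). H ((w, max 0 r), y)))"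
  proof (rule set_integrable_bounded_interval[OF m, of 0 R "rate_sup * G"])
    fix r :: real
    show "\<bar>indicator {0<..R} r * (LINT y|left_intensity M (w, max 0 r). H ((w, max 0 r), y))\<bar> \<le> rate_sup * G"
    proof (cases "r \<in> {0<..R}")
      case True
      then have "\<bar>LINT y|left_intensity M (w, r). H ((w, r), y)\<bar> \<le> rate_sup * G"
        using w G by (intro left_intensity_integral_le G0) auto
      then show ?thesis using True by (simp add: max_def)
    qed (use rate_sup_nonneg G0 in simp)
  qed auto
  then show "set_integrable lborel {0<..R} (\<lambda>r. LINT y|left_intensity M (w, max 0 r). H ((w, max 0 r), y))"
    unfolding set_integrable_def
    by (rule Bochner_Integration.integrable_cong[OF refl, THEN iffD1, rotated]) (simp add: indicator_def)
qed auto

lemma compensator_eq_comp_int: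
  fixes H :: "('w \<times> real) \<times> 'k \<Rightarrow> real"
  assumes H: "H \<in> borel_measurable marked_predictable" and w: "w \<in> sample_space M"
    and G: "\<And>r y. 0 < r \<Longrightarrow> r \<le> R \<Longrightarrow> y \<in> space (state_space M) \<Longrightarrow> 0 \<le> H ((w, r), y) \<and> H ((w, r), y) \<le> G"
    and G0: "0 \<le> G"
  shows "compensator M R (\<lambda>z. ennreal (H z)) w = ennreal (comp_int R H w)" "0 \<le> comp_int R H w"
proof -
  have z: "(w, r) \<in> space (predictable M)" if "r \<in> {0<..R}" for r using that w by simp
  have inner: "0 \<le> (LINT y|left_intensity M (w, r). H ((w, r), y))" if "r \<in> {0<..R}" for r
    using that G by (intro Bochner_Integration.integral_nonneg) (auto simp: space_left_intensity[OF z[OF that]])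
  have "compensator M R (\<lambda>z. ennreal (H z)) w
      = (\<integral>\<^sup>+ r. ennreal (indicator {0<..R} r *\<^sub>R (LINT y|left_intensity M (w, r). H ((w, r), y))) \<partial>lborel)"
    unfolding compensator_def
  proof (intro nn_integral_cong)
    fix r
    show "(\<integral>\<^sup>+ y. ennreal (H ((w, r), y)) \<partial>left_intensity M (w, r)) * indicator {0<..R} r
        = ennreal (indicator {0<..R} r *\<^sub>R (LINT y|left_intensity M (w, r). H ((w, r), y)))"
    proof (cases "r \<in> {0<..R}")
      case True
      have "integrable (left_intensity M (w, r)) (\<lambda>y. H ((w, r), y))"
        using True G by (intro left_intensity_integrable[OF H z, of r G]) auto
      then have "(\<integral>\<^sup>+ y. ennreal (H ((w, r), y)) \<partial>left_intensity M (w, r)) = ennreal (LINT y|left_intensity M (w, r). H ((w, r), y))"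
        using True G by (intro nn_integral_eq_integral AE_I2) (auto simp: space_left_intensity[OF z[OF True]])
      then show ?thesis using True by simp
    qed simp
  qed
  also have "\<dots> = ennreal (LINT r|lborel. indicator {0<..R} r *\<^sub>R (LINT y|left_intensity M (w, r). H ((w, r), y)))"
  proof (rule nn_integral_eq_integral)
    have "set_integrable lborel {0<..R} (\<lambda>r. LINT y|left_intensity M (w, r). H ((w, r), y))"
      by (rule left_intensity_path_integrable[OF H w, of R G]) (use G G0 in auto)
    then show "integrable lborel (\<lambda>r. indicator {0<..R} r *\<^sub>R (LINT y|left_intensity M (w, r). H ((w, r), y)))"
      unfolding set_integrable_def .
  qed (use inner in \<open>auto simp: indicator_def\<close>)
  finally show "compensator M R (\<lambda>z. ennreal (H z)) w = ennreal (comp_int R H w)"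
    unfolding comp_int_def set_lebesgue_integral_def .
  show "0 \<le> comp_int R H w" unfolding comp_int_def set_lebesgue_integral_def
    using inner by (intro Bochner_Integration.integral_nonneg) (auto simp: indicator_def)
qed

lemma comp_int_le:
  fixes H :: "('w \<times> real) \<times> 'k \<Rightarrow> real"
  assumes w: "w \<in> sample_space M" and R: "0 \<le> R"
    and G: "\<And>r y. 0 < r \<Longrightarrow> r \<le> R \<Longrightarrow> y \<in> space (state_space M) \<Longrightarrow> \<bar>H ((w, r), y)\<bar> \<le> G" and G0: "0 \<le> G"
  shows "\<bar>comp_int R H w\<bar> \<le> rate_sup * G * R"
proof -
  have "\<bar>comp_int R H w\<bar> \<le> rate_sup * G * (R - 0)"
    unfolding comp_int_def
    using w R rate_sup_nonneg G0 by (intro abs_set_integral_le left_intensity_integral_le G G0) auto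
  then show ?thesis by simp
qed

text \<open>
  The bound \<open>G\<close> may depend on the path, since the density processes below are bounded by an
  exponential of the number of jumps only.
\<close>

lemma jump_sum_comp_int:
  fixes H :: "('w \<times> real) \<times> 'k \<Rightarrow> real"
  assumes S: "(x, a) \<in> space (age_state_space M)" and R: "0 \<le> R"
    and H [measurable]: "H \<in> borel_measurable marked_predictable"
    and G: "\<And>w r y. w \<in> sample_space M \<Longrightarrow> 0 < r \<Longrightarrow> r \<le> R \<Longrightarrow> y \<in> space (state_space M) \<Longrightarrow>
      0 \<le> H ((w, r), y) \<and> H ((w, r), y) \<le> G w"
    and G0: "\<And>w. w \<in> sample_space M \<Longrightarrow> 0 \<le> G w" and Gi: "integrable (law M x a) G"
  shows "integrable (law M x a) (jump_sum M {0<..R} H)" "integrable (law M x a) (comp_int R H)"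
    "(LINT w|law M x a. jump_sum M {0<..R} H w) = (LINT w|law M x a. comp_int R H w)"
proof -
  define P where "P = law M x a"
  have spP: "space P = sample_space M" unfolding P_def using S by (rule law_space)
  have jm: "jump_sum M {0<..R} H \<in> borel_measurable P" and cm: "comp_int R H \<in> borel_measurable P"
    unfolding P_def by (auto intro!: measurable_law_generated[OF S] jump_sum_measurable_real comp_int_measurable H R)
  have js: "jump_sum M {0<..R} (\<lambda>z. ennreal (H z)) w = ennreal (jump_sum M {0<..R} H w)" "0 \<le> jump_sum M {0<..R} H w"
    if w: "w \<in> sample_space M" for w
    unfolding jump_sum_def using G[OF w] state_in_space[OF w]
    by (auto intro!: sum_ennreal sum_nonneg)
  have ci: "compensator M R (\<lambda>z. ennreal (H z)) w = ennreal (comp_int R H w)" "0 \<le> comp_int R H w"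
    if w: "w \<in> sample_space M" for w
    using compensator_eq_comp_int[OF H w, of R "G w"] G[OF w] G0[OF w] by auto
  show ic: "integrable (law M x a) (comp_int R H)"
    unfolding P_def[symmetric]
  proof (rule Bochner_Integration.integrable_bound)
    show "integrable P (\<lambda>w. rate_sup * G w * R)" using Gi by (simp add: P_def)
    show "AE w in P. norm (comp_int R H w) \<le> norm (rate_sup * G w * R)"
    proof (rule AE_I2)
      fix w assume "w \<in> space P"
      then have w: "w \<in> sample_space M" by (simp add: spP)
      have "\<bar>comp_int R H w\<bar> \<le> rate_sup * G w * R" using G[OF w] by (intro comp_int_le w R G0) auto
      then show "norm (comp_int R H w) \<le> norm (rate_sup * G w * R)" by simp
    qed
  qed (rule cm)
  have eq: "(\<integral>\<^sup>+ w. ennreal (jump_sum M {0<..R} H w) \<partial>P) = (\<integral>\<^sup>+ w. ennreal (comp_int R H w) \<partial>P)"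
  proof -
    have "(\<integral>\<^sup>+ w. ennreal (jump_sum M {0<..R} H w) \<partial>P) = (\<integral>\<^sup>+ w. jump_sum M {0<..R} (\<lambda>z. ennreal (H z)) w \<partial>P)"
      by (intro nn_integral_cong) (simp add: js spP)
    also have "\<dots> = (\<integral>\<^sup>+ w. compensator M R (\<lambda>z. ennreal (H z)) w \<partial>P)"
      unfolding P_def by (rule jump_sum_compensator[OF S R]) measurable
    also have "\<dots> = (\<integral>\<^sup>+ w. ennreal (comp_int R H w) \<partial>P)"
      by (intro nn_integral_cong) (simp add: ci spP)
    finally show ?thesis .
  qed
  also have "\<dots> = ennreal (LINT w|P. comp_int R H w)"
    using ic ci(2) by (intro nn_integral_eq_integral) (auto simp: P_def law_space[OF S])
  finally have nn: "(\<integral>\<^sup>+ w. ennreal (jump_sum M {0<..R} H w) \<partial>P) = ennreal (LINT w|P. comp_int R H w)" .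
  show ij: "integrable (law M x a) (jump_sum M {0<..R} H)"
    unfolding P_def[symmetric] by (rule integrableI_nonneg[OF jm]) (use nn js(2) spP in auto)
  show "(LINT w|law M x a. jump_sum M {0<..R} H w) = (LINT w|law M x a. comp_int R H w)"
    unfolding P_def[symmetric]
  proof -
    have "ennreal (LINT w|P. jump_sum M {0<..R} H w) = (\<integral>\<^sup>+ w. ennreal (jump_sum M {0<..R} H w) \<partial>P)"
      using ij js(2) unfolding P_def[symmetric]
      by (intro nn_integral_eq_integral[symmetric] AE_I2) (auto simp: spP)
    moreover have "0 \<le> (LINT w|P. jump_sum M {0<..R} H w)" "0 \<le> (LINT w|P. comp_int R H w)"
      using js(2) ci(2) by (auto intro!: Bochner_Integration.integral_nonneg simp: spP)
    ultimately show "(LINT w|P. jump_sum M {0<..R} H w) = (LINT w|P. comp_int R H w)"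
      using nn by simp
  qed
qed

definition drift :: "(('w \<times> real) \<times> 'k \<Rightarrow> real) \<Rightarrow> 'w \<times> real \<Rightarrow> real" where
  "drift \<rho> z = (LINT y|left_intensity M z. 1 - \<rho> (z, y))"

definition jump_density :: "real \<Rightarrow> (('w \<times> real) \<times> 'k \<Rightarrow> real) \<Rightarrow> 'w \<Rightarrow> real" where
  "jump_density R \<rho> w = exp (LINT r:{0..R}|lborel. drift \<rho> (w, r)) * (\<Prod>\<tau>\<in>jumps M w \<inter> {0<..R}. \<rho> ((w, \<tau>), state M \<tau> w))"

text \<open>
  The left limit of the density process; its predictability is what makes the compensator formula
  applicable.
\<close>

definition left_density :: "(('w \<times> real) \<times> 'k \<Rightarrow> real) \<Rightarrow> 'w \<times> real \<Rightarrow> real" where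
  "left_density \<rho> z = exp (LINT r:{0..snd z}|lborel. drift \<rho> (fst z, r))
     * (\<Prod>\<tau>\<in>jumps M (fst z) \<inter> {0<..<snd z}. \<rho> ((fst z, \<tau>), state M \<tau> (fst z)))"

context
  fixes \<rho> :: "('w \<times> real) \<times> 'k \<Rightarrow> real" and B :: real
  assumes \<rho>_measurable [measurable]: "\<rho> \<in> borel_measurable marked_predictable"
    and \<rho>_bounds: "\<And>z. 0 \<le> \<rho> z \<and> \<rho> z \<le> B" and B_ge_1: "1 \<le> B"
begin

lemma drift_measurable: "drift \<rho> \<in> borel_measurable (predictable M)"
  unfolding drift_def[abs_def]
  by (rule integral_left_intensity_predictable[of "\<lambda>z. 1 - \<rho> z"]) measurable

lemma drift_bound:
  assumes "z \<in> space (predictable M)" shows "\<bar>drift \<rho> z\<bar> \<le> rate_sup * B"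
  unfolding drift_def
proof (rule left_intensity_integral_le[OF assms])
  show "\<bar>1 - \<rho> (z, y)\<bar> \<le> B" for y using \<rho>_bounds[of "(z, y)"] B_ge_1 by linarith
qed (use B_ge_1 in simp)

lemma drift_path:
  assumes w: "w \<in> sample_space M"
  shows "(\<lambda>r. drift \<rho> (w, max 0 r)) \<in> borel_measurable borel" "\<bar>drift \<rho> (w, max 0 r)\<bar> \<le> rate_sup * B"
  using path_section_measurable[OF drift_measurable w] drift_bound[of "(w, max 0 r)"] w by auto

lemma drift_integral_clamp:
  "(LINT r:{0..s}|lborel. drift \<rho> (w, r)) = (LINT r:{0..s}|lborel. drift \<rho> (w, max 0 r))"
  unfolding set_lebesgue_integral_def
  by (intro Bochner_Integration.integral_cong refl) (auto simp: indicator_def max_def)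

lemma drift_integral_le:
  assumes w: "w \<in> sample_space M" and s: "0 \<le> s" "s \<le> R"
  shows "(LINT r:{0..s}|lborel. drift \<rho> (w, r)) \<le> rate_sup * B * R"
proof -
  have "\<bar>LINT r:{0<..s}|lborel. drift \<rho> (w, r)\<bar> \<le> rate_sup * B * (s - 0)"
    using w s rate_sup_nonneg B_ge_1 by (intro abs_set_integral_le drift_bound) auto
  also have "\<dots> \<le> rate_sup * B * R" using s rate_sup_nonneg B_ge_1 by (intro mult_left_mono) auto
  finally show ?thesis by (simp add: set_integral_endpoints(1))
qed

lemma prod_\<rho>_le:
  assumes w: "w \<in> sample_space M" and sub: "F \<subseteq> jumps M w \<inter> {0<..R}"
  shows "0 \<le> (\<Prod>\<tau>\<in>F. \<rho> ((w, \<tau>), state M \<tau> w))" "(\<Prod>\<tau>\<in>F. \<rho> ((w, \<tau>), state M \<tau> w)) \<le> B powr landing_count M UNIV 0 R w"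
proof -
  show "0 \<le> (\<Prod>\<tau>\<in>F. \<rho> ((w, \<tau>), state M \<tau> w))" using \<rho>_bounds by (intro prod_nonneg) auto
  have "(\<Prod>\<tau>\<in>F. \<rho> ((w, \<tau>), state M \<tau> w)) \<le> (\<Prod>\<tau>\<in>F. B)" using \<rho>_bounds by (intro prod_mono) auto
  also have "\<dots> = B ^ card F" by simp
  also have "\<dots> \<le> B ^ card (jumps M w \<inter> {0<..R})"
    using B_ge_1 card_mono[OF finite_jumps_Ioc[OF w] sub] by (intro power_increasing) auto
  finally show "(\<Prod>\<tau>\<in>F. \<rho> ((w, \<tau>), state M \<tau> w)) \<le> B powr landing_count M UNIV 0 R w"
    using B_ge_1 by (simp add: landing_count_UNIV powr_realpow)
qed

lemma left_density_bounds:
  assumes w: "w \<in> sample_space M" and s: "0 \<le> s" "s \<le> R"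
  shows "0 \<le> left_density \<rho> (w, s)" "left_density \<rho> (w, s) \<le> exp (rate_sup * B * R) * B powr landing_count M UNIV 0 R w"
proof -
  have sub: "jumps M w \<inter> {0<..<s} \<subseteq> jumps M w \<inter> {0<..R}" using s by auto
  show "0 \<le> left_density \<rho> (w, s)" using prod_\<rho>_le(1)[OF w sub] by (simp add: left_density_def)
  show "left_density \<rho> (w, s) \<le> exp (rate_sup * B * R) * B powr landing_count M UNIV 0 R w"
    unfolding left_density_def fst_conv snd_conv using prod_\<rho>_le[OF w sub] drift_integral_le[OF w s]
    by (intro mult_mono) auto
qed

lemma jump_density_bounds:
  assumes w: "w \<in> sample_space M" and R: "0 \<le> R"
  shows "0 \<le> jump_density R \<rho> w" "jump_density R \<rho> w \<le> exp (rate_sup * B * R) * B powr landing_count M UNIV 0 R w"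
proof -
  show "0 \<le> jump_density R \<rho> w" using prod_\<rho>_le(1)[OF w order_refl] by (simp add: jump_density_def)
  show "jump_density R \<rho> w \<le> exp (rate_sup * B * R) * B powr landing_count M UNIV 0 R w"
    unfolding jump_density_def using prod_\<rho>_le[OF w order_refl] drift_integral_le[OF w R order_refl]
    by (intro mult_mono) auto
qed

text \<open>
  This reduces the measurability of a product over the jumps to that of sums over the jumps; a
  vanishing factor is detected by counting.
\<close>

lemma prod_as_jump_sums:
  assumes "finite F" "\<And>\<tau>. \<tau> \<in> F \<Longrightarrow> 0 \<le> (q \<tau> :: real)"
  shows "(\<Prod>\<tau>\<in>F. q \<tau>) = (if (\<Sum>\<tau>\<in>F. indicator {0} (q \<tau>) :: real) = 0 then exp (\<Sum>\<tau>\<in>F. ln (q \<tau>)) else 0)"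
proof (cases "\<exists>\<tau>\<in>F. q \<tau> = 0")
  case True
  then have "(\<Prod>\<tau>\<in>F. q \<tau>) = 0" using assms(1) by (simp add: prod_zero_iff)
  moreover have "(\<Sum>\<tau>\<in>F. indicator {0} (q \<tau>) :: real) \<noteq> 0"
    using True assms(1) by (subst sum_nonneg_eq_0_iff) (auto simp: indicator_def)
  ultimately show ?thesis by simp
next
  case False
  then have pos: "0 < q \<tau>" if "\<tau> \<in> F" for \<tau> using assms(2)[OF that] that by force
  have "(\<Sum>\<tau>\<in>F. indicator {0} (q \<tau>) :: real) = 0" using False by (intro sum.neutral) auto
  moreover have "exp (\<Sum>\<tau>\<in>F. ln (q \<tau>)) = (\<Prod>\<tau>\<in>F. q \<tau>)"
    using pos by (simp add: exp_sum[OF assms(1)])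
  ultimately show ?thesis by simp
qed

lemma left_density_measurable: "left_density \<rho> \<in> borel_measurable (predictable M)"
proof -
  have e: "(\<lambda>z. exp (LINT r:{0..snd z}|lborel. drift \<rho> (fst z, r))) \<in> borel_measurable (predictable M)"
    using integral_past_predictable[OF drift_measurable] by (simp add: split_beta')
  have "(\<lambda>z. indicator {0} (\<rho> z) :: real) \<in> borel_measurable marked_predictable" by measurable
  from jump_sum_predictable_real[OF this]
  have m1: "(\<lambda>z. jump_sum M {0<..<snd z} (\<lambda>z. indicator {0} (\<rho> z)) (fst z) :: real) \<in> borel_measurable (predictable M)"
    by (simp add: split_beta')
  have "(\<lambda>z. ln (\<rho> z)) \<in> borel_measurable marked_predictable" by measurable
  from jump_sum_predictable_real[OF this]
  have m2: "(\<lambda>z. jump_sum M {0<..<snd z} (\<lambda>z. ln (\<rho> z)) (fst z)) \<in> borel_measurable (predictable M)"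
    by (simp add: split_beta')
  have "(\<lambda>z. exp (LINT r:{0..snd z}|lborel. drift \<rho> (fst z, r))
     * (if (jump_sum M {0<..<snd z} (\<lambda>z. indicator {0} (\<rho> z)) (fst z) :: real) = 0
        then exp (jump_sum M {0<..<snd z} (\<lambda>z. ln (\<rho> z)) (fst z)) else 0)) \<in> borel_measurable (predictable M)"
    using e m1 m2 by measurable
  then show ?thesis
  proof (rule measurable_cong[THEN iffD1, rotated])
    fix z assume "z \<in> space (predictable M)"
    then have "finite (jumps M (fst z) \<inter> {0<..<snd z})" by (auto intro: finite_jumps_Ioo)
    from prod_as_jump_sums[OF this, of "\<lambda>\<tau>. \<rho> ((fst z, \<tau>), state M \<tau> (fst z))"] \<rho>_bounds
    show "exp (LINT r:{0..snd z}|lborel. drift \<rho> (fst z, r))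
     * (if (jump_sum M {0<..<snd z} (\<lambda>z. indicator {0} (\<rho> z)) (fst z) :: real) = 0
        then exp (jump_sum M {0<..<snd z} (\<lambda>z. ln (\<rho> z)) (fst z)) else 0) = left_density \<rho> z"
      unfolding left_density_def jump_sum_def by simp
  qed
qed

text \<open>
  Path by path, the density satisfies \<open>L = 1 + \<integral> L\<^sub>- (\<rho> - 1) (dp - d\<kappa>)\<close>.
\<close>

lemma jump_density_formula:
  assumes w: "w \<in> sample_space M" and R: "0 \<le> R"
  defines "H1 \<equiv> \<lambda>z. left_density \<rho> (fst z) * \<rho> z" and "H2 \<equiv> \<lambda>z :: ('w \<times> real) \<times> 'k. left_density \<rho> (fst z)"
  shows "jump_density R \<rho> w = 1 + (comp_int R H2 w - comp_int R H1 w) + (jump_sum M {0<..R} H1 w - jump_sum M {0<..R} H2 w)"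
proof -
  define \<beta> where "\<beta> r = drift \<rho> (w, max 0 r)" for r
  define q where "q \<tau> = \<rho> ((w, \<tau>), state M \<tau> w)" for \<tau>
  define J where "J = jumps M w \<inter> {0<..R}"
  have \<beta>: "\<beta> \<in> borel_measurable borel" "\<And>r. \<bar>\<beta> r\<bar> \<le> rate_sup * B"
    unfolding \<beta>_def[abs_def] using drift_path[OF w] by auto
  have J: "finite J" "J \<subseteq> {0<..R}" unfolding J_def using finite_jumps_Ioc[OF w] by auto
  have ld: "jump_exp \<beta> q J s = left_density \<rho> (w, s)" if s: "0 \<le> s" "s \<le> R" for s
  proof -
    have "(\<Prod>\<sigma>\<in>J. if \<sigma> < s then q \<sigma> else 1) = (\<Prod>\<sigma>\<in>jumps M w \<inter> {0<..<s}. q \<sigma>)"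
      using s by (intro prod.mono_neutral_cong_right J) (auto simp: J_def)
    then show ?thesis unfolding jump_exp_def left_density_def \<beta>_def q_def by (simp add: drift_integral_clamp[symmetric])
  qed
  have m1: "H1 \<in> borel_measurable marked_predictable" and m2: "H2 \<in> borel_measurable marked_predictable"
    unfolding H1_def H2_def using left_density_measurable by measurable
  let ?c = "exp (rate_sup * B * R) * B powr landing_count M UNIV 0 R w"
  have c0: "0 \<le> ?c" by simp
  have b2: "\<bar>H2 ((w, r), y)\<bar> \<le> ?c * B" and b1: "\<bar>H1 ((w, r), y)\<bar> \<le> ?c * B" if "0 < r" "r \<le> R" for r y
  proof -
    have l: "0 \<le> left_density \<rho> (w, r)" "left_density \<rho> (w, r) \<le> ?c"
      using left_density_bounds[OF w, of r R] that by auto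
    show "\<bar>H1 ((w, r), y)\<bar> \<le> ?c * B"
      unfolding H1_def abs_mult using l \<rho>_bounds[of "((w, r), y)"] c0 by (intro mult_mono) auto
    have "?c * 1 \<le> ?c * B" using B_ge_1 by (intro mult_left_mono) auto
    then have "left_density \<rho> (w, r) \<le> ?c * B" using l(2) by linarith
    then show "\<bar>H2 ((w, r), y)\<bar> \<le> ?c * B" using l(1) by (simp only: H2_def fst_conv abs_of_nonneg)
  qed
  have cB: "0 \<le> ?c * B" using B_ge_1 by simp
  have "(LINT s:{0..R}|lborel. \<beta> s * jump_exp \<beta> q J s)
      = (LINT s:{0<..R}|lborel. (LINT y|left_intensity M (w, s). H2 ((w, s), y)) - (LINT y|left_intensity M (w, s). H1 ((w, s), y)))"
    unfolding set_integral_endpoints(1)[symmetric] unfolding set_lebesgue_integral_def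
  proof (intro Bochner_Integration.integral_cong refl)
    fix s
    show "indicator {0<..R} s *\<^sub>R (\<beta> s * jump_exp \<beta> q J s)
       = indicator {0<..R} s *\<^sub>R ((LINT y|left_intensity M (w, s). H2 ((w, s), y)) - (LINT y|left_intensity M (w, s). H1 ((w, s), y)))"
    proof (cases "s \<in> {0<..R}")
      case True
      then have s: "0 < s" "s \<le> R" and z: "(w, s) \<in> space (predictable M)" using w by auto
      have "(LINT y|left_intensity M (w, s). H2 ((w, s), y)) - (LINT y|left_intensity M (w, s). H1 ((w, s), y))
          = (LINT y|left_intensity M (w, s). H2 ((w, s), y) - H1 ((w, s), y))"
        by (rule Bochner_Integration.integral_diff[symmetric])
          (rule left_intensity_integrable[OF m2 z b2[OF s]] left_intensity_integrable[OF m1 z b1[OF s]])+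
      also have "\<dots> = (LINT y|left_intensity M (w, s). left_density \<rho> (w, s) * (1 - \<rho> ((w, s), y)))"
        by (intro Bochner_Integration.integral_cong refl) (simp add: H1_def H2_def algebra_simps)
      also have "\<dots> = left_density \<rho> (w, s) * drift \<rho> (w, s)" unfolding drift_def by simp
      finally show ?thesis using s ld[of s] by (simp add: \<beta>_def max_def)
    qed simp
  qed
  also have "\<dots> = comp_int R H2 w - comp_int R H1 w"
    unfolding comp_int_def
    by (intro set_integral_diff left_intensity_path_integrable[OF m1 w _ cB] left_intensity_path_integrable[OF m2 w _ cB] b1 b2)
  finally have int: "(LINT s:{0..R}|lborel. \<beta> s * jump_exp \<beta> q J s) = comp_int R H2 w - comp_int R H1 w" .
  have sum: "(\<Sum>\<tau>\<in>J. jump_exp \<beta> q J \<tau> * (q \<tau> - 1)) = jump_sum M {0<..R} H1 w - jump_sum M {0<..R} H2 w"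
    unfolding jump_sum_def sum_subtractf[symmetric] J_def[symmetric]
  proof (intro sum.cong refl)
    fix \<tau> assume "\<tau> \<in> J"
    then have "jump_exp \<beta> q J \<tau> = left_density \<rho> (w, \<tau>)" using J by (intro ld) auto
    then show "jump_exp \<beta> q J \<tau> * (q \<tau> - 1) = H1 ((w, \<tau>), state M \<tau> w) - H2 ((w, \<tau>), state M \<tau> w)"
      by (simp add: H1_def H2_def q_def algebra_simps)
  qed
  have "jump_density R \<rho> w = exp (LINT r:{0..R}|lborel. \<beta> r) * (\<Prod>\<sigma>\<in>J. q \<sigma>)"
    unfolding jump_density_def J_def q_def \<beta>_def drift_integral_clamp[symmetric] ..
  also have "\<dots> = 1 + (LINT s:{0..R}|lborel. \<beta> s * jump_exp \<beta> q J s) + (\<Sum>\<tau>\<in>J. jump_exp \<beta> q J \<tau> * (q \<tau> - 1))"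
    by (rule jump_exp_formula[OF \<beta> J(1) R J(2)])
  finally show ?thesis unfolding int sum .
qed

lemma jump_density_measurable:
  assumes S: "(x, a) \<in> space (age_state_space M)" and R: "0 \<le> R"
  shows "jump_density R \<rho> \<in> borel_measurable (law M x a)"
proof -
  have [measurable]: "left_density \<rho> \<in> borel_measurable (predictable M)" by (rule left_density_measurable)
  have "(\<lambda>w. 1 + (comp_int R (\<lambda>z. left_density \<rho> (fst z)) w - comp_int R (\<lambda>z. left_density \<rho> (fst z) * \<rho> z) w)
    + (jump_sum M {0<..R} (\<lambda>z. left_density \<rho> (fst z) * \<rho> z) w - jump_sum M {0<..R} (\<lambda>z. left_density \<rho> (fst z)) w))
    \<in> borel_measurable (law M x a)"
    by (intro borel_measurable_add borel_measurable_diff borel_measurable_const measurable_law_generated[OF S]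
        comp_int_measurable jump_sum_measurable_real R) measurable
  then show ?thesis
    by (rule measurable_cong[THEN iffD1, rotated]) (simp add: jump_density_formula[OF _ R] law_space[OF S])
qed

text \<open>
  In \<open>jump_density_formula\<close> each sum over jumps has the expectation of the corresponding
  compensator, so that all terms but \<open>1\<close> cancel.
\<close>

lemma jump_density_expectation:
  assumes S: "(x, a) \<in> space (age_state_space M)" and R: "0 \<le> R"
  shows "integrable (law M x a) (jump_density R \<rho>)" "(LINT w|law M x a. jump_density R \<rho> w) = 1"
proof -
  interpret prob_space "law M x a" using S by (rule law_prob)
  have [measurable]: "left_density \<rho> \<in> borel_measurable (predictable M)" by (rule left_density_measurable)
  let ?H1 = "\<lambda>z. left_density \<rho> (fst z) * \<rho> z" and ?H2 = "\<lambda>z :: ('w \<times> real) \<times> 'k. left_density \<rho> (fst z)"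
  let ?G = "\<lambda>w. exp (rate_sup * B * R) * B powr landing_count M UNIV 0 R w * B"
  have G: "integrable (law M x a) ?G" using powr_count_integrable[OF S R B_ge_1] by simp
  have G0: "0 \<le> ?G w" for w using B_ge_1 by simp
  have b: "0 \<le> ?H1 ((w, r), y) \<and> ?H1 ((w, r), y) \<le> ?G w" "0 \<le> ?H2 ((w, r), y) \<and> ?H2 ((w, r), y) \<le> ?G w"
    if w: "w \<in> sample_space M" and r: "0 < r" "r \<le> R" for w r y
  proof -
    have l: "0 \<le> left_density \<rho> (w, r)" "left_density \<rho> (w, r) \<le> exp (rate_sup * B * R) * B powr landing_count M UNIV 0 R w"
      using left_density_bounds[OF w, of r R] r by auto
    show "0 \<le> ?H1 ((w, r), y) \<and> ?H1 ((w, r), y) \<le> ?G w"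
      using l \<rho>_bounds[of "((w, r), y)"] by (auto intro!: mult_mono)
    have "left_density \<rho> (w, r) * 1 \<le> ?G w" using l B_ge_1 by (intro mult_mono) auto
    then show "0 \<le> ?H2 ((w, r), y) \<and> ?H2 ((w, r), y) \<le> ?G w" using l by simp
  qed
  have H1: "?H1 \<in> borel_measurable marked_predictable" and H2: "?H2 \<in> borel_measurable marked_predictable"
    by measurable
  note 1 = jump_sum_comp_int[OF S R H1 b(1) G0 G] and 2 = jump_sum_comp_int[OF S R H2 b(2) G0 G]
  let ?F = "\<lambda>w. 1 + (comp_int R ?H2 w - comp_int R ?H1 w) + (jump_sum M {0<..R} ?H1 w - jump_sum M {0<..R} ?H2 w)"
  have "integrable (law M x a) ?F" using 1 2 by simp
  then show "integrable (law M x a) (jump_density R \<rho>)"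
    by (rule Bochner_Integration.integrable_cong[THEN iffD1, rotated -1]) (simp_all add: jump_density_formula[OF _ R] law_space[OF S])
  have "(LINT w|law M x a. jump_density R \<rho> w) = (LINT w|law M x a. ?F w)"
    by (intro Bochner_Integration.integral_cong refl) (simp add: jump_density_formula[OF _ R] law_space[OF S])
  also have "\<dots> = 1" using 1 2 prob_space by simp
  finally show "(LINT w|law M x a. jump_density R \<rho> w) = 1" .
qed

end

end

section \<open>The intensity under the changed law\<close>

text \<open>
  A bound for the difference quotients that is uniform in \<open>\<epsilon>\<close>; it dominates the passage to the
  derivative at \<open>0\<close>.
\<close>

lemma prod_perturbation_le:
  fixes z :: "'b \<Rightarrow> real"
  assumes "finite F" "\<And>i. i \<in> F \<Longrightarrow> 0 \<le> z i" "0 \<le> \<epsilon>" "\<epsilon> \<le> 1"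
  shows "1 \<le> (\<Prod>i\<in>F. 1 + \<epsilon> * z i) \<and> (\<Prod>i\<in>F. 1 + \<epsilon> * z i) - 1 \<le> \<epsilon> * (\<Prod>i\<in>F. 1 + z i)"
  using assms
proof (induction F rule: finite_induct)
  case (insert j F)
  define p where "p = (\<Prod>i\<in>F. 1 + \<epsilon> * z i)"
  define p1 where "p1 = (\<Prod>i\<in>F. 1 + z i)"
  have IH: "1 \<le> p" "p - 1 \<le> \<epsilon> * p1" using insert by (auto simp: p_def p1_def)
  have z: "0 \<le> z j" using insert.prems by simp
  have pp1: "p \<le> p1" unfolding p_def p1_def
    using insert.prems by (intro prod_mono) (auto simp: mult_left_le_one_le)
  have "(1 + \<epsilon> * z j) * p - 1 = (p - 1) + \<epsilon> * z j * p" by (simp add: algebra_simps)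
  also have "\<dots> \<le> \<epsilon> * p1 + \<epsilon> * z j * p1" using IH(2) pp1 z insert.prems by (intro add_mono mult_left_mono) auto
  also have "\<dots> = \<epsilon> * ((1 + z j) * p1)" by (simp add: algebra_simps)
  finally have up: "(1 + \<epsilon> * z j) * p - 1 \<le> \<epsilon> * ((1 + z j) * p1)" .
  have "1 * 1 \<le> (1 + \<epsilon> * z j) * p" using IH(1) z insert.prems by (intro mult_mono) auto
  then show ?case using up insert.hyps by (simp add: p_def p1_def)
qed simp

lemma prod_perturbation_derivative:
  fixes z :: "'b \<Rightarrow> real"
  assumes "finite F"
  shows "(\<lambda>n. ((\<Prod>i\<in>F. 1 + z i / real (Suc n)) * exp (- (c / real (Suc n))) - 1) * real (Suc n))
    \<longlonglongrightarrow> (\<Sum>i\<in>F. z i) - c"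
proof -
  let ?f = "\<lambda>e. (\<Prod>i\<in>F. 1 + z i * e) * exp (- (c * e))"
  have P: "((\<lambda>e. \<Prod>i\<in>F. 1 + z i * e) has_real_derivative (\<Sum>i\<in>F. z i)) (at 0)"
    using assms
  proof (induction F rule: finite_induct)
    case (insert j F)
    have "((\<lambda>e. (1 + z j * e) * (\<Prod>i\<in>F. 1 + z i * e)) has_real_derivative
        (z j * (\<Prod>i\<in>F. 1 + z i * 0) + (1 + z j * 0) * (\<Sum>i\<in>F. z i))) (at 0)"
      by (rule derivative_eq_intros insert.IH refl | simp)+
    then show ?case using insert.hyps by simp
  qed simp
  have "(?f has_real_derivative ((\<Sum>i\<in>F. z i) - c)) (at 0)"
    by (rule derivative_eq_intros P refl | simp)+
  then have "((\<lambda>h. (?f (0 + h) - ?f 0) / h) \<longlongrightarrow> (\<Sum>i\<in>F. z i) - c) (at 0)"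
    by (simp add: DERIV_def)
  moreover have "filterlim (\<lambda>n. inverse (real (Suc n))) (at 0) sequentially"
    unfolding filterlim_at using LIMSEQ_inverse_real_of_nat by auto
  ultimately have "(\<lambda>n. (?f (0 + inverse (real (Suc n))) - ?f 0) / inverse (real (Suc n))) \<longlonglongrightarrow> (\<Sum>i\<in>F. z i) - c"
    by (rule filterlim_compose)
  then show ?thesis by (simp add: divide_inverse)
qed

context semi_markov
begin

text \<open>
  The density of \<open>\<rho> * (1 + \<epsilon> * z)\<close> has expectation \<open>1\<close> for every small \<open>\<epsilon> \<ge> 0\<close>; the derivative
  at \<open>0\<close> of this identity says that \<open>\<rho>\<close> times the old intensity is the new intensity.
\<close>

lemma jump_density_intensity_bounded:
  fixes \<rho> Z :: "('w \<times> real) \<times> 'k \<Rightarrow> real"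
  assumes S: "(x, a) \<in> space (age_state_space M)" and R: "0 \<le> R"
    and \<rho> [measurable]: "\<rho> \<in> borel_measurable marked_predictable"
    and \<rho>B: "\<And>z. 0 \<le> \<rho> z \<and> \<rho> z \<le> B" and B: "1 \<le> B"
    and Z [measurable]: "Z \<in> borel_measurable marked_predictable"
    and Zk: "\<And>z. 0 \<le> Z z \<and> Z z \<le> k"
  shows "integrable (law M x a) (\<lambda>w. jump_density R \<rho> w * jump_sum M {0<..R} Z w)"
    "integrable (law M x a) (\<lambda>w. jump_density R \<rho> w * comp_int R (\<lambda>z. Z z * \<rho> z) w)"
    "(LINT w|law M x a. jump_density R \<rho> w * jump_sum M {0<..R} Z w)
      = (LINT w|law M x a. jump_density R \<rho> w * comp_int R (\<lambda>z. Z z * \<rho> z) w)"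
proof -
  define P where "P = law M x a"
  interpret prob_space P unfolding P_def using S by (rule law_prob)
  have spP: "space P = sample_space M" unfolding P_def using S by (rule law_space)
  have k: "0 \<le> k" using Zk[of undefined] by linarith
  define C where "C w = comp_int R (\<lambda>z. Z z * \<rho> z) w" for w
  define N where "N w = landing_count M UNIV 0 R w" for w
  have ZR: "\<bar>Z z * \<rho> z\<bar> \<le> k * B" for z
    unfolding abs_mult using Zk[of z] \<rho>B[of z] k by (intro mult_mono) auto
  have kB: "0 \<le> k * B" using k B by simp
  have C_le: "\<bar>C w\<bar> \<le> rate_sup * (k * B) * R" if "w \<in> sample_space M" for w
    unfolding C_def by (rule comp_int_le[OF that R ZR kB])
  have C0: "0 \<le> C w" if w: "w \<in> sample_space M" for w
    unfolding C_def
    by (rule compensator_eq_comp_int(2)[OF _ w _ kB]) (measurable, use Zk \<rho>B ZR in \<open>auto simp: abs_le_iff\<close>)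
  have [measurable]: "C \<in> borel_measurable P" "jump_density R \<rho> \<in> borel_measurable P" "jump_sum M {0<..R} Z \<in> borel_measurable P"
    unfolding P_def C_def[abs_def]
    by (auto intro!: measurable_law_generated[OF S] comp_int_measurable jump_sum_measurable_real R
        jump_density_measurable[OF \<rho> \<rho>B B S R])
  let ?L = "jump_density R \<rho>"
  let ?c = "exp (rate_sup * B * R)"
  have L: "0 \<le> ?L w" "?L w \<le> ?c * B powr N w" if "w \<in> sample_space M" for w
    unfolding N_def by (rule jump_density_bounds[OF \<rho> \<rho>B B that R])+
  have LC: "integrable P (\<lambda>w. ?L w * C w)"
  proof (rule Bochner_Integration.integrable_bound)
    show "integrable P (\<lambda>w. ?c * B powr N w * (rate_sup * (k * B) * R))"
      unfolding N_def P_def using powr_count_integrable[OF S R B] by simp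
    show "AE w in P. norm (?L w * C w) \<le> norm (?c * B powr N w * (rate_sup * (k * B) * R))"
    proof (rule AE_I2)
      fix w assume "w \<in> space P"
      then have w: "w \<in> sample_space M" by (simp add: spP)
      have "\<bar>?L w\<bar> * \<bar>C w\<bar> \<le> ?c * B powr N w * (rate_sup * (k * B) * R)"
        using L[OF w] C_le[OF w] by (intro mult_mono) auto
      then have "\<bar>?L w * C w\<bar> \<le> ?c * B powr N w * (rate_sup * (k * B) * R)" by (simp only: abs_mult)
      then show "norm (?L w * C w) \<le> norm (?c * B powr N w * (rate_sup * (k * B) * R))"
        unfolding real_norm_def by (rule order_trans[OF _ abs_ge_self])
    qed
  qed measurable
  \<comment> \<open>the factor \<open>\<rho> (1 + \<epsilon> Z)\<close> for \<open>\<epsilon> = 1 / (n + 1)\<close>; its density is \<open>h\<close> times that of \<open>\<rho>\<close>\<close>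
  define \<rho>' where "\<rho>' n z = \<rho> z * (1 + Z z / real (Suc n))" for n z
  define h where "h n w = (\<Prod>\<tau>\<in>jumps M w \<inter> {0<..R}. 1 + Z ((w, \<tau>), state M \<tau> w) / real (Suc n)) * exp (- (C w / real (Suc n)))" for n w
  have \<rho>'m [measurable]: "\<rho>' n \<in> borel_measurable marked_predictable" for n
    unfolding \<rho>'_def by measurable
  have \<rho>'B: "0 \<le> \<rho>' n z \<and> \<rho>' n z \<le> B * (1 + k)" for n z
  proof -
    have "Z z / real (Suc n) \<le> k / 1" using Zk[of z] k by (intro frac_le) auto
    then have "\<rho> z * (1 + Z z / real (Suc n)) \<le> B * (1 + k)" using Zk[of z] \<rho>B[of z] B by (intro mult_mono) auto
    then show ?thesis using Zk[of z] \<rho>B[of z] by (simp add: \<rho>'_def)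
  qed
  have Bk: "1 \<le> B * (1 + k)" using B k mult_mono[of 1 B 1 "1 + k"] by simp
  have factor: "jump_density R (\<rho>' n) w = ?L w * h n w" if w: "w \<in> sample_space M" for n w
  proof -
    let ?e = "1 / real (Suc n)"
    have dr: "drift (\<rho>' n) (w, r) = drift \<rho> (w, r) - ?e * (LINT y|left_intensity M (w, r). Z ((w, r), y) * \<rho> ((w, r), y))"
      if r: "0 \<le> r" for r
    proof -
      have z: "(w, r) \<in> space (predictable M)" using w r by simp
      have i1: "integrable (left_intensity M (w, r)) (\<lambda>y. (\<lambda>z. 1 - \<rho> z) ((w, r), y))"
      proof (rule left_intensity_integrable[OF _ z])
        show "\<bar>1 - \<rho> ((w, r), y)\<bar> \<le> B" for y using \<rho>B[of "((w, r), y)"] B by linarith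
      qed measurable
      have i2: "integrable (left_intensity M (w, r)) (\<lambda>y. (\<lambda>z. Z z * \<rho> z) ((w, r), y))"
        by (rule left_intensity_integrable[OF _ z ZR]) measurable
      have "drift (\<rho>' n) (w, r) = (LINT y|left_intensity M (w, r). (1 - \<rho> ((w, r), y)) - ?e * (Z ((w, r), y) * \<rho> ((w, r), y)))"
        unfolding drift_def \<rho>'_def by (intro Bochner_Integration.integral_cong refl) (simp add: algebra_simps)
      then show ?thesis using i1 i2 by (simp add: drift_def)
    qed
    have wi: "set_integrable lborel {0<..R} (\<lambda>r. LINT y|left_intensity M (w, r). Z ((w, r), y) * \<rho> ((w, r), y))"
      by (rule left_intensity_path_integrable[of "\<lambda>z. Z z * \<rho> z", OF _ w ZR kB]) measurable
    have di: "set_integrable lborel {0<..R} (\<lambda>r. drift \<rho> (w, r))"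
    proof (rule set_integrable_clamp)
      show "set_integrable lborel {0<..R} (\<lambda>r. drift \<rho> (w, max 0 r))"
        by (rule set_integrable_bounded_interval[OF drift_path[OF \<rho> \<rho>B B w], where s=0 and v=R]) auto
    qed auto
    have "(LINT r:{0..R}|lborel. drift (\<rho>' n) (w, r))
        = (LINT r:{0<..R}|lborel. drift \<rho> (w, r) - ?e * (LINT y|left_intensity M (w, r). Z ((w, r), y) * \<rho> ((w, r), y)))"
      unfolding set_integral_endpoints(1)[symmetric] unfolding set_lebesgue_integral_def
      by (intro Bochner_Integration.integral_cong refl) (simp add: indicator_def dr)
    also have "\<dots> = (LINT r:{0<..R}|lborel. drift \<rho> (w, r)) - ?e * C w"
      unfolding C_def comp_int_def
      by (subst set_integral_diff(2)[OF di]) (use wi in \<open>simp_all add: set_integrable_mult_right\<close>)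
    finally have I: "(LINT r:{0..R}|lborel. drift (\<rho>' n) (w, r)) = (LINT r:{0..R}|lborel. drift \<rho> (w, r)) + (- (C w / real (Suc n)))"
      by (simp add: set_integral_endpoints(1))
    show ?thesis
      unfolding jump_density_def I exp_add h_def \<rho>'_def prod.distrib by simp
  qed
  have E0: "(LINT w|P. ?L w * ((h n w - 1) * real (Suc n))) = 0"
    and Ei: "integrable P (\<lambda>w. ?L w * ((h n w - 1) * real (Suc n)))" for n
  proof -
    note 1 = jump_density_expectation[OF \<rho> \<rho>B B S R] and 2 = jump_density_expectation[OF \<rho>'m \<rho>'B Bk S R, of n]
    have eq: "?L w * ((h n w - 1) * real (Suc n)) = (jump_density R (\<rho>' n) w - ?L w) * real (Suc n)"
      if "w \<in> space P" for w
      using factor[of w n] that by (simp add: spP algebra_simps)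
    have "(LINT w|P. ?L w * ((h n w - 1) * real (Suc n))) = (LINT w|P. (jump_density R (\<rho>' n) w - ?L w) * real (Suc n))"
      by (intro Bochner_Integration.integral_cong refl eq)
    also have "\<dots> = (LINT w|P. jump_density R (\<rho>' n) w - ?L w) * real (Suc n)" by (rule integral_mult_left_zero)
    also have "\<dots> = 0" using 1 2 by (simp add: P_def)
    finally show "(LINT w|P. ?L w * ((h n w - 1) * real (Suc n))) = 0" .
    have "integrable P (\<lambda>w. (jump_density R (\<rho>' n) w - ?L w) * real (Suc n))" using 1 2 by (simp add: P_def)
    then show "integrable P (\<lambda>w. ?L w * ((h n w - 1) * real (Suc n)))"
      by (rule Bochner_Integration.integrable_cong[OF refl, THEN iffD1, rotated]) (rule eq[symmetric])
  qed
  define W where "W w = ?c * B powr N w * ((1 + k) powr N w + rate_sup * (k * B) * R)" for w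
  have Wi: "integrable P W"
  proof -
    have "W w = ?c * (B * (1 + k)) powr N w + ?c * (rate_sup * (k * B) * R) * B powr N w" for w
    proof -
      have "(B * (1 + k)) powr N w = B powr N w * (1 + k) powr N w" by (rule powr_mult)
      then show ?thesis unfolding W_def by (simp add: distrib_left mult_ac)
    qed
    then have "W = (\<lambda>w. ?c * (B * (1 + k)) powr N w + ?c * (rate_sup * (k * B) * R) * B powr N w)"
      by (rule ext)
    then show ?thesis
      unfolding N_def P_def using powr_count_integrable[OF S R B] powr_count_integrable[OF S R Bk] by simp
  qed
  have lim: "(\<lambda>n. ?L w * ((h n w - 1) * real (Suc n))) \<longlonglongrightarrow> ?L w * (jump_sum M {0<..R} Z w - C w)"
    if "w \<in> sample_space M" for w
    unfolding h_def jump_sum_def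
    by (intro tendsto_mult[OF tendsto_const] prod_perturbation_derivative finite_jumps_Ioc[OF that])
  have dom: "norm (?L w * ((h n w - 1) * real (Suc n))) \<le> W w" if w: "w \<in> sample_space M" for w n
  proof -
    let ?e = "1 / real (Suc n)"
    let ?F = "jumps M w \<inter> {0<..R}"
    define p where "p = (\<Prod>\<tau>\<in>?F. 1 + ?e * Z ((w, \<tau>), state M \<tau> w))"
    have e: "0 \<le> ?e" "?e \<le> 1" by auto
    have pe: "1 \<le> p \<and> p - 1 \<le> ?e * (\<Prod>\<tau>\<in>?F. 1 + Z ((w, \<tau>), state M \<tau> w))"
      unfolding p_def using Zk by (intro prod_perturbation_le finite_jumps_Ioc[OF w] e) auto
    have "(\<Prod>\<tau>\<in>?F. 1 + Z ((w, \<tau>), state M \<tau> w)) \<le> (\<Prod>\<tau>\<in>?F. 1 + k)" using Zk by (intro prod_mono) (auto intro: add_nonneg_nonneg)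
    also have "\<dots> = (1 + k) powr N w" using k by (simp add: N_def landing_count_UNIV powr_realpow)
    finally have P1: "(\<Prod>\<tau>\<in>?F. 1 + Z ((w, \<tau>), state M \<tau> w)) \<le> (1 + k) powr N w" .
    have eC: "0 \<le> ?e * C w" using C0[OF w] by simp
    have x1: "exp (- (?e * C w)) \<le> 1" "1 - exp (- (?e * C w)) \<le> ?e * C w"
      using eC exp_ge_add_one_self[of "- (?e * C w)"] by auto
    have h: "h n w - 1 = exp (- (?e * C w)) * (p - 1) - (1 - exp (- (?e * C w)))"
      by (simp add: h_def p_def algebra_simps)
    have "\<bar>h n w - 1\<bar> \<le> exp (- (?e * C w)) * (p - 1) + (1 - exp (- (?e * C w)))"
      unfolding h using pe x1 by (intro order_trans[OF abs_triangle_ineq4]) (simp add: abs_mult)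
    also have "\<dots> \<le> 1 * (p - 1) + ?e * C w" using pe x1 by (intro add_mono mult_right_mono) auto
    also have "\<dots> \<le> ?e * ((1 + k) powr N w) + ?e * (rate_sup * (k * B) * R)"
    proof (intro add_mono mult_left_mono)
      have "p - 1 \<le> ?e * (\<Prod>\<tau>\<in>?F. 1 + Z ((w, \<tau>), state M \<tau> w))" using pe by simp
      also have "\<dots> \<le> ?e * ((1 + k) powr N w)" using P1 e(1) by (rule mult_left_mono)
      finally show "1 * (p - 1) \<le> ?e * ((1 + k) powr N w)" by simp
      show "C w \<le> rate_sup * (k * B) * R" using C_le[OF w] by (simp add: abs_le_iff)
    qed simp
    finally have "\<bar>h n w - 1\<bar> * real (Suc n) \<le> (?e * ((1 + k) powr N w) + ?e * (rate_sup * (k * B) * R)) * real (Suc n)"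
      by (rule mult_right_mono) simp
    also have "\<dots> = (1 + k) powr N w + rate_sup * (k * B) * R" by (simp add: field_simps del: of_nat_Suc)
    finally have "\<bar>?L w\<bar> * (\<bar>h n w - 1\<bar> * real (Suc n)) \<le> ?c * B powr N w * ((1 + k) powr N w + rate_sup * (k * B) * R)"
      using L[OF w] by (intro mult_mono) auto
    then show ?thesis by (simp add: W_def abs_mult del: of_nat_Suc)
  qed
  have m: "(\<lambda>w. ?L w * (jump_sum M {0<..R} Z w - C w)) \<in> borel_measurable P" by measurable
  have limP: "AE w in P. (\<lambda>n. ?L w * ((h n w - 1) * real (Suc n))) \<longlonglongrightarrow> ?L w * (jump_sum M {0<..R} Z w - C w)"
    by (rule AE_I2) (rule lim, simp only: spP)
  have domP: "AE w in P. norm (?L w * ((h n w - 1) * real (Suc n))) \<le> W w" for n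
    by (rule AE_I2) (rule dom, simp only: spP)
  have "(\<lambda>n. LINT w|P. ?L w * ((h n w - 1) * real (Suc n))) \<longlonglongrightarrow> (LINT w|P. ?L w * (jump_sum M {0<..R} Z w - C w))"
    by (rule integral_dominated_convergence[OF m borel_measurable_integrable[OF Ei] Wi limP domP])
  then have zero: "(LINT w|P. ?L w * (jump_sum M {0<..R} Z w - C w)) = 0"
    unfolding E0 by (simp add: LIMSEQ_const_iff)
  have i: "integrable P (\<lambda>w. ?L w * (jump_sum M {0<..R} Z w - C w))"
    by (rule integrable_dominated_convergence[OF m borel_measurable_integrable[OF Ei] Wi limP domP])
  have "integrable P (\<lambda>w. ?L w * (jump_sum M {0<..R} Z w - C w) + ?L w * C w)" using i LC by (rule Bochner_Integration.integrable_add)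
  then have LJ: "integrable P (\<lambda>w. ?L w * jump_sum M {0<..R} Z w)" by (simp add: algebra_simps)
  have "(LINT w|P. ?L w * jump_sum M {0<..R} Z w) - (LINT w|P. ?L w * C w) = 0"
    using zero LJ LC by (simp add: right_diff_distrib)
  then show "integrable (law M x a) (\<lambda>w. ?L w * jump_sum M {0<..R} Z w)"
    "integrable (law M x a) (\<lambda>w. ?L w * comp_int R (\<lambda>z. Z z * \<rho> z) w)"
    "(LINT w|law M x a. ?L w * jump_sum M {0<..R} Z w) = (LINT w|law M x a. ?L w * comp_int R (\<lambda>z. Z z * \<rho> z) w)"
    using LJ LC by (simp_all add: P_def C_def[abs_def])
qed

text \<open>
  Bounded truncations of \<open>Z\<close> increase to \<open>Z\<close>.
\<close>

lemma jump_density_intensity: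
  fixes \<rho> Z :: "('w \<times> real) \<times> 'k \<Rightarrow> real"
  assumes S: "(x, a) \<in> space (age_state_space M)" and R: "0 \<le> R"
    and \<rho> [measurable]: "\<rho> \<in> borel_measurable marked_predictable"
    and \<rho>B: "\<And>z. 0 \<le> \<rho> z \<and> \<rho> z \<le> B" and B: "1 \<le> B"
    and Z [measurable]: "Z \<in> borel_measurable marked_predictable" and Z0: "\<And>z. 0 \<le> Z z"
  shows "(\<integral>\<^sup>+ w. ennreal (jump_density R \<rho> w * jump_sum M {0<..R} Z w) \<partial>law M x a)
      = (\<integral>\<^sup>+ w. ennreal (jump_density R \<rho> w) * compensator M R (\<lambda>z. ennreal (Z z * \<rho> z)) w \<partial>law M x a)"
proof -
  define P where "P = law M x a"
  have spP: "space P = sample_space M" unfolding P_def using S by (rule law_space)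
  let ?L = "jump_density R \<rho>"
  have Lm [measurable]: "?L \<in> borel_measurable P" unfolding P_def by (rule jump_density_measurable[OF \<rho> \<rho>B B S R])
  have L0: "0 \<le> ?L w" if "w \<in> sample_space M" for w by (rule jump_density_bounds[OF \<rho> \<rho>B B that R])
  define Zn where "Zn n z = min (Z z) (real n)" for n z
  have Znm [measurable]: "Zn n \<in> borel_measurable marked_predictable" for n
    unfolding Zn_def by measurable
  have Znb: "0 \<le> Zn n z \<and> Zn n z \<le> real n" for n z using Z0[of z] by (simp add: Zn_def)
  have Zn_mono: "Zn n z \<le> Zn (Suc n) z" for n z by (simp add: Zn_def)
  have step: "(\<integral>\<^sup>+ w. ennreal (?L w * jump_sum M {0<..R} (Zn n) w) \<partial>P)
      = (\<integral>\<^sup>+ w. ennreal (?L w) * compensator M R (\<lambda>z. ennreal (Zn n z * \<rho> z)) w \<partial>P)" for n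
  proof -
    note B1 = jump_density_intensity_bounded[OF S R \<rho> \<rho>B B Znm Znb, of n]
    have c: "compensator M R (\<lambda>z. ennreal (Zn n z * \<rho> z)) w = ennreal (comp_int R (\<lambda>z. Zn n z * \<rho> z) w)"
      "0 \<le> comp_int R (\<lambda>z. Zn n z * \<rho> z) w" if w: "w \<in> sample_space M" for w
    proof -
      have b: "0 \<le> Zn n z * \<rho> z \<and> Zn n z * \<rho> z \<le> real n * B" for z
        using Znb[of n z] \<rho>B[of z] by (auto intro!: mult_mono)
      have "(\<lambda>z. Zn n z * \<rho> z) \<in> borel_measurable marked_predictable" by measurable
      from compensator_eq_comp_int[OF this w b] B
      show "compensator M R (\<lambda>z. ennreal (Zn n z * \<rho> z)) w = ennreal (comp_int R (\<lambda>z. Zn n z * \<rho> z) w)"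
        "0 \<le> comp_int R (\<lambda>z. Zn n z * \<rho> z) w" by auto
    qed
    have j0: "0 \<le> jump_sum M {0<..R} (Zn n) w" for w unfolding jump_sum_def using Znb by (intro sum_nonneg) auto
    have "(\<integral>\<^sup>+ w. ennreal (?L w * jump_sum M {0<..R} (Zn n) w) \<partial>P) = ennreal (LINT w|P. ?L w * jump_sum M {0<..R} (Zn n) w)"
      using B1(1) L0 j0 by (intro nn_integral_eq_integral AE_I2) (auto simp: P_def law_space[OF S])
    also have "\<dots> = ennreal (LINT w|P. ?L w * comp_int R (\<lambda>z. Zn n z * \<rho> z) w)" unfolding P_def B1(3) ..
    also have "\<dots> = (\<integral>\<^sup>+ w. ennreal (?L w * comp_int R (\<lambda>z. Zn n z * \<rho> z) w) \<partial>P)"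
      using B1(2) L0 c(2) by (intro nn_integral_eq_integral[symmetric] AE_I2) (auto simp: P_def law_space[OF S])
    also have "\<dots> = (\<integral>\<^sup>+ w. ennreal (?L w) * compensator M R (\<lambda>z. ennreal (Zn n z * \<rho> z)) w \<partial>P)"
      using L0 by (intro nn_integral_cong) (simp add: spP c ennreal_mult)
    finally show ?thesis .
  qed
  have SUP1: "(SUP n. ennreal (Zn n z * q)) = ennreal (Z z * q)" if "0 \<le> q" for z q
  proof (rule LIMSEQ_unique[OF LIMSEQ_SUP])
    show "incseq (\<lambda>n. ennreal (Zn n z * q))"
      using that by (intro incseq_SucI ennreal_leI mult_right_mono Zn_mono)
    have "\<forall>\<^sub>F n in sequentially. ennreal (Zn n z * q) = ennreal (Z z * q)"
      using eventually_ge_at_top[of "nat \<lceil>Z z\<rceil>"]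
    proof eventually_elim
      case (elim n)
      then have "Z z \<le> real n" by linarith
      then show ?case by (simp add: Zn_def min_def)
    qed
    then show "(\<lambda>n. ennreal (Zn n z * q)) \<longlonglongrightarrow> ennreal (Z z * q)" by (rule tendsto_eventually)
  qed
  have inc: "incseq (\<lambda>n z. ennreal (Zn n z * \<rho> z))"
    using \<rho>B by (intro incseq_SucI le_funI ennreal_leI mult_right_mono Zn_mono) auto
  have inc1: "incseq (\<lambda>n z. ennreal (Zn n z))"
    by (intro incseq_SucI le_funI ennreal_leI Zn_mono)
  have jn: "jump_sum M {0<..R} (\<lambda>z. ennreal (h z)) w = ennreal (jump_sum M {0<..R} h w)" if "\<And>z. 0 \<le> h z" for h w
    unfolding jump_sum_def using that by (intro sum_ennreal)
  have "(\<integral>\<^sup>+ w. ennreal (?L w * jump_sum M {0<..R} Z w) \<partial>P)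
      = (\<integral>\<^sup>+ w. (SUP n. ennreal (?L w * jump_sum M {0<..R} (Zn n) w)) \<partial>P)"
  proof (intro nn_integral_cong)
    fix w assume "w \<in> space P"
    then have w: "w \<in> sample_space M" by (simp add: spP)
    have "jump_sum M {0<..R} (\<lambda>z. ennreal (Z z)) w = jump_sum M {0<..R} (SUP n. (\<lambda>z. ennreal (Zn n z))) w"
      using SUP1[of 1] by (intro arg_cong[where f="\<lambda>h. jump_sum M {0<..R} h w"]) (auto simp: fun_eq_iff image_comp)
    also have "\<dots> = (SUP n. jump_sum M {0<..R} (\<lambda>z. ennreal (Zn n z)) w)" by (rule jump_sum_SUP[OF inc1])
    finally have "ennreal (jump_sum M {0<..R} Z w) = (SUP n. ennreal (jump_sum M {0<..R} (Zn n) w))"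
      using jn[OF Z0] jn[of "Zn _"] Znb by simp
    then have "ennreal (?L w) * ennreal (jump_sum M {0<..R} Z w) = (SUP n. ennreal (?L w) * ennreal (jump_sum M {0<..R} (Zn n) w))"
      by (simp add: SUP_mult_left_ennreal)
    moreover have "0 \<le> jump_sum M {0<..R} (Zn n) w" "0 \<le> jump_sum M {0<..R} Z w" for n
      unfolding jump_sum_def using Znb Z0 by (auto intro!: sum_nonneg)
    ultimately show "ennreal (?L w * jump_sum M {0<..R} Z w) = (SUP n. ennreal (?L w * jump_sum M {0<..R} (Zn n) w))"
      using L0[OF w] by (simp add: ennreal_mult)
  qed
  also have "\<dots> = (SUP n. \<integral>\<^sup>+ w. ennreal (?L w * jump_sum M {0<..R} (Zn n) w) \<partial>P)"
  proof (rule nn_integral_monotone_convergence_SUP_AE)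
    have jm: "jump_sum M {0<..R} (Zn n) \<in> borel_measurable P" for n
      unfolding P_def by (rule measurable_law_generated[OF S jump_sum_measurable_real[OF Znm R]])
    show "(\<lambda>w. ennreal (?L w * jump_sum M {0<..R} (Zn n) w)) \<in> borel_measurable P" for n using jm by measurable
    show "AE w in P. ennreal (?L w * jump_sum M {0<..R} (Zn n) w) \<le> ennreal (?L w * jump_sum M {0<..R} (Zn (Suc n)) w)" for n
      unfolding jump_sum_def using L0 by (intro AE_I2 ennreal_leI mult_left_mono sum_mono Zn_mono) (auto simp: spP)
  qed
  also have "\<dots> = (SUP n. \<integral>\<^sup>+ w. ennreal (?L w) * compensator M R (\<lambda>z. ennreal (Zn n z * \<rho> z)) w \<partial>P)"
    unfolding step ..
  also have "\<dots> = (\<integral>\<^sup>+ w. (SUP n. ennreal (?L w) * compensator M R (\<lambda>z. ennreal (Zn n z * \<rho> z)) w) \<partial>P)"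
  proof (rule nn_integral_monotone_convergence_SUP[symmetric])
    show "incseq (\<lambda>n w. ennreal (?L w) * compensator M R (\<lambda>z. ennreal (Zn n z * \<rho> z)) w)"
      unfolding compensator_def
      by (intro incseq_SucI le_funI mult_left_mono nn_integral_mono mult_right_mono le_funD[OF incseq_SucD[OF inc]]) auto
    have "compensator M R (\<lambda>z. ennreal (Zn n z * \<rho> z)) \<in> borel_measurable P" for n
      unfolding P_def by (rule measurable_law_generated[OF S compensator_measurable]) measurable
    then show "(\<lambda>w. ennreal (?L w) * compensator M R (\<lambda>z. ennreal (Zn n z * \<rho> z)) w) \<in> borel_measurable P" for n
      by measurable
  qed
  also have "\<dots> = (\<integral>\<^sup>+ w. ennreal (?L w) * compensator M R (\<lambda>z. ennreal (Z z * \<rho> z)) w \<partial>P)"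
  proof (intro nn_integral_cong)
    fix w assume "w \<in> space P"
    then have w: "w \<in> sample_space M" by (simp add: spP)
    have "compensator M R (\<lambda>z. ennreal (Z z * \<rho> z)) w = compensator M R (SUP n. (\<lambda>z. ennreal (Zn n z * \<rho> z))) w"
      using SUP1 \<rho>B by (intro arg_cong[where f="\<lambda>h. compensator M R h w"]) (auto simp: fun_eq_iff image_comp)
    also have "\<dots> = (SUP n. compensator M R (\<lambda>z. ennreal (Zn n z * \<rho> z)) w)"
      by (rule compensator_SUP[OF _ inc w]) measurable
    finally show "(SUP n. ennreal (?L w) * compensator M R (\<lambda>z. ennreal (Zn n z * \<rho> z)) w)
        = ennreal (?L w) * compensator M R (\<lambda>z. ennreal (Z z * \<rho> z)) w"
      by (simp add: SUP_mult_left_ennreal)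
  qed
  finally show ?thesis unfolding P_def .
qed

end

section \<open>Square integrable marked integrands\<close>

lemma young_powr:
  fixes L v \<alpha> :: real
  assumes "0 \<le> L" "0 \<le> v" "1 < \<alpha>"
  shows "L * v \<le> L powr (\<alpha> / (\<alpha> - 1)) + v powr \<alpha>"
proof (cases "L = 0 \<or> v = 0")
  case False
  with assms have pos: "0 < L" "0 < v" by auto
  show ?thesis
  proof (cases "L \<le> v powr (\<alpha> - 1)")
    case True
    then have "L * v \<le> v powr (\<alpha> - 1) * v" using assms by (intro mult_right_mono) auto
    also have "\<dots> = v powr \<alpha>" using pos powr_add[of v "\<alpha> - 1" 1] by simp
    finally show ?thesis by (simp add: add_increasing)
  next
    case False
    have "v = (v powr (\<alpha> - 1)) powr (1 / (\<alpha> - 1))" using pos assms by (simp add: powr_powr)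
    also have "\<dots> \<le> L powr (1 / (\<alpha> - 1))" using False assms by (intro powr_mono2) auto
    finally have "L * v \<le> L * L powr (1 / (\<alpha> - 1))" using assms by (intro mult_left_mono) auto
    also have "\<dots> = L powr (1 + 1 / (\<alpha> - 1))" using pos by (simp add: powr_add)
    also have "1 + 1 / (\<alpha> - 1) = \<alpha> / (\<alpha> - 1)" using assms by (simp add: field_simps)
    finally show ?thesis by (simp add: add_increasing2)
  qed
qed auto

context semi_markov
begin

text \<open>
  The jumps of a path have Lebesgue measure zero, so that in time integrals the left limits may
  replace the current values.
\<close>

lemma AE_off_jumps:
  assumes w: "w \<in> sample_space M"
  shows "AE r in lborel. r \<in> {0..R} \<longrightarrow> 0 < r \<and> state_left M r w = state M r w \<and> age_left M r w = age M r w"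
proof -
  have "AE r in lborel. r \<notin> insert 0 (jumps M w \<inter> {..R})"
    using finite_jumps_bounded[OF w, of R] by (intro AE_discrete_difference) (auto intro: countable_finite)
  then show ?thesis
  proof eventually_elim
    case (elim r)
    then show ?case using left_eq_off_jumps[OF w, of r] by auto
  qed
qed

lemma left_intensity_off_jump:
  "state_left M r w = state M r w \<Longrightarrow> age_left M r w = age M r w \<Longrightarrow>
    left_intensity M (w, r) = intensity M (state M r w) (age M r w)"
  by (simp add: left_intensity_def)

lemma set_integral_off_jumps:
  fixes f h :: "real \<Rightarrow> real"
  assumes w: "w \<in> sample_space M"
    and eq: "\<And>r. 0 < r \<Longrightarrow> r \<le> R \<Longrightarrow> state_left M r w = state M r w \<Longrightarrow> age_left M r w = age M r w \<Longrightarrow> f r = h r"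
  shows "(LINT r:{0..R}|lborel. f r) = (LINT r:{0<..R}|lborel. h r)"
    "set_integrable lborel {0..R} f \<longleftrightarrow> set_integrable lborel {0<..R} h"
proof -
  let ?X = "insert 0 (jumps M w \<inter> {..R})"
  have X: "countable ?X" using finite_jumps_bounded[OF w, of R] by (auto intro: countable_finite)
  have e: "indicator {0..R} r *\<^sub>R f r = indicator {0<..R} r *\<^sub>R h r" if "r \<notin> ?X" for r
    using that eq[of r] left_eq_off_jumps[OF w, of r] by (auto simp: indicator_def)
  show "(LINT r:{0..R}|lborel. f r) = (LINT r:{0<..R}|lborel. h r)"
    unfolding set_lebesgue_integral_def by (rule integral_discrete_difference[OF X _ _ e]) auto
  show "set_integrable lborel {0..R} f \<longleftrightarrow> set_integrable lborel {0<..R} h"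
    unfolding set_integrable_def by (rule integrable_discrete_difference[OF X _ _ e]) auto
qed

lemma compensator_mono:
  assumes "w \<in> sample_space M" "\<And>z. H z \<le> H' z"
  shows "compensator M R H w \<le> compensator M R H' w"
  unfolding compensator_def using assms(2) by (intro nn_integral_mono mult_right_mono) auto

lemma compensator_finite:
  fixes H :: "('w \<times> real) \<times> 'k \<Rightarrow> real"
  assumes H [measurable]: "H \<in> borel_measurable marked_predictable" and w: "w \<in> sample_space M"
    and fin: "compensator M R (\<lambda>z. ennreal \<bar>H z\<bar>) w < \<infinity>"
  shows "AE r in lborel. r \<in> {0<..R} \<longrightarrow> integrable (left_intensity M (w, r)) (\<lambda>y. H ((w, r), y))"
    "set_integrable lborel {0<..R} (\<lambda>r. LINT y|left_intensity M (w, r). H ((w, r), y))"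
    "(\<And>z. 0 \<le> H z) \<Longrightarrow> compensator M R (\<lambda>z. ennreal (H z)) w = ennreal (comp_int R H w)"
proof -
  let ?n = "\<lambda>r. \<integral>\<^sup>+ y. ennreal \<bar>H ((w, r), y)\<bar> \<partial>left_intensity M (w, r)"
  have absH: "(\<lambda>z. ennreal \<bar>H z\<bar>) \<in> borel_measurable marked_predictable" by measurable
  have "AE r in lborel. ?n r * indicator {0<..R} r \<noteq> \<infinity>"
    using fin path_left_intensity_measurable[OF absH w] unfolding compensator_def
    by (intro nn_integral_noteq_infinite) auto
  then show int: "AE r in lborel. r \<in> {0<..R} \<longrightarrow> integrable (left_intensity M (w, r)) (\<lambda>y. H ((w, r), y))"
  proof eventually_elim
    case (elim r)
    show ?case
    proof
      assume r: "r \<in> {0<..R}"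
      then have z: "(w, r) \<in> space (predictable M)" using w by simp
      have "?n r < \<infinity>" using elim r by (simp add: less_top)
      then show "integrable (left_intensity M (w, r)) (\<lambda>y. H ((w, r), y))"
        using left_intensity_section[OF H z] by (intro integrableI_bounded) auto
    qed
  qed
  have m: "(\<lambda>r. indicator {0<..R} r *\<^sub>R (LINT y|left_intensity M (w, r). H ((w, r), y))) \<in> borel_measurable lborel"
  proof -
    have "(\<lambda>r. indicator {0<..R} r *\<^sub>R (LINT y|left_intensity M (w, max 0 r). H ((w, max 0 r), y))) \<in> borel_measurable lborel"
      using path_integral_left_intensity_measurable[OF H w] by measurable
    then show ?thesis by (rule measurable_cong[THEN iffD1, rotated]) (auto simp: indicator_def max_def)
  qed
  show "set_integrable lborel {0<..R} (\<lambda>r. LINT y|left_intensity M (w, r). H ((w, r), y))"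
    unfolding set_integrable_def
  proof (rule integrableI_bounded[OF m])
    have "(\<integral>\<^sup>+ r. ennreal (norm (indicator {0<..R} r *\<^sub>R (LINT y|left_intensity M (w, r). H ((w, r), y)))) \<partial>lborel)
        \<le> (\<integral>\<^sup>+ r. ?n r * indicator {0<..R} r \<partial>lborel)"
    proof (rule nn_integral_mono_AE)
      show "AE r in lborel. ennreal (norm (indicator {0<..R} r *\<^sub>R (LINT y|left_intensity M (w, r). H ((w, r), y)))) \<le> ?n r * indicator {0<..R} r"
        using int
      proof eventually_elim
        case (elim r)
        then show ?case
          using integral_norm_bound_ennreal[of "left_intensity M (w, r)" "\<lambda>y. H ((w, r), y)"]
          by (cases "r \<in> {0<..R}") auto
      qed
    qed
    also have "\<dots> < \<infinity>" using fin by (simp add: compensator_def)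
    finally show "(\<integral>\<^sup>+ r. ennreal (norm (indicator {0<..R} r *\<^sub>R (LINT y|left_intensity M (w, r). H ((w, r), y)))) \<partial>lborel) < \<infinity>" .
  qed
  then have si: "integrable lborel (\<lambda>r. indicator {0<..R} r *\<^sub>R (LINT y|left_intensity M (w, r). H ((w, r), y)))"
    unfolding set_integrable_def .
  show "compensator M R (\<lambda>z. ennreal (H z)) w = ennreal (comp_int R H w)" if H0: "\<And>z. 0 \<le> H z"
  proof -
    have "compensator M R (\<lambda>z. ennreal (H z)) w
       = (\<integral>\<^sup>+ r. ennreal (indicator {0<..R} r *\<^sub>R (LINT y|left_intensity M (w, r). H ((w, r), y))) \<partial>lborel)"
      unfolding compensator_def
    proof (rule nn_integral_cong_AE)
      show "AE r in lborel. (\<integral>\<^sup>+ y. ennreal (H ((w, r), y)) \<partial>left_intensity M (w, r)) * indicator {0<..R} r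
          = ennreal (indicator {0<..R} r *\<^sub>R (LINT y|left_intensity M (w, r). H ((w, r), y)))"
        using int
      proof eventually_elim
        case (elim r)
        then show ?case using H0 by (cases "r \<in> {0<..R}") (auto simp: nn_integral_eq_integral)
      qed
    qed
    also have "\<dots> = ennreal (LINT r|lborel. indicator {0<..R} r *\<^sub>R (LINT y|left_intensity M (w, r). H ((w, r), y)))"
      using si H0 by (intro nn_integral_eq_integral AE_I2) auto
    finally show ?thesis unfolding comp_int_def set_lebesgue_integral_def .
  qed
qed

lemma compensator_const_le:
  assumes w: "w \<in> sample_space M" and R: "0 \<le> R"
  shows "compensator M R (\<lambda>_. ennreal c) w \<le> ennreal c * ennreal (rate_sup * R)"
proof -
  have "compensator M R (\<lambda>_. ennreal c) w \<le> (\<integral>\<^sup>+ r. (ennreal c * ennreal rate_sup) * indicator {0<..R} r \<partial>lborel)"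
    unfolding compensator_def
  proof (rule nn_integral_mono)
    fix r
    show "(\<integral>\<^sup>+ y. ennreal c \<partial>left_intensity M (w, r)) * indicator {0<..R} r \<le> (ennreal c * ennreal rate_sup) * indicator {0<..R} r"
    proof (cases "r \<in> {0<..R}")
      case True
      then have "(w, r) \<in> space (predictable M)" using w by simp
      then have "ennreal c * emeasure (left_intensity M (w, r)) (space (left_intensity M (w, r))) \<le> ennreal c * ennreal rate_sup"
        by (intro mult_left_mono left_intensity_emeasure_le) auto
      then show ?thesis using True by simp
    qed simp
  qed
  also have "\<dots> = ennreal c * (ennreal rate_sup * ennreal R)" using R by (simp add: nn_integral_cmult mult.assoc)
  also have "\<dots> = ennreal c * ennreal (rate_sup * R)" using R rate_sup_nonneg by (simp add: ennreal_mult)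
  finally show ?thesis .
qed

text \<open>
  The density is bounded by an exponential of the number of jumps, which has all exponential moments.
\<close>

lemma jump_density_powr_integrable:
  assumes S: "(x, a) \<in> space (age_state_space M)" and R: "0 \<le> R"
    and \<rho>: "\<rho> \<in> borel_measurable marked_predictable"
    and \<rho>B: "\<And>z. 0 \<le> \<rho> z \<and> \<rho> z \<le> B" and B: "1 \<le> B" and p: "0 \<le> p"
  shows "integrable (law M x a) (\<lambda>w. jump_density R \<rho> w powr p)"
proof (rule Bochner_Integration.integrable_bound)
  let ?c = "exp (rate_sup * B * R)"
  have Bp: "1 \<le> B powr p" using B p by (rule ge_one_powr_ge_zero)
  show "integrable (law M x a) (\<lambda>w. ?c powr p * (B powr p) powr landing_count M UNIV 0 R w)"
    using powr_count_integrable[OF S R Bp] by simp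
  show "(\<lambda>w. jump_density R \<rho> w powr p) \<in> borel_measurable (law M x a)"
    using jump_density_measurable[OF \<rho> \<rho>B B S R] by measurable
  show "AE w in law M x a. norm (jump_density R \<rho> w powr p) \<le> norm (?c powr p * (B powr p) powr landing_count M UNIV 0 R w)"
  proof (rule AE_I2)
    fix w assume "w \<in> space (law M x a)"
    then have w: "w \<in> sample_space M" by (simp add: law_space[OF S])
    have "jump_density R \<rho> w powr p \<le> (?c * B powr landing_count M UNIV 0 R w) powr p"
      using jump_density_bounds[OF \<rho> \<rho>B B w R] p by (intro powr_mono2) auto
    also have "\<dots> = ?c powr p * (B powr p) powr landing_count M UNIV 0 R w"
      by (simp add: powr_mult powr_powr mult.commute)
    finally show "norm (jump_density R \<rho> w powr p) \<le> norm (?c powr p * (B powr p) powr landing_count M UNIV 0 R w)" by simp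
  qed
qed

text \<open>
  For square integrable \<open>Z\<close> the products with the density are integrable because the density has
  all moments.
\<close>

lemma jump_density_intensity_L2:
  fixes \<rho> Z :: "('w \<times> real) \<times> 'k \<Rightarrow> real"
  assumes S: "(x, a) \<in> space (age_state_space M)" and R: "0 \<le> R"
    and \<rho> [measurable]: "\<rho> \<in> borel_measurable marked_predictable"
    and \<rho>B: "\<And>z. 0 \<le> \<rho> z \<and> \<rho> z \<le> B" and B: "1 \<le> B"
    and Z [measurable]: "Z \<in> borel_measurable marked_predictable"
    and Z2: "(\<integral>\<^sup>+ w. compensator M R (\<lambda>z. ennreal ((Z z)\<^sup>2)) w \<partial>law M x a) < \<infinity>"
  shows "AE w in law M x a. compensator M R (\<lambda>z. ennreal ((Z z)\<^sup>2)) w < \<infinity>"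
    "AE w in law M x a. compensator M R (\<lambda>z. ennreal \<bar>Z z\<bar>) w < \<infinity>"
    "AE w in law M x a. compensator M R (\<lambda>z. ennreal \<bar>Z z * \<rho> z\<bar>) w < \<infinity>"
    "integrable (law M x a) (\<lambda>w. jump_density R \<rho> w * jump_sum M {0<..R} Z w)"
    "integrable (law M x a) (\<lambda>w. jump_density R \<rho> w * comp_int R (\<lambda>z. Z z * \<rho> z) w)"
    "(LINT w|law M x a. jump_density R \<rho> w * jump_sum M {0<..R} Z w)
      = (LINT w|law M x a. jump_density R \<rho> w * comp_int R (\<lambda>z. Z z * \<rho> z) w)"
proof -
  define P where "P = law M x a"
  have spP: "space P = sample_space M" unfolding P_def using S by (rule law_space)
  let ?L = "jump_density R \<rho>"
  have Lm [measurable]: "?L \<in> borel_measurable P" unfolding P_def by (rule jump_density_measurable[OF \<rho> \<rho>B B S R])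
  have L0: "0 \<le> ?L w" if "w \<in> sample_space M" for w by (rule jump_density_bounds[OF \<rho> \<rho>B B that R])
  have cm: "compensator M R (\<lambda>z. ennreal (h z)) \<in> borel_measurable P"
    if "h \<in> borel_measurable marked_predictable" for h
    unfolding P_def by (rule measurable_law_generated[OF S compensator_measurable]) (use that in measurable)
  have ab: "c * \<bar>z\<bar> \<le> c\<^sup>2 + z\<^sup>2" for c z :: real
  proof -
    have "2 * c * \<bar>z\<bar> \<le> c\<^sup>2 + z\<^sup>2" using sum_squares_bound[of c "\<bar>z\<bar>"] by simp
    moreover have "c * \<bar>z\<bar> \<le> 2 * c * \<bar>z\<bar> \<or> c * \<bar>z\<bar> \<le> 0" by (cases "0 \<le> c") (auto simp: mult_nonpos_nonneg)
    ultimately show ?thesis by (smt (verit) zero_le_power2)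
  qed
  \<comment> \<open>\<open>c \<bar>z\<bar> \<le> c\<^sup>2 + z\<^sup>2\<close>, integrated; \<open>c\<close> is going to be the value of the density\<close>
  have weight: "ennreal c * compensator M R (\<lambda>z. ennreal \<bar>Z z\<bar>) w
      \<le> ennreal (c\<^sup>2) * ennreal (rate_sup * R) + compensator M R (\<lambda>z. ennreal ((Z z)\<^sup>2)) w"
    if w: "w \<in> sample_space M" and c: "0 \<le> c" for c w
  proof -
    have "ennreal c * compensator M R (\<lambda>z. ennreal \<bar>Z z\<bar>) w = compensator M R (\<lambda>z. ennreal c * ennreal \<bar>Z z\<bar>) w"
      by (rule compensator_cmult[symmetric, OF _ w]) measurable
    also have "\<dots> \<le> compensator M R (\<lambda>z. ennreal (c\<^sup>2) + ennreal ((Z z)\<^sup>2)) w"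
      using ab c by (intro compensator_mono w) (auto simp: ennreal_mult[symmetric] ennreal_plus[symmetric] simp del: ennreal_plus intro!: ennreal_leI)
    also have "\<dots> = compensator M R (\<lambda>z. ennreal (c\<^sup>2)) w + compensator M R (\<lambda>z. ennreal ((Z z)\<^sup>2)) w"
      by (rule compensator_add[OF _ _ w]) measurable
    also have "\<dots> \<le> ennreal (c\<^sup>2) * ennreal (rate_sup * R) + compensator M R (\<lambda>z. ennreal ((Z z)\<^sup>2)) w"
      by (intro add_right_mono compensator_const_le w R)
    finally show ?thesis .
  qed
  have rhoB: "compensator M R (\<lambda>z. ennreal (\<bar>Z z\<bar> * \<rho> z)) w \<le> ennreal B * compensator M R (\<lambda>z. ennreal \<bar>Z z\<bar>) w"
    if w: "w \<in> sample_space M" for w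
  proof -
    have "compensator M R (\<lambda>z. ennreal (\<bar>Z z\<bar> * \<rho> z)) w \<le> compensator M R (\<lambda>z. ennreal B * ennreal \<bar>Z z\<bar>) w"
    proof (rule compensator_mono[OF w])
      fix z
      have "\<bar>Z z\<bar> * \<rho> z \<le> B * \<bar>Z z\<bar>" using \<rho>B[of z] by (simp add: mult.commute mult_right_mono)
      then show "ennreal (\<bar>Z z\<bar> * \<rho> z) \<le> ennreal B * ennreal \<bar>Z z\<bar>" using B by (simp add: ennreal_mult[symmetric] ennreal_leI)
    qed
    also have "\<dots> = ennreal B * compensator M R (\<lambda>z. ennreal \<bar>Z z\<bar>) w" by (rule compensator_cmult[OF _ w]) measurable
    finally show ?thesis .
  qed
  have sq: "AE w in P. compensator M R (\<lambda>z. ennreal ((Z z)\<^sup>2)) w < \<infinity>"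
  proof -
    have "(\<lambda>z. (Z z)\<^sup>2) \<in> borel_measurable marked_predictable" by measurable
    from nn_integral_noteq_infinite[OF cm[OF this]] Z2 show ?thesis by (simp add: P_def less_top)
  qed
  then show "AE w in law M x a. compensator M R (\<lambda>z. ennreal ((Z z)\<^sup>2)) w < \<infinity>" unfolding P_def .
  have fin1: "AE w in P. compensator M R (\<lambda>z. ennreal \<bar>Z z\<bar>) w < \<infinity>"
    using sq AE_space
  proof eventually_elim
    case (elim w)
    then have "compensator M R (\<lambda>z. ennreal \<bar>Z z\<bar>) w \<le> ennreal (1\<^sup>2) * ennreal (rate_sup * R) + compensator M R (\<lambda>z. ennreal ((Z z)\<^sup>2)) w"
      using weight[of w 1] by (simp add: spP)
    also have "\<dots> < \<infinity>" using elim by (simp add: ennreal_mult_less_top)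
    finally show ?case .
  qed
  then show "AE w in law M x a. compensator M R (\<lambda>z. ennreal \<bar>Z z\<bar>) w < \<infinity>" unfolding P_def .
  have abs\<rho>: "\<bar>Z z * \<rho> z\<bar> = \<bar>Z z\<bar> * \<rho> z" for z using \<rho>B[of z] by (simp add: abs_mult)
  have fin2: "AE w in P. compensator M R (\<lambda>z. ennreal \<bar>Z z * \<rho> z\<bar>) w < \<infinity>"
    unfolding abs\<rho> using fin1 AE_space
  proof eventually_elim
    case (elim w)
    then have "compensator M R (\<lambda>z. ennreal (\<bar>Z z\<bar> * \<rho> z)) w \<le> ennreal B * compensator M R (\<lambda>z. ennreal \<bar>Z z\<bar>) w"
      by (intro rhoB) (simp add: spP)
    also have "\<dots> < \<infinity>" using elim by (simp add: ennreal_mult_less_top)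
    finally show ?case .
  qed
  then show "AE w in law M x a. compensator M R (\<lambda>z. ennreal \<bar>Z z * \<rho> z\<bar>) w < \<infinity>" unfolding P_def .
  have Lfin: "(\<integral>\<^sup>+ w. ennreal (?L w) * compensator M R (\<lambda>z. ennreal (\<bar>Z z\<bar> * \<rho> z)) w \<partial>P) < \<infinity>"
  proof -
    have "(\<integral>\<^sup>+ w. ennreal (?L w) * compensator M R (\<lambda>z. ennreal (\<bar>Z z\<bar> * \<rho> z)) w \<partial>P)
        \<le> (\<integral>\<^sup>+ w. ennreal B * (ennreal (rate_sup * R) * ennreal (?L w powr 2) + compensator M R (\<lambda>z. ennreal ((Z z)\<^sup>2)) w) \<partial>P)"
    proof (rule nn_integral_mono)
      fix w assume "w \<in> space P"
      then have w: "w \<in> sample_space M" by (simp add: spP)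
      have "ennreal (?L w) * compensator M R (\<lambda>z. ennreal (\<bar>Z z\<bar> * \<rho> z)) w
          \<le> ennreal (?L w) * (ennreal B * compensator M R (\<lambda>z. ennreal \<bar>Z z\<bar>) w)"
        by (intro mult_left_mono rhoB w) simp
      also have "\<dots> = ennreal B * (ennreal (?L w) * compensator M R (\<lambda>z. ennreal \<bar>Z z\<bar>) w)" by (simp add: mult_ac)
      also have "\<dots> \<le> ennreal B * (ennreal ((?L w)\<^sup>2) * ennreal (rate_sup * R) + compensator M R (\<lambda>z. ennreal ((Z z)\<^sup>2)) w)"
        by (intro mult_left_mono weight w L0) simp
      finally show "ennreal (?L w) * compensator M R (\<lambda>z. ennreal (\<bar>Z z\<bar> * \<rho> z)) w
          \<le> ennreal B * (ennreal (rate_sup * R) * ennreal (?L w powr 2) + compensator M R (\<lambda>z. ennreal ((Z z)\<^sup>2)) w)"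
        using L0[OF w] by (simp add: powr_numeral mult.commute)
    qed
    also have "\<dots> = ennreal B * (ennreal (rate_sup * R) * (\<integral>\<^sup>+ w. ennreal (?L w powr 2) \<partial>P)
        + (\<integral>\<^sup>+ w. compensator M R (\<lambda>z. ennreal ((Z z)\<^sup>2)) w \<partial>P))"
      using cm[of "\<lambda>z. (Z z)\<^sup>2"] by (simp add: nn_integral_cmult nn_integral_add)
    also have "\<dots> < \<infinity>"
      using Z2 jump_density_powr_integrable[OF S R \<rho> \<rho>B B, of 2]
      by (simp add: P_def ennreal_mult_less_top integrable_iff_bounded)
    finally show ?thesis .
  qed
  define Zp where "Zp z = max 0 (Z z)" for z
  define Zm where "Zm z = max 0 (- Z z)" for z
  have part: "integrable P (\<lambda>w. ?L w * jump_sum M {0<..R} h w) \<and> integrable P (\<lambda>w. ?L w * comp_int R (\<lambda>z. h z * \<rho> z) w)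
      \<and> (LINT w|P. ?L w * jump_sum M {0<..R} h w) = (LINT w|P. ?L w * comp_int R (\<lambda>z. h z * \<rho> z) w)"
    if h [measurable]: "h \<in> borel_measurable marked_predictable" and h0: "\<And>z. 0 \<le> h z" "\<And>z. h z \<le> \<bar>Z z\<bar>" for h
  proof -
    have hr0: "0 \<le> h z * \<rho> z" and hr: "h z * \<rho> z \<le> \<bar>Z z\<bar> * \<rho> z" for z
      using h0[of z] \<rho>B[of z] by (auto intro: mult_right_mono)
    have hm: "(\<lambda>z. h z * \<rho> z) \<in> borel_measurable marked_predictable" by measurable
    have jm: "jump_sum M {0<..R} h \<in> borel_measurable P" and cim: "comp_int R (\<lambda>z. h z * \<rho> z) \<in> borel_measurable P"
      unfolding P_def by (rule measurable_law_generated[OF S jump_sum_measurable_real[OF h R]])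
        (rule measurable_law_generated[OF S comp_int_measurable[OF hm]])
    have j0: "0 \<le> jump_sum M {0<..R} h w" for w unfolding jump_sum_def using h0 by (intro sum_nonneg) auto
    have c0: "0 \<le> comp_int R (\<lambda>z. h z * \<rho> z) w" for w
      unfolding comp_int_def set_lebesgue_integral_def using hr0 by (intro Bochner_Integration.integral_nonneg) (auto intro!: Bochner_Integration.integral_nonneg)
    have ci: "AE w in P. compensator M R (\<lambda>z. ennreal (h z * \<rho> z)) w = ennreal (comp_int R (\<lambda>z. h z * \<rho> z) w)"
      using fin2 AE_space
    proof eventually_elim
      case (elim w)
      then have w: "w \<in> sample_space M" by (simp add: spP)
      have "compensator M R (\<lambda>z. ennreal \<bar>h z * \<rho> z\<bar>) w \<le> compensator M R (\<lambda>z. ennreal \<bar>Z z * \<rho> z\<bar>) w"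
        using hr hr0 by (intro compensator_mono w ennreal_leI) (simp add: abs\<rho>)
      then have "compensator M R (\<lambda>z. ennreal \<bar>h z * \<rho> z\<bar>) w < \<infinity>" using elim(1) by (rule le_less_trans)
      then show ?case by (rule compensator_finite(3)[OF hm w _ hr0])
    qed
    have J: "(\<integral>\<^sup>+ w. ennreal (?L w * jump_sum M {0<..R} h w) \<partial>P) = (\<integral>\<^sup>+ w. ennreal (?L w) * compensator M R (\<lambda>z. ennreal (h z * \<rho> z)) w \<partial>P)"
      unfolding P_def by (rule jump_density_intensity[OF S R \<rho> \<rho>B B h h0(1)])
    also have K: "\<dots> = (\<integral>\<^sup>+ w. ennreal (?L w * comp_int R (\<lambda>z. h z * \<rho> z) w) \<partial>P)"
    proof (rule nn_integral_cong_AE)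
      show "AE w in P. ennreal (?L w) * compensator M R (\<lambda>z. ennreal (h z * \<rho> z)) w = ennreal (?L w * comp_int R (\<lambda>z. h z * \<rho> z) w)"
        using ci AE_space by eventually_elim (use L0 c0 in \<open>simp add: spP ennreal_mult\<close>)
    qed
    finally have JK: "(\<integral>\<^sup>+ w. ennreal (?L w * jump_sum M {0<..R} h w) \<partial>P) = (\<integral>\<^sup>+ w. ennreal (?L w * comp_int R (\<lambda>z. h z * \<rho> z) w) \<partial>P)" .
    have "(\<integral>\<^sup>+ w. ennreal (?L w) * compensator M R (\<lambda>z. ennreal (h z * \<rho> z)) w \<partial>P)
        \<le> (\<integral>\<^sup>+ w. ennreal (?L w) * compensator M R (\<lambda>z. ennreal (\<bar>Z z\<bar> * \<rho> z)) w \<partial>P)"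
      using hr by (intro nn_integral_mono mult_left_mono compensator_mono ennreal_leI) (auto simp: spP)
    also note Lfin
    finally have fin: "(\<integral>\<^sup>+ w. ennreal (?L w * comp_int R (\<lambda>z. h z * \<rho> z) w) \<partial>P) < \<infinity>" unfolding K .
    have n1: "AE w in P. 0 \<le> ?L w * jump_sum M {0<..R} h w" and n2: "AE w in P. 0 \<le> ?L w * comp_int R (\<lambda>z. h z * \<rho> z) w"
      using L0 j0 c0 by (auto simp: spP intro!: AE_I2)
    have i1: "integrable P (\<lambda>w. ?L w * jump_sum M {0<..R} h w)"
      by (rule integrableI_nonneg[OF _ n1]) (use jm fin JK in auto)
    have i2: "integrable P (\<lambda>w. ?L w * comp_int R (\<lambda>z. h z * \<rho> z) w)"
      by (rule integrableI_nonneg[OF _ n2]) (use cim fin in auto)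
    have "ennreal (LINT w|P. ?L w * jump_sum M {0<..R} h w) = ennreal (LINT w|P. ?L w * comp_int R (\<lambda>z. h z * \<rho> z) w)"
      using JK unfolding nn_integral_eq_integral[OF i1 n1] nn_integral_eq_integral[OF i2 n2] .
    then have "(LINT w|P. ?L w * jump_sum M {0<..R} h w) = (LINT w|P. ?L w * comp_int R (\<lambda>z. h z * \<rho> z) w)"
      using integral_nonneg_AE[OF n1] integral_nonneg_AE[OF n2] by simp
    with i1 i2 show ?thesis by blast
  qed
  have Zp: "Zp \<in> borel_measurable marked_predictable" and Zm: "Zm \<in> borel_measurable marked_predictable"
    unfolding Zp_def[abs_def] Zm_def[abs_def] by measurable
  have pp: "integrable P (\<lambda>w. ?L w * jump_sum M {0<..R} Zp w)" "integrable P (\<lambda>w. ?L w * comp_int R (\<lambda>z. Zp z * \<rho> z) w)"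
    "(LINT w|P. ?L w * jump_sum M {0<..R} Zp w) = (LINT w|P. ?L w * comp_int R (\<lambda>z. Zp z * \<rho> z) w)"
    using part[OF Zp] by (auto simp: Zp_def)
  have mm: "integrable P (\<lambda>w. ?L w * jump_sum M {0<..R} Zm w)" "integrable P (\<lambda>w. ?L w * comp_int R (\<lambda>z. Zm z * \<rho> z) w)"
    "(LINT w|P. ?L w * jump_sum M {0<..R} Zm w) = (LINT w|P. ?L w * comp_int R (\<lambda>z. Zm z * \<rho> z) w)"
    using part[OF Zm] by (auto simp: Zm_def)
  have Zd: "Z z = Zp z - Zm z" for z by (auto simp: Zp_def Zm_def)
  have jd: "?L w * jump_sum M {0<..R} Z w = ?L w * jump_sum M {0<..R} Zp w - ?L w * jump_sum M {0<..R} Zm w" for w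
    unfolding jump_sum_def right_diff_distrib[symmetric] sum_subtractf[symmetric] Zd ..
  have cd: "AE w in P. ?L w * comp_int R (\<lambda>z. Z z * \<rho> z) w = ?L w * comp_int R (\<lambda>z. Zp z * \<rho> z) w - ?L w * comp_int R (\<lambda>z. Zm z * \<rho> z) w"
    using fin2 AE_space
  proof eventually_elim
    case (elim w)
    then have w: "w \<in> sample_space M" by (simp add: spP)
    have le: "compensator M R (\<lambda>z. ennreal \<bar>Zp z * \<rho> z\<bar>) w \<le> compensator M R (\<lambda>z. ennreal \<bar>Z z * \<rho> z\<bar>) w"
       "compensator M R (\<lambda>z. ennreal \<bar>Zm z * \<rho> z\<bar>) w \<le> compensator M R (\<lambda>z. ennreal \<bar>Z z * \<rho> z\<bar>) w"
      by (intro compensator_mono w ennreal_leI; auto simp: abs_mult Zp_def Zm_def intro!: mult_right_mono)+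
    have Zpm: "(\<lambda>z. Zp z * \<rho> z) \<in> borel_measurable marked_predictable"
      and Zmm: "(\<lambda>z. Zm z * \<rho> z) \<in> borel_measurable marked_predictable" using Zp Zm by measurable
    note fp = compensator_finite[OF Zpm w le_less_trans[OF le(1) elim(1)]]
      and fm = compensator_finite[OF Zmm w le_less_trans[OF le(2) elim(1)]]
    have "comp_int R (\<lambda>z. Z z * \<rho> z) w = (LINT r:{0<..R}|lborel. (LINT y|left_intensity M (w, r). Zp ((w, r), y) * \<rho> ((w, r), y))
        - (LINT y|left_intensity M (w, r). Zm ((w, r), y) * \<rho> ((w, r), y)))"
      unfolding comp_int_def set_lebesgue_integral_def
    proof (rule integral_cong_AE)
      show "(\<lambda>r. indicator {0<..R} r *\<^sub>R (LINT y|left_intensity M (w, r). Z ((w, r), y) * \<rho> ((w, r), y))) \<in> borel_measurable lborel"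
        using compensator_finite(2)[of "\<lambda>z. Z z * \<rho> z", OF _ w elim(1)] unfolding set_integrable_def by (auto dest: borel_measurable_integrable)
      show "(\<lambda>r. indicator {0<..R} r *\<^sub>R ((LINT y|left_intensity M (w, r). Zp ((w, r), y) * \<rho> ((w, r), y))
        - (LINT y|left_intensity M (w, r). Zm ((w, r), y) * \<rho> ((w, r), y)))) \<in> borel_measurable lborel"
        using set_integral_diff(1)[OF fp(2) fm(2)] unfolding set_integrable_def by (auto dest: borel_measurable_integrable)
      show "AE r in lborel. indicator {0<..R} r *\<^sub>R (LINT y|left_intensity M (w, r). Z ((w, r), y) * \<rho> ((w, r), y))
        = indicator {0<..R} r *\<^sub>R ((LINT y|left_intensity M (w, r). Zp ((w, r), y) * \<rho> ((w, r), y))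
        - (LINT y|left_intensity M (w, r). Zm ((w, r), y) * \<rho> ((w, r), y)))"
        using fp(1) fm(1)
      proof eventually_elim
        case (elim r)
        show ?case
        proof (cases "r \<in> {0<..R}")
          case True
          then show ?thesis using elim by (simp add: Zd left_diff_distrib)
        qed simp
      qed
    qed
    also have "\<dots> = comp_int R (\<lambda>z. Zp z * \<rho> z) w - comp_int R (\<lambda>z. Zm z * \<rho> z) w"
      unfolding comp_int_def by (rule set_integral_diff(2)[OF fp(2) fm(2)])
    finally show ?case by (simp add: right_diff_distrib)
  qed
  have m: "(\<lambda>w. ?L w * comp_int R (\<lambda>z. Z z * \<rho> z) w) \<in> borel_measurable P"
  proof -
    have "comp_int R (\<lambda>z. Z z * \<rho> z) \<in> borel_measurable P"
      unfolding P_def by (rule measurable_law_generated[OF S comp_int_measurable]) measurable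
    then show ?thesis by measurable
  qed
  have id: "integrable P (\<lambda>w. ?L w * comp_int R (\<lambda>z. Zp z * \<rho> z) w - ?L w * comp_int R (\<lambda>z. Zm z * \<rho> z) w)"
    using pp(2) mm(2) by simp
  show "integrable (law M x a) (\<lambda>w. ?L w * jump_sum M {0<..R} Z w)"
    unfolding jd P_def[symmetric] using pp(1) mm(1) by simp
  show "integrable (law M x a) (\<lambda>w. ?L w * comp_int R (\<lambda>z. Z z * \<rho> z) w)"
    unfolding P_def[symmetric] using integrable_cong_AE[OF m borel_measurable_integrable[OF id] cd] id by simp
  have "(LINT w|P. ?L w * comp_int R (\<lambda>z. Z z * \<rho> z) w) = (LINT w|P. ?L w * comp_int R (\<lambda>z. Zp z * \<rho> z) w - ?L w * comp_int R (\<lambda>z. Zm z * \<rho> z) w)"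
    by (rule integral_cong_AE[OF m borel_measurable_integrable[OF id] cd])
  then show "(LINT w|law M x a. ?L w * jump_sum M {0<..R} Z w) = (LINT w|law M x a. ?L w * comp_int R (\<lambda>z. Z z * \<rho> z) w)"
    unfolding jd P_def[symmetric] using pp mm by simp
qed

section \<open>Events at time zero\<close>

text \<open>
  An event at time \<open>0\<close> depends on the path through its initial value only.
\<close>

lemma initial_sigma_trivial:
  assumes E: "E \<in> sets (nat_filtration M 0)"
    and w: "w \<in> sample_space M" "w' \<in> sample_space M" "state M 0 w = state M 0 w'" "age M 0 w = age M 0 w'"
  shows "w \<in> E \<longleftrightarrow> w' \<in> E"
proof -
  have "E \<in> sigma_sets (sample_space M) {(\<lambda>w. (state M s w, age M s w)) -` B \<inter> sample_space M | s B. s \<in> {0..0} \<and> B \<in> sets (age_state_space M)}"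
    using E unfolding nat_filtration_def sets_generated .
  then show ?thesis
  proof (induction rule: sigma_sets.induct)
    case (Basic E)
    then obtain B where "E = (\<lambda>w. (state M 0 w, age M 0 w)) -` B \<inter> sample_space M" by auto
    then show ?case using w by simp
  next
    case (Compl E)
    then show ?case using w by simp
  qed auto
qed

text \<open>
  The initial value of the process is almost surely fixed, and it determines \<open>Y\<close>.
\<close>

lemma initial_value_deterministic:
  assumes S: "(x, a) \<in> space (age_state_space M)" and Y: "Y \<in> borel_measurable (nat_filtration M 0)"
  obtains y :: real where "AE w in law M x a. Y w = y"
proof (cases "\<exists>w0 \<in> sample_space M. state M 0 w0 = x \<and> age M 0 w0 = a")
  case True
  then obtain w0 where w0: "w0 \<in> sample_space M" "state M 0 w0 = x" "age M 0 w0 = a" by blast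
  have E: "{w \<in> sample_space M. Y w = Y w0} \<in> sets (nat_filtration M 0)"
  proof -
    have "{w \<in> space (nat_filtration M 0). Y w = Y w0} \<in> sets (nat_filtration M 0)" using Y by measurable
    then show ?thesis by simp
  qed
  have "AE w in law M x a. Y w = Y w0"
    using AE_initial[OF S] AE_space
  proof eventually_elim
    case (elim w)
    then have "w \<in> {w \<in> sample_space M. Y w = Y w0}"
      using initial_sigma_trivial[OF E w0(1), of w] w0 by (simp add: law_space[OF S])
    then show ?case by simp
  qed
  then show ?thesis by (rule that)
next
  case False
  have "AE w in law M x a. Y w = 0"
    using AE_initial[OF S] AE_space by eventually_elim (use False in \<open>auto simp: law_space[OF S]\<close>)
  then show ?thesis by (rule that)
qed

end

section \<open>Controlled paths\<close>

context semi_markov_control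
begin

lemma control_measurable:
  "u \<in> admissible M C \<Longrightarrow> (\<lambda>z. u (snd z) (fst z)) \<in>
     restrict_space (predictable M) (sample_space M \<times> {0..horizon C}) \<rightarrow>\<^sub>M control_space C"
  by (simp add: admissible_def split_beta')

lemma control_in_space:
  assumes "u \<in> admissible M C" "w \<in> sample_space M" "0 \<le> s" "s \<le> horizon C"
  shows "u s w \<in> space (control_space C)"
  using measurable_space[OF control_measurable[OF assms(1)], of "(w, s)"] assms(2-)
  by (simp add: space_restrict_space)

text \<open>
  Evaluated at left limits instead of current values, to be predictable.
\<close>

definition running_path :: "real \<Rightarrow> (real \<Rightarrow> 'w \<Rightarrow> 'u) \<Rightarrow> 'w \<times> real \<Rightarrow> real" where
  "running_path t u z = (if snd z \<le> horizon C - t then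
     running_cost C (t + snd z) (state_left M (snd z) (fst z)) (age_left M (snd z) (fst z)) (u (snd z) (fst z)) else 0)"

text \<open>
  The density factor along a controlled path, at left limits. It is clamped to \<open>[0, B]\<close>, and equal
  to \<open>1\<close> after the end of the horizon, since its values are controlled on the domain of the data
  only; \<open>jump_density\<close> needs a predictable factor that is bounded everywhere.
\<close>

definition factor_path :: "real \<Rightarrow> real \<Rightarrow> (real \<Rightarrow> 'w \<Rightarrow> 'u) \<Rightarrow> ('w \<times> real) \<times> 'k \<Rightarrow> real" where
  "factor_path B t u z = (if snd (fst z) \<le> horizon C - t then
     max 0 (min B (density_factor C (t + snd (fst z)) (state_left M (snd (fst z)) (fst (fst z)))
       (age_left M (snd (fst z)) (fst (fst z))) (snd z) (u (snd (fst z)) (fst (fst z))))) else 1)"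

lemma running_path_measurable:
  assumes t: "0 \<le> t" "t \<le> horizon C" and u: "u \<in> admissible M C"
  shows "running_path t u \<in> borel_measurable (predictable M)"
proof -
  let ?R = "horizon C - t"
  let ?P = "restrict_space (predictable M) {z. snd z \<le> ?R}"
  have spP: "z \<in> space ?P \<longleftrightarrow> fst z \<in> sample_space M \<and> 0 \<le> snd z \<and> snd z \<le> ?R" for z
    by (cases z) (auto simp: space_restrict_space)
  have 1: "(\<lambda>z. t + snd z) \<in> ?P \<rightarrow>\<^sub>M restrict_space borel {0..horizon C}"
    using t by (intro measurable_restrict_space2 measurable_restrict_space1) (auto simp: spP, measurable)
  have 2: "(\<lambda>z. (state_left M (snd z) (fst z), age_left M (snd z) (fst z))) \<in> ?P \<rightarrow>\<^sub>M age_state_space M"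
    using left_predictable by (intro measurable_restrict_space1) (simp add: split_beta')
  have 3: "(\<lambda>z. u (snd z) (fst z)) \<in> ?P \<rightarrow>\<^sub>M control_space C"
  proof -
    have "(\<lambda>z. z) \<in> ?P \<rightarrow>\<^sub>M restrict_space (predictable M) (sample_space M \<times> {0..horizon C})"
      using t by (intro measurable_restrict_space2 measurable_restrict_space1) (auto simp: spP)
    from measurable_compose[OF this control_measurable[OF u]] show ?thesis .
  qed
  have "(\<lambda>z. (t + snd z, (state_left M (snd z) (fst z), age_left M (snd z) (fst z)), u (snd z) (fst z)))
      \<in> ?P \<rightarrow>\<^sub>M restrict_space borel {0..horizon C} \<Otimes>\<^sub>M age_state_space M \<Otimes>\<^sub>M control_space C"
    by (intro measurable_Pair 1 2 3)
  from measurable_compose[OF this running_cost_measurable]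
  have "(\<lambda>z. running_cost C (t + snd z) (state_left M (snd z) (fst z)) (age_left M (snd z) (fst z)) (u (snd z) (fst z))) \<in> borel_measurable ?P"
    by simp
  moreover have "{z \<in> space (predictable M). snd z \<le> ?R} \<in> sets (predictable M)" by measurable
  ultimately show ?thesis
    unfolding running_path_def[abs_def] by (subst measurable_If_restrict_space_iff) simp_all
qed

lemma factor_path_measurable:
  assumes t: "0 \<le> t" "t \<le> horizon C" and u: "u \<in> admissible M C"
  shows "factor_path B t u \<in> borel_measurable marked_predictable"
proof -
  let ?R = "horizon C - t"
  let ?P = "restrict_space marked_predictable {z. snd (fst z) \<le> ?R}"
  have spP: "z \<in> space ?P \<longleftrightarrow> fst (fst z) \<in> sample_space M \<and> 0 \<le> snd (fst z) \<and> snd (fst z) \<le> ?R \<and> snd z \<in> space (state_space M)" for z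
    by (cases z) (auto simp: space_restrict_space space_pair_measure)
  have 1: "(\<lambda>z. t + snd (fst z)) \<in> ?P \<rightarrow>\<^sub>M restrict_space borel {0..horizon C}"
    using t by (intro measurable_restrict_space2 measurable_restrict_space1) (auto simp: spP, measurable)
  have 2: "(\<lambda>z. (state_left M (snd (fst z)) (fst (fst z)), age_left M (snd (fst z)) (fst (fst z)))) \<in> ?P \<rightarrow>\<^sub>M age_state_space M"
    using measurable_compose[OF measurable_fst left_predictable] by (intro measurable_restrict_space1) (simp add: split_beta')
  have 3: "snd \<in> ?P \<rightarrow>\<^sub>M state_space M" by (intro measurable_restrict_space1) simp
  have 4: "(\<lambda>z. u (snd (fst z)) (fst (fst z))) \<in> ?P \<rightarrow>\<^sub>M control_space C"
  proof -
    have "fst \<in> ?P \<rightarrow>\<^sub>M restrict_space (predictable M) (sample_space M \<times> {0..horizon C})"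
      using t by (intro measurable_restrict_space2 measurable_restrict_space1) (auto simp: spP mem_Times_iff)
    from measurable_compose[OF this control_measurable[OF u]] show ?thesis .
  qed
  have "(\<lambda>z. (t + snd (fst z), (state_left M (snd (fst z)) (fst (fst z)), age_left M (snd (fst z)) (fst (fst z))), snd z, u (snd (fst z)) (fst (fst z))))
      \<in> ?P \<rightarrow>\<^sub>M restrict_space borel {0..horizon C} \<Otimes>\<^sub>M age_state_space M \<Otimes>\<^sub>M state_space M \<Otimes>\<^sub>M control_space C"
    by (intro measurable_Pair 1 2 3 4)
  from measurable_compose[OF this density_factor_measurable]
  have "(\<lambda>z. density_factor C (t + snd (fst z)) (state_left M (snd (fst z)) (fst (fst z)))
       (age_left M (snd (fst z)) (fst (fst z))) (snd z) (u (snd (fst z)) (fst (fst z)))) \<in> borel_measurable ?P"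
    by simp
  then have "(\<lambda>z. max 0 (min B (density_factor C (t + snd (fst z)) (state_left M (snd (fst z)) (fst (fst z)))
       (age_left M (snd (fst z)) (fst (fst z))) (snd z) (u (snd (fst z)) (fst (fst z)))))) \<in> borel_measurable ?P"
    by measurable
  then show ?thesis unfolding factor_path_def[abs_def]
    by (subst measurable_If_restrict_space_iff) (auto, measurable)
qed

lemma factor_path_bounds: "1 \<le> B \<Longrightarrow> 0 \<le> factor_path B t u z \<and> factor_path B t u z \<le> B"
  by (auto simp: factor_path_def)

lemma factor_path_eq:
  assumes B: "\<forall>t\<in>{0..horizon C}. \<forall>(x, a)\<in>space (age_state_space M).
         \<forall>y\<in>space (state_space M). \<forall>u\<in>space (control_space C).
           0 \<le> density_factor C t x a y u \<and> density_factor C t x a y u \<le> B"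
    and t: "0 \<le> t" "t \<le> horizon C" and u: "u \<in> admissible M C"
    and w: "w \<in> sample_space M" and s: "0 \<le> s" "s \<le> horizon C - t" and y: "y \<in> space (state_space M)"
  shows "factor_path B t u ((w, s), y) = density_factor C (t + s) (state_left M s w) (age_left M s w) y (u s w)"
proof -
  have "(state_left M s w, age_left M s w) \<in> space (age_state_space M)"
    using left_state_space[of "(w, s)"] w s by simp
  moreover have "t + s \<in> {0..horizon C}" using t s by auto
  moreover have "u s w \<in> space (control_space C)" using control_in_space[OF u w s(1)] t s by simp
  ultimately have "0 \<le> density_factor C (t + s) (state_left M s w) (age_left M s w) y (u s w)
      \<and> density_factor C (t + s) (state_left M s w) (age_left M s w) y (u s w) \<le> B"
    using B y by fast
  then show ?thesis using s by (simp add: factor_path_def)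
qed

lemma density_process_eq:
  assumes B: "\<forall>t\<in>{0..horizon C}. \<forall>(x, a)\<in>space (age_state_space M).
         \<forall>y\<in>space (state_space M). \<forall>u\<in>space (control_space C).
           0 \<le> density_factor C t x a y u \<and> density_factor C t x a y u \<le> B"
    and t: "0 \<le> t" "t \<le> horizon C" and u: "u \<in> admissible M C" and w: "w \<in> sample_space M"
  shows "density_process M C t u (horizon C - t) w = jump_density (horizon C - t) (factor_path B t u) w"
proof -
  let ?R = "horizon C - t"
  note eq = factor_path_eq[OF B t u w]
  have "(LINT \<sigma>:{0..?R}|lborel. (LINT y|intensity M (state M \<sigma> w) (age M \<sigma> w).
               1 - density_factor C (t + \<sigma>) (state M \<sigma> w) (age M \<sigma> w) y (u \<sigma> w)))
      = (LINT \<sigma>:{0<..?R}|lborel. drift (factor_path B t u) (w, \<sigma>))"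
  proof (rule set_integral_off_jumps(1)[OF w])
    fix r assume r: "0 < r" "r \<le> ?R" and l: "state_left M r w = state M r w" "age_left M r w = age M r w"
    have z: "(w, r) \<in> space (predictable M)" using w r by simp
    show "(LINT y|intensity M (state M r w) (age M r w). 1 - density_factor C (t + r) (state M r w) (age M r w) y (u r w))
        = drift (factor_path B t u) (w, r)"
      unfolding drift_def left_intensity_off_jump[OF l, symmetric]
      using eq[of r] r l by (intro Bochner_Integration.integral_cong refl) (simp add: space_left_intensity[OF z])
  qed
  moreover have "(\<Prod>n\<in>{n. 1 \<le> n \<and> jump_time M n w \<le> ereal ?R}.
          let \<tau> = real_of_ereal (jump_time M n w)
          in density_factor C (t + \<tau>) (state_left M \<tau> w) (age_left M \<tau> w) (state M \<tau> w) (u \<tau> w))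
     = (\<Prod>\<tau>\<in>jumps M w \<inter> {0<..?R}. density_factor C (t + \<tau>) (state_left M \<tau> w) (age_left M \<tau> w) (state M \<tau> w) (u \<tau> w))"
    unfolding Let_def by (rule prod.reindex_bij_betw[OF bij_betw_jump_time_upto[OF w]])
  moreover have "\<dots> = (\<Prod>\<tau>\<in>jumps M w \<inter> {0<..?R}. factor_path B t u ((w, \<tau>), state M \<tau> w))"
    using eq state_in_space[OF w] by (intro prod.cong refl) auto
  ultimately show ?thesis
    unfolding density_process_def jump_density_def set_integral_endpoints(1) by simp
qed

text \<open>
  Up to time \<open>R\<close> there are finitely many jumps, and they correspond to the times \<open>T n\<close> bijectively;
  so the integral over the jump measure is a finite sum over the jumps.
\<close>

lemma compensated_integral_eq:
  fixes H :: "('w \<times> real) \<times> 'k \<Rightarrow> real"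
  assumes H: "H \<in> borel_measurable marked_predictable" and w: "w \<in> sample_space M"
    and eq: "\<And>r y. 0 < r \<Longrightarrow> r \<le> R \<Longrightarrow> Z r y = H ((w, r), y)"
  shows "compensated_integral M 0 R Z w = jump_sum M {0<..R} H w - comp_int R H w"
proof -
  let ?K = "state_space M"
  define N where "N = {n. 1 \<le> n \<and> jump_time M n w < \<infinity>}"
  define T where "T n = real_of_ereal (jump_time M n w)" for n
  have NT: "T n \<in> jumps M w" if "n \<in> N" for n
    using bij_betwE[OF bij_betw_jump_time[OF w]] that by (auto simp: N_def T_def)
  have "(LINT z:{0<..R} \<times> space ?K|jump_measure M w. Z (fst z) (snd z))
      = (LINT z|jump_measure M w. indicator ({0<..R} \<times> space ?K) z * H ((w, max 0 (fst z)), snd z))"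
    unfolding set_lebesgue_integral_def
    by (intro Bochner_Integration.integral_cong refl) (auto simp: indicator_def eq max_def)
  also have "\<dots> = (LINT n|count_space N. indicator ({0<..R} \<times> space ?K) (T n, state M (T n) w) * H ((w, max 0 (T n)), state M (T n) w))"
    unfolding jump_measure_def N_def[symmetric] T_def[symmetric]
  proof (subst integral_distr)
    show "(\<lambda>n. (T n, state M (T n) w)) \<in> count_space N \<rightarrow>\<^sub>M borel \<Otimes>\<^sub>M ?K"
      using state_in_space[OF w] jumps_pos NT by (auto simp: space_pair_measure dest!: NT intro: less_imp_le)
    have "(\<lambda>z. ((w, max 0 (fst z)), snd z)) \<in> borel \<Otimes>\<^sub>M ?K \<rightarrow>\<^sub>M predictable M \<Otimes>\<^sub>M ?K"
    proof (intro measurable_Pair measurable_snd)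
      have "w \<in> space (generated_by_times M {0..})" using w by simp
      from measurable_compose[OF measurable_fst measurable_compose[OF measurable_Pair1'[OF this] clamp_predictable]]
      show "(\<lambda>z. (w, max 0 (fst z))) \<in> borel \<Otimes>\<^sub>M ?K \<rightarrow>\<^sub>M predictable M" by simp
    qed
    from measurable_compose[OF this H]
    show "(\<lambda>z. indicator ({0<..R} \<times> space ?K) z * H ((w, max 0 (fst z)), snd z)) \<in> borel_measurable (borel \<Otimes>\<^sub>M ?K)"
      by measurable
  qed simp
  also have "\<dots> = (LINT n|count_space N. indicator {0<..R} (T n) * H ((w, T n), state M (T n) w))"
    using state_in_space[OF w] jumps_pos NT
    by (intro Bochner_Integration.integral_cong refl) (auto simp: indicator_def max_def)
  also have "\<dots> = (\<Sum>n\<in>{n\<in>N. indicator {0<..R} (T n) * H ((w, T n), state M (T n) w) \<noteq> 0}. indicator {0<..R} (T n) * H ((w, T n), state M (T n) w))"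
  proof (rule lebesgue_integral_count_space_finite_support)
    have "{n\<in>N. T n \<le> R} \<subseteq> {n. 1 \<le> n \<and> jump_time M n w \<le> ereal R}"
    proof
      fix n assume "n \<in> {n\<in>N. T n \<le> R}"
      then show "n \<in> {n. 1 \<le> n \<and> jump_time M n w \<le> ereal R}"
        using jump_time_cases[OF w, of n] by (auto simp: N_def T_def)
    qed
    moreover have "finite {n. 1 \<le> n \<and> jump_time M n w \<le> ereal R}"
      using bij_betw_finite[OF bij_betw_jump_time_upto[OF w]] finite_jumps_Ioc[OF w] by blast
    ultimately have "finite {n\<in>N. T n \<le> R}" by (rule finite_subset)
    then show "finite {n\<in>N. indicator {0<..R} (T n) * H ((w, T n), state M (T n) w) \<noteq> 0}"
      by (rule finite_subset[rotated]) (auto simp: indicator_def split: if_splits)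
  qed
  also have "\<dots> = (\<Sum>n\<in>{n. 1 \<le> n \<and> jump_time M n w \<le> ereal R}. H ((w, T n), state M (T n) w))"
  proof (rule sum.mono_neutral_cong_left)
    show "finite {n. 1 \<le> n \<and> jump_time M n w \<le> ereal R}"
      using bij_betw_finite[OF bij_betw_jump_time_upto[OF w]] finite_jumps_Ioc[OF w] by blast
    have up: "T n \<in> jumps M w \<inter> {0<..R}" if "n \<in> {n. 1 \<le> n \<and> jump_time M n w \<le> ereal R}" for n
      using bij_betwE[OF bij_betw_jump_time_upto[OF w, of R]] that unfolding T_def by blast
    have upN: "n \<in> N" if "n \<in> {n. 1 \<le> n \<and> jump_time M n w \<le> ereal R}" for n
      using that unfolding N_def by (cases "jump_time M n w") auto
    show "\<forall>i\<in>{n. 1 \<le> n \<and> jump_time M n w \<le> ereal R} - {n\<in>N. indicator {0<..R} (T n) * H ((w, T n), state M (T n) w) \<noteq> 0}.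
       H ((w, T i), state M (T i) w) = 0"
    proof
      fix n assume n: "n \<in> {n. 1 \<le> n \<and> jump_time M n w \<le> ereal R} - {n\<in>N. indicator {0<..R} (T n) * H ((w, T n), state M (T n) w) \<noteq> 0}"
      then have "T n \<in> {0<..R}" "n \<in> N" using up[of n] upN[of n] by blast+
      with n show "H ((w, T n), state M (T n) w) = 0" by simp
    qed
    show "{n\<in>N. indicator {0<..R} (T n) * H ((w, T n), state M (T n) w) \<noteq> 0} \<subseteq> {n. 1 \<le> n \<and> jump_time M n w \<le> ereal R}"
    proof
      fix n assume "n \<in> {n\<in>N. indicator {0<..R} (T n) * H ((w, T n), state M (T n) w) \<noteq> 0}"
      then have "n \<in> N" "T n \<le> R" by (auto simp: indicator_def split: if_splits)
      then show "n \<in> {n. 1 \<le> n \<and> jump_time M n w \<le> ereal R}"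
        using jump_time_cases[OF w, of n] by (auto simp: N_def T_def)
    qed
  qed (auto simp: indicator_def)
  also have "\<dots> = jump_sum M {0<..R} H w"
    unfolding jump_sum_def T_def
    by (rule sum.reindex_bij_betw[OF bij_betw_jump_time_upto[OF w], of "\<lambda>\<tau>. H ((w, \<tau>), state M \<tau> w)"])
  finally have 1: "(LINT z:{0<..R} \<times> space ?K|jump_measure M w. Z (fst z) (snd z)) = jump_sum M {0<..R} H w" .
  have 2: "(LINT \<sigma>:{0<..R}|lborel. (LINT y|intensity M (state_left M \<sigma> w) (age_left M \<sigma> w). Z \<sigma> y)) = comp_int R H w"
    unfolding comp_int_def left_intensity_def fst_conv snd_conv
    by (rule set_lebesgue_integral_cong) (simp_all add: eq)
  show ?thesis unfolding compensated_integral_def 1 2 ..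
qed

section \<open>The Hamiltonian inequality\<close>

text \<open>
  The running cost is bounded below, and the density factor is bounded, so that \<open>1 + z\<^sup>2\<close> dominates
  the integrand uniformly in the control. Without a lower bound the infimum in the Hamiltonian would
  not be a lower bound of its values.
\<close>

lemma pre_hamiltonian_bdd_below:
  assumes t: "t \<in> {0..horizon C}" and S: "(x, a) \<in> space (age_state_space M)" and u: "u \<in> admissible M C"
    and z: "z \<in> L2_intensity M x a"
  shows "bdd_below (pre_hamiltonian M C t x a z ` space (control_space C))"
proof -
  obtain Cr where Cr: "\<forall>t\<in>{0..horizon C}. \<forall>(x, a)\<in>space (age_state_space M).
         \<forall>y\<in>space (state_space M). \<forall>u\<in>space (control_space C).
           0 \<le> density_factor C t x a y u \<and> density_factor C t x a y u \<le> Cr"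
    using density_factor_bound by blast
  obtain \<alpha> where "\<forall>t\<in>{0..horizon C}. \<forall>(x, a)\<in>space (age_state_space M). \<forall>u\<in>admissible M C.
         bdd_below (running_cost C t x a ` space (control_space C))"
    using running_cost_bound by fast
  then have "bdd_below (running_cost C t x a ` space (control_space C))" using t S u by fast
  then obtain b where b: "\<And>v. v \<in> space (control_space C) \<Longrightarrow> b \<le> running_cost C t x a v"
    unfolding bdd_below_def by blast
  interpret finite_measure "intensity M x a" by (rule finite_measure_intensity[OF S])
  have zm: "z \<in> borel_measurable (intensity M x a)"
    using z measurable_cong_sets[OF sets_intensity[OF S] refl] unfolding L2_intensity_def by blast
  have z2: "integrable (intensity M x a) (\<lambda>y. (z y)\<^sup>2)" using z unfolding L2_intensity_def by blast
  have bound: "integrable (intensity M x a) (\<lambda>y. (\<bar>Cr\<bar> + 1) * (1 + (z y)\<^sup>2))" using z2 by simp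
  define K where "K = (LINT y|intensity M x a. (\<bar>Cr\<bar> + 1) * (1 + (z y)\<^sup>2))"
  have "b - K \<le> pre_hamiltonian M C t x a z v" if v: "v \<in> space (control_space C)" for v
  proof -
    let ?h = "\<lambda>y. z y * (density_factor C t x a y v - 1)"
    have "\<bar>LINT y|intensity M x a. ?h y\<bar> \<le> (LINT y|intensity M x a. \<bar>?h y\<bar>)" by (rule integral_abs_bound)
    also have "\<dots> \<le> K" unfolding K_def
    proof (rule integral_mono'[OF bound])
      fix y assume y: "y \<in> space (intensity M x a)"
      have "0 \<le> density_factor C t x a y v \<and> density_factor C t x a y v \<le> Cr"
        using bspec[OF bspec[OF Cr t] S] y v by (simp add: space_intensity[OF S])
      then have "\<bar>density_factor C t x a y v - 1\<bar> \<le> \<bar>Cr\<bar> + 1" by linarith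
      moreover have "\<bar>z y\<bar> \<le> 1 + (z y)\<^sup>2"
        using sum_squares_bound[of 1 "\<bar>z y\<bar>"] by (simp add: power2_eq_square)
      ultimately have "\<bar>z y\<bar> * \<bar>density_factor C t x a y v - 1\<bar> \<le> (1 + (z y)\<^sup>2) * (\<bar>Cr\<bar> + 1)"
        by (intro mult_mono) auto
      then show "\<bar>?h y\<bar> \<le> (\<bar>Cr\<bar> + 1) * (1 + (z y)\<^sup>2)" by (simp add: abs_mult mult.commute)
    qed simp
    finally show ?thesis using b[OF v] unfolding pre_hamiltonian_def by linarith
  qed
  then show ?thesis by (intro bdd_belowI2[where m="b - K"])
qed

text \<open>
  The equation at time \<open>0\<close>, multiplied by the density, has the form \<open>L y = W - L (D - \<integral> f)\<close>, where
  \<open>D\<close> is the integral of the expression whose infimum is the Hamiltonian \<open>f\<close>, and the expectation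
  of \<open>W\<close> is the cost, because the jumps have the intensity \<open>\<rho> \<kappa>\<close> under the changed law. Since
  \<open>L\<close> has expectation \<open>1\<close>, the sign of \<open>D - \<integral> f\<close> decides.
\<close>

lemma cost_ge_bsde:
  fixes Y :: "real \<Rightarrow> 'w \<Rightarrow> real" and Z :: "real \<Rightarrow> 'w \<Rightarrow> 'k \<Rightarrow> real"
  assumes t: "t \<in> {0..horizon C}" and S: "(x, a) \<in> space (age_state_space M)" and u: "u \<in> admissible M C"
    and sol: "bsde_solution M C t x a Y Z" and y: "AE w in law M x a. Y 0 w = y"
  shows "y \<le> cost M C t x a u"
    "(AE w in law M x a. \<forall>s\<in>{0..horizon C - t}.
        Z s w \<in> L2_intensity M (state_left M s w) (age_left M s w) \<longrightarrow>
        u s w \<in> minimizers M C (t + s) (state_left M s w) (age_left M s w) (Z s w)) \<Longrightarrow>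
      cost M C t x a u = y"
proof -
  define R where "R = horizon C - t"
  define P where "P = law M x a"
  interpret prob_space P unfolding P_def using S by (rule law_prob)
  have spP: "space P = sample_space M" unfolding P_def using S by (rule law_space)
  have R: "0 \<le> R" and t': "0 \<le> t" "t \<le> horizon C" using t by (auto simp: R_def)
  obtain B where B1: "1 < B" and B: "\<forall>t\<in>{0..horizon C}. \<forall>(x, a)\<in>space (age_state_space M).
         \<forall>y\<in>space (state_space M). \<forall>u\<in>space (control_space C).
           0 \<le> density_factor C t x a y u \<and> density_factor C t x a y u \<le> B"
    using density_factor_bound by blast
  have B1': "1 \<le> B" using B1 by simp
  define \<rho> where "\<rho> = factor_path B t u"
  have \<rho> [measurable]: "\<rho> \<in> borel_measurable marked_predictable"
    unfolding \<rho>_def by (rule factor_path_measurable[OF t' u])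
  have \<rho>B: "0 \<le> \<rho> z \<and> \<rho> z \<le> B" for z unfolding \<rho>_def by (rule factor_path_bounds[OF B1'])
  let ?L = "jump_density R \<rho>"
  have Lm [measurable]: "?L \<in> borel_measurable P" unfolding P_def by (rule jump_density_measurable[OF \<rho> \<rho>B B1' S R])
  have L0: "0 \<le> ?L w" if "w \<in> sample_space M" for w by (rule jump_density_bounds[OF \<rho> \<rho>B B1' that R])
  have Li: "integrable P ?L" and L1: "(LINT w|P. ?L w) = 1"
    unfolding P_def by (rule jump_density_expectation[OF \<rho> \<rho>B B1' S R])+
  have Lp: "integrable P (\<lambda>w. ?L w powr p)" if "0 \<le> p" for p
    unfolding P_def by (rule jump_density_powr_integrable[OF S R \<rho> \<rho>B B1' that])
  define G where "G w = terminal_cost C (state M R w) (age M R w)" for w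
  define l where "l s w = running_cost C (t + s) (state M s w) (age M s w) (u s w)" for s w
  define V where "V w = (LINT s:{0..R}|lborel. l s w)" for w
  define Va where "Va w = (LINT s:{0..R}|lborel. \<bar>l s w\<bar>)" for w
  have l_eq: "l r w = running_path t u (w, r)"
    if "r \<le> R" "state_left M r w = state M r w" "age_left M r w = age M r w" for r w
    using that by (simp add: l_def running_path_def R_def)
  have rpm: "running_path t u \<in> borel_measurable (predictable M)" by (rule running_path_measurable[OF t' u])
  have V_eq: "V w = (LINT s:{0<..R}|lborel. running_path t u (w, s))" if "w \<in> sample_space M" for w
    unfolding V_def by (rule set_integral_off_jumps(1)[OF that]) (rule l_eq)
  have Va_eq: "Va w = (LINT s:{0<..R}|lborel. \<bar>running_path t u (w, s)\<bar>)" if "w \<in> sample_space M" for w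
    unfolding Va_def by (rule set_integral_off_jumps(1)[OF that]) (simp add: l_eq)
  have Vm [measurable]: "V \<in> borel_measurable P"
  proof -
    have "(\<lambda>w. LINT s:{0<..R}|lborel. running_path t u (w, s)) \<in> borel_measurable P"
      unfolding P_def by (rule measurable_law_generated[OF S path_integral_measurable[OF rpm]]) auto
    then show ?thesis by (rule measurable_cong[THEN iffD1, rotated]) (simp add: V_eq spP)
  qed
  have Vam [measurable]: "Va \<in> borel_measurable P"
  proof -
    have "(\<lambda>z. \<bar>running_path t u z\<bar>) \<in> borel_measurable (predictable M)" using rpm by measurable
    then have "(\<lambda>w. LINT s:{0<..R}|lborel. \<bar>running_path t u (w, s)\<bar>) \<in> borel_measurable P"
      unfolding P_def by (rule measurable_law_generated[OF S path_integral_measurable]) auto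
    then show ?thesis by (rule measurable_cong[THEN iffD1, rotated]) (simp add: Va_eq spP)
  qed
  have Gm [measurable]: "G \<in> borel_measurable P"
    using measurable_compose[OF measurable_law[OF S state_age_measurable[OF R order_refl]] terminal_cost_measurable]
    by (simp add: G_def[abs_def] P_def)
  obtain \<alpha> where \<alpha>: "1 < \<alpha>"
    and lint: "AE w in P. set_integrable lborel {0..R} (\<lambda>s. l s w)"
    and lpow: "(\<integral>\<^sup>+ w. ennreal (Va w powr \<alpha>) \<partial>P) < \<infinity>"
  proof -
    obtain \<alpha> where "1 < \<alpha>" and *: "\<forall>t\<in>{0..horizon C}. \<forall>(x, a)\<in>space (age_state_space M). \<forall>u\<in>admissible M C.
         bdd_below (running_cost C t x a ` space (control_space C)) \<and>
         (\<integral>\<^sup>+ w. (\<integral>\<^sup>+ s\<in>{0..horizon C - t}.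
            ennreal (\<bar>INF v\<in>space (control_space C).
                        running_cost C (t + s) (state M s w) (age M s w) v\<bar>\<^sup>2) \<partial>lborel)
            \<partial>law M x a) < \<infinity> \<and>
         (AE w in law M x a. set_integrable lborel {0..horizon C - t}
            (\<lambda>s. running_cost C (t + s) (state M s w) (age M s w) (u s w))) \<and>
         (\<integral>\<^sup>+ w. ennreal ((LINT s:{0..horizon C - t}|lborel.
            \<bar>running_cost C (t + s) (state M s w) (age M s w) (u s w)\<bar>) powr \<alpha>)
            \<partial>law M x a) < \<infinity>"
      using running_cost_bound by blast
    note ** = bspec[OF bspec[OF * t] S]
    show ?thesis using \<open>1 < \<alpha>\<close> bspec[OF **[unfolded prod.case] u]
      unfolding R_def[symmetric] P_def[symmetric] l_def[symmetric] Va_def[symmetric]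
      by (intro that[of \<alpha>]) blast+
  qed
  have LG: "integrable P (\<lambda>w. ?L w * G w)"
  proof (rule Bochner_Integration.integrable_bound)
    have "(\<integral>\<^sup>+ w. ennreal ((G w)\<^sup>2) \<partial>P) < \<infinity>"
      using terminal_cost_bound[OF t S] by (simp add: G_def P_def R_def)
    then have "integrable P (\<lambda>w. (G w)\<^sup>2)" by (intro integrableI_nonneg) auto
    then show "integrable P (\<lambda>w. ?L w powr 2 + (G w)\<^sup>2)" using Lp[of 2] by simp
    show "AE w in P. norm (?L w * G w) \<le> norm (?L w powr 2 + (G w)\<^sup>2)"
    proof (rule AE_I2)
      fix w assume "w \<in> space P"
      then have "0 \<le> ?L w" using L0 by (simp add: spP)
      moreover have "2 * ?L w * \<bar>G w\<bar> \<le> (?L w)\<^sup>2 + \<bar>G w\<bar>\<^sup>2" by (rule sum_squares_bound)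
      moreover have "0 \<le> ?L w * \<bar>G w\<bar>" using \<open>0 \<le> ?L w\<close> by simp
      ultimately have "?L w * \<bar>G w\<bar> \<le> (?L w)\<^sup>2 + (G w)\<^sup>2" unfolding power2_abs by linarith
      then show "norm (?L w * G w) \<le> norm (?L w powr 2 + (G w)\<^sup>2)"
        using \<open>0 \<le> ?L w\<close> by (simp add: abs_mult powr_numeral)
    qed
  qed measurable
  have V_le: "\<bar>V w\<bar> \<le> Va w" for w
  proof -
    have "\<bar>V w\<bar> \<le> (LINT s|lborel. norm (indicator {0..R} s *\<^sub>R l s w))"
      unfolding V_def set_lebesgue_integral_def real_norm_def[symmetric] by (rule integral_norm_bound)
    also have "\<dots> = Va w" unfolding Va_def set_lebesgue_integral_def
      by (intro Bochner_Integration.integral_cong refl) (simp add: indicator_def)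
    finally show ?thesis .
  qed
  \<comment> \<open>Young's inequality with the exponents \<open>\<alpha>\<close> and \<open>\<alpha> / (\<alpha> - 1)\<close>\<close>
  have LV: "integrable P (\<lambda>w. ?L w * V w)"
  proof (rule Bochner_Integration.integrable_bound)
    have "integrable P (\<lambda>w. Va w powr \<alpha>)" using lpow by (intro integrableI_nonneg) auto
    then show "integrable P (\<lambda>w. ?L w powr (\<alpha> / (\<alpha> - 1)) + Va w powr \<alpha>)" using Lp[of "\<alpha> / (\<alpha> - 1)"] \<alpha> by simp
    show "AE w in P. norm (?L w * V w) \<le> norm (?L w powr (\<alpha> / (\<alpha> - 1)) + Va w powr \<alpha>)"
    proof (rule AE_I2)
      fix w assume "w \<in> space P"
      then have L: "0 \<le> ?L w" using L0 by (simp add: spP)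
      then have "\<bar>?L w * V w\<bar> \<le> ?L w * Va w" using V_le[of w] by (simp add: abs_mult mult_left_mono)
      also have "\<dots> \<le> ?L w powr (\<alpha> / (\<alpha> - 1)) + Va w powr \<alpha>"
        using V_le[of w] by (intro young_powr L \<alpha>) linarith
      finally show "norm (?L w * V w) \<le> norm (?L w powr (\<alpha> / (\<alpha> - 1)) + Va w powr \<alpha>)" by simp
    qed
  qed measurable
  have cost: "cost M C t x a u = (LINT w|P. ?L w * (V w + G w))"
  proof -
    have dp: "density_process M C t u R w = ?L w" if "w \<in> sample_space M" for w
      unfolding R_def \<rho>_def by (rule density_process_eq[OF B t' u that])
    have dpm: "density_process M C t u R \<in> borel_measurable P"
      by (rule measurable_cong[THEN iffD1, OF _ Lm]) (simp add: dp spP)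
    have "cost M C t x a u = (LINT w|density P (\<lambda>w. ennreal (density_process M C t u R w)). V w + G w)"
      unfolding cost_def controlled_law_def R_def[symmetric] P_def[symmetric] V_def l_def G_def ..
    also have "\<dots> = (LINT w|P. density_process M C t u R w *\<^sub>R (V w + G w))"
      using dpm L0 by (intro integral_density) (auto simp: spP dp)
    also have "\<dots> = (LINT w|P. ?L w * (V w + G w))"
      by (intro Bochner_Integration.integral_cong refl) (simp add: spP dp)
    finally show ?thesis .
  qed
  \<comment> \<open>the martingale integrand, extended by zero after time \<open>R\<close>\<close>
  define H where "H z = (if snd (fst z) \<le> R then Z (snd (fst z)) (fst (fst z)) (snd z) else 0)" for z
  have H_eq: "H ((w, r), y) = Z r w y" if "r \<le> R" for w r y using that by (simp add: H_def)
  note sol' = sol[unfolded bsde_solution_def Let_def R_def[symmetric] P_def[symmetric]]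
  have Hm [measurable]: "H \<in> borel_measurable marked_predictable"
  proof -
    let ?Q = "restrict_space marked_predictable {z. snd (fst z) \<le> R}"
    have Zm: "(\<lambda>((w, s), y). Z s w y) \<in> borel_measurable (restrict_space (predictable M) (sample_space M \<times> {0..R}) \<Otimes>\<^sub>M state_space M)"
      using sol' by blast
    have spQ: "z \<in> space ?Q \<longleftrightarrow> fst (fst z) \<in> sample_space M \<and> 0 \<le> snd (fst z) \<and> snd (fst z) \<le> R \<and> snd z \<in> space (state_space M)" for z
      by (cases z) (auto simp: space_restrict_space space_pair_measure)
    have "fst \<in> ?Q \<rightarrow>\<^sub>M restrict_space (predictable M) (sample_space M \<times> {0..R})"
      by (intro measurable_restrict_space2 measurable_restrict_space1) (auto simp: spQ mem_Times_iff)
    moreover have "snd \<in> ?Q \<rightarrow>\<^sub>M state_space M" by (intro measurable_restrict_space1) simp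
    ultimately have "(\<lambda>z. (fst z, snd z)) \<in> ?Q \<rightarrow>\<^sub>M restrict_space (predictable M) (sample_space M \<times> {0..R}) \<Otimes>\<^sub>M state_space M"
      by (rule measurable_Pair)
    from measurable_compose[OF this Zm]
    have "(\<lambda>z. Z (snd (fst z)) (fst (fst z)) (snd z)) \<in> borel_measurable ?Q" by (simp add: split_beta')
    then show ?thesis unfolding H_def[abs_def]
      by (subst measurable_If_restrict_space_iff) (auto, measurable)
  qed
  have H2: "(\<integral>\<^sup>+ w. compensator M R (\<lambda>z. ennreal ((H z)\<^sup>2)) w \<partial>P) < \<infinity>"
  proof -
    have "(\<integral>\<^sup>+ w. compensator M R (\<lambda>z. ennreal ((H z)\<^sup>2)) w \<partial>P)
        = (\<integral>\<^sup>+ w. (\<integral>\<^sup>+ s\<in>{0..R}. (\<integral>\<^sup>+ y. ennreal (\<bar>Z s w y\<bar>\<^sup>2) \<partial>intensity M (state M s w) (age M s w)) \<partial>lborel) \<partial>P)"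
    proof (rule nn_integral_cong)
      fix w assume "w \<in> space P"
      then have w: "w \<in> sample_space M" by (simp add: spP)
      show "compensator M R (\<lambda>z. ennreal ((H z)\<^sup>2)) w
          = (\<integral>\<^sup>+ s\<in>{0..R}. (\<integral>\<^sup>+ y. ennreal (\<bar>Z s w y\<bar>\<^sup>2) \<partial>intensity M (state M s w) (age M s w)) \<partial>lborel)"
        unfolding compensator_def
      proof (rule nn_integral_cong_AE)
        show "AE r in lborel. (\<integral>\<^sup>+ y. ennreal ((H ((w, r), y))\<^sup>2) \<partial>left_intensity M (w, r)) * indicator {0<..R} r
            = (\<integral>\<^sup>+ y. ennreal (\<bar>Z r w y\<bar>\<^sup>2) \<partial>intensity M (state M r w) (age M r w)) * indicator {0..R} r"
          using AE_off_jumps[OF w, of R]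
        proof eventually_elim
          case (elim r)
          show ?case
          proof (cases "r \<in> {0..R}")
            case True
            with elim have l: "0 < r" "state_left M r w = state M r w" "age_left M r w = age M r w" by auto
            then show ?thesis using True by (simp add: left_intensity_off_jump H_eq)
          next
            case False
            then have "indicator {0..R} r = (0::ennreal)" "indicator {0<..R} r = (0::ennreal)"
              by (auto intro!: indicator_simps)
            then show ?thesis by (simp only: mult_zero_right)
          qed
        qed
      qed
    qed
    also have "\<dots> < \<infinity>" using sol' by blast
    finally show ?thesis .
  qed
  note J = jump_density_intensity_L2[OF S R \<rho> \<rho>B B1' Hm H2[unfolded P_def], folded P_def]
  \<comment> \<open>the last two terms cancel in expectation\<close>
  define W where "W w = ?L w * V w + ?L w * G w - ?L w * jump_sum M {0<..R} H w + ?L w * comp_int R (\<lambda>z. H z * \<rho> z) w" for w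
  have Wi: "integrable P W" unfolding W_def using LV LG J(4,5) by simp
  have WE: "(LINT w|P. W w) = cost M C t x a u"
  proof -
    have "(LINT w|P. W w) = (LINT w|P. ?L w * V w) + (LINT w|P. ?L w * G w)"
      unfolding W_def using LV LG J(4,5,6) by simp
    also have "\<dots> = cost M C t x a u" unfolding cost using LV LG by (simp add: distrib_left)
    finally show ?thesis .
  qed
  define ham where "ham r w = hamiltonian M C (t + r) (state M r w) (age M r w) (Z r w)" for r w
  define pre where "pre r w = pre_hamiltonian M C (t + r) (state M r w) (age M r w) (Z r w) (u r w)" for r w
  have bsde: "AE w in P. set_integrable lborel {0..R} (\<lambda>r. ham r w) \<and>
      Y 0 w + compensated_integral M 0 R (\<lambda>\<sigma>. Z \<sigma> w) w = G w + (LINT r:{0..R}|lborel. ham r w)"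
  proof -
    have "AE w in P. set_integrable lborel {0..R} (\<lambda>r. ham r w) \<and>
       (\<forall>s\<in>{0..R}. Y s w + compensated_integral M s R (\<lambda>\<sigma>. Z \<sigma> w) w = G w + (LINT r:{s..R}|lborel. ham r w))"
      using sol' unfolding ham_def G_def by blast
    then show ?thesis by eventually_elim (use R in auto)
  qed
  \<comment> \<open>the integral of the bracketed expression of the Hamiltonian, evaluated at the control \<open>u\<close>\<close>
  define D where "D w = V w + comp_int R (\<lambda>z. H z * \<rho> z) w - comp_int R H w" for w
  have pathwise: "AE w in P. ?L w * y = W w - ?L w * (D w - (LINT r:{0..R}|lborel. ham r w))
      \<and> (LINT r:{0..R}|lborel. ham r w) \<le> D w
      \<and> ((\<forall>s\<in>{0..R}. Z s w \<in> L2_intensity M (state_left M s w) (age_left M s w) \<longrightarrow>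
             u s w \<in> minimizers M C (t + s) (state_left M s w) (age_left M s w) (Z s w))
          \<longrightarrow> (LINT r:{0..R}|lborel. ham r w) = D w)"
    using bsde lint J(1) J(2) J(3) y[folded P_def] AE_space
  proof eventually_elim
    case (elim w)
    then have w: "w \<in> sample_space M" by (simp add: spP)
    have Hr: "(\<lambda>z. H z * \<rho> z) \<in> borel_measurable marked_predictable" by measurable
    note fH = compensator_finite(1,2)[OF Hm w elim(4)] and fHr = compensator_finite(1,2)[OF Hr w elim(5)]
    have H2m: "(\<lambda>z. (H z)\<^sup>2) \<in> borel_measurable marked_predictable" by measurable
    have fin2: "compensator M R (\<lambda>z. ennreal \<bar>(H z)\<^sup>2\<bar>) w < \<infinity>" using elim(3) by simp
    note fH2 = compensator_finite(1)[OF H2m w fin2]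
    have pre_eq: "AE r in lborel. r \<in> {0..R} \<longrightarrow> Z r w \<in> L2_intensity M (state M r w) (age M r w) \<and>
         state_left M r w = state M r w \<and> age_left M r w = age M r w \<and> ham r w \<le> pre r w \<and>
         pre r w = l r w + ((LINT y|left_intensity M (w, r). H ((w, r), y) * \<rho> ((w, r), y)) - (LINT y|left_intensity M (w, r). H ((w, r), y)))"
      using AE_off_jumps[OF w, of R] fH(1) fHr(1) fH2
    proof eventually_elim
      case (elim r)
      show ?case
      proof
        assume r: "r \<in> {0..R}"
        with elim have lf: "0 < r" "state_left M r w = state M r w" "age_left M r w = age M r w" by auto
        have r': "r \<in> {0<..R}" "0 \<le> r" "r \<le> R" using lf r by auto
        have z: "(w, r) \<in> space (predictable M)" using w r by simp
        have Sr: "(state M r w, age M r w) \<in> space (age_state_space M)" using process_space[OF _ w] r by auto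
        have tr: "t + r \<in> {0..horizon C}" using r t' by (auto simp: R_def)
        note li = left_intensity_off_jump[OF lf(2,3)]
        have L2: "Z r w \<in> L2_intensity M (state M r w) (age M r w)"
        proof -
          have "integrable (left_intensity M (w, r)) (\<lambda>y. (H ((w, r), y))\<^sup>2)" using elim r' by blast
          then have "integrable (intensity M (state M r w) (age M r w)) (\<lambda>y. (Z r w y)\<^sup>2)" using r' by (simp add: li H_eq)
          moreover have "Z r w \<in> borel_measurable (state_space M)" using section_measurable[OF Hm z] r' by (simp add: H_eq)
          ultimately show ?thesis by (simp add: L2_intensity_def)
        qed
        have us: "u r w \<in> space (control_space C)" using control_in_space[OF u w] tr r t' by (auto simp: R_def)
        have le: "ham r w \<le> pre r w"
          unfolding ham_def pre_def hamiltonian_def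
          by (rule cINF_lower[OF pre_hamiltonian_bdd_below[OF tr Sr u L2] us])
        have i1: "integrable (left_intensity M (w, r)) (\<lambda>y. H ((w, r), y))"
          and i2: "integrable (left_intensity M (w, r)) (\<lambda>y. H ((w, r), y) * \<rho> ((w, r), y))" using elim r' by blast+
        have "(LINT y|intensity M (state M r w) (age M r w). Z r w y * (density_factor C (t + r) (state M r w) (age M r w) y (u r w) - 1))
            = (LINT y|left_intensity M (w, r). H ((w, r), y) * \<rho> ((w, r), y) - H ((w, r), y))"
          unfolding li[symmetric]
        proof (intro Bochner_Integration.integral_cong refl)
          fix y assume "y \<in> space (left_intensity M (w, r))"
          then have y: "y \<in> space (state_space M)" by (simp add: space_left_intensity[OF z])
          have "\<rho> ((w, r), y) = density_factor C (t + r) (state M r w) (age M r w) y (u r w)"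
            unfolding \<rho>_def using factor_path_eq[OF B t' u w r'(2) _ y] r' lf by (simp add: R_def)
          then show "Z r w y * (density_factor C (t + r) (state M r w) (age M r w) y (u r w) - 1) = H ((w, r), y) * \<rho> ((w, r), y) - H ((w, r), y)"
            using r' by (simp add: H_eq right_diff_distrib)
        qed
        also have "\<dots> = (LINT y|left_intensity M (w, r). H ((w, r), y) * \<rho> ((w, r), y)) - (LINT y|left_intensity M (w, r). H ((w, r), y))"
          using i1 i2 by simp
        finally have "pre r w = l r w + ((LINT y|left_intensity M (w, r). H ((w, r), y) * \<rho> ((w, r), y)) - (LINT y|left_intensity M (w, r). H ((w, r), y)))"
          by (simp add: pre_def pre_hamiltonian_def l_def)
        with L2 lf le show "Z r w \<in> L2_intensity M (state M r w) (age M r w) \<and>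
         state_left M r w = state M r w \<and> age_left M r w = age M r w \<and> ham r w \<le> pre r w \<and>
         pre r w = l r w + ((LINT y|left_intensity M (w, r). H ((w, r), y) * \<rho> ((w, r), y)) - (LINT y|left_intensity M (w, r). H ((w, r), y)))"
          by blast
      qed
    qed
    define q where "q r = (LINT y|left_intensity M (w, r). H ((w, r), y) * \<rho> ((w, r), y)) - (LINT y|left_intensity M (w, r). H ((w, r), y))" for r
    have qi: "set_integrable lborel {0<..R} q" unfolding q_def by (rule set_integral_diff(1)[OF fHr(2) fH(2)])
    have qI: "(LINT r:{0<..R}|lborel. q r) = comp_int R (\<lambda>z. H z * \<rho> z) w - comp_int R H w"
      unfolding q_def comp_int_def by (rule set_integral_diff(2)[OF fHr(2) fH(2)])
    have li: "set_integrable lborel {0<..R} (\<lambda>r. l r w)"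
      by (rule set_integrable_subset[OF elim(2)]) auto
    have lq: "set_integrable lborel {0<..R} (\<lambda>r. l r w + q r)" by (rule set_integral_add(1)[OF li qi])
    have D: "D w = (LINT r:{0<..R}|lborel. l r w + q r)"
      unfolding set_integral_add(2)[OF li qi] qI D_def V_def
        set_integral_endpoints(1)[symmetric, of 0 R "\<lambda>r. l r w"] by simp
    have hi: "set_integrable lborel {0<..R} (\<lambda>r. ham r w)"
      by (rule set_integrable_subset[OF conjunct1[OF elim(1)]]) auto
    have le: "(LINT r:{0..R}|lborel. ham r w) \<le> D w"
      unfolding D set_integral_endpoints(1)[symmetric, of 0 R "\<lambda>r. ham r w"]
    proof (rule set_integral_mono_AE[OF hi lq])
      show "AE r\<in>{0<..R} in lborel. ham r w \<le> l r w + q r"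
        using pre_eq by eventually_elim (auto simp: q_def)
    qed
    have eq: "(LINT r:{0..R}|lborel. ham r w) = D w"
      if min: "\<forall>s\<in>{0..R}. Z s w \<in> L2_intensity M (state_left M s w) (age_left M s w) \<longrightarrow>
             u s w \<in> minimizers M C (t + s) (state_left M s w) (age_left M s w) (Z s w)"
      unfolding D set_integral_endpoints(1)[symmetric, of 0 R "\<lambda>r. ham r w"]
      unfolding set_lebesgue_integral_def
    proof (rule integral_cong_AE)
      show "(\<lambda>r. indicat_real {0<..R} r *\<^sub>R ham r w) \<in> borel_measurable lborel"
        using borel_measurable_integrable[OF hi[unfolded set_integrable_def]] .
      show "(\<lambda>r. indicat_real {0<..R} r *\<^sub>R (l r w + q r)) \<in> borel_measurable lborel"
        using borel_measurable_integrable[OF lq[unfolded set_integrable_def]] .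
      show "AE r in lborel. indicat_real {0<..R} r *\<^sub>R ham r w = indicat_real {0<..R} r *\<^sub>R (l r w + q r)"
        using pre_eq
      proof eventually_elim
        case (elim r)
        show ?case
        proof (cases "r \<in> {0<..R}")
          case True
          then have r: "r \<in> {0..R}" by simp
          note e = elim[rule_format, OF r]
          have "u r w \<in> minimizers M C (t + r) (state M r w) (age M r w) (Z r w)"
            using bspec[OF min r] e by simp
          then have "ham r w = pre r w" by (simp add: minimizers_def ham_def pre_def)
          with e show ?thesis by (simp add: q_def)
        qed simp
      qed
    qed
    have ce: "compensated_integral M 0 R (\<lambda>\<sigma>. Z \<sigma> w) w = jump_sum M {0<..R} H w - comp_int R H w"
      by (rule compensated_integral_eq[OF Hm w]) (simp add: H_eq)
    have "y + (jump_sum M {0<..R} H w - comp_int R H w) = G w + (LINT r:{0..R}|lborel. ham r w)"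
      using conjunct2[OF elim(1)] unfolding elim(6) ce .
    then have y: "y = G w + (LINT r:{0..R}|lborel. ham r w) - jump_sum M {0<..R} H w + comp_int R H w"
      by linarith
    have "?L w * y = W w - ?L w * (D w - (LINT r:{0..R}|lborel. ham r w))"
      unfolding W_def D_def y by (simp add: algebra_simps)
    with le eq show ?case by blast
  qed
  have Ey: "(LINT w|P. ?L w * y) = y" using L1 by simp
  have yi: "integrable P (\<lambda>w. ?L w * y)" using Li by simp
  have "(LINT w|P. ?L w * y) \<le> (LINT w|P. W w)"
  proof (rule integral_mono_AE[OF yi Wi])
    show "AE w in P. ?L w * y \<le> W w"
      using pathwise AE_space
    proof eventually_elim
      case (elim w)
      then have "0 \<le> ?L w * (D w - (LINT r:{0..R}|lborel. ham r w))" using L0 by (simp add: spP)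
      with elim show ?case by linarith
    qed
  qed
  then show "y \<le> cost M C t x a u" unfolding Ey WE .
  assume "AE w in law M x a. \<forall>s\<in>{0..horizon C - t}.
        Z s w \<in> L2_intensity M (state_left M s w) (age_left M s w) \<longrightarrow>
        u s w \<in> minimizers M C (t + s) (state_left M s w) (age_left M s w) (Z s w)"
  then have min: "AE w in P. \<forall>s\<in>{0..R}.
        Z s w \<in> L2_intensity M (state_left M s w) (age_left M s w) \<longrightarrow>
        u s w \<in> minimizers M C (t + s) (state_left M s w) (age_left M s w) (Z s w)"
    unfolding P_def R_def .
  have "(LINT w|P. W w) = (LINT w|P. ?L w * y)"
  proof (rule integral_cong_AE)
    show "AE w in P. W w = ?L w * y" using pathwise min by eventually_elim simp
  qed (use Wi yi in auto)
  then show "cost M C t x a u = y" unfolding Ey WE .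
qed

end

theorem theorem3p6:
  fixes M :: "('w, 'k) semi_markov_data"
    and C :: "('k, 'u) control_data"
    and Y :: "real \<Rightarrow> 'k \<Rightarrow> real \<Rightarrow> real \<Rightarrow> 'w \<Rightarrow> real"
    and Z :: "real \<Rightarrow> 'k \<Rightarrow> real \<Rightarrow> real \<Rightarrow> 'w \<Rightarrow> 'k \<Rightarrow> real"
    and ustar :: "real \<Rightarrow> 'k \<Rightarrow> real \<Rightarrow> real \<Rightarrow> 'w \<Rightarrow> 'u"
  assumes control: "semi_markov_control M C"
    and solution: "\<And>t x a. t \<in> {0..horizon C} \<Longrightarrow> (x, a) \<in> space (age_state_space M) \<Longrightarrow>
          bsde_solution M C t x a (Y t x a) (Z t x a)"
    and minimizers_nonempty: "\<And>s x a z. s \<in> {0..horizon C} \<Longrightarrow>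
          (x, a) \<in> space (age_state_space M) \<Longrightarrow> z \<in> L2_intensity M x a \<Longrightarrow>
          minimizers M C s x a z \<noteq> {}"
    and ustar_predictable: "\<And>t x a. t \<in> {0..horizon C} \<Longrightarrow>
          (x, a) \<in> space (age_state_space M) \<Longrightarrow> ustar t x a \<in> admissible M C"
    and ustar_minimizer: "\<And>t x a. t \<in> {0..horizon C} \<Longrightarrow>
          (x, a) \<in> space (age_state_space M) \<Longrightarrow>
          AE \<omega> in law M x a. \<forall>s\<in>{0..horizon C - t}.
            Z t x a s \<omega> \<in> L2_intensity M (state_left M s \<omega>) (age_left M s \<omega>) \<longrightarrow>
            ustar t x a s \<omega>
              \<in> minimizers M C (t + s) (state_left M s \<omega>) (age_left M s \<omega>) (Z t x a s \<omega>)"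
  shows "\<forall>t\<in>{0..horizon C}. \<forall>(x, a)\<in>space (age_state_space M).
           ustar t x a \<in> admissible M C \<and>
           (\<forall>u\<in>admissible M C. cost M C t x a (ustar t x a) \<le> cost M C t x a u) \<and>
           (AE \<omega> in law M x a. Y t x a 0 \<omega> = cost M C t x a (ustar t x a)) \<and>
           cost M C t x a (ustar t x a) = (INF u\<in>admissible M C. cost M C t x a u)"
proof (intro ballI)
  interpret semi_markov_control M C by (rule control)
  fix t z assume t: "t \<in> {0..horizon C}" and "z \<in> space (age_state_space M)"
  then obtain x a where z: "z = (x, a)" and S: "(x, a) \<in> space (age_state_space M)" by (cases z) auto
  have "Y t x a 0 \<in> borel_measurable (nat_filtration M 0)"
    using solution[OF t S] t unfolding bsde_solution_def Let_def by auto
  then obtain y where y: "AE \<omega> in law M x a. Y t x a 0 \<omega> = y"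
    by (rule initial_value_deterministic[OF S])
  note adm = ustar_predictable[OF t S]
  have le: "y \<le> cost M C t x a u" if "u \<in> admissible M C" for u
    by (rule cost_ge_bsde(1)[OF t S that solution[OF t S] y])
  have eq: "cost M C t x a (ustar t x a) = y"
    by (rule cost_ge_bsde(2)[OF t S adm solution[OF t S] y ustar_minimizer[OF t S]])
  have "(INF u\<in>admissible M C. cost M C t x a u) = y"
    using adm le eq by (intro cInf_eq_minimum) auto
  with adm le eq y show "case z of (x, a) \<Rightarrow> ustar t x a \<in> admissible M C \<and>
           (\<forall>u\<in>admissible M C. cost M C t x a (ustar t x a) \<le> cost M C t x a u) \<and>
           (AE \<omega> in law M x a. Y t x a 0 \<omega> = cost M C t x a (ustar t x a)) \<and>
           cost M C t x a (ustar t x a) = (INF u\<in>admissible M C. cost M C t x a u)"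
    by (simp add: z)
qed


end
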